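(* Let the system data of a coupled ODE-PDE system with equal input and output dimensions $n_w=n_y$ be given, and let $H_0,G_0,G_1,G_2$, $\hat A_0,\dots,\hat A_5$, $\hat B_0,\hat B_2$, $\hat C_0,\hat C_1$, $\hat D_0$, $I_0,I_1$ be the matrices and matrix-valued functions constructed from these data (all as defined in the context). Suppose there exist $\epsilon>0$, $\gamma>0$, integers $d_1,d_2\ge 0$, a symmetric matrix $P\in\mathbb{R}^{n_x\times n_x}$, and matrix-valued polynomials $Q:\mathbb{R}\to\mathbb{R}^{n_x\times n_z}$, $S:\mathbb{R}\to\mathbb{R}^{n_z\times n_z}$ (with symmetric values), $R_1,R_2:\mathbb{R}\times\mathbb{R}\to\mathbb{R}^{n_z\times n_z}$ such that $$\{P-\epsilon I,\,Q,\,Q^{\top}\,|\,S-\epsilon I,\,R_1,\,R_2\}\in\Phi_{d_1}.$$ Define $$\{K_0,K_1,K_2\,|\,K_3,K_4,K_5\}=\{I_1,0,H_0\,|\,G_0,G_1,G_2\}^*\times\{P,Q,Q^{\top}\,|\,S,R_1,R_2\},$$ \begin{align*} \{J_0,J_1,J_2\,|\,J_3,J_4,J_5\}=\;&\{K_0,K_1,K_2\,|\,K_3,K_4,K_5\}\times\{\hat A_0+\hat B_0,\hat A_1,\hat A_2+\hat B_2\,|\,\hat A_3,\hat A_4,\hat A_5\}\\ &-\{(\hat C_0+\hat D_0)^{\top}I_0,\,0,\,\hat C_1^{\top}I_0\,|\,0,0,0\}. \end{align*} If $$-\{J_0,J_1,J_2\,|\,J_3,J_4,J_5\}-\{J_0,J_1,J_2\,|\,J_3,J_4,J_5\}^*\in\Phi_{d_2},$$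 then for all $w\in L_2^{n_y}[0,\infty)$, $y\in L_2^{n_y}[0,\infty)$ and $\bar{\mathbf{x}}(t)=\mathrm{col}(x(t),\mathbf{z}_p(\cdot,t))\in X$ that satisfy the coupled ODE-PDE system (with its boundary conditions and zero initial state), we have $\langle w,y\rangle_{L_2}=\int_0^\infty w(t)^\top y(t)\,dt\ge0$.
   Context: **Spaces.** Fix $a<b$ and nonnegative integers $n_x,n_w,n_y,n_1,n_2,n_3$; $n_z=n_1+n_2+n_3$. $L_2^n[a,b]$ is the space of square integrable $\mathbb{R}^n$-valued functions, $W^{q,n}[a,b]$ the Sobolev space of $\mathbf x\in L_2^n[a,b]$ with $\partial_s^k\mathbf x\in L_2^n[a,b]$ for $k\le q$. $X=\mathbb{R}^{n_x}\times L_2^{n_1}[a,b]\times W^{1,n_2}[a,b]\times W^{2,n_3}[a,b]$, with the inner product of $\mathbb{R}^{n_x}\times L_2^{n_z}[a,b]$. Subscript $s$ denotes $\partial_s$; $\mathrm{col}$ denotes vertical stacking. **System data.** Constant matrices $A\in\mathbb{R}^{n_x\times n_x}$, $B_{wo}\in\mathbb{R}^{n_x\times n_w}$, $C\in\mathbb{R}^{n_y\times n_x}$, $D_w\in\mathbb{R}^{n_y\times n_w}$, $C_1\in\mathbb{R}^{n_y\times(2n_2+4n_3)}$, $E_1\in\mathbb{R}^{n_x\times(2n_2+4n_3)}$, $B\in\mathbb{R}^{(n_2+2n_3)\times(2n_2+4n_3)}$ of row rank $n_2+2n_3$, $B_1\in\mathbb{R}^{(n_2+2n_3)\times n_x}$,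 $B_2\in\mathbb{R}^{(n_2+2n_3)\times n_w}$; matrix-valued polynomials in $s$: $A_0$ ($n_z\times n_z$), $A_1$ ($n_z\times(n_2+n_3)$), $A_2$ ($n_z\times n_3$), $E$ ($n_z\times n_x$), $B_{wp}$ ($n_z\times n_w$), $C_a$ ($n_y\times n_z$), $C_b$ ($n_y\times(n_2+n_3)$), $E_a$ ($n_x\times n_z$), $E_b$ ($n_x\times(n_2+n_3)$). **Coupled ODE-PDE system.** For $\mathbf z_p=\mathrm{col}(\mathbf z_1,\mathbf z_2,\mathbf z_3)$ put $z_b=\mathrm{col}(\mathbf z_2(a),\mathbf z_2(b),\mathbf z_3(a),\mathbf z_3(b),\mathbf z_{3s}(a),\mathbf z_{3s}(b))$ and $$\mathcal C\mathbf z_p=C_1z_b+\int_a^b\big(C_a(s)\mathbf z_p(s)+C_b(s)\,\mathrm{col}(\mathbf z_{2s}(s),\mathbf z_{3s}(s))\big)ds,$$ $$\mathcal E\mathbf z_p=E_1z_b+\int_a^b\big(E_a(s)\mathbf z_p(s)+E_b(s)\,\mathrm{col}(\mathbf z_{2s}(s),\mathbf z_{3s}(s))\big)ds.$$ The system with input $w$, state $\bar{\mathbf x}=\mathrm{col}(x,\mathbf z_p)$ and output $y$ is \begin{align*} \dot x(t)&=Ax(t)+\mathcal E\mathbf z_p(\cdot,t)+B_{wo}w(t),\\ \dot{\mathbf z}_p(s,t)&=A_0(s)\mathbf z_p(s,t)+A_1(s)\,\mathrm{col}(\mathbf z_{2s},\mathbf z_{3s})(s,t)+A_2(s)\mathbf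 z_{3ss}(s,t)+E(s)x(t)+B_{wp}(s)w(t),\\ y(t)&=Cx(t)+\mathcal C\mathbf z_p(\cdot,t)+D_ww(t), \end{align*} with boundary conditions $Bz_b(t)=B_1x(t)+B_2w(t)$ and $x(0)=0$, $\mathbf z_p(\cdot,0)=0$. A solution is understood as a locally absolutely continuous function $t\mapsto\bar{\mathbf x}(t)\in\mathbb{R}^{n_x}\times L_2^{n_z}[a,b]$, a.e. differentiable, with $\bar{\mathbf x}(t)\in X$, the equations and the boundary conditions holding for almost every $t\ge0$. **PQRS operators.** A tuple $\{P,Q_1,Q_2\,|\,S,R_1,R_2\}$ consists of a matrix $P\in\mathbb{R}^{n\times m}$ and bounded (polynomial) functions $Q_1:[a,b]\to\mathbb{R}^{n\times q}$, $Q_2:[a,b]\to\mathbb{R}^{r\times m}$, $S:[a,b]\to\mathbb{R}^{r\times q}$, $R_1,R_2:[a,b]^2\to\mathbb{R}^{r\times q}$. It represents the operator $\mathbb{R}^m\times L_2^q[a,b]\to\mathbb{R}^n\times L_2^r[a,b]$ sending $\mathrm{col}(x,\mathbf z)$ to the pair with components $Px+\int_a^bQ_1(s)\mathbf z(s)ds$ and $$Q_2(s)x+S(s)\mathbf z(s)+\int_a^sR_1(s,\theta)\mathbf z(\theta)d\theta+\int_s^bR_2(s,\theta)\mathbf z(\theta)d\theta.$$ Zero blocks have whatever compatible sizes are needed (possibly zero rows or columns, when the finite- or infinite-dimensional component is absent). Sums and scalar multiples of tuples are entrywise. Composition: $\{\hat P,\hat Q_1,\hat Q_2|\hat S,\hat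 R_1,\hat R_2\}=\{A',B_1',B_2'|D',C_1',C_2'\}\times\{P,Q_1,Q_2|S,R_1,R_2\}$ means \begin{align*} \hat P&=A'P+\int_a^bB_1'(s)Q_2(s)ds,\qquad \hat S(s)=D'(s)S(s),\\ \hat Q_1(s)&=A'Q_1(s)+B_1'(s)S(s)+\int_s^bB_1'(\eta)R_1(\eta,s)d\eta+\int_a^sB_1'(\eta)R_2(\eta,s)d\eta,\\ \hat Q_2(s)&=B_2'(s)P+D'(s)Q_2(s)+\int_a^sC_1'(s,\eta)Q_2(\eta)d\eta+\int_s^bC_2'(s,\eta)Q_2(\eta)d\eta,\\ \hat R_1(s,\eta)&=B_2'(s)Q_1(\eta)+D'(s)R_1(s,\eta)+C_1'(s,\eta)S(\eta)+\int_a^\eta C_1'(s,\theta)R_2(\theta,\eta)d\theta\\&\quad+\int_\eta^sC_1'(s,\theta)R_1(\theta,\eta)d\theta+\int_s^bC_2'(s,\theta)R_1(\theta,\eta)d\theta,\\ \hat R_2(s,\eta)&=B_2'(s)Q_1(\eta)+D'(s)R_2(s,\eta)+C_2'(s,\eta)S(\eta)+\int_a^sC_1'(s,\theta)R_2(\theta,\eta)d\theta\\&\quad+\int_s^\eta C_2'(s,\theta)R_2(\theta,\eta)d\theta+\int_\eta^bC_2'(s,\theta)R_1(\theta,\eta)d\theta \end{align*} (these are the parameters of the composite operator). Adjoint: $\{P,Q_1,Q_2|S,R_1,R_2\}^*=\{P^\top,Q_2^\top,Q_1^\top\,|\,S^\top,\,R_2(\eta,s)^\top,\,R_1(\eta,s)^\top\}$,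 where the last two entries are the new $R_1(s,\eta)$ and $R_2(s,\eta)$. **The set $\Phi_d$.** Consider tuples $\{P,Q,Q^\top|S,R_1,R_2\}$ acting on $\mathbb{R}^m\times L_2^n[a,b]$. For $d\ge0$ let $Z_1(s)=\mathbf m_d(s)\otimes I_n$ and $Z_2(s,\theta)=\mathbf m_d(s,\theta)\otimes I_n$, with $\mathbf m_d$ the column vector of all monomials of degree at most $d$ in the indicated variables. For a function $g\ge0$ on $[a,b]$, a tuple is $g$-admissible if there is a symmetric positive semidefinite block matrix $T=(T_{ij})_{i,j=1}^4\succcurlyeq0$ (block sizes $m$, number of rows of $Z_1$, number of rows of $Z_2$, number of rows of $Z_2$) with \begin{align*} P&=T_{11}\int_a^bg(s)ds,\qquad S(s)=g(s)Z_1(s)^\top T_{22}Z_1(s),\\ Q(\eta)&=g(\eta)T_{12}Z_1(\eta)+\int_\eta^bg(s)T_{13}Z_2(s,\eta)ds+\int_a^\eta g(s)T_{14}Z_2(s,\eta)ds,\\ R_1(s,\eta)&=g(s)Z_1(s)^\top T_{23}Z_2(s,\eta)+g(\eta)Z_2(\eta,s)^\top T_{42}Z_1(\eta)+\int_s^bg(\theta)Z_2(\theta,s)^\top T_{33}Z_2(\theta,\eta)d\theta\\&\quad+\int_\eta^sg(\theta)Z_2(\theta,s)^\top T_{43}Z_2(\theta,\eta)d\theta+\int_a^\eta g(\theta)Z_2(\theta,s)^\top T_{44}Z_2(\theta,\eta)d\theta,\\ R_2(s,\eta)&=g(s)Z_1(s)^\top T_{24}Z_2(s,\eta)+g(\eta)Z_2(\eta,s)^\top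 T_{32}Z_1(\eta)+\int_\eta^bg(\theta)Z_2(\theta,s)^\top T_{33}Z_2(\theta,\eta)d\theta\\&\quad+\int_s^\eta g(\theta)Z_2(\theta,s)^\top T_{34}Z_2(\theta,\eta)d\theta+\int_a^sg(\theta)Z_2(\theta,s)^\top T_{44}Z_2(\theta,\eta)d\theta. \end{align*} $\Phi_d$ is the set of all sums of a $g$-admissible tuple with $g(s)=1$ and a $g$-admissible tuple with $g(s)=(s-a)(b-s)$. (Here $(m,n)=(n_x,n_z)$ for the condition with $d_1$ and $(m,n)=(n_w+n_x,n_z)$ for the condition with $d_2$.) **Matrices built from the data.** With block sizes $n_1,n_2,n_3$ (or $n_2,n_3,n_3$) as appropriate, $$T=\begin{bmatrix} I&0&0\\ I&0&0\\ 0&I&0\\ 0&I&(b-a)I\\ 0&0&I\\ 0&0&I\end{bmatrix},\quad N(\theta)=\begin{bmatrix}0&0&0\\ 0&I&0\\ 0&0&0\\ 0&0&(b-\theta)I\\ 0&0&0\\ 0&0&I\end{bmatrix},\quad K(s)=\begin{bmatrix}0&0&0\\ I&0&0\\ 0&I&(s-a)I\end{bmatrix},\quad V(s)=\begin{bmatrix}0&0&0\\ 0&0&I\end{bmatrix}.$$ It is assumed that the square matrix $BT$ is invertible. Put \begin{align*} &H_0(s)=K(s)(BT)^{-1}[B_2\ B_1],\quad H_1(s)=V(s)(BT)^{-1}[B_2\ B_1],\\ &G_0=\begin{bmatrix} I&0&0\\ 0&0&0\\ 0&0&0\end{bmatrix},\quad G_3=\begin{bmatrix}0&I&0\\ 0&0&0\end{bmatrix},\\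 &G_2(s,\theta)=-K(s)(BT)^{-1}BN(\theta),\quad G_5(s,\theta)=-V(s)(BT)^{-1}BN(\theta),\\ &G_1(s,\theta)=\begin{bmatrix}0&0&0\\ 0&I&0\\ 0&0&(s-\theta)I\end{bmatrix}+G_2(s,\theta),\quad G_4(s,\theta)=\begin{bmatrix}0&0&0\\ 0&0&I\end{bmatrix}+G_5(s,\theta),\\ &T_1=T(BT)^{-1}[B_2\ B_1],\quad T_2(\theta)=-T(BT)^{-1}BN(\theta)+N(\theta),\\ &\hat B_0=[B_{wo}\ 0],\quad\hat B_2(s)=[B_{wp}(s)\ 0],\quad\hat D_0=[D_w\ 0],\quad I_0=[I\ 0]\in\mathbb{R}^{n_w\times(n_w+n_x)},\quad I_1=[0\ I]\in\mathbb{R}^{n_x\times(n_w+n_x)}, \end{align*} \begin{align*} \{\hat A_0,\hat A_1,\hat A_2|\hat A_3,\hat A_4,\hat A_5\}&=\{0,E_a,0|A_0,0,0\}\times\{0,0,H_0|G_0,G_1,G_2\}+\{0,E_b,0|A_1,0,0\}\times\{0,0,H_1|G_3,G_4,G_5\}\\ &\quad+\{E_1,0,0|0,0,0\}\times\{T_1,T_2,0|0,0,0\}+\{[0\ A],0,[0\ E]\,|\,[0\ 0\ A_2],0,0\},\\ \{\hat C_0,\hat C_1,0|0,0,0\}&=\{0,C_a,0|0,0,0\}\times\{0,0,H_0|G_0,G_1,G_2\}+\{0,C_b,0|0,0,0\}\times\{0,0,H_1|G_3,G_4,G_5\}\\ &\quad+\{C_1,0,0|0,0,0\}\times\{T_1,T_2,0|0,0,0\}+\{[0\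 C],0,0|0,0,0\}. \end{align*} *)

theory Defs
  imports
    "HOL-Analysis.Analysis"
    "HOL-Computational_Algebra.Polynomial"
    "Jordan_Normal_Form.Gauss_Jordan_Elimination"
    "Jordan_Normal_Form.DL_Rank"
begin

no_notation vec_nth (infixl \<open>$\<close> 90)
no_notation inner (infix \<open>\<bullet>\<close> 70)

text \<open>All dimensions are natural numbers that may be zero, hence the carrier-based matrices and
  vectors. A sum or difference of matrices takes its dimensions from the right operand, and products
  over an empty index range are zero matrices, so blocks with zero rows or columns behave as
  expected.\<close>

definition append_cols :: "'a::zero mat \<Rightarrow> 'a mat \<Rightarrow> 'a mat" (infixr \<open>@\<^sub>c\<close> 66) where
  "A @\<^sub>c B = four_block_mat A B (0\<^sub>m 0 (dim_col A)) (0\<^sub>m 0 (dim_col B))"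

definition kron :: "real mat \<Rightarrow> real mat \<Rightarrow> real mat" where
  "kron A B = mat (dim_row A * dim_row B) (dim_col A * dim_col B)
     (\<lambda>(i, j). A $$ (i div dim_row B, j div dim_col B) * B $$ (i mod dim_row B, j mod dim_col B))"

text \<open>\<open>block sz T i j\<close> is the block \<open>T\<^sub>i\<^sub>j\<close> (counted from 1) of a square matrix whose rows and
  columns are both partitioned into groups of the sizes listed in \<open>sz\<close>.\<close>

definition block :: "nat list \<Rightarrow> real mat \<Rightarrow> nat \<Rightarrow> nat \<Rightarrow> real mat" where
  "block sz T i j = mat (sz ! (i - 1)) (sz ! (j - 1))
     (\<lambda>(k, l). T $$ (sum_list (take (i - 1) sz) + k, sum_list (take (j - 1) sz) + l))"

definition psd_mat :: "nat \<Rightarrow> real mat \<Rightarrow> bool" where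
  "psd_mat n T \<longleftrightarrow> T \<in> carrier_mat n n \<and> T\<^sup>T = T \<and> (\<forall>v \<in> carrier_vec n. 0 \<le> v \<bullet> (T *\<^sub>v v))"

definition row_rank :: "real mat \<Rightarrow> nat" where
  "row_rank M = vec_space.rank (dim_col M) (M\<^sup>T)"

definition mat_inv :: "real mat \<Rightarrow> real mat" where
  "mat_inv M = the (mat_inverse M)"

definition poly_mat1 :: "nat \<Rightarrow> nat \<Rightarrow> (real \<Rightarrow> real mat) \<Rightarrow> bool" where
  "poly_mat1 n m F \<longleftrightarrow>
     (\<exists>M \<in> carrier_mat n m. \<forall>s. F s = map_mat (\<lambda>p. poly p s) M)"

definition poly_mat2 :: "nat \<Rightarrow> nat \<Rightarrow> (real \<Rightarrow> real \<Rightarrow> real mat) \<Rightarrow> bool" where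
  "poly_mat2 n m F \<longleftrightarrow>
     (\<exists>M \<in> carrier_mat n m. \<forall>s \<theta>. F s \<theta> = map_mat (\<lambda>p. poly (poly p [:s:]) \<theta>) M)"

text \<open>Entrywise oriented integral of a matrix-valued function of constant dimensions: it changes
  sign when the bounds are exchanged, so that the formulas below are meaningful on the whole square
  and not only on the triangle on which the kernel acts.\<close>

definition mint :: "real \<Rightarrow> real \<Rightarrow> (real \<Rightarrow> real mat) \<Rightarrow> real mat" where
  "mint l r F = mat (dim_row (F l)) (dim_col (F l)) (\<lambda>(i, j). LBINT s=l..r. F s $$ (i, j))"

datatype pqrs =
  PQRS (tP: "real mat") (tQ1: "real \<Rightarrow> real mat") (tQ2: "real \<Rightarrow> real mat")
       (tS: "real \<Rightarrow> real mat") (tR1: "real \<Rightarrow> real \<Rightarrow> real mat") (tR2: "real \<Rightarrow> real \<Rightarrow> real mat")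

definition pqrs_add :: "pqrs \<Rightarrow> pqrs \<Rightarrow> pqrs" (infixl \<open>\<oplus>\<^sub>p\<close> 65) where
  "t \<oplus>\<^sub>p u = PQRS (tP t + tP u) (\<lambda>s. tQ1 t s + tQ1 u s) (\<lambda>s. tQ2 t s + tQ2 u s)
     (\<lambda>s. tS t s + tS u s) (\<lambda>s \<eta>. tR1 t s \<eta> + tR1 u s \<eta>) (\<lambda>s \<eta>. tR2 t s \<eta> + tR2 u s \<eta>)"

definition pqrs_uminus :: "pqrs \<Rightarrow> pqrs" (\<open>\<ominus>\<^sub>p _\<close> [81] 80) where
  "\<ominus>\<^sub>p t = PQRS (- tP t) (\<lambda>s. - tQ1 t s) (\<lambda>s. - tQ2 t s)
     (\<lambda>s. - tS t s) (\<lambda>s \<eta>. - tR1 t s \<eta>) (\<lambda>s \<eta>. - tR2 t s \<eta>)"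

definition pqrs_minus :: "pqrs \<Rightarrow> pqrs \<Rightarrow> pqrs" (infixl \<open>-\<^sub>p\<close> 65) where
  "t -\<^sub>p u = PQRS (tP t - tP u) (\<lambda>s. tQ1 t s - tQ1 u s) (\<lambda>s. tQ2 t s - tQ2 u s)
     (\<lambda>s. tS t s - tS u s) (\<lambda>s \<eta>. tR1 t s \<eta> - tR1 u s \<eta>) (\<lambda>s \<eta>. tR2 t s \<eta> - tR2 u s \<eta>)"

definition pqrs_adj :: "pqrs \<Rightarrow> pqrs" where
  "pqrs_adj t = PQRS ((tP t)\<^sup>T) (\<lambda>s. (tQ2 t s)\<^sup>T) (\<lambda>s. (tQ1 t s)\<^sup>T)
     (\<lambda>s. (tS t s)\<^sup>T) (\<lambda>s \<eta>. (tR2 t \<eta> s)\<^sup>T) (\<lambda>s \<eta>. (tR1 t \<eta> s)\<^sup>T)"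

fun pqrs_comp :: "real \<Rightarrow> real \<Rightarrow> pqrs \<Rightarrow> pqrs \<Rightarrow> pqrs" where
  "pqrs_comp a b (PQRS A B1 B2 D C1 C2) (PQRS P Q1 Q2 S R1 R2) = PQRS
     (A * P + mint a b (\<lambda>s. B1 s * Q2 s))
     (\<lambda>s. A * Q1 s + B1 s * S s + mint s b (\<lambda>\<eta>. B1 \<eta> * R1 \<eta> s) + mint a s (\<lambda>\<eta>. B1 \<eta> * R2 \<eta> s))
     (\<lambda>s. B2 s * P + D s * Q2 s + mint a s (\<lambda>\<eta>. C1 s \<eta> * Q2 \<eta>) + mint s b (\<lambda>\<eta>. C2 s \<eta> * Q2 \<eta>))
     (\<lambda>s. D s * S s)
     (\<lambda>s \<eta>. B2 s * Q1 \<eta> + D s * R1 s \<eta> + C1 s \<eta> * S \<eta>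
        + mint a \<eta> (\<lambda>\<theta>. C1 s \<theta> * R2 \<theta> \<eta>)
        + mint \<eta> s (\<lambda>\<theta>. C1 s \<theta> * R1 \<theta> \<eta>)
        + mint s b (\<lambda>\<theta>. C2 s \<theta> * R1 \<theta> \<eta>))
     (\<lambda>s \<eta>. B2 s * Q1 \<eta> + D s * R2 s \<eta> + C2 s \<eta> * S \<eta>
        + mint a s (\<lambda>\<theta>. C1 s \<theta> * R2 \<theta> \<eta>)
        + mint s \<eta> (\<lambda>\<theta>. C2 s \<theta> * R2 \<theta> \<eta>)
        + mint \<eta> b (\<lambda>\<theta>. C2 s \<theta> * R1 \<theta> \<eta>))"

definition monos1 :: "nat \<Rightarrow> real \<Rightarrow> real mat" where
  "monos1 d s = mat (d + 1) 1 (\<lambda>(i, _). s ^ i)"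

definition exps2 :: "nat \<Rightarrow> (nat \<times> nat) list" where
  "exps2 d = [(i, j). i \<leftarrow> [0..<d + 1], j \<leftarrow> [0..<d + 1 - i]]"

definition monos2 :: "nat \<Rightarrow> real \<Rightarrow> real \<Rightarrow> real mat" where
  "monos2 d s \<theta> = mat (length (exps2 d)) 1 (\<lambda>(k, _). s ^ fst (exps2 d ! k) * \<theta> ^ snd (exps2 d ! k))"

definition Z1 :: "nat \<Rightarrow> nat \<Rightarrow> real \<Rightarrow> real mat" where
  "Z1 d n s = kron (monos1 d s) (1\<^sub>m n)"

definition Z2 :: "nat \<Rightarrow> nat \<Rightarrow> real \<Rightarrow> real \<Rightarrow> real mat" where
  "Z2 d n s \<theta> = kron (monos2 d s \<theta>) (1\<^sub>m n)"

text \<open>The data functions of a tuple are functions on the interval, so the equations are imposed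
  there and the values elsewhere are left free.\<close>

definition admissible ::
    "real \<Rightarrow> real \<Rightarrow> nat \<Rightarrow> nat \<Rightarrow> nat \<Rightarrow> (real \<Rightarrow> real) \<Rightarrow> pqrs \<Rightarrow> bool" where
  "admissible a b m n d g t \<longleftrightarrow>
    (\<exists>TT. let z1 = Z1 d n; z2 = Z2 d n;
             sz = [m, (d + 1) * n, length (exps2 d) * n, length (exps2 d) * n];
             T = block sz TT
         in psd_mat (sum_list sz) TT
          \<and> tP t = (LBINT s=a..b. g s) \<cdot>\<^sub>m T 1 1
          \<and> (\<forall>s \<in> {a..b}. tS t s = g s \<cdot>\<^sub>m ((z1 s)\<^sup>T * T 2 2 * z1 s))
          \<and> (\<forall>\<eta> \<in> {a..b}. tQ1 t \<eta> = g \<eta> \<cdot>\<^sub>m (T 1 2 * z1 \<eta>)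
                + mint \<eta> b (\<lambda>s. g s \<cdot>\<^sub>m (T 1 3 * z2 s \<eta>))
                + mint a \<eta> (\<lambda>s. g s \<cdot>\<^sub>m (T 1 4 * z2 s \<eta>)))
          \<and> (\<forall>s \<in> {a..b}. tQ2 t s = (tQ1 t s)\<^sup>T)
          \<and> (\<forall>s \<in> {a..b}. \<forall>\<eta> \<in> {a..b}. tR1 t s \<eta> =
                g s \<cdot>\<^sub>m ((z1 s)\<^sup>T * T 2 3 * z2 s \<eta>) + g \<eta> \<cdot>\<^sub>m ((z2 \<eta> s)\<^sup>T * T 4 2 * z1 \<eta>)
                + mint s b (\<lambda>\<theta>. g \<theta> \<cdot>\<^sub>m ((z2 \<theta> s)\<^sup>T * T 3 3 * z2 \<theta> \<eta>))
                + mint \<eta> s (\<lambda>\<theta>. g \<theta> \<cdot>\<^sub>m ((z2 \<theta> s)\<^sup>T * T 4 3 * z2 \<theta> \<eta>))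
                + mint a \<eta> (\<lambda>\<theta>. g \<theta> \<cdot>\<^sub>m ((z2 \<theta> s)\<^sup>T * T 4 4 * z2 \<theta> \<eta>)))
          \<and> (\<forall>s \<in> {a..b}. \<forall>\<eta> \<in> {a..b}. tR2 t s \<eta> =
                g s \<cdot>\<^sub>m ((z1 s)\<^sup>T * T 2 4 * z2 s \<eta>) + g \<eta> \<cdot>\<^sub>m ((z2 \<eta> s)\<^sup>T * T 3 2 * z1 \<eta>)
                + mint \<eta> b (\<lambda>\<theta>. g \<theta> \<cdot>\<^sub>m ((z2 \<theta> s)\<^sup>T * T 3 3 * z2 \<theta> \<eta>))
                + mint s \<eta> (\<lambda>\<theta>. g \<theta> \<cdot>\<^sub>m ((z2 \<theta> s)\<^sup>T * T 3 4 * z2 \<theta> \<eta>))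
                + mint a s (\<lambda>\<theta>. g \<theta> \<cdot>\<^sub>m ((z2 \<theta> s)\<^sup>T * T 4 4 * z2 \<theta> \<eta>))))"

definition Phi :: "real \<Rightarrow> real \<Rightarrow> nat \<Rightarrow> nat \<Rightarrow> nat \<Rightarrow> pqrs set" where
  "Phi a b m n d = {t \<oplus>\<^sub>p u | t u.
     admissible a b m n d (\<lambda>s. 1) t \<and> admissible a b m n d (\<lambda>s. (s - a) * (b - s)) u}"

definition L2_vec :: "real set \<Rightarrow> nat \<Rightarrow> (real \<Rightarrow> real vec) set" where
  "L2_vec A n = {f. (\<forall>s \<in> A. f s \<in> carrier_vec n) \<and>
     (\<forall>i < n. (\<lambda>s. f s $ i) \<in> borel_measurable (lebesgue_on A) \<and>
              integrable (lebesgue_on A) (\<lambda>s. (f s $ i)\<^sup>2))}"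

text \<open>Absolute continuity on \<open>{l..r}\<close> with respect to a given (pseudo-)distance \<open>d\<close> on the values.\<close>

definition abs_cont_on :: "('a \<Rightarrow> 'a \<Rightarrow> real) \<Rightarrow> real \<Rightarrow> real \<Rightarrow> (real \<Rightarrow> 'a) \<Rightarrow> bool" where
  "abs_cont_on d l r f \<longleftrightarrow> (\<forall>\<epsilon>>0. \<exists>\<delta>>0. \<forall>I :: (real \<times> real) set.
     finite I \<and> (\<forall>(u, v) \<in> I. l \<le> u \<and> u \<le> v \<and> v \<le> r) \<and>
     pairwise (\<lambda>p q. {fst p<..<snd p} \<inter> {fst q<..<snd q} = {}) I \<and>
     (\<Sum>(u, v) \<in> I. v - u) < \<delta> \<longrightarrow> (\<Sum>(u, v) \<in> I. d (f u) (f v)) < \<epsilon>)"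

text \<open>\<open>sob_deriv a b n f g\<close>: \<open>f\<close> is an element of the first order Sobolev space on \<open>[a,b]\<close>, given by
  its absolutely continuous representative (the one whose boundary values are meaningful), and
  \<open>\<partial>\<^sub>s f = g\<close> almost everywhere.\<close>

definition sob_deriv ::
    "real \<Rightarrow> real \<Rightarrow> nat \<Rightarrow> (real \<Rightarrow> real vec) \<Rightarrow> (real \<Rightarrow> real vec) \<Rightarrow> bool" where
  "sob_deriv a b n f g \<longleftrightarrow> f \<in> L2_vec {a..b} n \<and> g \<in> L2_vec {a..b} n \<and>
     (\<forall>i < n. abs_cont_on dist a b (\<lambda>s. f s $ i) \<and>
        (AE s in lebesgue_on {a..b}. ((\<lambda>r. f r $ i) has_real_derivative g s $ i) (at s)))"

primrec sobolev :: "real \<Rightarrow> real \<Rightarrow> nat \<Rightarrow> nat \<Rightarrow> (real \<Rightarrow> real vec) set" where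
  "sobolev a b 0 n = L2_vec {a..b} n"
| "sobolev a b (Suc q) n = {f. \<exists>g. sob_deriv a b n f g \<and> g \<in> sobolev a b q n}"

definition vint :: "real \<Rightarrow> real \<Rightarrow> (real \<Rightarrow> real vec) \<Rightarrow> real vec" where
  "vint a b F = vec (dim_vec (F a)) (\<lambda>i. LINT s|lebesgue_on {a..b}. F s $ i)"

text \<open>Norm, distance and differentiation in \<open>\<real>\<^sup>n \<times> L\<^sub>2[a,b]\<close>, on representatives.\<close>

type_synonym state = "real vec \<times> (real \<Rightarrow> real vec)"

fun state_norm :: "real \<Rightarrow> real \<Rightarrow> state \<Rightarrow> real" where
  "state_norm a b (x, z) = sqrt (x \<bullet> x + (LINT s|lebesgue_on {a..b}. z s \<bullet> z s))"

definition state_diff :: "state \<Rightarrow> state \<Rightarrow> state" where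
  "state_diff X Y = (fst X - fst Y, \<lambda>s. snd X s - snd Y s)"

definition state_scale :: "real \<Rightarrow> state \<Rightarrow> state" where
  "state_scale c X = (c \<cdot>\<^sub>v fst X, \<lambda>s. c \<cdot>\<^sub>v snd X s)"

definition state_dist :: "real \<Rightarrow> real \<Rightarrow> state \<Rightarrow> state \<Rightarrow> real" where
  "state_dist a b X Y = state_norm a b (state_diff X Y)"

definition has_state_deriv :: "real \<Rightarrow> real \<Rightarrow> (real \<Rightarrow> state) \<Rightarrow> state \<Rightarrow> real \<Rightarrow> bool" where
  "has_state_deriv a b X X' t \<longleftrightarrow>
     ((\<lambda>h. state_dist a b (state_scale (1 / h) (state_diff (X (t + h)) (X t))) X') \<longlongrightarrow> 0) (at 0)"

text \<open>Field names: \<open>lo\<close>, \<open>hi\<close> are the interval end points, a prefix \<open>c\<close> marks constant matrices and a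
  prefix \<open>p\<close> matrix-valued polynomials.\<close>

record ode_pde =
  lo :: real  hi :: real
  nx :: nat  nw :: nat  ny :: nat  n1 :: nat  n2 :: nat  n3 :: nat
  cA :: "real mat"  cBwo :: "real mat"  cC :: "real mat"  cDw :: "real mat"
  cC1 :: "real mat"  cE1 :: "real mat"  cB :: "real mat"  cB1 :: "real mat"  cB2 :: "real mat"
  pA0 :: "real \<Rightarrow> real mat"  pA1 :: "real \<Rightarrow> real mat"  pA2 :: "real \<Rightarrow> real mat"
  pE :: "real \<Rightarrow> real mat"  pBwp :: "real \<Rightarrow> real mat"
  pCa :: "real \<Rightarrow> real mat"  pCb :: "real \<Rightarrow> real mat"
  pEa :: "real \<Rightarrow> real mat"  pEb :: "real \<Rightarrow> real mat"

abbreviation nz :: "ode_pde \<Rightarrow> nat" where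
  "nz D \<equiv> n1 D + n2 D + n3 D"

abbreviation nbc :: "ode_pde \<Rightarrow> nat" where
  "nbc D \<equiv> n2 D + 2 * n3 D"

abbreviation nbv :: "ode_pde \<Rightarrow> nat" where
  "nbv D \<equiv> 2 * n2 D + 4 * n3 D"

definition Tmat :: "ode_pde \<Rightarrow> real mat" where
  "Tmat D = (let k = n2 D; l = n3 D in
       1\<^sub>m k   @\<^sub>c 0\<^sub>m k l @\<^sub>c 0\<^sub>m k l
    @\<^sub>r 1\<^sub>m k   @\<^sub>c 0\<^sub>m k l @\<^sub>c 0\<^sub>m k l
    @\<^sub>r 0\<^sub>m l k @\<^sub>c 1\<^sub>m l   @\<^sub>c 0\<^sub>m l l
    @\<^sub>r 0\<^sub>m l k @\<^sub>c 1\<^sub>m l   @\<^sub>c ((hi D - lo D) \<cdot>\<^sub>m 1\<^sub>m l)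
    @\<^sub>r 0\<^sub>m l k @\<^sub>c 0\<^sub>m l l @\<^sub>c 1\<^sub>m l
    @\<^sub>r 0\<^sub>m l k @\<^sub>c 0\<^sub>m l l @\<^sub>c 1\<^sub>m l)"

definition Nmat :: "ode_pde \<Rightarrow> real \<Rightarrow> real mat" where
  "Nmat D \<theta> = (let j = n1 D; k = n2 D; l = n3 D in
       0\<^sub>m k j @\<^sub>c 0\<^sub>m k k @\<^sub>c 0\<^sub>m k l
    @\<^sub>r 0\<^sub>m k j @\<^sub>c 1\<^sub>m k   @\<^sub>c 0\<^sub>m k l
    @\<^sub>r 0\<^sub>m l j @\<^sub>c 0\<^sub>m l k @\<^sub>c 0\<^sub>m l l
    @\<^sub>r 0\<^sub>m l j @\<^sub>c 0\<^sub>m l k @\<^sub>c ((hi D - \<theta>) \<cdot>\<^sub>m 1\<^sub>m l)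
    @\<^sub>r 0\<^sub>m l j @\<^sub>c 0\<^sub>m l k @\<^sub>c 0\<^sub>m l l
    @\<^sub>r 0\<^sub>m l j @\<^sub>c 0\<^sub>m l k @\<^sub>c 1\<^sub>m l)"

definition Kmat :: "ode_pde \<Rightarrow> real \<Rightarrow> real mat" where
  "Kmat D s = (let j = n1 D; k = n2 D; l = n3 D in
       0\<^sub>m j k @\<^sub>c 0\<^sub>m j l @\<^sub>c 0\<^sub>m j l
    @\<^sub>r 1\<^sub>m k   @\<^sub>c 0\<^sub>m k l @\<^sub>c 0\<^sub>m k l
    @\<^sub>r 0\<^sub>m l k @\<^sub>c 1\<^sub>m l   @\<^sub>c ((s - lo D) \<cdot>\<^sub>m 1\<^sub>m l))"

definition Vmat :: "ode_pde \<Rightarrow> real mat" where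
  "Vmat D = (let k = n2 D; l = n3 D in
       0\<^sub>m k k @\<^sub>c 0\<^sub>m k l @\<^sub>c 0\<^sub>m k l
    @\<^sub>r 0\<^sub>m l k @\<^sub>c 0\<^sub>m l l @\<^sub>c 1\<^sub>m l)"

definition wf_ode_pde :: "ode_pde \<Rightarrow> bool" where
  "wf_ode_pde D \<longleftrightarrow> lo D < hi D
   \<and> cA D \<in> carrier_mat (nx D) (nx D) \<and> cBwo D \<in> carrier_mat (nx D) (nw D)
   \<and> cC D \<in> carrier_mat (ny D) (nx D) \<and> cDw D \<in> carrier_mat (ny D) (nw D)
   \<and> cC1 D \<in> carrier_mat (ny D) (nbv D) \<and> cE1 D \<in> carrier_mat (nx D) (nbv D)
   \<and> cB D \<in> carrier_mat (nbc D) (nbv D) \<and> row_rank (cB D) = nbc D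
   \<and> cB1 D \<in> carrier_mat (nbc D) (nx D) \<and> cB2 D \<in> carrier_mat (nbc D) (nw D)
   \<and> poly_mat1 (nz D) (nz D) (pA0 D) \<and> poly_mat1 (nz D) (n2 D + n3 D) (pA1 D)
   \<and> poly_mat1 (nz D) (n3 D) (pA2 D) \<and> poly_mat1 (nz D) (nx D) (pE D)
   \<and> poly_mat1 (nz D) (nw D) (pBwp D)
   \<and> poly_mat1 (ny D) (nz D) (pCa D) \<and> poly_mat1 (ny D) (n2 D + n3 D) (pCb D)
   \<and> poly_mat1 (nx D) (nz D) (pEa D) \<and> poly_mat1 (nx D) (n2 D + n3 D) (pEb D)
   \<and> invertible_mat (cB D * Tmat D)"

definition state_space :: "ode_pde \<Rightarrow>
    (real vec \<times> (real \<Rightarrow> real vec) \<times> (real \<Rightarrow> real vec) \<times> (real \<Rightarrow> real vec)) set" where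
  "state_space D = carrier_vec (nx D) \<times> L2_vec {lo D..hi D} (n1 D)
     \<times> sobolev (lo D) (hi D) 1 (n2 D) \<times> sobolev (lo D) (hi D) 2 (n3 D)"

text \<open>The operators \<open>\<C>\<close> and \<open>\<E>\<close> are \<open>pde_output\<close> with the respective coefficients; \<open>z\<^sub>b\<close> is the
  stacked boundary data, \<open>z\<close> the PDE state and \<open>zs\<close> the stacked derivatives of its second and third
  components.\<close>

definition pde_output :: "real \<Rightarrow> real \<Rightarrow> real mat \<Rightarrow> (real \<Rightarrow> real mat) \<Rightarrow> (real \<Rightarrow> real mat) \<Rightarrow>
    real vec \<Rightarrow> (real \<Rightarrow> real vec) \<Rightarrow> (real \<Rightarrow> real vec) \<Rightarrow> real vec" where
  "pde_output a b F1 Fa Fb zb z zs = F1 *\<^sub>v zb + vint a b (\<lambda>s. Fa s *\<^sub>v z s + Fb s *\<^sub>v zs s)"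

text \<open>\<open>z1\<close>, \<open>z2\<close>, \<open>z3\<close> take the time first and the spatial variable second. The witnesses \<open>xd\<close>, \<open>zd\<close>
  and \<open>z2s\<close>, \<open>z3s\<close>, \<open>z3ss\<close> are the time and space derivatives, which are unique as elements of the
  respective spaces.\<close>

definition is_solution :: "ode_pde \<Rightarrow> (real \<Rightarrow> real vec) \<Rightarrow> (real \<Rightarrow> real vec) \<Rightarrow> (real \<Rightarrow> real vec) \<Rightarrow>
    (real \<Rightarrow> real \<Rightarrow> real vec) \<Rightarrow> (real \<Rightarrow> real \<Rightarrow> real vec) \<Rightarrow> (real \<Rightarrow> real \<Rightarrow> real vec) \<Rightarrow> bool" where
  "is_solution D w y x z1 z2 z3 \<longleftrightarrow>
    (let a = lo D; b = hi D; zp = (\<lambda>t s. z1 t s @\<^sub>v z2 t s @\<^sub>v z3 t s) in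
      (\<forall>t\<ge>0. x t \<in> carrier_vec (nx D) \<and> z1 t \<in> L2_vec {a..b} (n1 D)
               \<and> z2 t \<in> L2_vec {a..b} (n2 D) \<and> z3 t \<in> L2_vec {a..b} (n3 D))
    \<and> (\<forall>\<tau>\<ge>0. abs_cont_on (state_dist a b) 0 \<tau> (\<lambda>t. (x t, zp t)))
    \<and> x 0 = 0\<^sub>v (nx D) \<and> (AE s in lebesgue_on {a..b}. zp 0 s = 0\<^sub>v (nz D))
    \<and> (AE t in lebesgue_on {0..}.
         (x t, z1 t, z2 t, z3 t) \<in> state_space D
       \<and> (\<exists>xd zd z2s z3s z3ss.
            xd \<in> carrier_vec (nx D) \<and> zd \<in> L2_vec {a..b} (nz D)
          \<and> has_state_deriv a b (\<lambda>t. (x t, zp t)) (xd, zd) t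
          \<and> sob_deriv a b (n2 D) (z2 t) z2s
          \<and> sob_deriv a b (n3 D) (z3 t) z3s \<and> sob_deriv a b (n3 D) z3s z3ss
          \<and> (let zb = z2 t a @\<^sub>v z2 t b @\<^sub>v z3 t a @\<^sub>v z3 t b @\<^sub>v z3s a @\<^sub>v z3s b;
                 zs = (\<lambda>s. z2s s @\<^sub>v z3s s)
             in xd = cA D *\<^sub>v x t + pde_output a b (cE1 D) (pEa D) (pEb D) zb (zp t) zs
                       + cBwo D *\<^sub>v w t
              \<and> (AE s in lebesgue_on {a..b}.
                   zd s = pA0 D s *\<^sub>v zp t s + pA1 D s *\<^sub>v zs s + pA2 D s *\<^sub>v z3ss s
                            + pE D s *\<^sub>v x t + pBwp D s *\<^sub>v w t)
              \<and> y t = cC D *\<^sub>v x t + pde_output a b (cC1 D) (pCa D) (pCb D) zb (zp t) zs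
                       + cDw D *\<^sub>v w t
              \<and> cB D *\<^sub>v zb = cB1 D *\<^sub>v x t + cB2 D *\<^sub>v w t))))"

definition BTi :: "ode_pde \<Rightarrow> real mat" where
  "BTi D = mat_inv (cB D * Tmat D)"

definition B21 :: "ode_pde \<Rightarrow> real mat" where
  "B21 D = cB2 D @\<^sub>c cB1 D"

definition H0 :: "ode_pde \<Rightarrow> real \<Rightarrow> real mat" where
  "H0 D s = Kmat D s * BTi D * B21 D"

definition H1 :: "ode_pde \<Rightarrow> real \<Rightarrow> real mat" where
  "H1 D s = Vmat D * BTi D * B21 D"

definition G0 :: "ode_pde \<Rightarrow> real \<Rightarrow> real mat" where
  "G0 D s = (let j = n1 D; k = n2 D; l = n3 D in
       1\<^sub>m j   @\<^sub>c 0\<^sub>m j k @\<^sub>c 0\<^sub>m j l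
    @\<^sub>r 0\<^sub>m k j @\<^sub>c 0\<^sub>m k k @\<^sub>c 0\<^sub>m k l
    @\<^sub>r 0\<^sub>m l j @\<^sub>c 0\<^sub>m l k @\<^sub>c 0\<^sub>m l l)"

definition G3 :: "ode_pde \<Rightarrow> real \<Rightarrow> real mat" where
  "G3 D s = (let j = n1 D; k = n2 D; l = n3 D in
       0\<^sub>m k j @\<^sub>c 1\<^sub>m k   @\<^sub>c 0\<^sub>m k l
    @\<^sub>r 0\<^sub>m l j @\<^sub>c 0\<^sub>m l k @\<^sub>c 0\<^sub>m l l)"

definition G2 :: "ode_pde \<Rightarrow> real \<Rightarrow> real \<Rightarrow> real mat" where
  "G2 D s \<theta> = - (Kmat D s * BTi D * cB D * Nmat D \<theta>)"

definition G5 :: "ode_pde \<Rightarrow> real \<Rightarrow> real \<Rightarrow> real mat" where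
  "G5 D s \<theta> = - (Vmat D * BTi D * cB D * Nmat D \<theta>)"

definition G1 :: "ode_pde \<Rightarrow> real \<Rightarrow> real \<Rightarrow> real mat" where
  "G1 D s \<theta> = (let j = n1 D; k = n2 D; l = n3 D in
      (0\<^sub>m j j @\<^sub>c 0\<^sub>m j k @\<^sub>c 0\<^sub>m j l
    @\<^sub>r 0\<^sub>m k j @\<^sub>c 1\<^sub>m k   @\<^sub>c 0\<^sub>m k l
    @\<^sub>r 0\<^sub>m l j @\<^sub>c 0\<^sub>m l k @\<^sub>c (s - \<theta>) \<cdot>\<^sub>m 1\<^sub>m l) + G2 D s \<theta>)"

definition G4 :: "ode_pde \<Rightarrow> real \<Rightarrow> real \<Rightarrow> real mat" where
  "G4 D s \<theta> = (let j = n1 D; k = n2 D; l = n3 D in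
      (0\<^sub>m k j @\<^sub>c 0\<^sub>m k k @\<^sub>c 0\<^sub>m k l
    @\<^sub>r 0\<^sub>m l j @\<^sub>c 0\<^sub>m l k @\<^sub>c 1\<^sub>m l) + G5 D s \<theta>)"

definition T1 :: "ode_pde \<Rightarrow> real mat" where
  "T1 D = Tmat D * BTi D * B21 D"

definition T2 :: "ode_pde \<Rightarrow> real \<Rightarrow> real mat" where
  "T2 D \<theta> = - (Tmat D * BTi D * cB D * Nmat D \<theta>) + Nmat D \<theta>"

definition hatB0 :: "ode_pde \<Rightarrow> real mat" where
  "hatB0 D = cBwo D @\<^sub>c 0\<^sub>m (nx D) (nx D)"

definition hatB2 :: "ode_pde \<Rightarrow> real \<Rightarrow> real mat" where
  "hatB2 D s = pBwp D s @\<^sub>c 0\<^sub>m (nz D) (nx D)"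

definition hatD0 :: "ode_pde \<Rightarrow> real mat" where
  "hatD0 D = cDw D @\<^sub>c 0\<^sub>m (ny D) (nx D)"

definition I0 :: "ode_pde \<Rightarrow> real mat" where
  "I0 D = 1\<^sub>m (nw D) @\<^sub>c 0\<^sub>m (nw D) (nx D)"

definition I1 :: "ode_pde \<Rightarrow> real mat" where
  "I1 D = 0\<^sub>m (nx D) (nw D) @\<^sub>c 1\<^sub>m (nx D)"

text \<open>In the products below an absent intermediate finite-dimensional or infinite-dimensional
  component is given dimension 0.\<close>

abbreviation zmat1 :: "nat \<Rightarrow> nat \<Rightarrow> real \<Rightarrow> real mat" where
  "zmat1 n m \<equiv> (\<lambda>_. 0\<^sub>m n m)"

abbreviation zmat2 :: "nat \<Rightarrow> nat \<Rightarrow> real \<Rightarrow> real \<Rightarrow> real mat" where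
  "zmat2 n m \<equiv> (\<lambda>_ _. 0\<^sub>m n m)"

definition hatA :: "ode_pde \<Rightarrow> pqrs" where
  "hatA D = (let p = nx D; u = nw D + nx D; v = nz D; q = n2 D + n3 D; r = nbv D in
     pqrs_comp (lo D) (hi D)
       (PQRS (0\<^sub>m p 0) (pEa D) (zmat1 v 0) (pA0 D) (zmat2 v v) (zmat2 v v))
       (PQRS (0\<^sub>m 0 u) (zmat1 0 v) (H0 D) (G0 D) (G1 D) (G2 D))
     \<oplus>\<^sub>p
     pqrs_comp (lo D) (hi D)
       (PQRS (0\<^sub>m p 0) (pEb D) (zmat1 v 0) (pA1 D) (zmat2 v q) (zmat2 v q))
       (PQRS (0\<^sub>m 0 u) (zmat1 0 v) (H1 D) (G3 D) (G4 D) (G5 D))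
     \<oplus>\<^sub>p
     pqrs_comp (lo D) (hi D)
       (PQRS (cE1 D) (zmat1 p 0) (zmat1 v r) (zmat1 v 0) (zmat2 v 0) (zmat2 v 0))
       (PQRS (T1 D) (T2 D) (zmat1 0 u) (zmat1 0 v) (zmat2 0 v) (zmat2 0 v))
     \<oplus>\<^sub>p
     PQRS (0\<^sub>m p (nw D) @\<^sub>c cA D) (zmat1 p v) (\<lambda>s. 0\<^sub>m v (nw D) @\<^sub>c pE D s)
       (\<lambda>s. 0\<^sub>m v (n1 D) @\<^sub>c 0\<^sub>m v (n2 D) @\<^sub>c pA2 D s) (zmat2 v v) (zmat2 v v))"

definition hatC :: "ode_pde \<Rightarrow> pqrs" where
  "hatC D = (let p = ny D; u = nw D + nx D; v = nz D; q = n2 D + n3 D; r = nbv D in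
     pqrs_comp (lo D) (hi D)
       (PQRS (0\<^sub>m p 0) (pCa D) (zmat1 0 0) (zmat1 0 v) (zmat2 0 v) (zmat2 0 v))
       (PQRS (0\<^sub>m 0 u) (zmat1 0 v) (H0 D) (G0 D) (G1 D) (G2 D))
     \<oplus>\<^sub>p
     pqrs_comp (lo D) (hi D)
       (PQRS (0\<^sub>m p 0) (pCb D) (zmat1 0 0) (zmat1 0 q) (zmat2 0 q) (zmat2 0 q))
       (PQRS (0\<^sub>m 0 u) (zmat1 0 v) (H1 D) (G3 D) (G4 D) (G5 D))
     \<oplus>\<^sub>p
     pqrs_comp (lo D) (hi D)
       (PQRS (cC1 D) (zmat1 p 0) (zmat1 0 r) (zmat1 0 0) (zmat2 0 0) (zmat2 0 0))
       (PQRS (T1 D) (T2 D) (zmat1 0 u) (zmat1 0 v) (zmat2 0 v) (zmat2 0 v))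
     \<oplus>\<^sub>p
     PQRS (0\<^sub>m p (nw D) @\<^sub>c cC D) (zmat1 p v) (zmat1 0 u) (zmat1 0 v) (zmat2 0 v) (zmat2 0 v))"

abbreviation "hatA0 D \<equiv> tP (hatA D)"
abbreviation "hatA1 D \<equiv> tQ1 (hatA D)"
abbreviation "hatA2 D \<equiv> tQ2 (hatA D)"
abbreviation "hatA3 D \<equiv> tS (hatA D)"
abbreviation "hatA4 D \<equiv> tR1 (hatA D)"
abbreviation "hatA5 D \<equiv> tR2 (hatA D)"
abbreviation "hatC0 D \<equiv> tP (hatC D)"
abbreviation "hatC1 D \<equiv> tQ1 (hatC D)"

end

theory Submission
  imports Defs
begin

text \<open>The storage function is \<open>V(t) = \<langle>\<P>\<^bold>x(t), \<^bold>x(t)\<rangle>\<close>, where \<open>\<P>\<close> is the operator given by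
  \<open>P, Q, S, R\<^sub>1, R\<^sub>2\<close>; membership in \<open>\<Phi>\<^sub>d\<close> makes it self-adjoint and nonnegative. Integrating the
  spatial derivatives and eliminating the boundary values expresses the state, its time derivative
  and the output as \<open>\<T>U\<close>, \<open>\<A>U\<close> and \<open>\<C>U\<close> for \<open>U = ((w, x), (z\<^sub>1, \<partial>\<^sub>s z\<^sub>2, \<partial>\<^sub>s\<^sup>2 z\<^sub>3))\<close>, so that
  \<open>V' - 2 w\<^sup>T y = 2\<langle>\<T>U, \<P>\<A>U\<rangle> - 2 w\<^sup>T \<C>U = \<langle>U, (\<J> + \<J>\<^sup>*)U\<rangle> \<le> 0\<close> almost everywhere. Since \<open>V\<close> is
  absolutely continuous with \<open>V(0) = 0\<close>, it follows that \<open>0 \<le> V(\<tau>) \<le> 2 \<integral>\<^sub>0\<^sup>\<tau> w\<^sup>T y\<close>.\<close>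

section \<open>Absolutely continuous functions\<close>

text \<open>Regularity in time is weak: the state is a curve that is absolutely continuous only for
  the distance of the product space, and the spatial derivatives that enter the dissipation
  inequality exist only for almost every time, with no control of how they depend on time. Hence the
  inequality is an algebraic statement about one fixed time, and the scalar V alone is integrated.
  Its derivative is merely bounded above by an integrable function, so the fundamental theorem of
  calculus is proved as an inequality that asks for no measurability of the derivative. The
  coordinates U are chosen because they are unconstrained: any vectors w and x may be combined with
  any square integrable functions in the places of z_1, of the first derivative of z_2 and of the
  second derivative of z_3. The boundary conditions are absorbed in the operator that reconstructs
  the state, and so positivity on the whole space, which is what \<open>Phi\<close> supplies, can be
  applied to U.\<close>

definition short_family :: "real \<Rightarrow> real \<Rightarrow> real \<Rightarrow> (real \<times> real) set \<Rightarrow> bool" where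
  "short_family l r \<delta> I \<longleftrightarrow> finite I \<and> (\<forall>(u, v) \<in> I. l \<le> u \<and> u \<le> v \<and> v \<le> r) \<and>
     pairwise (\<lambda>p q. {fst p<..<snd p} \<inter> {fst q<..<snd q} = {}) I \<and> (\<Sum>(u, v) \<in> I. v - u) < \<delta>"

lemma abs_cont_on_iff:
  "abs_cont_on d l r f \<longleftrightarrow>
     (\<forall>\<epsilon>>0. \<exists>\<delta>>0. \<forall>I. short_family l r \<delta> I \<longrightarrow> (\<Sum>(u, v) \<in> I. d (f u) (f v)) < \<epsilon>)"
  by (simp add: abs_cont_on_def short_family_def)

lemma abs_cont_onE:
  assumes "abs_cont_on d l r f" "e > 0"
  obtains \<delta> where "\<delta> > 0" "\<And>I. short_family l r \<delta> I \<Longrightarrow> (\<Sum>(u, v) \<in> I. d (f u) (f v)) < e"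
  using assms unfolding abs_cont_on_iff by blast

text \<open>This is the gauge proof of the fundamental theorem of calculus: a tag in the exceptional
  null set only gets intervals inside an open set of small measure, whose increments are controlled
  by absolute continuity.\<close>

lemma abs_cont_increment_le_integral:
  fixes f g :: "real \<Rightarrow> real"
  assumes lr: "l \<le> r" and ac: "abs_cont_on dist l r f"
    and der: "AE s in lebesgue_on {l..r}. \<exists>D. (f has_real_derivative D) (at s) \<and> D \<le> g s"
    and g: "integrable (lebesgue_on {l..r}) g"
  shows "f r - f l \<le> (LINT s|lebesgue_on {l..r}. g s)"
proof (rule field_le_epsilon)
  fix e0 :: real assume "e0 > 0"
  \<comment> \<open>The error budget: e for the Riemann sum, e for the increments over cells tagged
    in the null set, and e (r - l) for the cells at whose tag the derivative exists.\<close>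
  define e where "e = e0 / (r - l + 2)"
  have e: "e > 0" and ee: "e * (r - l + 2) = e0"
    using \<open>e0 > 0\<close> lr unfolding e_def by auto
  obtain N where N: "N \<in> null_sets (lebesgue_on {l..r})"
    and Nd: "\<And>s. s \<in> {l..r} \<Longrightarrow> s \<notin> N \<Longrightarrow> \<exists>D. (f has_real_derivative D) (at s) \<and> D \<le> g s"
    using der by (auto simp: eventually_ae_filter space_restrict_space) blast
  have Nn: "N \<in> null_sets lebesgue"
    using N by (simp add: null_sets_restrict_space)
  \<comment> \<open>Setting the integrand to 0 on the null set keeps its integral and removes the
    Riemann terms of the tags there, so at those tags only increments of f remain to be
    estimated.\<close>
  define g' where "g' = (\<lambda>s. if s \<in> N then 0 else g s)"
  let ?I = "LINT s|lebesgue_on {l..r}. g s"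
  have "(g has_integral ?I) {l..r}"
    using has_integral_integral_lebesgue_on[OF g] by simp
  then have g'I: "(g' has_integral ?I) {l..r}"
    by (rule has_integral_spike[rotated 2])
       (use Nn in \<open>auto simp: g'_def negligible_iff_null_sets\<close>)
  obtain \<gamma>1 where g1: "gauge \<gamma>1"
    and g1d: "\<And>p. p tagged_division_of {l..r} \<Longrightarrow> \<gamma>1 fine p \<Longrightarrow>
        norm ((\<Sum>(x,k)\<in>p. measure lborel k *\<^sub>R g' x) - ?I) < e"
    using g'I e unfolding has_integral_real by metis
  obtain \<delta> where \<delta>: "\<delta> > 0"
    and acd: "\<And>I. short_family l r \<delta> I \<Longrightarrow> (\<Sum>(u, v) \<in> I. dist (f u) (f v)) < e"
    using abs_cont_onE[OF ac e] by blast
  \<comment> \<open>Since N is null, T itself has measure below \<delta>; nonoverlapping cells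
    inside T therefore have total length below \<delta>.\<close>
  obtain T where T: "open T" "N \<subseteq> T" "T - N \<in> lmeasurable" "emeasure lebesgue (T - N) < ennreal \<delta>"
    using sets_lebesgue_outer_open[of N \<delta>] Nn \<delta> by blast
  have Tm: "emeasure lebesgue T < ennreal \<delta>"
  proof -
    have "T \<in> sets lebesgue" using T(1) by simp
    then have "emeasure lebesgue (T - N) = emeasure lebesgue T"
      using emeasure_Diff_null_set[OF Nn] by blast
    with T(4) show ?thesis by simp
  qed
  have Tl: "T \<in> lmeasurable"
    using Tm T(1) by (auto simp: fmeasurable_def top.not_eq_extremum[symmetric] dest:
        less_trans[OF _ ennreal_less_top])
  have Tmm: "measure lebesgue T < \<delta>"
    using Tm Tl \<delta> by (simp add: emeasure_eq_measure2 ennreal_less_iff)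
  \<comment> \<open>Straddling estimate: the tag s may be interior to the cell, so the derivative
    bounds the increments over [u,s] and [s,v] separately and the two bounds are added. At all other
    s the claim is vacuous, which makes the choice of a radius total.\<close>
  have "\<exists>d>0. \<forall>u v. s \<in> {l..r} - N \<longrightarrow> u \<le> s \<longrightarrow> s \<le> v \<longrightarrow> {u..v} \<subseteq> ball s d \<longrightarrow> f v - f u \<le> (g' s + e)
      * (v - u)" for s
  proof (cases "s \<in> {l..r} - N")
    case True
    then obtain D where D: "(f has_real_derivative D) (at s)" and Dg: "D \<le> g s" using Nd by auto
    obtain d where d: "d > 0" "\<And>y. \<bar>y - s\<bar> < d \<Longrightarrow> \<bar>f y - f s - D * (y - s)\<bar> \<le> e * \<bar>y - s\<bar>"
      using D[unfolded has_field_derivative_def has_derivative_at_alt] e by auto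
    show ?thesis
    proof (intro exI[of _ d] conjI allI impI)
      fix u v assume uv: "u \<le> s" "s \<le> v" "{u..v} \<subseteq> ball s d"
      have "u \<in> {u..v}" "v \<in> {u..v}" using uv(1,2) by auto
      then have "u \<in> ball s d" "v \<in> ball s d" using uv(3) by blast+
      then have "\<bar>f u - f s - D * (u - s)\<bar> \<le> e * \<bar>u - s\<bar>" "\<bar>f v - f s - D * (v - s)\<bar> \<le> e * \<bar>v - s\<bar>"
        using d(2)[of u] d(2)[of v] by (auto simp: dist_real_def abs_minus_commute)
      then have "f s - f u \<le> (D + e) * (s - u)" "f v - f s \<le> (D + e) * (v - s)"
        using uv by (auto simp: algebra_simps abs_le_iff)
      then have "f v - f u \<le> (D + e) * (v - u)" by (simp add: algebra_simps)
      also have "\<dots> \<le> (g' s + e) * (v - u)"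
        using Dg True uv by (intro mult_right_mono) (auto simp: g'_def)
      finally show "f v - f u \<le> (g' s + e) * (v - u)" .
    qed (fact d)
  qed (auto intro: exI[of _ 1])
  then obtain dd where dd: "\<And>s. dd s > 0"
    "\<And>s u v. s \<in> {l..r} - N \<Longrightarrow> u \<le> s \<Longrightarrow> s \<le> v \<Longrightarrow> {u..v} \<subseteq> ball s (dd s) \<Longrightarrow> f v - f u \<le> (g' s + e) * (v - u)"
    by metis
  define \<gamma> where "\<gamma> = (\<lambda>x. \<gamma>1 x \<inter> (if x \<in> N then T else ball x (dd x)))"
  have "gauge \<gamma>"
    using g1 T dd(1) by (auto simp: gauge_def \<gamma>_def)
  then obtain p where p: "p tagged_division_of {l..r}" "\<gamma> fine p"
    using fine_division_exists_real by blast
  have fp: "\<gamma>1 fine p" using p(2) by (force simp: fine_def \<gamma>_def)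
  have finp: "finite p" using p(1) by (auto dest: tagged_division_of_finite)
  have K: "\<exists>u v. K = {u..v} \<and> u \<le> x \<and> x \<le> v \<and> l \<le> u \<and> v \<le> r \<and> Inf K = u \<and> Sup K = v
      \<and> measure lborel K = v - u
      \<and> K \<subseteq> (if x \<in> N then T else ball x (dd x)) \<and> interior K = {u<..<v}" if "(x,K) \<in> p" for x K
  proof -
    have "x \<in> K" "K \<subseteq> {l..r}" "\<exists>u v. K = cbox u v" using tagged_division_ofD(2-4)[OF p(1) that] by auto
    then obtain u v where "K = {u..v}" "u \<le> x" "x \<le> v" "l \<le> u" "v \<le> r" by auto
    moreover have "K \<subseteq> (if x \<in> N then T else ball x (dd x))"
      using p(2) that by (force simp: fine_def \<gamma>_def)
    ultimately show ?thesis by (intro exI[of _ u] exI[of _ v]) auto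
  qed
  \<comment> \<open>Degenerate cells carry no increment. Without them all interiors are nonempty, so
    disjointness makes the map \<open>h\<close> to the end points injective, and sums over cells
    become sums over intervals.\<close>
  define q where "q = {z \<in> p. fst z \<in> N \<and> Inf (snd z) < Sup (snd z)}"
  define h where "h = (\<lambda>z::real \<times> real set. (Inf (snd z), Sup (snd z)))"
  have qD: "z \<in> p" "z \<in> q \<Longrightarrow> fst z \<in> N" "Inf (snd z) < Sup (snd z)" if "z \<in> q" for z
    using that by (auto simp: q_def)
  have finq: "finite q" using finp by (simp add: q_def)
  have disj: "{fst (h z)<..<snd (h z)} \<inter> {fst (h z')<..<snd (h z')} = {}"
      if "z \<in> q" "z' \<in> q" "z \<noteq> z'" for z z'
  proof -
    have "interior (snd z) \<inter> interior (snd z') = {}"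
      using tagged_division_ofD(5)[OF p(1), of "fst z" "snd z" "fst z'" "snd z'"] that qD(1)
          by (cases z; cases z') auto
    then show ?thesis using K[of "fst z" "snd z"] K[of "fst z'" "snd z'"] qD(1)[OF that(1)]
        qD(1)[OF that(2)]
      by (auto simp: h_def)
  qed
  have inj: "inj_on h q"
  proof (rule inj_onI, rule ccontr)
    fix z z' assume "z \<in> q" "z' \<in> q" "h z = h z'" "z \<noteq> z'"
    with disj[of z z'] have "{fst (h z)<..<snd (h z)} = {}" by auto
    with qD(3)[OF \<open>z \<in> q\<close>] show False by (simp add: h_def)
  qed
  have "(\<Sum>(u, v) \<in> h ` q. dist (f u) (f v)) < e"
  proof (rule acd, unfold short_family_def, intro conjI)
    show "finite (h ` q)" using finq by simp
    show "\<forall>(u, v) \<in> h ` q. l \<le> u \<and> u \<le> v \<and> v \<le> r"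
    proof -
      have "l \<le> fst (h z) \<and> fst (h z) \<le> snd (h z) \<and> snd (h z) \<le> r" if "z \<in> q" for z
        using K[of "fst z" "snd z"] qD(1)[OF that] by (auto simp: h_def)
      then show ?thesis by (auto simp: case_prod_beta)
    qed
    show "pairwise (\<lambda>p q. {fst p<..<snd p} \<inter> {fst q<..<snd q} = {}) (h ` q)"
      using disj by (auto simp: pairwise_def)
    have "(\<Sum>(u, v) \<in> h ` q. v - u) = (\<Sum>z\<in>q. measure lebesgue {fst (h z)<..<snd (h z)})"
      by (subst sum.reindex[OF inj]) (auto intro!: sum.cong simp: case_prod_beta h_def dest!: qD(3))
    also have "\<dots> = measure lebesgue (\<Union>z\<in>q. {fst (h z)<..<snd (h z)})"
    proof (rule measure_finite_Union[symmetric])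
      show "emeasure lebesgue {fst (h z)<..<snd (h z)} \<noteq> \<infinity>" if "z \<in> q" for z
        using qD(3)[OF that] by (simp add: h_def)
    qed (use finq disj in \<open>auto simp: disjoint_family_on_def\<close>)
    also have "\<dots> \<le> measure lebesgue T"
    proof (rule measure_mono_fmeasurable)
      show "(\<Union>z\<in>q. {fst (h z)<..<snd (h z)}) \<subseteq> T"
      proof (rule UN_least)
        fix z assume "z \<in> q"
        then have "snd z \<subseteq> T" "{fst (h z)<..<snd (h z)} \<subseteq> snd z"
          using K[of "fst z" "snd z"] qD(1,2)[of z] by (auto simp: h_def)
        then show "{fst (h z)<..<snd (h z)} \<subseteq> T" by blast
      qed
    qed (use Tl finq in auto)
    finally show "(\<Sum>(u, v) \<in> h ` q. v - u) < \<delta>" using Tmm by simp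
  qed
  then have qe: "(\<Sum>z\<in>q. \<bar>f (Sup (snd z)) - f (Inf (snd z))\<bar>) < e"
    by (subst (asm) sum.reindex[OF inj])
        (simp add: h_def dist_real_def abs_minus_commute case_prod_beta)
  have "f r - f l = (\<Sum>z\<in>p. f (Sup (snd z)) - f (Inf (snd z)))"
    using additive_tagged_division_1[OF lr p(1), of f] by (simp add: case_prod_beta)
  \<comment> \<open>A tag outside N pays with the derivative bound. A tag in N pays with the
    increment of its own cell, since its Riemann term is 0.\<close>
  also have "\<dots> \<le> (\<Sum>z\<in>p. measure lborel (snd z) *\<^sub>R g' (fst z) + e * (Sup (snd z) - Inf (snd z))
       + (if z \<in> q then \<bar>f (Sup (snd z)) - f (Inf (snd z))\<bar> else 0))"
  proof (rule sum_mono)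
    fix z assume z: "z \<in> p"
    obtain x k where zk: "z = (x,k)" by force
    obtain u v where uv: "k = {u..v}" "u \<le> x" "x \<le> v" "l \<le> u" "v \<le> r" "Inf k = u" "Sup k = v"
        "measure lborel k = v - u"
      "k \<subseteq> (if x \<in> N then T else ball x (dd x))" using K[of x k] z zk by blast
    show "f (Sup (snd z)) - f (Inf (snd z)) \<le> measure lborel (snd z) *\<^sub>R g' (fst z) + e
        * (Sup (snd z) - Inf (snd z))
       + (if z \<in> q then \<bar>f (Sup (snd z)) - f (Inf (snd z))\<bar> else 0)"
    proof (cases "x \<in> N")
      case True
      have "e * (v - u) \<ge> 0" using e uv by auto
      then show ?thesis using True z uv by (cases "u = v") (auto simp: zk q_def g'_def abs_if)
    next
      case False
      then have "f v - f u \<le> (g' x + e) * (v - u)" using uv by (intro dd(2)) auto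
      moreover have "z \<notin> q" using False zk by (simp add: q_def)
      ultimately show ?thesis using uv by (simp add: zk algebra_simps)
    qed
  qed
  also have "\<dots> = (\<Sum>z\<in>p. measure lborel (snd z) *\<^sub>R g' (fst z)) + e * (\<Sum>z\<in>p. Sup (snd z) - Inf (snd z))
       + (\<Sum>z\<in>q. \<bar>f (Sup (snd z)) - f (Inf (snd z))\<bar>)"
  proof -
    have "p \<inter> q = q" by (auto simp: q_def)
    then show ?thesis by (simp add: sum.distrib sum_distrib_left finp flip: sum.inter_restrict)
  qed
  also have "(\<Sum>z\<in>p. Sup (snd z) - Inf (snd z)) = r - l"
    using additive_tagged_division_1[OF lr p(1), of "\<lambda>x. x"] by (simp add: case_prod_beta)
  also have "(\<Sum>z\<in>p. measure lborel (snd z) *\<^sub>R g' (fst z)) + e * (r - l)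
       + (\<Sum>z\<in>q. \<bar>f (Sup (snd z)) - f (Inf (snd z))\<bar>) \<le> (?I + e) + e * (r - l) + e"
    using g1d[OF p(1) fp] qe by (auto simp: case_prod_beta abs_less_iff)
  finally show "f r - f l \<le> ?I + e0" using ee by (simp add: algebra_simps)
qed

text \<open>The one-sided estimate, applied to f and to -f.\<close>

lemma abs_cont_increment_eq_integral:
  fixes f g :: "real \<Rightarrow> real"
  assumes lr: "l \<le> r" and ac: "abs_cont_on dist l r f"
    and der: "AE s in lebesgue_on {l..r}. (f has_real_derivative g s) (at s)"
    and g: "integrable (lebesgue_on {l..r}) g"
  shows "f r - f l = (LINT s|lebesgue_on {l..r}. g s)"
proof (rule antisym)
  show "f r - f l \<le> (LINT s|lebesgue_on {l..r}. g s)"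
    using der by (intro abs_cont_increment_le_integral[OF lr ac _ g]) auto
  have ac': "abs_cont_on dist l r (\<lambda>s. - f s)"
    using ac unfolding abs_cont_on_def by (simp add: dist_real_def abs_minus_commute)
  have "AE s in lebesgue_on {l..r}. ((\<lambda>s. - f s) has_real_derivative (- g s)) (at s)"
    using der by eventually_elim (rule DERIV_minus)
  then have "- f r - - f l \<le> (LINT s|lebesgue_on {l..r}. - g s)"
    using g by (intro abs_cont_increment_le_integral[OF lr ac']) auto
  then show "(LINT s|lebesgue_on {l..r}. g s) \<le> f r - f l" by simp
qed

section \<open>Integral operators on square integrable functions\<close>

lemma abs_mult_bound: "\<bar>x\<bar> \<le> C \<Longrightarrow> \<bar>x * y\<bar> \<le> \<bar>C\<bar> * \<bar>y :: real\<bar>"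
  by (simp add: abs_mult mult_right_mono)

lemma abs_mult_bound2: "\<bar>x\<bar> \<le> C \<Longrightarrow> \<bar>y\<bar> \<le> D \<Longrightarrow> \<bar>x * y\<bar> \<le> \<bar>C\<bar> * \<bar>D :: real\<bar>"
  unfolding abs_mult by (rule mult_mono) linarith+

lemma abs_mult_le_squares: "\<bar>x * y\<bar> \<le> x\<^sup>2 + (y :: real)\<^sup>2"
proof -
  have "2 * (\<bar>x\<bar> * \<bar>y\<bar>) \<le> x\<^sup>2 + y\<^sup>2" using sum_squares_bound[of "\<bar>x\<bar>" "\<bar>y\<bar>"] by (simp add: mult.assoc)
  moreover have "0 \<le> \<bar>x\<bar> * \<bar>y\<bar>" by simp
  ultimately show ?thesis unfolding abs_mult by linarith
qed

lemma integrable_mult_squares: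
  fixes f g :: "'a \<Rightarrow> real"
  assumes "f \<in> borel_measurable M" "g \<in> borel_measurable M"
    and "integrable M (\<lambda>s. (f s)\<^sup>2)" "integrable M (\<lambda>s. (g s)\<^sup>2)"
  shows "integrable M (\<lambda>s. f s * g s)"
proof (rule Bochner_Integration.integrable_bound)
  show "integrable M (\<lambda>s. (f s)\<^sup>2 + (g s)\<^sup>2)" using assms by simp
  show "AE s in M. norm (f s * g s) \<le> norm ((f s)\<^sup>2 + (g s)\<^sup>2)" using abs_mult_le_squares by simp
qed (use assms in simp)

text \<open>Diffuse means that points are null, so the values of a kernel on the diagonal never
  matter. Finiteness makes bounded functions square integrable and square integrable functions
  integrable. \<open>N\<close> is the common range of the summation indices.\<close>

locale diffuse_finite_measure = finite_measure \<mu> for \<mu> :: "'a measure" +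
  fixes N :: nat
  assumes AE_neq: "\<And>x. AE y in \<mu>. y \<noteq> x"
begin

sublocale pair_sigma_finite \<mu> \<mu> ..

lemma sigma_finite: "sigma_finite_measure \<mu>"
  by unfold_locales

text \<open>The bound is demanded on the space only: continuous functions on the line are bounded on
  a compact interval, but in general not globally.\<close>

definition bmeas :: "('a \<Rightarrow> real) \<Rightarrow> bool" where
  "bmeas f \<longleftrightarrow> f \<in> borel_measurable \<mu> \<and> (\<exists>C. \<forall>s\<in>space \<mu>. \<bar>f s\<bar> \<le> C)"

definition bmeas2 :: "('a \<Rightarrow> 'a \<Rightarrow> real) \<Rightarrow> bool" where
  "bmeas2 k \<longleftrightarrow> (\<lambda>(s, \<theta>). k s \<theta>) \<in> borel_measurable (\<mu> \<Otimes>\<^sub>M \<mu>) \<and>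
     (\<exists>C. \<forall>s\<in>space \<mu>. \<forall>\<theta>\<in>space \<mu>. \<bar>k s \<theta>\<bar> \<le> C)"

definition L2f :: "('a \<Rightarrow> real) \<Rightarrow> bool" where
  "L2f f \<longleftrightarrow> f \<in> borel_measurable \<mu> \<and> integrable \<mu> (\<lambda>s. (f s)\<^sup>2)"

lemma bmeas2D: "bmeas2 k \<Longrightarrow> (\<lambda>(s, \<theta>). k s \<theta>) \<in> borel_measurable (\<mu> \<Otimes>\<^sub>M \<mu>)"
  by (simp add: bmeas2_def)

lemma bmeas2_measurable:
  assumes "bmeas2 k" "f \<in> measurable A \<mu>" "g \<in> measurable A \<mu>"
  shows "(\<lambda>x. k (f x) (g x)) \<in> borel_measurable A"
  using measurable_compose[OF measurable_Pair[OF assms(2,3)] bmeas2D[OF assms(1)]] by simp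

lemma bmeas_add: "bmeas f \<Longrightarrow> bmeas g \<Longrightarrow> bmeas (\<lambda>s. f s + g s)"
  unfolding bmeas_def
proof (elim conjE exE, intro conjI)
  fix C D assume "\<forall>s\<in>space \<mu>. \<bar>f s\<bar> \<le> C" "\<forall>s\<in>space \<mu>. \<bar>g s\<bar> \<le> D"
  then show "\<exists>C. \<forall>s\<in>space \<mu>. \<bar>f s + g s\<bar> \<le> C" by (intro exI[of _ "C + D"]) fastforce
qed auto

lemma bmeas_mult: "bmeas f \<Longrightarrow> bmeas g \<Longrightarrow> bmeas (\<lambda>s. f s * g s)"
  unfolding bmeas_def
proof (elim conjE exE, intro conjI)
  fix C D assume "\<forall>s\<in>space \<mu>. \<bar>f s\<bar> \<le> C" "\<forall>s\<in>space \<mu>. \<bar>g s\<bar> \<le> D"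
  then show "\<exists>C. \<forall>s\<in>space \<mu>. \<bar>f s * g s\<bar> \<le> C"
    by (intro exI[of _ "\<bar>C\<bar> * \<bar>D\<bar>"]) (simp add: abs_mult_bound2)
qed auto

lemma bmeas_const: "bmeas (\<lambda>_. c)"
  by (auto simp: bmeas_def)

lemma bmeas_sum: "(\<And>i. i \<in> A \<Longrightarrow> bmeas (f i)) \<Longrightarrow> bmeas (\<lambda>s. \<Sum>i\<in>A. f i s)"
  by (induction A rule: infinite_finite_induct) (auto intro: bmeas_const bmeas_add)

lemma bmeas2_add: "bmeas2 f \<Longrightarrow> bmeas2 g \<Longrightarrow> bmeas2 (\<lambda>s \<theta>. f s \<theta> + g s \<theta>)"
  unfolding bmeas2_def
proof (elim conjE exE, intro conjI)
  fix C D assume "\<forall>s\<in>space \<mu>. \<forall>\<theta>\<in>space \<mu>. \<bar>f s \<theta>\<bar> \<le> C" "\<forall>s\<in>space \<mu>. \<forall>\<theta>\<in>space \<mu>. \<bar>g s \<theta>\<bar> \<le> D"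
  then show "\<exists>C. \<forall>s\<in>space \<mu>. \<forall>\<theta>\<in>space \<mu>. \<bar>f s \<theta> + g s \<theta>\<bar> \<le> C"
    by (intro exI[of _ "C + D"]) fastforce
qed (auto simp: case_prod_beta)

lemma bmeas2_mult: "bmeas2 f \<Longrightarrow> bmeas2 g \<Longrightarrow> bmeas2 (\<lambda>s \<theta>. f s \<theta> * g s \<theta>)"
  unfolding bmeas2_def
proof (elim conjE exE, intro conjI)
  fix C D assume "\<forall>s\<in>space \<mu>. \<forall>\<theta>\<in>space \<mu>. \<bar>f s \<theta>\<bar> \<le> C" "\<forall>s\<in>space \<mu>. \<forall>\<theta>\<in>space \<mu>. \<bar>g s \<theta>\<bar> \<le> D"
  then show "\<exists>C. \<forall>s\<in>space \<mu>. \<forall>\<theta>\<in>space \<mu>. \<bar>f s \<theta> * g s \<theta>\<bar> \<le> C"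
    by (intro exI[of _ "\<bar>C\<bar> * \<bar>D\<bar>"]) (simp add: abs_mult_bound2)
qed (auto simp: case_prod_beta)

lemma bmeas2_const: "bmeas2 (\<lambda>_ _. c)"
  by (auto simp: bmeas2_def)

lemma bmeas2_sum: "(\<And>i. i \<in> A \<Longrightarrow> bmeas2 (f i)) \<Longrightarrow> bmeas2 (\<lambda>s \<theta>. \<Sum>i\<in>A. f i s \<theta>)"
  by (induction A rule: infinite_finite_induct) (auto intro: bmeas2_const bmeas2_add)

lemma bmeas2_swap:
  assumes "bmeas2 k" shows "bmeas2 (\<lambda>s \<theta>. k \<theta> s)"
  using assms bmeas2_measurable[OF assms measurable_snd measurable_fst]
  by (auto simp: bmeas2_def case_prod_beta)

lemma bmeas2_left: "bmeas f \<Longrightarrow> bmeas2 (\<lambda>s \<theta>. f s)"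
  unfolding bmeas_def bmeas2_def by (auto simp: case_prod_beta)

lemma bmeas2_right: "bmeas f \<Longrightarrow> bmeas2 (\<lambda>s \<theta>. f \<theta>)"
  unfolding bmeas_def bmeas2_def by (auto simp: case_prod_beta)

lemma bmeas2_section: "bmeas2 k \<Longrightarrow> s \<in> space \<mu> \<Longrightarrow> bmeas (k s)"
  unfolding bmeas_def
proof (rule conjI)
  assume k: "bmeas2 k" and s: "s \<in> space \<mu>"
  show "k s \<in> borel_measurable \<mu>"
    using bmeas2_measurable[OF k measurable_const[OF s] measurable_ident] by (simp only: id_apply)
  show "\<exists>C. \<forall>\<theta>\<in>space \<mu>. \<bar>k s \<theta>\<bar> \<le> C" using k s unfolding bmeas2_def by blast
qed

lemma integrable_bmeas_mult:
  assumes "bmeas f" "integrable \<mu> g" shows "integrable \<mu> (\<lambda>s. f s * g s)"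
proof -
  obtain C where "\<forall>s\<in>space \<mu>. \<bar>f s\<bar> \<le> C" "f \<in> borel_measurable \<mu>" using assms(1)
      by (auto simp: bmeas_def)
  then have b: "\<bar>f s * g s\<bar> \<le> \<bar>C\<bar> * \<bar>g s\<bar>" if "s \<in> space \<mu>" for s
    using that by (simp add: abs_mult_bound)
  have "integrable \<mu> (\<lambda>s. C * g s)" using assms(2) by simp
  then show ?thesis
  proof (rule Bochner_Integration.integrable_bound)
    show "AE s in \<mu>. norm (f s * g s) \<le> norm (C * g s)" using b by (intro AE_I2) (simp add: abs_mult)
  qed (use assms in \<open>auto simp: bmeas_def\<close>)
qed

lemma bmeas_integrable: "bmeas f \<Longrightarrow> integrable \<mu> f"
  using integrable_bmeas_mult[of f "\<lambda>_. 1"] by simp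

lemma L2f_mult: "L2f f \<Longrightarrow> L2f g \<Longrightarrow> integrable \<mu> (\<lambda>s. f s * g s)"
  by (auto simp: L2f_def intro: integrable_mult_squares)

lemma bmeas_L2f: "bmeas f \<Longrightarrow> L2f f"
  unfolding L2f_def using bmeas_integrable[OF bmeas_mult[of f f]]
      by (auto simp: bmeas_def power2_eq_square)

lemma L2f_integrable: "L2f f \<Longrightarrow> integrable \<mu> f"
  using L2f_mult[of f "\<lambda>_. 1"] bmeas_L2f[OF bmeas_const] by simp

lemma L2f_add:
  assumes "L2f f" "L2f g" shows "L2f (\<lambda>s. f s + g s)"
  using assms L2f_mult[OF assms] by (auto simp: L2f_def power2_sum mult.assoc)

lemma L2f_bmeas_mult:
  assumes "bmeas f" "L2f g" shows "L2f (\<lambda>s. f s * g s)"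
  using assms integrable_bmeas_mult[OF bmeas_mult[OF assms(1) assms(1)], of "\<lambda>s. (g s)\<^sup>2"]
  by (auto simp: L2f_def bmeas_def power2_eq_square ac_simps)

lemma L2f_sum: "(\<And>i. i \<in> A \<Longrightarrow> L2f (f i)) \<Longrightarrow> L2f (\<lambda>s. \<Sum>i\<in>A. f i s)"
  by (induction A rule: infinite_finite_induct) (auto intro: bmeas_L2f bmeas_const L2f_add)

lemma L2f_scale: "L2f f \<Longrightarrow> L2f (\<lambda>s. c * f s)"
  by (rule L2f_bmeas_mult[OF bmeas_const])

text \<open>Dominated by a constant multiple of the tensor product of f and g, which is integrable
  by Tonelli.\<close>

lemma integrable_kernel:
  assumes k: "bmeas2 k" and f: "integrable \<mu> f" and g: "integrable \<mu> g"
  shows "integrable (\<mu> \<Otimes>\<^sub>M \<mu>) (\<lambda>(s, \<theta>). f s * k s \<theta> * g \<theta>)"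
proof -
  obtain C where C: "\<And>s \<theta>. s \<in> space \<mu> \<Longrightarrow> \<theta> \<in> space \<mu> \<Longrightarrow> \<bar>k s \<theta>\<bar> \<le> C" using k by (auto simp: bmeas2_def)
  have fg: "integrable (\<mu> \<Otimes>\<^sub>M \<mu>) (\<lambda>(s, \<theta>). f s * g \<theta>)"
  proof (rule Fubini_integrable)
    show "integrable \<mu> (\<lambda>x. LINT y|\<mu>. norm (case (x, y) of (s, \<theta>) \<Rightarrow> f s * g \<theta>))"
      using f g by (simp add: abs_mult)
  qed (use f g in \<open>auto simp: case_prod_beta\<close>)
  then have "integrable (\<mu> \<Otimes>\<^sub>M \<mu>) (\<lambda>p. C * (f (fst p) * g (snd p)))"
    unfolding case_prod_unfold by (rule integrable_mult_right)
  then show ?thesis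
  proof (rule Bochner_Integration.integrable_bound)
    show "(\<lambda>(s, \<theta>). f s * k s \<theta> * g \<theta>) \<in> borel_measurable (\<mu> \<Otimes>\<^sub>M \<mu>)"
      using f g bmeas2_measurable[OF k measurable_fst measurable_snd] by (auto simp: case_prod_beta)
    show "AE p in \<mu> \<Otimes>\<^sub>M \<mu>. norm (case p of (s, \<theta>) \<Rightarrow> f s * k s \<theta> * g \<theta>)
        \<le> norm (C * (f (fst p) * g (snd p)))"
    proof (rule AE_I2)
      fix p assume "p \<in> space (\<mu> \<Otimes>\<^sub>M \<mu>)"
      then have "\<bar>k (fst p) (snd p)\<bar> \<le> \<bar>C\<bar>" using C[of "fst p" "snd p"]
          by (auto simp: space_pair_measure)
      then have "\<bar>k (fst p) (snd p)\<bar> * (\<bar>f (fst p)\<bar> * \<bar>g (snd p)\<bar>) \<le> \<bar>C\<bar> * (\<bar>f (fst p)\<bar> * \<bar>g (snd p)\<bar>)"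
        by (rule mult_right_mono) simp
      then show "norm (case p of (s, \<theta>) \<Rightarrow> f s * k s \<theta> * g \<theta>) \<le> norm (C * (f (fst p) * g (snd p)))"
        by (simp add: case_prod_beta abs_mult ac_simps)
    qed
  qed
qed

lemma kernel_Fubini:
  assumes k: "bmeas2 k" and f: "integrable \<mu> f" and g: "integrable \<mu> g"
  shows "(LINT s|\<mu>. f s * (LINT \<theta>|\<mu>. k s \<theta> * g \<theta>)) = (LINT \<theta>|\<mu>. (LINT s|\<mu>. f s * k s \<theta>) * g \<theta>)"
proof -
  have "(LINT s|\<mu>. f s * (LINT \<theta>|\<mu>. k s \<theta> * g \<theta>)) = (LINT s|\<mu>. LINT \<theta>|\<mu>. f s * k s \<theta> * g \<theta>)"
    by (simp add: mult.assoc)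
  also have "\<dots> = (LINT \<theta>|\<mu>. LINT s|\<mu>. f s * k s \<theta> * g \<theta>)"
    using Fubini_integral[OF integrable_kernel[OF assms]] by simp
  finally show ?thesis by simp
qed

text \<open>The sup norm is at most the bound of the kernel times the integral of |g|. This
  smoothing keeps iterated kernel operators inside the classes to which Fubini applies.\<close>

lemma bmeas_kernel:
  assumes k: "bmeas2 k" and g: "integrable \<mu> g"
  shows "bmeas (\<lambda>s. LINT \<theta>|\<mu>. k s \<theta> * g \<theta>)"
proof -
  obtain C where C: "\<And>s \<theta>. s \<in> space \<mu> \<Longrightarrow> \<theta> \<in> space \<mu> \<Longrightarrow> \<bar>k s \<theta>\<bar> \<le> C" using k by (auto simp: bmeas2_def)
  have "(\<lambda>s. LINT \<theta>|\<mu>. k s \<theta> * g \<theta>) \<in> borel_measurable \<mu>"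
    using g bmeas2_measurable[OF k measurable_fst measurable_snd]
    by (intro sigma_finite_measure.borel_measurable_lebesgue_integral sigma_finite)
        (auto simp: case_prod_beta)
  moreover have "\<bar>LINT \<theta>|\<mu>. k s \<theta> * g \<theta>\<bar> \<le> (LINT \<theta>|\<mu>. \<bar>C\<bar> * \<bar>g \<theta>\<bar>)" if s: "s \<in> space \<mu>" for s
  proof -
    have "norm (LINT \<theta>|\<mu>. k s \<theta> * g \<theta>) \<le> (LINT \<theta>|\<mu>. norm (k s \<theta> * g \<theta>))" by (rule integral_norm_bound)
    also have "\<dots> \<le> (LINT \<theta>|\<mu>. \<bar>C\<bar> * \<bar>g \<theta>\<bar>)"
      using integrable_bmeas_mult[OF bmeas2_section[OF k s] g] g C[OF s]
      by (intro integral_mono) (auto simp: abs_mult_bound simp del: abs_mult)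
    finally show ?thesis by simp
  qed
  ultimately show ?thesis by (auto simp: bmeas_def)
qed

lemma bmeas2_kernel_comp:
  assumes k: "bmeas2 k" and l: "bmeas2 l"
  shows "bmeas2 (\<lambda>s \<eta>. LINT \<theta>|\<mu>. k s \<theta> * l \<theta> \<eta>)"
proof -
  obtain C where C: "\<And>s \<theta>. s \<in> space \<mu> \<Longrightarrow> \<theta> \<in> space \<mu> \<Longrightarrow> \<bar>k s \<theta>\<bar> \<le> C" using k by (auto simp: bmeas2_def)
  obtain D where D: "\<And>s \<theta>. s \<in> space \<mu> \<Longrightarrow> \<theta> \<in> space \<mu> \<Longrightarrow> \<bar>l s \<theta>\<bar> \<le> D" using l by (auto simp: bmeas2_def)
  have "(\<lambda>p. LINT \<theta>|\<mu>. k (fst p) \<theta> * l \<theta> (snd p)) \<in> borel_measurable (\<mu> \<Otimes>\<^sub>M \<mu>)"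
  proof (intro sigma_finite_measure.borel_measurable_lebesgue_integral sigma_finite)
    have "(\<lambda>q. k (fst (fst q)) (snd q)) \<in> borel_measurable ((\<mu> \<Otimes>\<^sub>M \<mu>) \<Otimes>\<^sub>M \<mu>)"
      "(\<lambda>q. l (snd q) (snd (fst q))) \<in> borel_measurable ((\<mu> \<Otimes>\<^sub>M \<mu>) \<Otimes>\<^sub>M \<mu>)"
      by (rule bmeas2_measurable[OF k]; measurable) (rule bmeas2_measurable[OF l]; measurable)
    then show "(\<lambda>(p, \<theta>). k (fst p) \<theta> * l \<theta> (snd p)) \<in> borel_measurable ((\<mu> \<Otimes>\<^sub>M \<mu>) \<Otimes>\<^sub>M \<mu>)"
      unfolding case_prod_unfold by (rule borel_measurable_times)
  qed
  moreover have "\<bar>LINT \<theta>|\<mu>. k s \<theta> * l \<theta> \<eta>\<bar> \<le> (LINT \<theta>|\<mu>. \<bar>C\<bar> * \<bar>D\<bar>)"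
      if s: "s \<in> space \<mu>" "\<eta> \<in> space \<mu>" for s \<eta>
  proof -
    have "norm (LINT \<theta>|\<mu>. k s \<theta> * l \<theta> \<eta>) \<le> (LINT \<theta>|\<mu>. norm (k s \<theta> * l \<theta> \<eta>))"
        by (rule integral_norm_bound)
    also have "\<dots> \<le> (LINT \<theta>|\<mu>. \<bar>C\<bar> * \<bar>D\<bar>)"
      using integrable_bmeas_mult[OF bmeas2_section[OF k s(1)]
          bmeas_integrable[OF bmeas2_section[OF bmeas2_swap[OF l] s(2)]]]
        C[OF s(1)] D[OF _ s(2)]
      by (intro integral_mono) (auto simp: abs_mult_bound2)
    finally show ?thesis by simp
  qed
  ultimately show ?thesis by (auto simp: bmeas2_def case_prod_beta)
qed

text \<open>All indices are covered, also those from \<open>N\<close> on: padded data vanish beyond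
  their dimensions, and the closure rules then carry no index bounds.\<close>

definition L2 :: "('a \<Rightarrow> nat \<Rightarrow> real) \<Rightarrow> bool" where
  "L2 X \<longleftrightarrow> (\<forall>i. L2f (\<lambda>s. X s i))"

definition bmul :: "('a \<Rightarrow> nat \<Rightarrow> nat \<Rightarrow> real) \<Rightarrow> bool" where
  "bmul M \<longleftrightarrow> (\<forall>i j. bmeas (\<lambda>s. M s i j))"

definition bker :: "('a \<Rightarrow> 'a \<Rightarrow> nat \<Rightarrow> nat \<Rightarrow> real) \<Rightarrow> bool" where
  "bker K \<longleftrightarrow> (\<forall>i j. bmeas2 (\<lambda>s \<theta>. K s \<theta> i j))"

definition op :: "('a \<Rightarrow> nat \<Rightarrow> nat \<Rightarrow> real) \<Rightarrow> ('a \<Rightarrow> 'a \<Rightarrow> nat \<Rightarrow> nat \<Rightarrow> real) \<Rightarrow>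
    ('a \<Rightarrow> nat \<Rightarrow> real) \<Rightarrow> 'a \<Rightarrow> nat \<Rightarrow> real" where
  "op M K X s i = (\<Sum>j<N. M s i j * X s j + (LINT \<theta>|\<mu>. K s \<theta> i j * X \<theta> j))"

definition ip :: "('a \<Rightarrow> nat \<Rightarrow> real) \<Rightarrow> ('a \<Rightarrow> nat \<Rightarrow> real) \<Rightarrow> real" where
  "ip X Y = (\<Sum>i<N. LINT s|\<mu>. X s i * Y s i)"

definition mcomp :: "('a \<Rightarrow> nat \<Rightarrow> nat \<Rightarrow> real) \<Rightarrow> ('a \<Rightarrow> nat \<Rightarrow> nat \<Rightarrow> real) \<Rightarrow> 'a \<Rightarrow> nat \<Rightarrow> nat \<Rightarrow> real" where
  "mcomp M M' s i k = (\<Sum>j<N. M s i j * M' s j k)"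

text \<open>The kernel of a product of two operators of the form multiplier plus kernel: multiplier
  after kernel, kernel after multiplier, kernel after kernel. Multiplier after multiplier stays a
  multiplier and is \<open>mcomp\<close>.\<close>

definition kcomp :: "('a \<Rightarrow> nat \<Rightarrow> nat \<Rightarrow> real) \<Rightarrow> ('a \<Rightarrow> 'a \<Rightarrow> nat \<Rightarrow> nat \<Rightarrow> real) \<Rightarrow>
    ('a \<Rightarrow> nat \<Rightarrow> nat \<Rightarrow> real) \<Rightarrow> ('a \<Rightarrow> 'a \<Rightarrow> nat \<Rightarrow> nat \<Rightarrow> real) \<Rightarrow> 'a \<Rightarrow> 'a \<Rightarrow> nat \<Rightarrow> nat \<Rightarrow> real" where
  "kcomp M K M' K' s \<eta> i k = (\<Sum>j<N. M s i j * K' s \<eta> j k + K s \<eta> i j * M' \<eta> j k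
      + (LINT \<theta>|\<mu>. K s \<theta> i j * K' \<theta> \<eta> j k))"

lemma L2D: "L2 X \<Longrightarrow> L2f (\<lambda>s. X s i)" by (simp add: L2_def)
lemma bmulD: "bmul M \<Longrightarrow> bmeas (\<lambda>s. M s i j)" by (simp add: bmul_def)
lemma bkerD: "bker K \<Longrightarrow> bmeas2 (\<lambda>s \<theta>. K s \<theta> i j)" by (simp add: bker_def)

lemma L2_integrable: "L2 X \<Longrightarrow> integrable \<mu> (\<lambda>s. X s i)"
  by (rule L2f_integrable[OF L2D])

lemma integrable_kernel_section:
  "bker K \<Longrightarrow> L2 X \<Longrightarrow> s \<in> space \<mu> \<Longrightarrow> integrable \<mu> (\<lambda>\<theta>. K s \<theta> i j * X \<theta> k)"
  by (rule integrable_bmeas_mult[OF bmeas2_section[OF bkerD] L2_integrable])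

lemma bmul_mcomp: "bmul M \<Longrightarrow> bmul M' \<Longrightarrow> bmul (mcomp M M')"
  unfolding bmul_def mcomp_def by (auto intro!: bmeas_sum bmeas_mult)

lemma bker_kcomp: "bmul M \<Longrightarrow> bker K \<Longrightarrow> bmul M' \<Longrightarrow> bker K' \<Longrightarrow> bker (kcomp M K M' K')"
  unfolding bmul_def bker_def kcomp_def
  by (auto intro!: bmeas2_sum bmeas2_add bmeas2_mult bmeas2_kernel_comp intro: bmeas2_left bmeas2_right)

lemma L2_op: "bmul M \<Longrightarrow> bker K \<Longrightarrow> L2 X \<Longrightarrow> L2 (op M K X)"
  unfolding L2_def[of "op M K X"] op_def
  by (intro allI L2f_sum L2f_add L2f_bmeas_mult[OF bmulD]
      bmeas_L2f[OF bmeas_kernel[OF bkerD L2_integrable]] L2D)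

text \<open>Fubini moves the outer kernel inside the inner integral. Afterwards both sides are the
  same double sum of four terms with the two summations in opposite order.\<close>

lemma op_comp:
  assumes M: "bmul M" and K: "bker K" and M': "bmul M'" and K': "bker K'" and X: "L2 X"
      and s: "s \<in> space \<mu>"
  shows "op M K (op M' K' X) s i = op (mcomp M M') (kcomp M K M' K') X s i"
proof -
  have Xi: "integrable \<mu> (\<lambda>s. X s k)" for k using X by (rule L2_integrable)
  have i1: "integrable \<mu> (\<lambda>\<theta>. K s \<theta> i j * (M' \<theta> j k * X \<theta> k))" for j k
    by (intro integrable_bmeas_mult bmeas2_section[OF bkerD[OF K] s] bmulD[OF M'] Xi)
  have i2: "integrable \<mu> (\<lambda>\<theta>. K s \<theta> i j * (LINT \<eta>|\<mu>. K' \<theta> \<eta> j k * X \<eta> k))" for j k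
    by (intro integrable_bmeas_mult bmeas2_section[OF bkerD[OF K] s] bmeas_integrable
        bmeas_kernel[OF bkerD[OF K']] Xi)
  have i3: "integrable \<mu> (\<lambda>\<eta>. K' s \<eta> j k * X \<eta> k)" for j k
    by (intro integrable_bmeas_mult bmeas2_section[OF bkerD[OF K'] s] Xi)
  have i4: "integrable \<mu> (\<lambda>\<eta>. (LINT \<theta>|\<mu>. K s \<theta> i j * K' \<theta> \<eta> j k) * X \<eta> k)" for j k
    using bmeas_kernel[OF bmeas2_swap[OF bkerD[OF K']]
        bmeas_integrable[OF bmeas2_section[OF bkerD[OF K] s]]]
    by (intro integrable_bmeas_mult Xi) (simp add: mult.commute)
  have L: "op M K (op M' K' X) s i
      = (\<Sum>j<N. \<Sum>k<N. M s i j * (M' s j k * X s k) + M s i j * (LINT \<eta>|\<mu>. K' s \<eta> j k * X \<eta> k)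
      + (LINT \<theta>|\<mu>. K s \<theta> i j * (M' \<theta> j k * X \<theta> k))
          + (LINT \<eta>|\<mu>. (LINT \<theta>|\<mu>. K s \<theta> i j * K' \<theta> \<eta> j k) * X \<eta> k))"
    unfolding op_def
    by (simp add: sum_distrib_left distrib_left sum.distrib i1 i2 add.assoc
        kernel_Fubini[OF bkerD[OF K'] bmeas_integrable[OF bmeas2_section[OF bkerD[OF K] s]] Xi])
  have R: "op (mcomp M M') (kcomp M K M' K') X s i
      = (\<Sum>k<N. \<Sum>j<N. M s i j * (M' s j k * X s k) + M s i j * (LINT \<eta>|\<mu>. K' s \<eta> j k * X \<eta> k)
      + (LINT \<theta>|\<mu>. K s \<theta> i j * (M' \<theta> j k * X \<theta> k))
          + (LINT \<eta>|\<mu>. (LINT \<theta>|\<mu>. K s \<theta> i j * K' \<theta> \<eta> j k) * X \<eta> k))"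
    unfolding op_def mcomp_def kcomp_def
    by (simp add: sum_distrib_right distrib_right sum.distrib i1 i3 i4 add.assoc mult.assoc)
  show ?thesis unfolding L R by (rule sum.swap)
qed

lemma ip_commute: "ip X Y = ip Y X"
  by (simp add: ip_def mult.commute)

lemma ip_add_right:
  assumes "L2 X" "L2 Y" "L2 Z" shows "ip X (\<lambda>s i. Y s i + Z s i) = ip X Y + ip X Z"
  unfolding ip_def using L2f_mult[OF L2D[OF assms(1)] L2D[OF assms(2)]]
      L2f_mult[OF L2D[OF assms(1)] L2D[OF assms(3)]]
  by (simp add: distrib_left sum.distrib)

lemma ip_scale_right: "ip X (\<lambda>s i. c * Y s i) = c * ip X Y"
  unfolding ip_def by (simp add: sum_distrib_left mult.left_commute)

lemma ip_cong: "(\<And>s i. s \<in> space \<mu> \<Longrightarrow> i < N \<Longrightarrow> X s i = X' s i) \<Longrightarrow>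
    (\<And>s i. s \<in> space \<mu> \<Longrightarrow> i < N \<Longrightarrow> Y s i = Y' s i) \<Longrightarrow> ip X Y = ip X' Y'"
  unfolding ip_def by (auto intro!: sum.cong Bochner_Integration.integral_cong)

lemma ip_nonneg: "0 \<le> ip X X"
  unfolding ip_def by (auto intro!: sum_nonneg)

text \<open>Fubini exchanges the two arguments of the kernel, and interchanging the two finite sums
  transposes the matrices.\<close>

lemma op_adjoint:
  assumes M: "bmul M" and K: "bker K" and X: "L2 X" and Y: "L2 Y"
  shows "ip X (op M K Y) = ip (op (\<lambda>s i j. M s j i) (\<lambda>s \<theta> i j. K \<theta> s j i) X) Y"
proof -
  have i1: "integrable \<mu> (\<lambda>s. X s i * (M s i j * Y s j))" for i j
    by (intro L2f_mult L2D[OF X] L2f_bmeas_mult bmulD[OF M] L2D[OF Y])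
  have i2: "integrable \<mu> (\<lambda>s. X s i * (LINT \<theta>|\<mu>. K s \<theta> i j * Y \<theta> j))" for i j
    by (intro L2f_mult L2D[OF X] bmeas_L2f bmeas_kernel[OF bkerD[OF K]] L2_integrable[OF Y])
  have e1: "(LINT s|\<mu>. X s i * (M s i j * Y s j)) = (LINT s|\<mu>. M s i j * X s i * Y s j)" for i j
    by (simp add: mult_ac)
  have e2: "(LINT s|\<mu>. (LINT \<theta>|\<mu>. X \<theta> i * K \<theta> s i j) * Y s j)
      = (LINT s|\<mu>. (LINT \<theta>|\<mu>. K \<theta> s i j * X \<theta> i) * Y s j)" for i j
    by (simp add: mult.commute)
  have i3: "integrable \<mu> (\<lambda>s. M s i j * X s i * Y s j)" for i j
    using i1[of i j] by (simp add: mult_ac)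
  have i4: "integrable \<mu> (\<lambda>s. (LINT \<theta>|\<mu>. K \<theta> s i j * X \<theta> i) * Y s j)" for i j
    by (intro integrable_bmeas_mult bmeas_kernel bmeas2_swap[OF bkerD[OF K]] L2_integrable X Y)
  have L: "ip X (op M K Y) =
      (\<Sum>i<N. \<Sum>j<N. (LINT s|\<mu>. M s i j * X s i * Y s j)
      + (LINT s|\<mu>. (LINT \<theta>|\<mu>. K \<theta> s i j * X \<theta> i) * Y s j))"
    unfolding ip_def op_def
    by (simp add: sum_distrib_left distrib_left sum.distrib i1 i2 e1
        kernel_Fubini[OF bkerD[OF K] L2_integrable[OF X] L2_integrable[OF Y]] e2)
  have R: "ip (op (\<lambda>s i j. M s j i) (\<lambda>s \<theta> i j. K \<theta> s j i) X) Y
      = (\<Sum>j<N. \<Sum>i<N. (LINT s|\<mu>. M s i j * X s i * Y s j)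
      + (LINT s|\<mu>. (LINT \<theta>|\<mu>. K \<theta> s i j * X \<theta> i) * Y s j))"
    unfolding ip_def op_def
    by (simp add: sum_distrib_right distrib_right sum.distrib i3 i4)
  show ?thesis unfolding L R by (rule sum.swap)
qed

text \<open>The point \<theta> = s is null, so agreement off the diagonal suffices. Transposing a
  kernel exchanges the triangles \<theta> < s and \<theta> > s, and the value on the diagonal then
  comes from the wrong triangle.\<close>

lemma op_cong:
  assumes K: "bker K" and K': "bker K'" and X: "L2 X" and s: "s \<in> space \<mu>"
    and M: "\<And>j. j < N \<Longrightarrow> M s i j = M' s i j"
    and KK: "\<And>\<theta> j. \<theta> \<in> space \<mu> \<Longrightarrow> \<theta> \<noteq> s \<Longrightarrow> j < N \<Longrightarrow> K s \<theta> i j = K' s \<theta> i j"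
  shows "op M K X s i = op M' K' X s i"
  unfolding op_def
proof (intro sum.cong refl arg_cong2[of _ _ _ _ "(+)"])
  fix j assume j: "j \<in> {..<N}"
  show "M s i j * X s j = M' s i j * X s j" using M j by simp
  have "AE \<theta> in \<mu>. K s \<theta> i j * X \<theta> j = K' s \<theta> i j * X \<theta> j"
    using AE_neq[of s] AE_space by eventually_elim (use KK j in auto)
  then show "(LINT \<theta>|\<mu>. K s \<theta> i j * X \<theta> j) = (LINT \<theta>|\<mu>. K' s \<theta> i j * X \<theta> j)"
    using integrable_kernel_section[OF K X s] integrable_kernel_section[OF K' X s]
    by (intro integral_cong_AE) auto
qed

lemma op_cong_vec: "(\<And>s j. s \<in> space \<mu> \<Longrightarrow> j < N \<Longrightarrow> X s j = Y s j) \<Longrightarrow> s \<in> space \<mu> \<Longrightarrow> op M K X s i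
    = op M K Y s i"
  unfolding op_def by (auto intro!: sum.cong arg_cong2[of _ _ _ _ "(+)"]
      Bochner_Integration.integral_cong)

lemma op_cong_pointwise: "(\<And>j. j < N \<Longrightarrow> M s i j = M' s i j) \<Longrightarrow>
    (\<And>\<theta> j. \<theta> \<in> space \<mu> \<Longrightarrow> j < N \<Longrightarrow> K s \<theta> i j = K' s \<theta> i j) \<Longrightarrow> op M K X s i = op M' K' X s i"
  unfolding op_def by (auto intro!: sum.cong arg_cong2[of _ _ _ _ "(+)"]
      Bochner_Integration.integral_cong)

lemma op_add:
  assumes K: "bker K" "bker K'" and X: "L2 X" and s: "s \<in> space \<mu>"
  shows "op (\<lambda>s i j. M s i j + M' s i j) (\<lambda>s \<theta> i j. K s \<theta> i j + K' s \<theta> i j) X s i = op M K X s i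
      + op M' K' X s i"
  unfolding op_def
  by (simp add: distrib_right sum.distrib integrable_kernel_section[OF K(1) X s]
      integrable_kernel_section[OF K(2) X s])

lemma op_scale: "op (\<lambda>s i j. c * M s i j) (\<lambda>s \<theta> i j. c * K s \<theta> i j) X s i = c * op M K X s i"
  unfolding op_def by (simp add: sum_distrib_left distrib_left mult.assoc)

text \<open>Young's inequality, entry by entry. The bound compares the storage function with the
  square of the state norm, which later gives both its Lipschitz estimate and its derivative along
  the solution.\<close>

lemma ip_op_bounded:
  assumes M: "bmul M" and K: "bker K"
  obtains C where "C \<ge> 0" "\<And>X. L2 X \<Longrightarrow> ip X (op M K X) \<le> C * ip X X"
proof -
  have "\<exists>C\<ge>0. \<forall>s\<in>space \<mu>. \<bar>M s i j\<bar> \<le> C" for i j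
    using bmulD[OF M, of i j] unfolding bmeas_def by (metis abs_ge_self abs_ge_zero order_trans)
  then obtain CM where CM: "\<And>i j. CM i j \<ge> 0" "\<And>i j s. s \<in> space \<mu> \<Longrightarrow> \<bar>M s i j\<bar> \<le> CM i j" by metis
  have "\<exists>C\<ge>0. \<forall>s\<in>space \<mu>. \<forall>\<theta>\<in>space \<mu>. \<bar>K s \<theta> i j\<bar> \<le> C" for i j
    using bkerD[OF K, of i j] unfolding bmeas2_def by (metis abs_ge_self abs_ge_zero order_trans)
  then obtain CK where CK: "\<And>i j. CK i j \<ge> 0"
      "\<And>i j s \<theta>. s \<in> space \<mu> \<Longrightarrow> \<theta> \<in> space \<mu> \<Longrightarrow> \<bar>K s \<theta> i j\<bar> \<le> CK i j" by metis
  let ?m = "measure \<mu> (space \<mu>)"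
  \<comment> \<open>A kernel entry acquires the total mass as a factor, because each of the two
    squares in Young's inequality is constant in one of the two integration variables.\<close>
  define C where "C = (\<Sum>i<N. \<Sum>j<N. CM i j + CK i j * ?m)"
  have C0: "C \<ge> 0" unfolding C_def using CM(1) CK(1) by (intro sum_nonneg) auto
  have "ip X (op M K X) \<le> C * ip X X" if X: "L2 X" for X
  proof -
    let ?q = "\<lambda>i. LINT s|\<mu>. (X s i)\<^sup>2"
    have sq: "integrable \<mu> (\<lambda>s. (X s i)\<^sup>2)" for i using L2D[OF X] by (auto simp: L2f_def)
    have ipX: "ip X X = (\<Sum>i<N. ?q i)" by (simp add: ip_def power2_eq_square)
    have qle: "?q i \<le> ip X X" if "i < N" for i
      unfolding ipX using that by (intro member_le_sum) auto
    have bas: "\<bar>c\<bar> \<le> C' \<Longrightarrow> x * (c * y) \<le> C' * (x\<^sup>2 / 2 + y\<^sup>2 / 2)" for c C' x y :: real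
    proof -
      assume c: "\<bar>c\<bar> \<le> C'"
      have "x * (c * y) \<le> \<bar>c\<bar> * (\<bar>x\<bar> * \<bar>y\<bar>)"
        by (metis abs_ge_self abs_mult mult.left_commute)
      also have "\<dots> \<le> C' * (x\<^sup>2 / 2 + y\<^sup>2 / 2)"
        using c sum_squares_bound[of "\<bar>x\<bar>" "\<bar>y\<bar>"] by (intro mult_mono) auto
      finally show ?thesis .
    qed
    have i1: "integrable \<mu> (\<lambda>s. X s i * (M s i j * X s j))" for i j
      by (intro L2f_mult L2D[OF X] L2f_bmeas_mult bmulD[OF M])
    have i2: "integrable \<mu> (\<lambda>s. X s i * (LINT \<theta>|\<mu>. K s \<theta> i j * X \<theta> j))" for i j
      by (intro L2f_mult L2D[OF X] bmeas_L2f bmeas_kernel[OF bkerD[OF K]] L2_integrable[OF X])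
    have t1: "(LINT s|\<mu>. X s i * (M s i j * X s j)) \<le> CM i j * ip X X" if "i < N" "j < N" for i j
    proof -
      have "(LINT s|\<mu>. X s i * (M s i j * X s j))
          \<le> (LINT s|\<mu>. CM i j * ((X s i)\<^sup>2 / 2 + (X s j)\<^sup>2 / 2))"
        using sq i1 CM(2) by (intro integral_mono bas) auto
      also have "\<dots> = CM i j * (?q i / 2 + ?q j / 2)" using sq by simp
      also have "\<dots> \<le> CM i j * ip X X"
        using qle[OF that(1)] qle[OF that(2)] CM(1) by (intro mult_left_mono) auto
      finally show ?thesis .
    qed
    have t2: "(LINT s|\<mu>. X s i * (LINT \<theta>|\<mu>. K s \<theta> i j * X \<theta> j)) \<le> CK i j * ?m * ip X X"
        if "i < N" "j < N" for i j
    proof -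
      have "(LINT s|\<mu>. X s i * (LINT \<theta>|\<mu>. K s \<theta> i j * X \<theta> j))
          \<le> (LINT s|\<mu>. CK i j * ((X s i)\<^sup>2 / 2 * ?m + ?q j / 2))"
      proof (rule integral_mono)
        fix s assume s: "s \<in> space \<mu>"
        have "X s i * (LINT \<theta>|\<mu>. K s \<theta> i j * X \<theta> j) = (LINT \<theta>|\<mu>. X s i * (K s \<theta> i j * X \<theta> j))"
          by simp
        also have "\<dots> \<le> (LINT \<theta>|\<mu>. CK i j * ((X s i)\<^sup>2 / 2 + (X \<theta> j)\<^sup>2 / 2))"
          using sq CK(2)[OF s] integrable_kernel_section[OF K X s] by (intro integral_mono bas) auto
        also have "\<dots> = CK i j * ((X s i)\<^sup>2 / 2 * ?m + ?q j / 2)" using sq by simp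
        finally show "X s i * (LINT \<theta>|\<mu>. K s \<theta> i j * X \<theta> j) \<le> CK i j
            * ((X s i)\<^sup>2 / 2 * ?m + ?q j / 2)" .
      qed (use sq i2 in auto)
      also have "\<dots> = CK i j * ?m * (?q i / 2 + ?q j / 2)" using sq by (simp add: algebra_simps)
      also have "\<dots> \<le> CK i j * ?m * ip X X"
        using qle[OF that(1)] qle[OF that(2)] CK(1) by (intro mult_left_mono) auto
      finally show ?thesis .
    qed
    have "ip X (op M K X) = (\<Sum>i<N. \<Sum>j<N. (LINT s|\<mu>. X s i * (M s i j * X s j))
        + (LINT s|\<mu>. X s i * (LINT \<theta>|\<mu>. K s \<theta> i j * X \<theta> j)))"
      unfolding ip_def op_def by (simp add: sum_distrib_left distrib_left sum.distrib i1 i2)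
    also have "\<dots> \<le> (\<Sum>i<N. \<Sum>j<N. CM i j * ip X X + CK i j * ?m * ip X X)"
      using t1 t2 by (intro sum_mono add_mono) auto
    also have "\<dots> = C * ip X X" by (simp add: C_def sum_distrib_right distrib_right)
    finally show ?thesis .
  qed
  then show thesis using that C0 by blast
qed

end

section \<open>Continuous matrix functions\<close>

lemma integrable_lebesgue_on_iff_absolutely:
  fixes f :: "real \<Rightarrow> real"
  shows "integrable (lebesgue_on {a..b}) f \<longleftrightarrow> f absolutely_integrable_on {a..b}"
  by (simp add: integrable_restrict_space set_integrable_def)

lemma integral_lebesgue_on_combine:
  fixes f :: "real \<Rightarrow> real"
  assumes "a \<le> c" "c \<le> b" "integrable (lebesgue_on {a..c}) f" "integrable (lebesgue_on {c..b}) f"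
  shows "integrable (lebesgue_on {a..b}) f"
    "(LINT s|lebesgue_on {a..b}. f s) = (LINT s|lebesgue_on {a..c}. f s)
        + (LINT s|lebesgue_on {c..b}. f s)"
proof -
  have "{a..b} = {a..c} \<union> {c..b}" using assms(1,2) by auto
  then have "f absolutely_integrable_on {a..b}"
    using assms(3,4) by (simp add: integrable_lebesgue_on_iff_absolutely set_integrable_Un)
  then show i: "integrable (lebesgue_on {a..b}) f"
    by (simp add: integrable_lebesgue_on_iff_absolutely)
  show "(LINT s|lebesgue_on {a..b}. f s) = (LINT s|lebesgue_on {a..c}. f s)
      + (LINT s|lebesgue_on {c..b}. f s)"
    using assms i Henstock_Kurzweil_Integration.integral_combine[of a c b f]
    by (simp add: lebesgue_integral_eq_integral integrable_lebesgue_on_iff_absolutely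
        set_lebesgue_integral_eq_integral(1))
qed

text \<open>Piecewise defined kernels change branch at the end points of the pieces, so agreement is
  available in the interior only; the two end points are negligible.\<close>

lemma integral_lebesgue_on_interior_cong:
  fixes f g :: "real \<Rightarrow> real"
  assumes g: "integrable (lebesgue_on {a..b}) g" and eq: "\<And>s. a < s \<Longrightarrow> s < b \<Longrightarrow> f s = g s"
  shows "integrable (lebesgue_on {a..b}) f"
    "(LINT s|lebesgue_on {a..b}. f s) = (LINT s|lebesgue_on {a..b}. g s)"
proof -
  have neg: "negligible {a, b}" by simp
  have eq': "f s = g s" if "s \<in> {a..b} - {a, b}" for s using that eq[of s] by auto
  show i: "integrable (lebesgue_on {a..b}) f"
    using g unfolding integrable_lebesgue_on_iff_absolutely
    by (rule absolutely_integrable_spike[OF _ neg eq'])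
  show "(LINT s|lebesgue_on {a..b}. f s) = (LINT s|lebesgue_on {a..b}. g s)"
    using i g integral_spike[OF neg, of "{a..b}" g f] eq' by (simp add: lebesgue_integral_eq_integral)
qed

lemma integrable_continuous_lebesgue_on:
  fixes f :: "real \<Rightarrow> real"
  assumes "continuous_on UNIV f"
  shows "integrable (lebesgue_on {a..b}) f"
  using assms by (intro continuous_imp_integrable_real) (auto intro: continuous_on_subset)

text \<open>The bridge between the oriented integrals in the formulas for tuples and the measure on
  the interval with which the operators are defined.\<close>

lemma LBINT_eq_lebesgue_on:
  fixes f :: "real \<Rightarrow> real"
  assumes "l \<le> r" "continuous_on UNIV f"
  shows "(LBINT s=l..r. f s) = (LINT s|lebesgue_on {l..r}. f s)"
proof -
  have "set_integrable lborel {l..r} f"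
    using assms(2) by (intro borel_integrable_atLeastAtMost') (auto intro: continuous_on_subset)
  then show ?thesis
    using assms integrable_continuous_lebesgue_on[OF assms(2), of l r]
    by (simp add: interval_integral_eq_integral lebesgue_integral_eq_integral)
qed

text \<open>In the use for composed kernels p and q are the two arguments of the kernel, at which
  the factors switch between the two triangles. Continuity of each piece on the whole line provides
  integrability.\<close>

lemma integral_lebesgue_on_split3:
  fixes f :: "real \<Rightarrow> real"
  assumes "a \<le> p" "p \<le> q" "q \<le> b"
    and c: "continuous_on UNIV f1" "continuous_on UNIV f2" "continuous_on UNIV f3"
    and eq: "\<And>s. a < s \<Longrightarrow> s < p \<Longrightarrow> f s = f1 s" "\<And>s. p < s \<Longrightarrow> s < q \<Longrightarrow> f s = f2 s"
      "\<And>s. q < s \<Longrightarrow> s < b \<Longrightarrow> f s = f3 s"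
  shows "integrable (lebesgue_on {a..b}) f"
    "(LINT s|lebesgue_on {a..b}. f s) = (LBINT s=a..p. f1 s) + (LBINT s=p..q. f2 s)
        + (LBINT s=q..b. f3 s)"
proof -
  note i1 = integral_lebesgue_on_interior_cong[OF integrable_continuous_lebesgue_on[OF c(1)], of a p
      f, OF eq(1)]
  note i2 = integral_lebesgue_on_interior_cong[OF integrable_continuous_lebesgue_on[OF c(2)], of p q
      f, OF eq(2)]
  note i3 = integral_lebesgue_on_interior_cong[OF integrable_continuous_lebesgue_on[OF c(3)], of q b
      f, OF eq(3)]
  have i12: "integrable (lebesgue_on {a..q}) f" 
    "(LINT s|lebesgue_on {a..q}. f s) = (LINT s|lebesgue_on {a..p}. f s)
        + (LINT s|lebesgue_on {p..q}. f s)"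
    using integral_lebesgue_on_combine[OF assms(1,2) i1(1) i2(1)] by auto
  show "integrable (lebesgue_on {a..b}) f"
    using integral_lebesgue_on_combine(1)[OF _ assms(3) i12(1) i3(1)] assms by auto
  show "(LINT s|lebesgue_on {a..b}. f s) = (LBINT s=a..p. f1 s) + (LBINT s=p..q. f2 s)
      + (LBINT s=q..b. f3 s)"
    using integral_lebesgue_on_combine(2)[OF _ assms(3) i12(1) i3(1)] assms
    by (simp add: i12 i1(2) i2(2) i3(2) LBINT_eq_lebesgue_on)
qed

text \<open>The appended interval has length one, so a constant on it is integrated to
  itself.\<close>

lemma integral_lebesgue_on_tail:
  fixes f :: "real \<Rightarrow> real"
  assumes "a \<le> b" "integrable (lebesgue_on {a..b}) f" "\<And>s. b < s \<Longrightarrow> s \<le> b + 1 \<Longrightarrow> f s = c"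
  shows "integrable (lebesgue_on {a..b+1}) f"
    "(LINT s|lebesgue_on {a..b+1}. f s) = (LINT s|lebesgue_on {a..b}. f s) + c"
proof -
  have i: "integrable (lebesgue_on {b..b+1}) f"
      "(LINT s|lebesgue_on {b..b+1}. f s) = (LINT s|lebesgue_on {b..b+1}. c)"
    using integral_lebesgue_on_interior_cong[of b "b+1" "\<lambda>_. c" f] assms(3) by auto
  show "integrable (lebesgue_on {a..b+1}) f"
    "(LINT s|lebesgue_on {a..b+1}. f s) = (LINT s|lebesgue_on {a..b}. f s) + c"
    using integral_lebesgue_on_combine[OF assms(1) _ assms(2) i(1)] i(2)
        by (auto simp: measure_restrict_space)
qed

text \<open>Entries are padded with zeros, so that all matrix products become sums over one common index
  range \<open>{..<N}\<close> and no bounds on the indices have to be carried along.\<close>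

definition ent :: "real mat \<Rightarrow> nat \<Rightarrow> nat \<Rightarrow> real" where
  "ent A i j = (if i < dim_row A \<and> j < dim_col A then A $$ (i, j) else 0)"

definition vnt :: "real vec \<Rightarrow> nat \<Rightarrow> real" where
  "vnt v i = (if i < dim_vec v then v $ i else 0)"

lemma sum_pad: "m \<le> (N::nat) \<Longrightarrow> (\<And>l. m \<le> l \<Longrightarrow> f l = (0::real)) \<Longrightarrow> (\<Sum>l<N. f l) = (\<Sum>l<m. f l)"
  by (rule sum.mono_neutral_right) (auto simp: not_less[symmetric])

lemma ent_mult:
  assumes "A \<in> carrier_mat n m" "B \<in> carrier_mat m k" "m \<le> N"
  shows "ent (A * B) i j = (\<Sum>l<N. ent A i l * ent B l j)"
proof -
  have "(\<Sum>l<N. ent A i l * ent B l j) = (\<Sum>l<m. ent A i l * ent B l j)"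
    using assms by (intro sum_pad) (auto simp: ent_def)
  then show ?thesis
    using assms by (auto simp: ent_def scalar_prod_def atLeast0LessThan intro!: sum.cong)
qed

lemma vnt_mult:
  assumes "A \<in> carrier_mat n m" "v \<in> carrier_vec m" "m \<le> N"
  shows "vnt (A *\<^sub>v v) i = (\<Sum>l<N. ent A i l * vnt v l)"
proof -
  have "(\<Sum>l<N. ent A i l * vnt v l) = (\<Sum>l<m. ent A i l * vnt v l)"
    using assms by (intro sum_pad) (auto simp: ent_def)
  then show ?thesis
    using assms by (auto simp: ent_def vnt_def scalar_prod_def atLeast0LessThan intro!: sum.cong)
qed

lemma scalar_prod_vnt:
  assumes "v \<in> carrier_vec n" "w \<in> carrier_vec n" "n \<le> N"
  shows "v \<bullet> w = (\<Sum>l<N. vnt v l * vnt w l)"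
proof -
  have "(\<Sum>l<N. vnt v l * vnt w l) = (\<Sum>l<n. vnt v l * vnt w l)"
    using assms by (intro sum_pad) (auto simp: vnt_def)
  then show ?thesis
    using assms by (auto simp: vnt_def scalar_prod_def atLeast0LessThan intro!: sum.cong)
qed

lemma ent_add: "A \<in> carrier_mat n m \<Longrightarrow> B \<in> carrier_mat n m \<Longrightarrow> ent (A + B) i j = ent A i j + ent B i j"
  by (auto simp: ent_def)
lemma ent_minus: "A \<in> carrier_mat n m \<Longrightarrow> B \<in> carrier_mat n m \<Longrightarrow> ent (A - B) i j = ent A i j - ent B i j"
  by (auto simp: ent_def)
lemma ent_uminus: "ent (- A) i j = - ent A i j"
  by (auto simp: ent_def)
lemma ent_transpose: "ent (A\<^sup>T) i j = ent A j i"
  by (auto simp: ent_def)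
lemma ent_smult: "ent (c \<cdot>\<^sub>m A) i j = c * ent A i j"
  by (auto simp: ent_def)
lemma ent_zero: "ent (0\<^sub>m n m) i j = 0"
  by (auto simp: ent_def)
lemma ent_one: "ent (1\<^sub>m n) i j = (if i = j \<and> i < n then 1 else 0)"
  by (auto simp: ent_def)

lemma vnt_add: "v \<in> carrier_vec n \<Longrightarrow> w \<in> carrier_vec n \<Longrightarrow> vnt (v + w) i = vnt v i + vnt w i"
  by (auto simp: vnt_def)
lemma vnt_minus: "v \<in> carrier_vec n \<Longrightarrow> w \<in> carrier_vec n \<Longrightarrow> vnt (v - w) i = vnt v i - vnt w i"
  by (auto simp: vnt_def)
lemma vnt_smult: "vnt (c \<cdot>\<^sub>v v) i = c * vnt v i"
  by (auto simp: vnt_def)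
lemma vnt_eqI: "v \<in> carrier_vec n \<Longrightarrow> w \<in> carrier_vec n \<Longrightarrow> (\<And>i. vnt v i = vnt w i) \<Longrightarrow> v = w"
  by (rule eq_vecI) (auto simp: vnt_def, metis)

text \<open>Padded coordinates from n on are identically 0, so the two conditions may be stated for
  every index.\<close>

lemma L2_vec_iff:
  "f \<in> L2_vec A n \<longleftrightarrow> (\<forall>s\<in>A. f s \<in> carrier_vec n) \<and>
     (\<forall>i. (\<lambda>s. vnt (f s) i) \<in> borel_measurable (lebesgue_on A) \<and>
          integrable (lebesgue_on A) (\<lambda>s. (vnt (f s) i)\<^sup>2))" (is "?L \<longleftrightarrow> ?R")
proof (cases "\<forall>s\<in>A. f s \<in> carrier_vec n")
  case True
  then have lt: "vnt (f s) i = f s $ i" if "i < n" "s \<in> space (lebesgue_on A)" for i s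
    using that by (auto simp: vnt_def)
  have ge: "vnt (f s) i = 0" if "\<not> i < n" "s \<in> space (lebesgue_on A)" for i s
    using True that by (auto simp: vnt_def)
  have m1: "(\<lambda>s. vnt (f s) i) \<in> borel_measurable (lebesgue_on A) \<longleftrightarrow> (\<lambda>s. f s $ i)
      \<in> borel_measurable (lebesgue_on A)"
    if "i < n" for i by (rule measurable_cong) (rule lt[OF that])
  have i1: "integrable (lebesgue_on A) (\<lambda>s. (vnt (f s) i)\<^sup>2) \<longleftrightarrow> integrable (lebesgue_on A)
      (\<lambda>s. (f s $ i)\<^sup>2)"
    if "i < n" for i by (rule Bochner_Integration.integrable_cong) (simp_all only: lt[OF that])
  have m2: "(\<lambda>s. vnt (f s) i) \<in> borel_measurable (lebesgue_on A) \<longleftrightarrow> (\<lambda>s. 0 :: real)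
      \<in> borel_measurable (lebesgue_on A)"
    if "\<not> i < n" for i by (rule measurable_cong) (rule ge[OF that])
  have i2: "integrable (lebesgue_on A) (\<lambda>s. (vnt (f s) i)\<^sup>2) \<longleftrightarrow> integrable (lebesgue_on A)
      (\<lambda>s. 0 :: real)"
    if "\<not> i < n" for i by (rule Bochner_Integration.integrable_cong) (simp_all add: ge[OF that])
  have "(\<lambda>s. vnt (f s) i) \<in> borel_measurable (lebesgue_on A)
      \<and> integrable (lebesgue_on A) (\<lambda>s. (vnt (f s) i)\<^sup>2)"
    if "\<not> i < n" for i using m2[OF that] i2[OF that] by simp
  then show ?thesis using True m1 i1 unfolding L2_vec_def by blast
next
  case False
  then show ?thesis unfolding L2_vec_def by blast
qed

text \<open>The parameter space is arbitrary so that functions of one variable and kernels, read as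
  functions of a pair, share the same closure rules.\<close>

definition contm :: "nat \<Rightarrow> nat \<Rightarrow> ('p::topological_space \<Rightarrow> real mat) \<Rightarrow> bool" where
  "contm n m F \<longleftrightarrow> (\<forall>p. F p \<in> carrier_mat n m) \<and> (\<forall>i j. continuous_on UNIV (\<lambda>p. ent (F p) i j))"

lemma contmD: "contm n m F \<Longrightarrow> F p \<in> carrier_mat n m"
    "contm n m F \<Longrightarrow> continuous_on UNIV (\<lambda>p. ent (F p) i j)"
  by (auto simp: contm_def)

lemma contm_comp: "contm n m F \<Longrightarrow> continuous_on UNIV f \<Longrightarrow> contm n m (\<lambda>p. F (f p))"
  by (auto simp: contm_def intro: continuous_on_compose2[where g="\<lambda>p. ent (F p) i j" for i j])

lemma contm_comp2:
  assumes "contm n m (\<lambda>p. F (fst p) (snd p))" "continuous_on UNIV f" "continuous_on UNIV g"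
  shows "contm n m (\<lambda>p. F (f p) (g p))"
  using contm_comp[OF assms(1), of "\<lambda>p. (f p, g p)"] assms(2,3) by (simp add: continuous_on_Pair)

lemma contm_const: "A \<in> carrier_mat n m \<Longrightarrow> contm n m (\<lambda>_. A)"
  by (auto simp: contm_def)

lemma contm_add: "contm n m F \<Longrightarrow> contm n m G \<Longrightarrow> contm n m (\<lambda>p. F p + G p)"
  unfolding contm_def by (auto simp: ent_add[where n=n and m=m] intro!: continuous_intros)

lemma contm_minus: "contm n m F \<Longrightarrow> contm n m G \<Longrightarrow> contm n m (\<lambda>p. F p - G p)"
  unfolding contm_def by (auto simp: ent_minus[where n=n and m=m] intro!: continuous_intros
      minus_carrier_mat)

lemma contm_uminus: "contm n m F \<Longrightarrow> contm n m (\<lambda>p. - F p)"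
  unfolding contm_def by (auto simp: ent_uminus intro!: continuous_intros)

lemma contm_transpose: "contm n m F \<Longrightarrow> contm m n (\<lambda>p. (F p)\<^sup>T)"
  unfolding contm_def by (auto simp: ent_transpose)

lemma contm_smult: "contm n m F \<Longrightarrow> continuous_on UNIV c \<Longrightarrow> contm n m (\<lambda>p. c p \<cdot>\<^sub>m F p)"
  unfolding contm_def by (auto simp: ent_smult intro!: continuous_intros)

lemma contm_mult:
  assumes "contm n m F" "contm m k G" shows "contm n k (\<lambda>p. F p * G p)"
proof -
  have "ent (F p * G p) i j = (\<Sum>l<m. ent (F p) i l * ent (G p) l j)" for p i j
    using contmD(1)[OF assms(1), of p] contmD(1)[OF assms(2), of p] by (intro ent_mult) auto
  then show ?thesis using assms unfolding contm_def by (auto intro!: continuous_intros mult_carrier_mat)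
qed

lemma carrier_mint: "F l \<in> carrier_mat n m \<Longrightarrow> mint l r F \<in> carrier_mat n m"
  by (auto simp: mint_def)

lemma ent_mint:
  assumes "\<And>s. F s \<in> carrier_mat n m"
  shows "ent (mint l r F) i j = (LBINT s=l..r. ent (F s) i j)"
  using assms[THEN carrier_matD(1)] assms[THEN carrier_matD(2)] by (auto simp: ent_def mint_def)

text \<open>Rescaling to the unit interval turns variable integration bounds into parameters of the
  integrand.\<close>

lemma LBINT_unit_interval:
  fixes f :: "real \<Rightarrow> real" and l r :: real
  assumes "continuous_on UNIV f"
  shows "(LBINT s=l..r. f s) = integral (cbox 0 1) (\<lambda>\<tau>. (r - l) * f (l + \<tau> * (r - l)))"
proof -
  have c: "continuous_on UNIV (\<lambda>\<tau>. (r - l) * f (l + \<tau> * (r - l)))"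
    by (intro continuous_intros continuous_on_compose2[OF assms]) auto
  have "(LBINT \<tau>=0..1. (r - l) *\<^sub>R f (l + \<tau> * (r - l)))
      = (LBINT s=l + 0 * (r - l)..l + 1 * (r - l). f s)"
    unfolding zero_ereal_def one_ereal_def
    by (rule interval_integral_substitution_finite)
       (auto intro!: derivative_eq_intros continuous_on_subset[OF assms])
  moreover have "(LBINT \<tau>=0..1. (r - l) *\<^sub>R f (l + \<tau> * (r - l)))
      = integral {0..1} (\<lambda>\<tau>. (r - l) * f (l + \<tau> * (r - l)))"
    using interval_integral_eq_integral[of 0 1 "\<lambda>\<tau>. (r - l) * f (l + \<tau> * (r - l))"] c
    by (simp add: zero_ereal_def one_ereal_def borel_integrable_atLeastAtMost' continuous_on_subset)
  ultimately show ?thesis by simp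
qed

lemma continuous_on_fst_snd_compose:
  "continuous_on UNIV f \<Longrightarrow> continuous_on UNIV (\<lambda>q. f (fst q))"
  by (rule continuous_on_compose2[of UNIV f]) (auto intro: continuous_intros)

text \<open>After rescaling, the domain of integration no longer depends on the parameter, and
  continuity under the integral sign applies whichever of the bounds is larger.\<close>

lemma contm_mint:
  fixes F :: "'p::topological_space \<Rightarrow> real \<Rightarrow> real mat"
  assumes F: "contm n m (\<lambda>q. F (fst q) (snd q))" and l: "continuous_on UNIV l"
      and r: "continuous_on UNIV r"
  shows "contm n m (\<lambda>p. mint (l p) (r p) (F p))"
proof -
  have cr: "F p s \<in> carrier_mat n m" for p s using contmD(1)[OF F, of "(p, s)"] by simp
  have "continuous_on UNIV (\<lambda>p. ent (mint (l p) (r p) (F p)) i j)" for i j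
  proof -
    have cF: "continuous_on UNIV (\<lambda>q. ent (F (fst q) (snd q)) i j)" using contmD(2)[OF F] .
    have cs: "continuous_on UNIV (\<lambda>s. ent (F p s) i j)" for p
      using continuous_on_compose2[OF cF, of UNIV "\<lambda>s. (p, s)"] by (simp add: continuous_on_Pair)
    have "continuous_on UNIV (\<lambda>p. integral (cbox 0 1)
        (\<lambda>\<tau>. (r p - l p) * ent (F p (l p + \<tau> * (r p - l p))) i j))"
    proof (rule integral_continuous_on_param)
      have "continuous_on UNIV (\<lambda>q::'p \<times> real. (fst q, l (fst q) + snd q * (r (fst q) - l (fst q))))"
        by (intro continuous_intros continuous_on_fst_snd_compose l r)
      then have "continuous_on UNIV
          (\<lambda>q::'p \<times> real. (r (fst q) - l (fst q))
          * ent (F (fst q) (l (fst q) + snd q * (r (fst q) - l (fst q)))) i j)"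
        using continuous_on_compose2[OF cF, of UNIV
            "\<lambda>q. (fst q, l (fst q) + snd q * (r (fst q) - l (fst q)))"]
        by (intro continuous_intros continuous_on_fst_snd_compose l r) simp
      then have "continuous_on (UNIV \<times> cbox 0 1)
          (\<lambda>q::'p \<times> real. (r (fst q) - l (fst q))
          * ent (F (fst q) (l (fst q) + snd q * (r (fst q) - l (fst q)))) i j)"
        by (rule continuous_on_subset) simp
      then show "continuous_on (UNIV \<times> cbox 0 1)
          (\<lambda>(p, \<tau>). (r p - l p) * ent (F p (l p + \<tau> * (r p - l p))) i j)"
        by (simp add: case_prod_unfold)
    qed
    then show ?thesis by (simp add: ent_mint[OF cr] LBINT_unit_interval[OF cs])
  qed
  then show ?thesis using carrier_mint[OF cr] by (auto simp: contm_def)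
qed

lemma contm_poly_mat1:
  assumes "poly_mat1 n m F" shows "contm n m F"
proof -
  obtain M where M: "M \<in> carrier_mat n m" "\<And>s. F s = map_mat (\<lambda>p. poly p s) M"
    using assms unfolding poly_mat1_def by blast
  have "ent (F s) i j = (if i < n \<and> j < m then poly (M $$ (i, j)) s else 0)" for s i j
    using M(1) unfolding M(2) ent_def by auto
  then have "continuous_on UNIV (\<lambda>s. ent (F s) i j)" for i j
    by (cases "i < n \<and> j < m") (auto intro!: continuous_intros)
  then show ?thesis using M by (auto simp: contm_def)
qed

lemma continuous_poly_poly:
  fixes p :: "real poly poly"
  shows "continuous_on UNIV (\<lambda>q. poly (poly p [:fst q:]) (snd q))"
  by (induction p) (auto intro!: continuous_intros)

lemma contm_poly_mat2:
  assumes "poly_mat2 n m F" shows "contm n m (\<lambda>p. F (fst p) (snd p))"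
proof -
  obtain M where M: "M \<in> carrier_mat n m" "\<And>s \<theta>. F s \<theta> = map_mat (\<lambda>p. poly (poly p [:s:]) \<theta>) M"
    using assms unfolding poly_mat2_def by blast
  have "ent (F s \<theta>) i j = (if i < n \<and> j < m then poly (poly (M $$ (i, j)) [:s:]) \<theta> else 0)" for s \<theta> i j
    using M(1) unfolding M(2) ent_def by auto
  then have "continuous_on UNIV (\<lambda>p. ent (F (fst p) (snd p)) i j)" for i j
    by (cases "i < n \<and> j < m") (auto intro!: continuous_poly_poly)
  then show ?thesis using M by (auto simp: contm_def)
qed

section \<open>Tuples as integral operators\<close>

lemma AE_lebesgue_on_neq: "AE y in lebesgue_on S. y \<noteq> (x::real)" if "S \<in> sets lebesgue"
proof -
  have "AE y in lebesgue. y \<noteq> x"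
    by (rule AE_I[of _ _ "{x}"]) auto
  then show ?thesis using that by (auto simp: AE_restrict_space_iff elim: eventually_mono)
qed

lemma borel_measurable_lebesgue_on:
  fixes f :: "real \<Rightarrow> real"
  assumes "f \<in> borel_measurable borel" shows "f \<in> borel_measurable (lebesgue_on S)"
  using assms by (simp add: measurable_completion measurable_restrict_space1 measurable_lborel1)

lemma continuous_borel_measurable_lebesgue_on:
  fixes f :: "real \<Rightarrow> real"
  assumes "continuous_on UNIV f" shows "f \<in> borel_measurable (lebesgue_on S)"
  by (rule borel_measurable_lebesgue_on[OF borel_measurable_continuous_onI[OF assms]])

text \<open>The identity from the product of the two restricted Lebesgue spaces to the Borel plane
  is measurable; this is how continuous kernels and indicators of triangles become measurable for
  the product measure.\<close>

lemma borel_measurable_pair_lebesgue_on: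
  fixes f :: "real \<times> real \<Rightarrow> real"
  assumes "f \<in> borel_measurable borel" shows "f \<in> borel_measurable (lebesgue_on S \<Otimes>\<^sub>M lebesgue_on T)"
proof -
  have id: "(\<lambda>x. x) \<in> lebesgue_on S \<rightarrow>\<^sub>M borel" for S :: "real set"
    by (rule continuous_borel_measurable_lebesgue_on) (rule continuous_on_id)
  have "(\<lambda>p. (fst p, snd p)) \<in> (lebesgue_on S \<Otimes>\<^sub>M lebesgue_on T) \<rightarrow>\<^sub>M (borel \<Otimes>\<^sub>M borel)"
    by (intro measurable_Pair measurable_compose[OF measurable_fst id]
        measurable_compose[OF measurable_snd id])
  from measurable_compose[OF this[unfolded borel_prod] assms] show ?thesis
    by (simp only: prod.collapse)
qed

text \<open>The dimensions are, in this order, the rows and columns of P and the rows and columns of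
  S. Continuity is demanded on the whole line and plane, where the oriented integrals of the
  composition formula still make sense.\<close>

definition wft :: "nat \<Rightarrow> nat \<Rightarrow> nat \<Rightarrow> nat \<Rightarrow> pqrs \<Rightarrow> bool" where
  "wft n m r q t \<longleftrightarrow> tP t \<in> carrier_mat n m \<and> contm n q (tQ1 t) \<and> contm r m (tQ2 t) \<and> contm r q (tS t) \<and>
     contm r q (\<lambda>p. tR1 t (fst p) (snd p)) \<and> contm r q (\<lambda>p. tR2 t (fst p) (snd p))"

lemma wftD:
  assumes "wft n m r q t"
  shows "tP t \<in> carrier_mat n m" "contm n q (tQ1 t)" "contm r m (tQ2 t)" "contm r q (tS t)"
    "contm r q (\<lambda>p. tR1 t (fst p) (snd p))" "contm r q (\<lambda>p. tR2 t (fst p) (snd p))"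
    "contm r q (\<lambda>\<theta>. tR1 t s \<theta>)" "contm r q (\<lambda>\<theta>. tR2 t s \<theta>)"
    "contm r q (\<lambda>s. tR1 t s \<theta>)" "contm r q (\<lambda>s. tR2 t s \<theta>)"
    "tQ1 t s \<in> carrier_mat n q" "tQ2 t s \<in> carrier_mat r m" "tS t s \<in> carrier_mat r q"
    "tR1 t s \<theta> \<in> carrier_mat r q" "tR2 t s \<theta> \<in> carrier_mat r q"
proof -
  show *: "tP t \<in> carrier_mat n m" "contm n q (tQ1 t)" "contm r m (tQ2 t)" "contm r q (tS t)"
    "contm r q (\<lambda>p. tR1 t (fst p) (snd p))" "contm r q (\<lambda>p. tR2 t (fst p) (snd p))"
    using assms by (auto simp: wft_def)
  show **: "contm r q (\<lambda>\<theta>. tR1 t s \<theta>)" "contm r q (\<lambda>\<theta>. tR2 t s \<theta>)"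
    "contm r q (\<lambda>s. tR1 t s \<theta>)" "contm r q (\<lambda>s. tR2 t s \<theta>)"
    by (intro contm_comp2[OF *(5)] contm_comp2[OF *(6)] continuous_intros)+
  show "tQ1 t s \<in> carrier_mat n q" "tQ2 t s \<in> carrier_mat r m" "tS t s \<in> carrier_mat r q"
    "tR1 t s \<theta> \<in> carrier_mat r q" "tR2 t s \<theta> \<in> carrier_mat r q"
    using * ** by (auto dest: contmD(1))
qed

lemma pqrs_comp_sel:
  "tP (pqrs_comp a b t u) = tP t * tP u + mint a b (\<lambda>s. tQ1 t s * tQ2 u s)"
  "tQ1 (pqrs_comp a b t u) s = tP t * tQ1 u s + tQ1 t s * tS u s + mint s b (\<lambda>\<eta>. tQ1 t \<eta> * tR1 u \<eta> s)
      + mint a s (\<lambda>\<eta>. tQ1 t \<eta> * tR2 u \<eta> s)"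
  "tQ2 (pqrs_comp a b t u) s = tQ2 t s * tP u + tS t s * tQ2 u s + mint a s (\<lambda>\<eta>. tR1 t s \<eta> * tQ2 u \<eta>)
      + mint s b (\<lambda>\<eta>. tR2 t s \<eta> * tQ2 u \<eta>)"
  "tS (pqrs_comp a b t u) s = tS t s * tS u s"
  "tR1 (pqrs_comp a b t u) s \<eta> = tQ2 t s * tQ1 u \<eta> + tS t s * tR1 u s \<eta> + tR1 t s \<eta> * tS u \<eta>
        + mint a \<eta> (\<lambda>\<theta>. tR1 t s \<theta> * tR2 u \<theta> \<eta>)
        + mint \<eta> s (\<lambda>\<theta>. tR1 t s \<theta> * tR1 u \<theta> \<eta>)
        + mint s b (\<lambda>\<theta>. tR2 t s \<theta> * tR1 u \<theta> \<eta>)"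
  "tR2 (pqrs_comp a b t u) s \<eta> = tQ2 t s * tQ1 u \<eta> + tS t s * tR2 u s \<eta> + tR2 t s \<eta> * tS u \<eta>
        + mint a s (\<lambda>\<theta>. tR1 t s \<theta> * tR2 u \<theta> \<eta>)
        + mint s \<eta> (\<lambda>\<theta>. tR2 t s \<theta> * tR2 u \<theta> \<eta>)
        + mint \<eta> b (\<lambda>\<theta>. tR2 t s \<theta> * tR1 u \<theta> \<eta>)"
  by (cases t; cases u; simp)+

lemma pqrs_sel:
  "tP (t \<oplus>\<^sub>p u) = tP t + tP u" "tQ1 (t \<oplus>\<^sub>p u) s = tQ1 t s + tQ1 u s"
      "tQ2 (t \<oplus>\<^sub>p u) s = tQ2 t s + tQ2 u s"
  "tS (t \<oplus>\<^sub>p u) s = tS t s + tS u s" "tR1 (t \<oplus>\<^sub>p u) s \<eta> = tR1 t s \<eta> + tR1 u s \<eta>"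
      "tR2 (t \<oplus>\<^sub>p u) s \<eta> = tR2 t s \<eta> + tR2 u s \<eta>"
  "tP (t -\<^sub>p u) = tP t - tP u" "tQ1 (t -\<^sub>p u) s = tQ1 t s - tQ1 u s"
      "tQ2 (t -\<^sub>p u) s = tQ2 t s - tQ2 u s"
  "tS (t -\<^sub>p u) s = tS t s - tS u s" "tR1 (t -\<^sub>p u) s \<eta> = tR1 t s \<eta> - tR1 u s \<eta>"
      "tR2 (t -\<^sub>p u) s \<eta> = tR2 t s \<eta> - tR2 u s \<eta>"
  "tP (\<ominus>\<^sub>p t) = - tP t" "tQ1 (\<ominus>\<^sub>p t) s = - tQ1 t s" "tQ2 (\<ominus>\<^sub>p t) s = - tQ2 t s"
  "tS (\<ominus>\<^sub>p t) s = - tS t s" "tR1 (\<ominus>\<^sub>p t) s \<eta> = - tR1 t s \<eta>" "tR2 (\<ominus>\<^sub>p t) s \<eta> = - tR2 t s \<eta>"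
  "tP (pqrs_adj t) = (tP t)\<^sup>T" "tQ1 (pqrs_adj t) s = (tQ2 t s)\<^sup>T" "tQ2 (pqrs_adj t) s = (tQ1 t s)\<^sup>T"
  "tS (pqrs_adj t) s = (tS t s)\<^sup>T" "tR1 (pqrs_adj t) s \<eta> = (tR2 t \<eta> s)\<^sup>T"
      "tR2 (pqrs_adj t) s \<eta> = (tR1 t \<eta> s)\<^sup>T"
  by (auto simp: pqrs_add_def pqrs_minus_def pqrs_uminus_def pqrs_adj_def)

lemma wft_pqrsI:
  assumes "P \<in> carrier_mat n m" "contm n q Q1" "contm r m Q2" "contm r q S"
    "contm r q (\<lambda>p. R1 (fst p) (snd p))" "contm r q (\<lambda>p. R2 (fst p) (snd p))"
  shows "wft n m r q (PQRS P Q1 Q2 S R1 R2)"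
  using assms by (simp add: wft_def)

lemma wft_add: "wft n m r q t \<Longrightarrow> wft n m r q u \<Longrightarrow> wft n m r q (t \<oplus>\<^sub>p u)"
  unfolding wft_def pqrs_add_def pqrs.sel by (auto intro!: contm_add minus_carrier_mat)

lemma wft_minus: "wft n m r q t \<Longrightarrow> wft n m r q u \<Longrightarrow> wft n m r q (t -\<^sub>p u)"
  unfolding wft_def pqrs_minus_def pqrs.sel by (auto intro!: contm_minus minus_carrier_mat)

lemma wft_uminus: "wft n m r q t \<Longrightarrow> wft n m r q (\<ominus>\<^sub>p t)"
  unfolding wft_def pqrs_uminus_def pqrs.sel by (auto intro!: contm_uminus minus_carrier_mat)

lemma wft_adj: assumes t: "wft n m r q t" shows "wft m n q r (pqrs_adj t)"
  unfolding wft_def pqrs_sel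
  by (intro conjI contm_transpose transpose_carrier_mat[THEN iffD2] wftD[OF t]
      contm_comp2[OF wftD(5)[OF t]] contm_comp2[OF wftD(6)[OF t]] continuous_intros)

text \<open>Oriented integrals depend continuously on their bounds, so composed kernels are
  continuous across the diagonal and can be composed again.\<close>

lemma wft_comp:
  assumes t: "wft n m r q t" and u: "wft m k q l u"
  shows "wft n k r l (pqrs_comp a b t u)"
proof -
  note T1 = contm_comp2[OF wftD(5)[OF t]] and T2 = contm_comp2[OF wftD(6)[OF t]]
  note U1 = contm_comp2[OF wftD(5)[OF u]] and U2 = contm_comp2[OF wftD(6)[OF u]]
  note c = continuous_intros
  have "tP (pqrs_comp a b t u) \<in> carrier_mat n k"
    unfolding pqrs_comp_sel
    by (intro add_carrier_mat carrier_mint mult_carrier_mat) (use wftD[OF t] wftD[OF u] in auto)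
  moreover have "contm n l (tQ1 (pqrs_comp a b t u))"
    unfolding pqrs_comp_sel[abs_def]
    by (intro contm_add contm_mint contm_mult[OF contm_const[OF wftD(1)[OF t]] wftD(2)[OF u]]
        contm_mult[OF wftD(2)[OF t] wftD(4)[OF u]] contm_mult[OF contm_comp[OF wftD(2)[OF t]] U1]
        contm_mult[OF contm_comp[OF wftD(2)[OF t]] U2] c)
  moreover have "contm r k (tQ2 (pqrs_comp a b t u))"
    unfolding pqrs_comp_sel[abs_def]
    by (intro contm_add contm_mint contm_mult[OF wftD(3)[OF t] contm_const[OF wftD(1)[OF u]]]
        contm_mult[OF wftD(4)[OF t] wftD(3)[OF u]] contm_mult[OF T1 contm_comp[OF wftD(3)[OF u]]]
        contm_mult[OF T2 contm_comp[OF wftD(3)[OF u]]] c)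
  moreover have "contm r l (tS (pqrs_comp a b t u))"
    unfolding pqrs_comp_sel[abs_def] by (intro contm_mult[OF wftD(4)[OF t]] wftD(4)[OF u])
  moreover have "contm r l (\<lambda>p. tR1 (pqrs_comp a b t u) (fst p) (snd p))"
    unfolding pqrs_comp_sel
    by (intro contm_add contm_mint
        contm_mult[OF contm_comp[OF wftD(3)[OF t]] contm_comp[OF wftD(2)[OF u]]] 
        contm_mult[OF contm_comp[OF wftD(4)[OF t]] U1] contm_mult[OF T1 contm_comp[OF wftD(4)[OF u]]]
        contm_mult[OF T1 U2] contm_mult[OF T1 U1] contm_mult[OF T2 U1] c)
  moreover have "contm r l (\<lambda>p. tR2 (pqrs_comp a b t u) (fst p) (snd p))"
    unfolding pqrs_comp_sel
    by (intro contm_add contm_mint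
        contm_mult[OF contm_comp[OF wftD(3)[OF t]] contm_comp[OF wftD(2)[OF u]]] 
        contm_mult[OF contm_comp[OF wftD(4)[OF t]] U2] contm_mult[OF T2 contm_comp[OF wftD(4)[OF u]]]
        contm_mult[OF T1 U2] contm_mult[OF T2 U2] contm_mult[OF T2 U1] c)
  ultimately show ?thesis by (simp add: wft_def)
qed

text \<open>A pair in \<open>\<real>\<^sup>m \<times> L\<^sub>2[a,b]\<close> is encoded as one function on \<open>[a,b+1]\<close>, the finite-dimensional
  component being its constant value on \<open>(b,b+1]\<close>, an interval of length 1. A tuple then acts as a
  multiplication operator plus a single integral operator, whose kernel on the diagonal (a null set)
  is immaterial, and the composition and adjoint formulas become those of integral operators.\<close>

locale interval_sites =
  fixes a b :: real and N :: nat
  assumes ab: "a < b"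
begin

abbreviation mu :: "real measure" where "mu \<equiv> lebesgue_on {a..b+1}"

sublocale diffuse_finite_measure mu N
proof -
  interpret finite_measure mu by (rule finite_measure_lebesgue_on) simp
  show "diffuse_finite_measure mu" by unfold_locales (rule AE_lebesgue_on_neq, simp)
qed

text \<open>There is no multiplier on (b, b+1]: P acts through the kernel, by integrating the
  finite-dimensional component over an interval of length one.\<close>

definition sM :: "pqrs \<Rightarrow> real \<Rightarrow> nat \<Rightarrow> nat \<Rightarrow> real" where
  "sM t s i j = (if s \<le> b then ent (tS t s) i j else 0)"

text \<open>The row is chosen by s and the column by \<theta>, with values above b for the
  finite-dimensional component. Assigning the diagonal to \<open>tR2\<close> is an arbitrary
  choice.\<close>

definition sK :: "pqrs \<Rightarrow> real \<Rightarrow> real \<Rightarrow> nat \<Rightarrow> nat \<Rightarrow> real" where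
  "sK t s \<theta> i j =
     (if s \<le> b then (if \<theta> \<le> b then (if \<theta> < s then ent (tR1 t s \<theta>) i j else ent (tR2 t s \<theta>) i j) else
         ent (tQ2 t s) i j)
      else (if \<theta> \<le> b then ent (tQ1 t \<theta>) i j else ent (tP t) i j))"

definition emb :: "real vec \<Rightarrow> (real \<Rightarrow> real vec) \<Rightarrow> real \<Rightarrow> nat \<Rightarrow> real" where
  "emb x z s i = (if s \<le> b then vnt (z s) i else vnt x i)"

definition app :: "pqrs \<Rightarrow> (real \<Rightarrow> nat \<Rightarrow> real) \<Rightarrow> real \<Rightarrow> nat \<Rightarrow> real" where
  "app t = op (sM t) (sK t)"

lemma bmeas_continuous:
  assumes "continuous_on UNIV f" shows "bmeas f"
proof -
  have "compact (f ` {a..b+1})"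
    using assms by (intro compact_continuous_image) (auto intro: continuous_on_subset)
  then have "\<exists>C. \<forall>s\<in>{a..b+1}. \<bar>f s\<bar> \<le> C" by (auto dest!: compact_imp_bounded simp: bounded_iff)
  then show ?thesis
    using continuous_borel_measurable_lebesgue_on[OF assms] by (simp add: bmeas_def)
qed

lemma bmeas2_continuous:
  assumes "continuous_on UNIV (\<lambda>p. k (fst p) (snd p))" shows "bmeas2 k"
proof -
  have "compact ((\<lambda>p. k (fst p) (snd p)) ` ({a..b+1} \<times> {a..b+1}))"
    using assms by (intro compact_continuous_image compact_Times) (auto intro: continuous_on_subset)
  then have "\<exists>C. \<forall>s\<in>{a..b+1}. \<forall>\<theta>\<in>{a..b+1}. \<bar>k s \<theta>\<bar> \<le> C"
      by (auto dest!: compact_imp_bounded simp: bounded_iff)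
  then show ?thesis
    using borel_measurable_pair_lebesgue_on[OF borel_measurable_continuous_onI[OF assms]]
    by (simp add: bmeas2_def case_prod_unfold)
qed

lemma bmeas_le: "bmeas (\<lambda>s. if s \<le> c then 1 else 0)"
proof -
  have "(\<lambda>s. if s \<le> c then 1 else 0 :: real) = indicat_real {..c}" by (auto simp: indicator_def)
  moreover have "indicat_real {..c} \<in> borel_measurable mu"
    by (rule borel_measurable_lebesgue_on) (rule borel_measurable_indicator, simp)
  ultimately show ?thesis by (auto simp: bmeas_def intro: exI[of _ 1])
qed

lemma bmeas2_less: "bmeas2 (\<lambda>s \<theta>. if \<theta> < s then 1 else 0)"
proof -
  have "{p. snd p < fst p} \<in> sets (borel :: (real \<times> real) measure)"
    by (intro borel_open open_Collect_less continuous_intros)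
  then have "indicat_real {p. snd p < fst p} \<in> borel_measurable (borel :: (real \<times> real) measure)"
      by (rule borel_measurable_indicator)
  moreover have "indicat_real {p. snd p < fst p} = (\<lambda>p::real \<times> real. if snd p < fst p then 1 else 0)"
    by (auto simp: indicator_def)
  ultimately have "(\<lambda>p::real \<times> real. if snd p < fst p then 1 else 0 :: real)
      \<in> borel_measurable borel" by simp
  from borel_measurable_pair_lebesgue_on[OF this, of "{a..b+1}" "{a..b+1}"] show ?thesis
    by (auto simp: bmeas2_def case_prod_unfold intro: exI[of _ 1])
qed

text \<open>A case distinction is a linear combination with the indicator of the condition, so
  closure under sums and products suffices.\<close>

lemma bmeas_If:
  assumes "bmeas (\<lambda>s. if P s then 1 else 0)" "bmeas f" "bmeas g"
  shows "bmeas (\<lambda>s. if P s then f s else g s)"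
proof -
  have "(\<lambda>s. if P s then f s else g s)
      = (\<lambda>s. (if P s then 1 else 0) * f s + (1 + (-1) * (if P s then 1 else 0)) * g s)" by auto
  moreover have "bmeas (\<lambda>s. (if P s then 1 else 0) * f s + (1 + (-1) * (if P s then 1 else 0)) * g s)"
    by (intro bmeas_add bmeas_mult bmeas_const assms)
  ultimately show ?thesis by simp
qed

lemma bmeas2_If:
  assumes "bmeas2 (\<lambda>s \<theta>. if P s \<theta> then 1 else 0)" "bmeas2 f" "bmeas2 g"
  shows "bmeas2 (\<lambda>s \<theta>. if P s \<theta> then f s \<theta> else g s \<theta>)"
proof -
  have "(\<lambda>s \<theta>. if P s \<theta> then f s \<theta> else g s \<theta>)
      = (\<lambda>s \<theta>. (if P s \<theta> then 1 else 0) * f s \<theta> + (1 + (-1) * (if P s \<theta> then 1 else 0)) * g s \<theta>)"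
    by (intro ext) auto
  moreover have "bmeas2 (\<lambda>s \<theta>. (if P s \<theta> then 1 else 0) * f s \<theta>
      + (1 + (-1) * (if P s \<theta> then 1 else 0)) * g s \<theta>)"
    by (intro bmeas2_add bmeas2_mult bmeas2_const assms)
  ultimately show ?thesis by simp
qed

lemma bmul_sM: assumes "wft n m r q t" shows "bmul (sM t)"
  unfolding bmul_def sM_def
  by (intro allI bmeas_If[OF bmeas_le bmeas_continuous[OF contmD(2)[OF wftD(4)[OF assms]]] bmeas_const])

lemma bker_sK: assumes "wft n m r q t" shows "bker (sK t)"
  unfolding bker_def sK_def
  by (intro allI bmeas2_If[OF bmeas2_left[OF bmeas_le]
        bmeas2_If[OF bmeas2_right[OF bmeas_le]
          bmeas2_If[OF bmeas2_less bmeas2_continuous[OF contmD(2)[OF wftD(5)[OF assms]]]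
            bmeas2_continuous[OF contmD(2)[OF wftD(6)[OF assms]]]]
          bmeas2_left[OF bmeas_continuous[OF contmD(2)[OF wftD(3)[OF assms]]]]]
        bmeas2_If[OF bmeas2_right[OF bmeas_le]
          bmeas2_right[OF bmeas_continuous[OF contmD(2)[OF wftD(2)[OF assms]]]] bmeas2_const]])

lemma L2_app: "wft n m r q t \<Longrightarrow> L2 X \<Longrightarrow> L2 (app t X)"
  unfolding app_def by (intro L2_op bmul_sM bker_sK)

lemma site_integral_split3:
  fixes f f1 f2 f3 :: "real \<Rightarrow> real"
  assumes "a \<le> p" "p \<le> q" "q \<le> b"
    and "continuous_on UNIV f1" "continuous_on UNIV f2" "continuous_on UNIV f3"
    and "\<And>s. a < s \<Longrightarrow> s < p \<Longrightarrow> f s = f1 s" "\<And>s. p < s \<Longrightarrow> s < q \<Longrightarrow> f s = f2 s"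
      "\<And>s. q < s \<Longrightarrow> s < b \<Longrightarrow> f s = f3 s" "\<And>s. b < s \<Longrightarrow> f s = c"
  shows "(LINT s|mu. f s) = c + (LBINT s=a..p. f1 s) + (LBINT s=p..q. f2 s) + (LBINT s=q..b. f3 s)"
proof -
  have "integrable (lebesgue_on {a..b}) f"
    "(LINT s|lebesgue_on {a..b}. f s) = (LBINT s=a..p. f1 s) + (LBINT s=p..q. f2 s)
        + (LBINT s=q..b. f3 s)"
    by (rule integral_lebesgue_on_split3[where p=p and q=q and ?f1.0=f1 and ?f2.0=f2 and ?f3.0=f3];
        use assms in blast)+
  then show ?thesis using integral_lebesgue_on_tail(2)[of a b f c] ab assms(10) by simp
qed

lemma site_integral_split2:
  fixes f f1 f2 :: "real \<Rightarrow> real"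
  assumes "a \<le> p" "p \<le> b"
    and "continuous_on UNIV f1" "continuous_on UNIV f2"
    and "\<And>s. a < s \<Longrightarrow> s < p \<Longrightarrow> f s = f1 s" "\<And>s. p < s \<Longrightarrow> s < b \<Longrightarrow> f s = f2 s" "\<And>s. b < s \<Longrightarrow> f s = c"
  shows "(LINT s|mu. f s) = c + (LBINT s=a..p. f1 s) + (LBINT s=p..b. f2 s)"
  using site_integral_split3[of p p f1 f1 f2 f c] assms by simp

lemma site_integral_split1:
  fixes f f1 :: "real \<Rightarrow> real"
  assumes "continuous_on UNIV f1" "\<And>s. a < s \<Longrightarrow> s < b \<Longrightarrow> f s = f1 s" "\<And>s. b < s \<Longrightarrow> f s = c"
  shows "(LINT s|mu. f s) = c + (LBINT s=a..b. f1 s)"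
  using site_integral_split3[of a a f1 f1 f1 f c] assms ab by simp

lemma sM_comp:
  assumes t: "wft n m r q t" and u: "wft m k q l u" and N: "m \<le> N" "q \<le> N"
  shows "sM (pqrs_comp a b t u) s i j = mcomp (sM t) (sM u) s i j"
  using wftD(13)[OF t, of s] wftD(13)[OF u, of s] N
  by (auto simp: sM_def mcomp_def pqrs_comp_sel ent_mult[where N=N])

text \<open>While the integration variable of the composed kernel runs through [a, b+1], the factors
  switch branch at s, \<eta> and b. Splitting there leaves one region for each of P, Q1, Q2, R1 and
  R2, and the pieces are the integrals in the composition formula. The piece over (b, b+1] is the
  product through the finite-dimensional component.\<close>

lemma sK_comp:
  assumes t: "wft n m r q t" and u: "wft m k q l u" and N: "m \<le> N" "q \<le> N"
    and s: "s \<in> {a..b+1}" and \<eta>: "\<eta> \<in> {a..b+1}"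
  shows "sK (pqrs_comp a b t u) s \<eta> i j = kcomp (sM t) (sK t) (sM u) (sK u) s \<eta> i j"
proof -
  let ?I = "LINT \<theta>|mu. (\<Sum>j'<N. sK t s \<theta> i j' * sK u \<theta> \<eta> j' j)"
  note wt = wftD(1,11-)[OF t] and wu = wftD(1,11-)[OF u]
  note em = ent_mult[where N=N and m=m, OF _ _ N(1), symmetric]
      ent_mult[where N=N and m=q, OF _ _ N(2), symmetric]
  \<comment> \<open>One instance for each combination of dimensions, so that conditional rewriting
    determines the intermediate dimension from the carriers of the factors.\<close>
  have cm: "A \<in> carrier_mat n m \<Longrightarrow> B \<in> carrier_mat m k \<Longrightarrow> (\<Sum>j'<N. ent A i j' * ent B j' j)
      = ent (A * B) i j"
    "A \<in> carrier_mat r m \<Longrightarrow> B \<in> carrier_mat m k \<Longrightarrow> (\<Sum>j'<N. ent A i j' * ent B j' j) = ent (A * B) i j"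
    "A \<in> carrier_mat n m \<Longrightarrow> B \<in> carrier_mat m l \<Longrightarrow> (\<Sum>j'<N. ent A i j' * ent B j' j) = ent (A * B) i j"
    "A \<in> carrier_mat r m \<Longrightarrow> B \<in> carrier_mat m l \<Longrightarrow> (\<Sum>j'<N. ent A i j' * ent B j' j) = ent (A * B) i j"
    "A \<in> carrier_mat n q \<Longrightarrow> B \<in> carrier_mat q k \<Longrightarrow> (\<Sum>j'<N. ent A i j' * ent B j' j) = ent (A * B) i j"
    "A \<in> carrier_mat r q \<Longrightarrow> B \<in> carrier_mat q k \<Longrightarrow> (\<Sum>j'<N. ent A i j' * ent B j' j) = ent (A * B) i j"
    "A \<in> carrier_mat n q \<Longrightarrow> B \<in> carrier_mat q l \<Longrightarrow> (\<Sum>j'<N. ent A i j' * ent B j' j) = ent (A * B) i j"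
    "A \<in> carrier_mat r q \<Longrightarrow> B \<in> carrier_mat q l \<Longrightarrow> (\<Sum>j'<N. ent A i j' * ent B j' j) = ent (A * B) i j"
    for A B by (auto intro: em)
  have int: "integrable mu (\<lambda>\<theta>. sK t s \<theta> i j' * sK u \<theta> \<eta> j' j)" for j'
    using s \<eta> by (intro integrable_bmeas_mult bmeas_integrable
        bmeas2_section[OF bkerD[OF bker_sK[OF t]]]
        bmeas2_section[OF bmeas2_swap[OF bkerD[OF bker_sK[OF u]]]]) simp_all
  have kc: "kcomp (sM t) (sK t) (sM u) (sK u) s \<eta> i j = (\<Sum>j'<N. sM t s i j' * sK u s \<eta> j' j)
     + (\<Sum>j'<N. sK t s \<eta> i j' * sM u \<eta> j' j) + ?I"
    by (simp add: kcomp_def sum.distrib int)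
  have c: "continuous_on UNIV (\<lambda>\<theta>. ent (A \<theta> * B \<theta>) i j)" if "contm n' m' A" "contm m' k' B"
    for A B :: "real \<Rightarrow> real mat" and n' m' k' using contmD(2)[OF contm_mult[OF that]] .
  have cr: "A * B \<in> carrier_mat n' k'" if "A \<in> carrier_mat n' m'" "B \<in> carrier_mat m' k'"
      for A B :: "real mat" and n' m' k'
    using that by simp
  have crm: "mint l' r' (\<lambda>\<theta>. A \<theta> * B \<theta>) \<in> carrier_mat n' k'"
      "ent (mint l' r' (\<lambda>\<theta>. A \<theta> * B \<theta>)) i j = (LBINT \<theta>=l'..r'. ent (A \<theta> * B \<theta>) i j)"
    if "\<And>\<theta>. A \<theta> \<in> carrier_mat n' m'" "\<And>\<theta>. B \<theta> \<in> carrier_mat m' k'" for l' r' n' k' m'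
        and A B :: "real \<Rightarrow> real mat"
    using carrier_mint[of "\<lambda>\<theta>. A \<theta> * B \<theta>" l' n' k' r'] ent_mint[of "\<lambda>\<theta>. A \<theta> * B \<theta>" n' k' l' r' i j]
        cr[OF that] by auto
  consider (pp) "b < s" "b < \<eta>" | (pi) "b < s" "\<eta> \<le> b" | (ip) "s \<le> b" "b < \<eta>" | (lt) "s \<le> b" "\<eta> < s"
      | (ge) "\<eta> \<le> b" "s \<le> \<eta>"
    using s \<eta> by fastforce
  then show ?thesis
  proof cases
    case pp
    have "?I = ent (tP t * tP u) i j + (LBINT \<theta>=a..b. ent (tQ1 t \<theta> * tQ2 u \<theta>) i j)"
      by (rule site_integral_split1[OF c[OF wftD(2)[OF t] wftD(3)[OF u]]])
          (use pp in \<open>auto simp: sK_def cm wt wu\<close>)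
    then show ?thesis unfolding kc using pp
      by (simp add: sM_def sK_def pqrs_comp_sel
          ent_add[OF cr[OF wt(1) wu(1)] crm(1)[OF wt(2) wu(3)]] crm(2)[OF wt(2) wu(3)])
  next
    case pi
    have "?I = ent (tP t * tQ1 u \<eta>) i j
       + (LBINT \<theta>=a..\<eta>. ent (tQ1 t \<theta> * tR2 u \<theta> \<eta>) i j) + (LBINT \<theta>=\<eta>..b. ent (tQ1 t \<theta> * tR1 u \<theta> \<eta>) i j)"
      by (rule site_integral_split2[OF _ _ c[OF wftD(2)[OF t] wftD(10)[OF u]]
          c[OF wftD(2)[OF t] wftD(9)[OF u]]])
         (use pi \<eta> in \<open>auto simp: sK_def cm wt wu\<close>)
    then show ?thesis unfolding kc using pi
      by (simp add: sM_def sK_def pqrs_comp_sel cm wt wu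
         ent_add[where n=n and m=l] cr[OF wt(1) wu(2)] cr[OF wt(2) wu(4)] crm(1)[OF wt(2) wu(5)]
             crm(1)[OF wt(2) wu(6)]
         crm(2)[OF wt(2) wu(5)] crm(2)[OF wt(2) wu(6)])
  next
    case ip
    have "?I = ent (tQ2 t s * tP u) i j
       + (LBINT \<theta>=a..s. ent (tR1 t s \<theta> * tQ2 u \<theta>) i j) + (LBINT \<theta>=s..b. ent (tR2 t s \<theta> * tQ2 u \<theta>) i j)"
      by (rule site_integral_split2[OF _ _ c[OF wftD(7)[OF t] wftD(3)[OF u]]
          c[OF wftD(8)[OF t] wftD(3)[OF u]]])
         (use ip s in \<open>auto simp: sK_def cm wt wu\<close>)
    then show ?thesis unfolding kc using ip
      by (simp add: sM_def sK_def pqrs_comp_sel cm wt wu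
         ent_add[where n=r and m=k] cr[OF wt(3) wu(1)] cr[OF wt(4) wu(3)] crm(1)[OF wt(5) wu(3)]
             crm(1)[OF wt(6) wu(3)]
         crm(2)[OF wt(5) wu(3)] crm(2)[OF wt(6) wu(3)])
  next
    case lt
    have "?I = ent (tQ2 t s * tQ1 u \<eta>) i j
       + (LBINT \<theta>=a..\<eta>. ent (tR1 t s \<theta> * tR2 u \<theta> \<eta>) i j)
           + (LBINT \<theta>=\<eta>..s. ent (tR1 t s \<theta> * tR1 u \<theta> \<eta>) i j)
       + (LBINT \<theta>=s..b. ent (tR2 t s \<theta> * tR1 u \<theta> \<eta>) i j)"
      by (rule site_integral_split3[OF _ _ _ c[OF wftD(7)[OF t] wftD(10)[OF u]]
          c[OF wftD(7)[OF t] wftD(9)[OF u]] c[OF wftD(8)[OF t] wftD(9)[OF u]]])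
         (use lt s \<eta> in \<open>auto simp: sK_def cm wt wu\<close>)
    then show ?thesis unfolding kc using lt
      by (simp add: sM_def sK_def pqrs_comp_sel cm wt wu
         ent_add[where n=r and m=l] cr[OF wt(3) wu(2)] cr[OF wt(4) wu(5)] cr[OF wt(5) wu(4)]
         crm(1)[OF wt(5) wu(6)] crm(1)[OF wt(5) wu(5)] crm(1)[OF wt(6) wu(5)]
         crm(2)[OF wt(5) wu(6)] crm(2)[OF wt(5) wu(5)] crm(2)[OF wt(6) wu(5)])
  next
    case ge
    have "?I = ent (tQ2 t s * tQ1 u \<eta>) i j
       + (LBINT \<theta>=a..s. ent (tR1 t s \<theta> * tR2 u \<theta> \<eta>) i j)
           + (LBINT \<theta>=s..\<eta>. ent (tR2 t s \<theta> * tR2 u \<theta> \<eta>) i j)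
       + (LBINT \<theta>=\<eta>..b. ent (tR2 t s \<theta> * tR1 u \<theta> \<eta>) i j)"
      by (rule site_integral_split3[OF _ _ _ c[OF wftD(7)[OF t] wftD(10)[OF u]]
          c[OF wftD(8)[OF t] wftD(10)[OF u]] c[OF wftD(8)[OF t] wftD(9)[OF u]]])
         (use ge s \<eta> in \<open>auto simp: sK_def cm wt wu\<close>)
    then show ?thesis unfolding kc using ge
      by (simp add: sM_def sK_def pqrs_comp_sel cm wt wu
         ent_add[where n=r and m=l] cr[OF wt(3) wu(2)] cr[OF wt(4) wu(6)] cr[OF wt(6) wu(4)]
         crm(1)[OF wt(5) wu(6)] crm(1)[OF wt(6) wu(6)] crm(1)[OF wt(6) wu(5)]
         crm(2)[OF wt(5) wu(6)] crm(2)[OF wt(6) wu(6)] crm(2)[OF wt(6) wu(5)])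
  qed
qed

text \<open>Only the intermediate dimensions have to be at most \<open>N\<close>, because only they
  are summed over when two kernels are multiplied.\<close>

lemma app_comp:
  assumes t: "wft n m r q t" and u: "wft m k q l u" and N: "m \<le> N" "q \<le> N" and X: "L2 X"
      and s: "s \<in> {a..b+1}"
  shows "app (pqrs_comp a b t u) X s i = app t (app u X) s i"
proof -
  have "app t (app u X) s i = op (mcomp (sM t) (sM u)) (kcomp (sM t) (sK t) (sM u) (sK u)) X s i"
    unfolding app_def using s
        by (intro op_comp[OF bmul_sM[OF t] bker_sK[OF t] bmul_sM[OF u] bker_sK[OF u] X]) simp
  also have "\<dots> = app (pqrs_comp a b t u) X s i"
    unfolding app_def using sM_comp[OF t u N] sK_comp[OF t u N s]
    by (intro op_cong_pointwise) (simp_all)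
  finally show ?thesis ..
qed

text \<open>The adjoint formula exchanges the triangles and transposes the entries, which is the
  transposed kernel off the diagonal; \<open>op_cong\<close> disposes of the diagonal.\<close>

lemma app_adj:
  assumes t: "wft n m r q t" and X: "L2 X" and Y: "L2 Y"
  shows "ip X (app (pqrs_adj t) Y) = ip (app t X) Y"
proof -
  note t' = wft_adj[OF t]
  have "ip X (app (pqrs_adj t) Y)
      = ip (op (\<lambda>s i j. sM (pqrs_adj t) s j i) (\<lambda>s \<theta> i j. sK (pqrs_adj t) \<theta> s j i) X) Y"
    unfolding app_def by (rule op_adjoint[OF bmul_sM[OF t'] bker_sK[OF t'] X Y])
  also have "\<dots> = ip (app t X) Y"
  proof (rule ip_cong)
    fix s i assume s: "s \<in> space mu"
    show "op (\<lambda>s i j. sM (pqrs_adj t) s j i) (\<lambda>s \<theta> i j. sK (pqrs_adj t) \<theta> s j i) X s i = app t X s i"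
      unfolding app_def
    proof (rule op_cong[OF _ bker_sK[OF t] X s])
      show "bker (\<lambda>s \<theta> i j. sK (pqrs_adj t) \<theta> s j i)"
        using bmeas2_swap[OF bkerD[OF bker_sK[OF t']]] by (simp add: bker_def)
    qed (auto simp: sM_def sK_def pqrs_sel ent_transpose)
  qed simp
  finally show ?thesis .
qed

lemma app_add:
  assumes t: "wft n m r q t" and u: "wft n m r q u" and X: "L2 X" and s: "s \<in> {a..b+1}"
  shows "app (t \<oplus>\<^sub>p u) X s i = app t X s i + app u X s i"
proof -
  note wt = wftD(1,11-)[OF t] and wu = wftD(1,11-)[OF u]
  have "app (t \<oplus>\<^sub>p u) X s i
      = op (\<lambda>s i j. sM t s i j + sM u s i j) (\<lambda>s \<theta> i j. sK t s \<theta> i j + sK u s \<theta> i j) X s i"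
    unfolding app_def
    by (rule op_cong_pointwise)
       (auto simp: sM_def sK_def pqrs_sel ent_add[OF wt(1) wu(1)] ent_add[OF wt(2) wu(2)]
           ent_add[OF wt(3) wu(3)]
        ent_add[OF wt(4) wu(4)] ent_add[OF wt(5) wu(5)] ent_add[OF wt(6) wu(6)])
  then show ?thesis using op_add[OF bker_sK[OF t] bker_sK[OF u] X, of s "sM t" "sM u" i] s
      by (simp add: app_def)
qed

lemma app_uminus: "app (\<ominus>\<^sub>p t) X s i = - app t X s i"
proof -
  have "app (\<ominus>\<^sub>p t) X s i = op (\<lambda>s i j. (-1) * sM t s i j) (\<lambda>s \<theta> i j. (-1) * sK t s \<theta> i j) X s i"
    unfolding app_def by (rule op_cong_pointwise) (auto simp: sM_def sK_def pqrs_sel ent_uminus)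
  then show ?thesis unfolding app_def op_scale by simp
qed

lemma app_minus:
  assumes t: "wft n m r q t" and u: "wft n m r q u" and X: "L2 X" and s: "s \<in> {a..b+1}"
  shows "app (t -\<^sub>p u) X s i = app t X s i - app u X s i"
proof -
  note wt = wftD(1,11-)[OF t] and wu = wftD(1,11-)[OF u]
  have "app (t -\<^sub>p u) X s i = app (t \<oplus>\<^sub>p (\<ominus>\<^sub>p u)) X s i"
    unfolding app_def
    by (rule op_cong_pointwise)
       (auto simp: sM_def sK_def pqrs_sel ent_minus[OF wt(1) wu(1)] ent_minus[OF wt(2) wu(2)]
           ent_minus[OF wt(3) wu(3)]
        ent_minus[OF wt(4) wu(4)] ent_minus[OF wt(5) wu(5)] ent_minus[OF wt(6) wu(6)]
        ent_add[OF wt(1) uminus_carrier_mat[OF wu(1)]]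
            ent_add[OF wt(2) uminus_carrier_mat[OF wu(2)]]
            ent_add[OF wt(3) uminus_carrier_mat[OF wu(3)]]
        ent_add[OF wt(4) uminus_carrier_mat[OF wu(4)]]
            ent_add[OF wt(5) uminus_carrier_mat[OF wu(5)]]
            ent_add[OF wt(6) uminus_carrier_mat[OF wu(6)]] ent_uminus)
  then show ?thesis using app_add[OF t wft_uminus[OF u] X s] by (simp add: app_uminus)
qed

lemma app_cong_vec: "(\<And>s j. s \<in> {a..b+1} \<Longrightarrow> j < N \<Longrightarrow> X s j = Y s j) \<Longrightarrow> s \<in> {a..b+1} \<Longrightarrow> app t X s i
    = app t Y s i"
  unfolding app_def by (rule op_cong_vec) auto

end

section \<open>Positivity of the tuples in \<open>\<Phi>\<^sub>d\<close>\<close>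

lemma contm_Z1: "contm ((d + 1) * n) n (Z1 d n)"
proof -
  have "ent (Z1 d n s) i j =
      (if i < (d + 1) * n \<and> j < n then s ^ (i div n) * (if i mod n = j then 1 else 0) else 0)" for s i j
    by (auto simp: ent_def Z1_def kron_def monos1_def less_mult_imp_div_less)
  then have "continuous_on UNIV (\<lambda>s. ent (Z1 d n s) i j)" for i j
    by (cases "i < (d + 1) * n \<and> j < n") (auto intro!: continuous_intros)
  then show ?thesis by (auto simp: contm_def Z1_def kron_def monos1_def)
qed

lemma contm_Z2: "contm (length (exps2 d) * n) n (\<lambda>p. Z2 d n (fst p) (snd p))"
proof -
  have "ent (Z2 d n s \<theta>) i j = (if i < length (exps2 d) * n \<and> j < n
     then s ^ fst (exps2 d ! (i div n)) * \<theta> ^ snd (exps2 d ! (i div n))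
         * (if i mod n = j then 1 else 0) else 0)" for s \<theta> i j
    by (auto simp: ent_def Z2_def kron_def monos2_def less_mult_imp_div_less)
  then have "continuous_on UNIV (\<lambda>p. ent (Z2 d n (fst p) (snd p)) i j)" for i j
    by (cases "i < length (exps2 d) * n \<and> j < n") (auto intro!: continuous_intros)
  then show ?thesis by (auto simp: contm_def Z2_def kron_def monos2_def)
qed

text \<open>The rows of A moved down by k, that is, the position of one block in the stacked vector
  to which the matrix T is applied.\<close>

definition pad :: "nat \<Rightarrow> real mat \<Rightarrow> nat \<Rightarrow> nat \<Rightarrow> real" where
  "pad k A i j = (if i < k then 0 else ent A (i - k) j)"

lemma sum_pad_shift:
  assumes "A \<in> carrier_mat r c" "k + r \<le> N"
  shows "(\<Sum>\<kappa><N. pad k A \<kappa> i * f \<kappa>) = (\<Sum>l<r. ent A l i * f (k + l))"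
proof -
  have "(\<Sum>\<kappa><N. pad k A \<kappa> i * f \<kappa>) = (\<Sum>\<kappa>\<in>{k..<k+r}. pad k A \<kappa> i * f \<kappa>)"
    using assms by (intro sum.mono_neutral_right) (auto simp: pad_def ent_def)
  also have "\<dots> = (\<Sum>l<r. ent A l i * f (k + l))"
    using sum.shift_bounds_nat_ivl[of "\<lambda>\<kappa>. pad k A \<kappa> i * f \<kappa>" 0 k r]
    by (simp add: pad_def atLeast0LessThan add.commute)
  finally show ?thesis .
qed

text \<open>Columns supported in one group of coordinates see only the corresponding block of the
  matrix. This translates the block notation of admissible tuples into sums over one index
  range.\<close>

lemma block_form:
  assumes TT: "TT \<in> carrier_mat (sum_list sz) (sum_list sz)" and N: "sum_list sz \<le> N"
    and p: "0 < p" "p \<le> length sz" and q: "0 < q" "q \<le> length sz"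
    and A: "A \<in> carrier_mat (sz ! (p - 1)) c" and B: "B \<in> carrier_mat (sz ! (q - 1)) c'"
  shows "(\<Sum>\<kappa><N. pad (sum_list (take (p - 1) sz)) A \<kappa> i
      * (\<Sum>\<rho><N. ent TT \<kappa> \<rho> * pad (sum_list (take (q - 1) sz)) B \<rho> j))
     = ent (A\<^sup>T * block sz TT p q * B) i j"
proof -
  let ?o = "\<lambda>p. sum_list (take (p - 1) sz)"
  have le: "?o p + sz ! (p - 1) \<le> sum_list sz" if "0 < p" "p \<le> length sz" for p
  proof -
    have "?o p + sz ! (p - 1) = sum_list (take (Suc (p - 1)) sz)"
      using that by (simp add: take_Suc_conv_app_nth del: Suc_pred Suc_diff_1)
    also have "\<dots> \<le> sum_list (take (Suc (p - 1)) sz) + sum_list (drop (Suc (p - 1)) sz)" by simp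
    also have "\<dots> = sum_list sz" by (simp only: sum_list_append[symmetric] append_take_drop_id)
    finally show ?thesis .
  qed
  have eT: "ent (block sz TT p q) k l = ent TT (?o p + k) (?o q + l)"
      if "k < sz ! (p - 1)" "l < sz ! (q - 1)" for k l
    using that TT le[OF p] le[OF q] by (auto simp: ent_def block_def)
  have T: "block sz TT p q \<in> carrier_mat (sz ! (p - 1)) (sz ! (q - 1))" by (auto simp: block_def)
  have "(\<Sum>\<kappa><N. pad (?o p) A \<kappa> i * (\<Sum>\<rho><N. ent TT \<kappa> \<rho> * pad (?o q) B \<rho> j))
     = (\<Sum>k<sz ! (p - 1). ent A k i * (\<Sum>\<rho><N. pad (?o q) B \<rho> j * ent TT (?o p + k) \<rho>))"
    using le[OF p] N by (subst sum_pad_shift[OF A]) (auto simp: mult.commute)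
  also have "\<dots> = (\<Sum>k<sz ! (p - 1). ent A k i
      * (\<Sum>l<sz ! (q - 1). ent B l j * ent TT (?o p + k) (?o q + l)))"
    using le[OF q] N by (subst sum_pad_shift[OF B]) auto
  also have "\<dots> = (\<Sum>k<sz ! (p - 1). \<Sum>l<sz ! (q - 1). ent A k i * ent (block sz TT p q) k l * ent B l j)"
    by (auto simp: sum_distrib_left eT mult_ac intro!: sum.cong)
  also have "\<dots> = (\<Sum>l<sz ! (q - 1). (\<Sum>k<sz ! (p - 1). ent (A\<^sup>T) i k * ent (block sz TT p q) k l)
      * ent B l j)"
    by (subst sum.swap) (simp add: sum_distrib_right ent_transpose)
  also have "\<dots> = (\<Sum>l<sz ! (q - 1). ent (A\<^sup>T * block sz TT p q) i l * ent B l j)"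
    using ent_mult[OF transpose_carrier_mat[THEN iffD2, OF A] T order.refl] by simp
  also have "\<dots> = ent (A\<^sup>T * block sz TT p q * B) i j"
    using ent_mult[OF mult_carrier_mat[OF transpose_carrier_mat[THEN iffD2, OF A] T] B order.refl]
        by simp
  finally show ?thesis .
qed

text \<open>An admissible tuple is only prescribed on \<open>[a,b]\<close>; \<open>adm\<close> is its continuous extension to the
  real line.\<close>

definition adm :: "real \<Rightarrow> real \<Rightarrow> nat \<Rightarrow> nat \<Rightarrow> nat \<Rightarrow> (real \<Rightarrow> real) \<Rightarrow> real mat \<Rightarrow> pqrs" where
  "adm a b m n d g TT = (let z1 = Z1 d n; z2 = Z2 d n;
      T = block [m, (d + 1) * n, length (exps2 d) * n, length (exps2 d) * n] TT;
      Q = (\<lambda>\<eta>. g \<eta> \<cdot>\<^sub>m (T 1 2 * z1 \<eta>) + mint \<eta> b (\<lambda>s. g s \<cdot>\<^sub>m (T 1 3 * z2 s \<eta>))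
                + mint a \<eta> (\<lambda>s. g s \<cdot>\<^sub>m (T 1 4 * z2 s \<eta>)))
    in PQRS ((LBINT s=a..b. g s) \<cdot>\<^sub>m T 1 1) Q (\<lambda>s. (Q s)\<^sup>T) (\<lambda>s. g s \<cdot>\<^sub>m ((z1 s)\<^sup>T * T 2 2 * z1 s))
       (\<lambda>s \<eta>. g s \<cdot>\<^sub>m ((z1 s)\<^sup>T * T 2 3 * z2 s \<eta>) + g \<eta> \<cdot>\<^sub>m ((z2 \<eta> s)\<^sup>T * T 4 2 * z1 \<eta>)
                + mint s b (\<lambda>\<theta>. g \<theta> \<cdot>\<^sub>m ((z2 \<theta> s)\<^sup>T * T 3 3 * z2 \<theta> \<eta>))
                + mint \<eta> s (\<lambda>\<theta>. g \<theta> \<cdot>\<^sub>m ((z2 \<theta> s)\<^sup>T * T 4 3 * z2 \<theta> \<eta>))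
                + mint a \<eta> (\<lambda>\<theta>. g \<theta> \<cdot>\<^sub>m ((z2 \<theta> s)\<^sup>T * T 4 4 * z2 \<theta> \<eta>)))
       (\<lambda>s \<eta>. g s \<cdot>\<^sub>m ((z1 s)\<^sup>T * T 2 4 * z2 s \<eta>) + g \<eta> \<cdot>\<^sub>m ((z2 \<eta> s)\<^sup>T * T 3 2 * z1 \<eta>)
                + mint \<eta> b (\<lambda>\<theta>. g \<theta> \<cdot>\<^sub>m ((z2 \<theta> s)\<^sup>T * T 3 3 * z2 \<theta> \<eta>))
                + mint s \<eta> (\<lambda>\<theta>. g \<theta> \<cdot>\<^sub>m ((z2 \<theta> s)\<^sup>T * T 3 4 * z2 \<theta> \<eta>))
                + mint a s (\<lambda>\<theta>. g \<theta> \<cdot>\<^sub>m ((z2 \<theta> s)\<^sup>T * T 4 4 * z2 \<theta> \<eta>))))"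

text \<open>Membership in \<Phi>_d determines a tuple only this far, and the operator depends on
  nothing else.\<close>

definition agree :: "real \<Rightarrow> real \<Rightarrow> pqrs \<Rightarrow> pqrs \<Rightarrow> bool" where
  "agree a b t u \<longleftrightarrow> tP t = tP u \<and> (\<forall>s\<in>{a..b}. tQ1 t s = tQ1 u s \<and> tQ2 t s = tQ2 u s \<and> tS t s = tS u s
     \<and> (\<forall>\<eta>\<in>{a..b}. tR1 t s \<eta> = tR1 u s \<eta> \<and> tR2 t s \<eta> = tR2 u s \<eta>))"

lemma agree_add: "agree a b t t' \<Longrightarrow> agree a b u u' \<Longrightarrow> agree a b (t \<oplus>\<^sub>p u) (t' \<oplus>\<^sub>p u')"
  by (simp add: agree_def pqrs_sel)

lemma admissible_adm:
  assumes "admissible a b m n d g t"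
  obtains TT where "psd_mat (m + (d + 1) * n + length (exps2 d) * n + length (exps2 d) * n) TT"
    "agree a b t (adm a b m n d g TT)"
proof -
  let ?sz = "[m, (d + 1) * n, length (exps2 d) * n, length (exps2 d) * n]"
  obtain TT where TT: "psd_mat (sum_list ?sz) TT"
    and eq: "tP t = tP (adm a b m n d g TT)" "\<forall>s\<in>{a..b}. tS t s = tS (adm a b m n d g TT) s"
      "\<forall>\<eta>\<in>{a..b}. tQ1 t \<eta> = tQ1 (adm a b m n d g TT) \<eta>" "\<forall>s\<in>{a..b}. tQ2 t s = (tQ1 t s)\<^sup>T"
      "\<forall>s\<in>{a..b}. \<forall>\<eta>\<in>{a..b}. tR1 t s \<eta> = tR1 (adm a b m n d g TT) s \<eta>"
      "\<forall>s\<in>{a..b}. \<forall>\<eta>\<in>{a..b}. tR2 t s \<eta> = tR2 (adm a b m n d g TT) s \<eta>"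
    using assms unfolding admissible_def Let_def
        by (elim exE conjE, intro that) (unfold adm_def Let_def pqrs.sel, assumption+)
  have "tQ2 (adm a b m n d g TT) s = (tQ1 (adm a b m n d g TT) s)\<^sup>T" for s
    by (simp add: adm_def Let_def)
  then have "agree a b t (adm a b m n d g TT)" using eq by (simp add: agree_def)
  then show thesis using TT by (intro that) (simp_all add: add.assoc)
qed

context interval_sites begin

lemma app_agree: "agree a b t u \<Longrightarrow> s \<in> {a..b+1} \<Longrightarrow> app t X s i = app u X s i"
  unfolding app_def by (rule op_cong_pointwise) (auto simp: agree_def sM_def sK_def)

text \<open>On [a,b] the integrand is g(s) times a value of the quadratic form of TT, and beyond b
  it vanishes. Functions in the range of the factor \<Z> live on [a,b] only.\<close>

lemma ip_psd_multiplier: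
  assumes TT: "psd_mat L TT" and L: "L \<le> N" and g: "\<And>s. s \<in> {a..b} \<Longrightarrow> 0 \<le> g s"
      and cg: "continuous_on UNIV g" and Y: "L2 Y"
  shows "0 \<le> ip Y (op (\<lambda>s \<kappa> \<rho>. if s \<le> b then g s * ent TT \<kappa> \<rho> else 0) (\<lambda>_ _ _ _. 0) Y)"
proof -
  let ?G = "\<lambda>s \<kappa> \<rho>. if s \<le> b then g s * ent TT \<kappa> \<rho> else 0"
  have G: "bmeas (\<lambda>s. ?G s \<kappa> \<rho>)" for \<kappa> \<rho>
    by (intro bmeas_If[OF bmeas_le bmeas_mult[OF bmeas_continuous[OF cg] bmeas_const] bmeas_const])
  have i: "integrable mu (\<lambda>s. Y s \<kappa> * (\<Sum>\<rho><N. ?G s \<kappa> \<rho> * Y s \<rho>))" for \<kappa>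
    by (intro L2f_mult L2f_sum L2f_bmeas_mult G L2D Y)
  have "ip Y (op ?G (\<lambda>_ _ _ _. 0) Y) = (LINT s|mu. (\<Sum>\<kappa><N. Y s \<kappa> * (\<Sum>\<rho><N. ?G s \<kappa> \<rho> * Y s \<rho>)))"
    unfolding ip_def op_def using i by simp
  also have "\<dots> \<ge> 0"
  proof (rule integral_nonneg_AE, rule AE_I2)
    fix s assume s: "s \<in> space mu"
    define v where "v = vec L (Y s)"
    have v: "v \<in> carrier_vec L" by (simp add: v_def)
    have T: "TT \<in> carrier_mat L L" using TT by (simp add: psd_mat_def)
    have "0 \<le> v \<bullet> (TT *\<^sub>v v)" using TT v by (simp add: psd_mat_def)
    also have "v \<bullet> (TT *\<^sub>v v) = (\<Sum>\<kappa><N. vnt v \<kappa> * (\<Sum>\<rho><N. ent TT \<kappa> \<rho> * vnt v \<rho>))"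
      using T v by (subst scalar_prod_vnt[OF v _ L]) (simp_all add: vnt_mult[OF T v L])
    \<comment> \<open>The padded entries of TT vanish from L on, so truncating Y(s) to its first L
      components changes neither of the two sums.\<close>
    also have "\<dots> = (\<Sum>\<kappa><N. Y s \<kappa> * (\<Sum>\<rho><N. ent TT \<kappa> \<rho> * Y s \<rho>))"
    proof -
      have e1: "ent TT \<kappa> \<rho> * vnt v \<rho> = ent TT \<kappa> \<rho> * Y s \<rho>" for \<kappa> \<rho>
        using T by (auto simp: ent_def vnt_def v_def)
      have e2: "vnt v \<kappa> * (\<Sum>\<rho><N. ent TT \<kappa> \<rho> * c \<rho>) = Y s \<kappa> * (\<Sum>\<rho><N. ent TT \<kappa> \<rho> * c \<rho>)" for \<kappa> c
        using T by (cases "\<kappa> < L") (auto simp: ent_def vnt_def v_def)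
      show ?thesis by (simp only: e1 e2)
    qed
    finally have nn: "0 \<le> (\<Sum>\<kappa><N. Y s \<kappa> * (\<Sum>\<rho><N. ent TT \<kappa> \<rho> * Y s \<rho>))" .
    show "0 \<le> (\<Sum>\<kappa><N. Y s \<kappa> * (\<Sum>\<rho><N. ?G s \<kappa> \<rho> * Y s \<rho>))"
    proof (cases "s \<le> b")
      case True
      have "(\<Sum>\<kappa><N. Y s \<kappa> * (\<Sum>\<rho><N. ?G s \<kappa> \<rho> * Y s \<rho>)) = g s * (\<Sum>\<kappa><N. Y s \<kappa> * (\<Sum>\<rho><N. ent TT \<kappa> \<rho> * Y s \<rho>))"
        using True by (simp add: sum_distrib_left mult_ac)
      then show ?thesis using g[of s] nn True s by simp
    qed simp
  qed
  finally show ?thesis .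
qed

end

lemma contm_congruence:
  assumes "contm r c A" "X \<in> carrier_mat r r'" "contm r' c' B" "continuous_on UNIV h"
  shows "contm c c' (\<lambda>p. h p \<cdot>\<^sub>m ((A p)\<^sup>T * X * B p))"
  by (intro contm_smult contm_mult[OF
      contm_mult[OF contm_transpose[OF assms(1)] contm_const[OF assms(2)]] assms(3)] assms(4))

context interval_sites begin

text \<open>The tuple is the composition \<open>\<Z>\<^sup>* (g T) \<Z>\<close>, where \<open>\<Z>\<close> sends \<open>(x, z)\<close> to the function
  \<open>s \<mapsto> col(x, Z\<^sub>1(s) z(s), \<integral>\<^sub>a\<^sup>s Z\<^sub>2(s,\<theta>) z(\<theta>) d\<theta>, \<integral>\<^sub>s\<^sup>b Z\<^sub>2(s,\<theta>) z(\<theta>) d\<theta>)\<close>; its multiplier and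
  kernel are \<open>Mz\<close> and \<open>Kz\<close> in the proof.\<close>

lemma adm_psd:
  fixes d m n :: nat and g :: "real \<Rightarrow> real" and TT :: "real mat"
  defines "r1 \<equiv> (d + 1) * n" and "r2 \<equiv> length (exps2 d) * n"
  assumes TT: "psd_mat (m + r1 + r2 + r2) TT" and L: "m + r1 + r2 + r2 \<le> N"
    and g: "\<And>s. s \<in> {a..b} \<Longrightarrow> 0 \<le> g s" and cg: "continuous_on UNIV g" and X: "L2 X"
  shows "wft m m n n (adm a b m n d g TT)" "0 \<le> ip X (app (adm a b m n d g TT) X)"
    "L2 Y \<Longrightarrow> ip Y (app (adm a b m n d g TT) X) = ip (app (adm a b m n d g TT) Y) X"
proof -
  define sz where "sz = [m, r1, r2, r2]"
  define T where "T = block sz TT"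
  define t where "t = adm a b m n d g TT"
  have szL: "sum_list sz = m + r1 + r2 + r2" by (simp add: sz_def)
  have TTc: "TT \<in> carrier_mat (sum_list sz) (sum_list sz)" and TTs: "TT\<^sup>T = TT"
    using TT unfolding szL by (auto simp: psd_mat_def)
  have c1: "contm r1 n (Z1 d n)" and c2: "contm r2 n (\<lambda>p. Z2 d n (fst p) (snd p))"
    unfolding r1_def r2_def by (rule contm_Z1 contm_Z2)+
  note c1' = contm_comp[OF c1] and c2' = contm_comp2[OF c2]
  have k1: "Z1 d n s \<in> carrier_mat r1 n" and k2: "Z2 d n s \<theta> \<in> carrier_mat r2 n" for s \<theta>
    using contmD(1)[OF c1] contmD(1)[OF c2, of "(s, \<theta>)"] by auto
  have kT: "T (Suc 0) (Suc 0) \<in> carrier_mat m m" "T (Suc 0) 2 \<in> carrier_mat m r1"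
      "T (Suc 0) 3 \<in> carrier_mat m r2" "T (Suc 0) 4 \<in> carrier_mat m r2"
    "T 2 2 \<in> carrier_mat r1 r1" "T 2 3 \<in> carrier_mat r1 r2" "T 2 4 \<in> carrier_mat r1 r2"
        "T 3 2 \<in> carrier_mat r2 r1" "T 4 2 \<in> carrier_mat r2 r1"
    "T 3 3 \<in> carrier_mat r2 r2" "T 3 4 \<in> carrier_mat r2 r2" "T 4 3 \<in> carrier_mat r2 r2"
        "T 4 4 \<in> carrier_mat r2 r2"
    by (auto simp: T_def block_def sz_def)
  have tsel: "tP t = (LBINT s=a..b. g s) \<cdot>\<^sub>m T (Suc 0) (Suc 0)"
    "tQ1 t \<eta> = g \<eta> \<cdot>\<^sub>m (T (Suc 0) 2 * Z1 d n \<eta>) + mint \<eta> b (\<lambda>s. g s \<cdot>\<^sub>m (T (Suc 0) 3 * Z2 d n s \<eta>))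
                + mint a \<eta> (\<lambda>s. g s \<cdot>\<^sub>m (T (Suc 0) 4 * Z2 d n s \<eta>))"
    "tQ2 t s = (tQ1 t s)\<^sup>T"
    "tS t s = g s \<cdot>\<^sub>m ((Z1 d n s)\<^sup>T * T 2 2 * Z1 d n s)"
    "tR1 t s \<eta> = g s \<cdot>\<^sub>m ((Z1 d n s)\<^sup>T * T 2 3 * Z2 d n s \<eta>)
        + g \<eta> \<cdot>\<^sub>m ((Z2 d n \<eta> s)\<^sup>T * T 4 2 * Z1 d n \<eta>)
                + mint s b (\<lambda>\<theta>. g \<theta> \<cdot>\<^sub>m ((Z2 d n \<theta> s)\<^sup>T * T 3 3 * Z2 d n \<theta> \<eta>))
                + mint \<eta> s (\<lambda>\<theta>. g \<theta> \<cdot>\<^sub>m ((Z2 d n \<theta> s)\<^sup>T * T 4 3 * Z2 d n \<theta> \<eta>))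
                + mint a \<eta> (\<lambda>\<theta>. g \<theta> \<cdot>\<^sub>m ((Z2 d n \<theta> s)\<^sup>T * T 4 4 * Z2 d n \<theta> \<eta>))"
    "tR2 t s \<eta> = g s \<cdot>\<^sub>m ((Z1 d n s)\<^sup>T * T 2 4 * Z2 d n s \<eta>)
        + g \<eta> \<cdot>\<^sub>m ((Z2 d n \<eta> s)\<^sup>T * T 3 2 * Z1 d n \<eta>)
                + mint \<eta> b (\<lambda>\<theta>. g \<theta> \<cdot>\<^sub>m ((Z2 d n \<theta> s)\<^sup>T * T 3 3 * Z2 d n \<theta> \<eta>))
                + mint s \<eta> (\<lambda>\<theta>. g \<theta> \<cdot>\<^sub>m ((Z2 d n \<theta> s)\<^sup>T * T 3 4 * Z2 d n \<theta> \<eta>))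
                + mint a s (\<lambda>\<theta>. g \<theta> \<cdot>\<^sub>m ((Z2 d n \<theta> s)\<^sup>T * T 4 4 * Z2 d n \<theta> \<eta>))" for s \<eta>
    unfolding t_def adm_def Let_def T_def sz_def r1_def r2_def One_nat_def by (simp_all only: pqrs.sel)
  note ci = continuous_intros continuous_on_compose2[OF cg] subset_UNIV
  have wQ: "contm m n (tQ1 t)" unfolding tsel(2)[abs_def]
    by (intro contm_add contm_mint contm_smult contm_mult[OF contm_const[OF kT(2)] c1]
        contm_mult[OF contm_const[OF kT(3)] c2']
        contm_mult[OF contm_const[OF kT(4)] c2'] cg ci)
  have wt: "wft m m n n t"
    unfolding wft_def
  proof (intro conjI)
    show "tP t \<in> carrier_mat m m" unfolding tsel using kT(1) by simp
    show "contm n m (tQ2 t)" unfolding tsel(3)[abs_def] by (rule contm_transpose[OF wQ])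
    show "contm n n (tS t)" unfolding tsel(4)[abs_def]
      by (rule contm_congruence[OF c1 kT(5) c1 cg])
    show "contm n n (\<lambda>p. tR1 t (fst p) (snd p))" unfolding tsel(5)
      by (intro contm_add contm_mint contm_congruence[OF c1' kT(6) c2']
          contm_congruence[OF c2' kT(9) c1'] contm_congruence[OF c2' kT(10) c2']
        contm_congruence[OF c2' kT(12) c2'] contm_congruence[OF c2' kT(13) c2'] ci)
    show "contm n n (\<lambda>p. tR2 t (fst p) (snd p))" unfolding tsel(6)
      by (intro contm_add contm_mint contm_congruence[OF c1' kT(7) c2']
          contm_congruence[OF c2' kT(8) c1'] contm_congruence[OF c2' kT(10) c2']
        contm_congruence[OF c2' kT(11) c2'] contm_congruence[OF c2' kT(13) c2'] ci)
  qed (rule wQ)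
  then show "wft m m n n (adm a b m n d g TT)" by (simp add: t_def)
  define o3 where "o3 = m + r1"
  define o4 where "o4 = m + r1 + r2"
  \<comment> \<open>\<open>W U V\<close> has the entries of U^T T V. Every matrix product in the
    definition of an admissible tuple is such a value, at blocks padded to their position.\<close>
  define W where "W = (\<lambda>(U :: nat \<Rightarrow> nat \<Rightarrow> real) (V :: nat \<Rightarrow> nat \<Rightarrow> real) i j. \<Sum>\<kappa><N. U \<kappa> i
      * (\<Sum>\<rho><N. ent TT \<kappa> \<rho> * V \<rho> j) :: real)"
  have W_sym: "W U V i j = W V U j i" for U V i j
  proof -
    have "ent TT \<kappa> \<rho> = ent TT \<rho> \<kappa>" for \<kappa> \<rho> using ent_transpose[of TT \<kappa> \<rho>] unfolding TTs .
    then have "W U V i j = (\<Sum>\<kappa><N. \<Sum>\<rho><N. V \<rho> j * (ent TT \<rho> \<kappa> * U \<kappa> i))"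
      unfolding W_def by (simp add: sum_distrib_left mult_ac)
    then show ?thesis unfolding W_def sum_distrib_left by (subst (asm) sum.swap) simp
  qed
  have off: "sum_list (take (1 - 1) sz) = 0" "sum_list (take (2 - 1) sz) = m"
      "sum_list (take (3 - 1) sz) = o3" "sum_list (take (4 - 1) sz) = o4"
    "sz ! (1 - 1) = m" "sz ! (2 - 1) = r1" "sz ! (3 - 1) = r2" "sz ! (4 - 1) = r2" "length sz = 4"
    by (simp_all add: sz_def o3_def o4_def)
  note bf = block_form[OF TTc, unfolded szL, OF L]
  have W1: "W (pad 0 (1\<^sub>m m)) (pad 0 (1\<^sub>m m)) i j = ent (T (Suc 0) (Suc 0)) i j" for i j
    using bf[of 1 1 "1\<^sub>m m" m "1\<^sub>m m" m i j] kT(1) unfolding off W_def T_def by simp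
  have W2: "A \<in> carrier_mat r1 n \<Longrightarrow> W (pad 0 (1\<^sub>m m)) (pad m A) i j = ent (T (Suc 0) 2 * A) i j"
      for A i j
    using bf[of 1 2 "1\<^sub>m m" m A n i j] kT(2) unfolding off W_def T_def by simp
  have W3: "A \<in> carrier_mat r2 n \<Longrightarrow> W (pad 0 (1\<^sub>m m)) (pad o3 A) i j = ent (T (Suc 0) 3 * A) i j"
      for A i j
    using bf[of 1 3 "1\<^sub>m m" m A n i j] kT(3) unfolding off W_def T_def by simp
  have W4: "A \<in> carrier_mat r2 n \<Longrightarrow> W (pad 0 (1\<^sub>m m)) (pad o4 A) i j = ent (T (Suc 0) 4 * A) i j"
      for A i j
    using bf[of 1 4 "1\<^sub>m m" m A n i j] kT(4) unfolding off W_def T_def by simp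
  have W5: "A \<in> carrier_mat r1 n \<Longrightarrow> B \<in> carrier_mat r1 n \<Longrightarrow> W (pad m A) (pad m B) i j
      = ent (A\<^sup>T * T 2 2 * B) i j"
    "A \<in> carrier_mat r1 n \<Longrightarrow> B \<in> carrier_mat r2 n \<Longrightarrow> W (pad m A) (pad o3 B) i j
        = ent (A\<^sup>T * T 2 3 * B) i j"
    "A \<in> carrier_mat r1 n \<Longrightarrow> B \<in> carrier_mat r2 n \<Longrightarrow> W (pad m A) (pad o4 B) i j
        = ent (A\<^sup>T * T 2 4 * B) i j"
    "A \<in> carrier_mat r2 n \<Longrightarrow> B \<in> carrier_mat r1 n \<Longrightarrow> W (pad o3 A) (pad m B) i j
        = ent (A\<^sup>T * T 3 2 * B) i j"
    "A \<in> carrier_mat r2 n \<Longrightarrow> B \<in> carrier_mat r1 n \<Longrightarrow> W (pad o4 A) (pad m B) i j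
        = ent (A\<^sup>T * T 4 2 * B) i j"
    "A \<in> carrier_mat r2 n \<Longrightarrow> B \<in> carrier_mat r2 n \<Longrightarrow> W (pad o3 A) (pad o3 B) i j
        = ent (A\<^sup>T * T 3 3 * B) i j"
    "A \<in> carrier_mat r2 n \<Longrightarrow> B \<in> carrier_mat r2 n \<Longrightarrow> W (pad o3 A) (pad o4 B) i j
        = ent (A\<^sup>T * T 3 4 * B) i j"
    "A \<in> carrier_mat r2 n \<Longrightarrow> B \<in> carrier_mat r2 n \<Longrightarrow> W (pad o4 A) (pad o3 B) i j
        = ent (A\<^sup>T * T 4 3 * B) i j"
    "A \<in> carrier_mat r2 n \<Longrightarrow> B \<in> carrier_mat r2 n \<Longrightarrow> W (pad o4 A) (pad o4 B) i j
        = ent (A\<^sup>T * T 4 4 * B) i j" for A B i j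
    using bf[of 2 2 A n B n i j] bf[of 2 3 A n B n i j] bf[of 2 4 A n B n i j]
        bf[of 3 2 A n B n i j] bf[of 4 2 A n B n i j]
      bf[of 3 3 A n B n i j] bf[of 3 4 A n B n i j] bf[of 4 3 A n B n i j] bf[of 4 4 A n B n i j]
    unfolding off W_def T_def by simp_all
  define Mz where "Mz = (\<lambda>s. if s \<le> b then pad m (Z1 d n s) else (\<lambda>_ _. 0))"
  \<comment> \<open>The vector x enters as an integral over (b, b+1], which explains the identity
    block as kernel value for \<theta> > b. The first triangle feeds the third group of rows and the
    second triangle the fourth.\<close>
  define Kz where "Kz = (\<lambda>s \<theta>. if s
      \<le> b then (if \<theta> \<le> b then (if \<theta> < s then pad o3 (Z2 d n s \<theta>) else pad o4 (Z2 d n s \<theta>)) else pad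
      0 (1\<^sub>m m))
     else (\<lambda>_ _. 0))"
  define GM where "GM = (\<lambda>s \<kappa> \<rho>. if s \<le> b then g s * ent TT \<kappa> \<rho> else 0)"
  define Z where "Z = (\<lambda>(_ :: real) (_ :: real) (_ :: nat) (_ :: nat). 0 :: real)"
  define Mt where "Mt = (\<lambda>s i j. Mz s j i)"
  define Kt where "Kt = (\<lambda>s \<theta> i j. Kz \<theta> s j i)"
  have cpad: "bmeas (\<lambda>s. pad k (A s) i j)" if "contm r c A" for k r c i j and A :: "real \<Rightarrow> real mat"
    using contmD(2)[OF that] by (cases "i < k")
        (auto simp: pad_def intro!: bmeas_const bmeas_continuous)
  have cpad2: "bmeas2 (\<lambda>s \<theta>. pad k (A s \<theta>) i j)" if "contm r c (\<lambda>p. A (fst p) (snd p))"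
      for k r c i j and A :: "real \<Rightarrow> real \<Rightarrow> real mat"
    using contmD(2)[OF that] by (cases "i < k")
        (auto simp: pad_def intro!: bmeas2_const bmeas2_continuous)
  have bMz: "bmul Mz" unfolding bmul_def
  proof (intro allI)
    fix i j show "bmeas (\<lambda>s. Mz s i j)"
      using bmeas_If[OF bmeas_le cpad[OF c1, of m i j] bmeas_const[of 0], of b]
          by (simp add: Mz_def if_distribR)
  qed
  have bKz: "bker Kz" unfolding bker_def
  proof (intro allI)
    fix i j
    have "(\<lambda>s \<theta>. Kz s \<theta> i j) =
        (\<lambda>s \<theta>. if s \<le> b then (if \<theta> \<le> b then (if \<theta> < s then pad o3 (Z2 d n s \<theta>) i j
        else pad o4 (Z2 d n s \<theta>) i j) else pad 0 (1\<^sub>m m) i j) else 0)"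
      by (intro ext) (simp add: Kz_def)
    then show "bmeas2 (\<lambda>s \<theta>. Kz s \<theta> i j)"
      using bmeas2_If[OF bmeas2_left[OF bmeas_le]
          bmeas2_If[OF bmeas2_right[OF bmeas_le]
          bmeas2_If[OF bmeas2_less cpad2[OF c2, of o3 i j] cpad2[OF c2, of o4 i j]]
          bmeas2_const[of "pad 0 (1\<^sub>m m) i j"]] bmeas2_const[of 0], of b b] by simp
  qed
  have bGM: "bmul GM" unfolding bmul_def GM_def
    by (intro allI bmeas_If[OF bmeas_le bmeas_mult[OF bmeas_continuous[OF cg] bmeas_const] bmeas_const])
  have bZ: "bker Z" unfolding bker_def Z_def by (intro allI bmeas2_const)
  have bMt: "bmul Mt" using bMz by (simp add: bmul_def Mt_def)
  have bKt: "bker Kt" using bmeas2_swap[OF bkerD[OF bKz]] by (simp add: bker_def Kt_def)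
  let ?M2 = "mcomp GM Mz" and ?K2 = "kcomp GM Z Mz Kz"
  have bM2: "bmul ?M2" and bK2: "bker ?K2" by (intro bmul_mcomp bker_kcomp bMz bKz bGM bZ)+
  have M2: "?M2 s \<kappa> j = (if s \<le> b then g s * (\<Sum>\<rho><N. ent TT \<kappa> \<rho> * Mz s \<rho> j) else 0)" for s \<kappa> j
    by (simp add: mcomp_def GM_def sum_distrib_left mult.assoc)
  have K2: "?K2 s \<eta> \<kappa> j = (if s \<le> b then g s * (\<Sum>\<rho><N. ent TT \<kappa> \<rho> * Kz s \<eta> \<rho> j) else 0)" for s \<eta> \<kappa> j
    by (simp add: kcomp_def GM_def Z_def sum_distrib_left mult.assoc)
  have gW: "(\<Sum>\<kappa><N. U \<kappa> i * (g s * (\<Sum>\<rho><N. ent TT \<kappa> \<rho> * V \<rho> j))) = g s * W U V i j" for U V i j s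
    by (simp add: W_def sum_distrib_left mult_ac)
  have Mm: "mcomp Mt ?M2 s i j = sM t s i j" for s i j
  proof -
    have "mcomp Mt ?M2 s i j = (if s \<le> b then g s * W (Mz s) (Mz s) i j else 0)"
      unfolding mcomp_def[of Mt] unfolding M2 Mt_def by (simp add: gW)
    then show ?thesis by (simp add: sM_def tsel ent_smult Mz_def W5 k1)
  qed
  \<comment> \<open>The part of the kernel to which both outer factors contribute through their
    kernels. Integration stops at b because the middle space has no finite-dimensional
    component.\<close>
  define KI where "KI = (\<lambda>s \<eta> i j. LINT \<theta>|mu. (if \<theta> \<le> b then g \<theta> * W (Kz \<theta> s) (Kz \<theta> \<eta>) i j else 0))"
  define kz where "kz = kcomp Mt Kt ?M2 ?K2"
  have int: "integrable mu (\<lambda>\<theta>. Kz \<theta> s \<kappa> i * ?K2 \<theta> \<eta> \<kappa> j)" if "s \<in> {a..b+1}" "\<eta> \<in> {a..b+1}"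
      for s \<eta> i j \<kappa>
    using that by (intro integrable_bmeas_mult bmeas_integrable
        bmeas2_section[OF bmeas2_swap[OF bkerD[OF bKz]]]
        bmeas2_section[OF bmeas2_swap[OF bkerD[OF bK2]]]) simp_all
  have kz: "kz s \<eta> i j = (if s \<le> b then g s * W (Mz s) (Kz s \<eta>) i j else 0)
      + (if \<eta> \<le> b then g \<eta> * W (Kz \<eta> s) (Mz \<eta>) i j else 0)
      + KI s \<eta> i j" if "s \<in> {a..b+1}" "\<eta> \<in> {a..b+1}" for s \<eta> i j
  proof -
    have "kz s \<eta> i j = (\<Sum>\<kappa><N. Mz s \<kappa> i * ?K2 s \<eta> \<kappa> j) + (\<Sum>\<kappa><N. Kz \<eta> s \<kappa> i * ?M2 \<eta> \<kappa> j)
       + (LINT \<theta>|mu. (\<Sum>\<kappa><N. Kz \<theta> s \<kappa> i * ?K2 \<theta> \<eta> \<kappa> j))"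
      unfolding kz_def kcomp_def[of Mt] using int[OF that] by (simp add: Mt_def Kt_def sum.distrib)
    also have "(\<lambda>\<theta>. \<Sum>\<kappa><N. Kz \<theta> s \<kappa> i * ?K2 \<theta> \<eta> \<kappa> j)
        = (\<lambda>\<theta>. if \<theta> \<le> b then g \<theta> * W (Kz \<theta> s) (Kz \<theta> \<eta>) i j else 0)"
      by (auto simp: K2 gW)
    finally show ?thesis by (simp add: K2 M2 gW KI_def)
  qed
  \<comment> \<open>Symmetry comes from T alone. It yields Q2 as the transpose of Q1 without a
    second computation, and later the self-adjointness of the tuple.\<close>
  have kz_sym: "kz s \<eta> i j = kz \<eta> s j i" if "s \<in> {a..b+1}" "\<eta> \<in> {a..b+1}" for s \<eta> i j
  proof -
    have "(\<lambda>\<theta>. if \<theta> \<le> b then g \<theta> * W (Kz \<theta> s) (Kz \<theta> \<eta>) i j else 0)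
        = (\<lambda>\<theta>. if \<theta> \<le> b then g \<theta> * W (Kz \<theta> \<eta>) (Kz \<theta> s) j i else 0)"
      by (subst W_sym) (rule refl)
    then show ?thesis
      using kz[OF that, of i j] kz[OF that(2,1), of j i] W_sym[of "Mz s" "Kz s \<eta>" i j]
          W_sym[of "Kz \<eta> s" "Mz \<eta>" i j]
      by (simp add: KI_def)
  qed
  have cc: "continuous_on UNIV (\<lambda>\<theta>. g \<theta> * ent (F \<theta>) i j)" if "contm r c F"
      for F :: "real \<Rightarrow> real mat" and r c i j
    by (intro continuous_intros cg contmD(2)[OF that])
  have e1: "ent (mint l r (\<lambda>\<theta>. g \<theta> \<cdot>\<^sub>m F \<theta>)) i j = (LBINT \<theta>=l..r. g \<theta> * ent (F \<theta>) i j)"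
    "mint l r (\<lambda>\<theta>. g \<theta> \<cdot>\<^sub>m F \<theta>) \<in> carrier_mat r' c" if "\<And>\<theta>. F \<theta> \<in> carrier_mat r' c" for F l r i j r' c
    using that by (auto simp: ent_mint[of _ r' c] ent_smult intro!: carrier_mint)
  have tri: "A\<^sup>T * X * B \<in> carrier_mat c c'"
      if "A \<in> carrier_mat r c" "X \<in> carrier_mat r r'" "B \<in> carrier_mat r' c'"
      for A X B :: "real mat" and r c r' c'
    using that by auto
  have c2t: "contm n n (\<lambda>\<theta>. (Z2 d n \<theta> s)\<^sup>T * A * Z2 d n \<theta> \<eta>)" if "A \<in> carrier_mat r2 r2" for A s \<eta>
    by (intro contm_mult[OF contm_mult[OF contm_transpose[OF c2'] contm_const[OF that]] c2']
        continuous_intros)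
  have c2b: "contm m n (\<lambda>\<theta>. A * Z2 d n \<theta> \<eta>)" if "A \<in> carrier_mat m r2" for A \<eta>
    by (intro contm_mult[OF contm_const[OF that] c2'] continuous_intros)
  have kQ: "kz s \<eta> i j = ent (tQ1 t \<eta>) i j" if "s \<in> {a..b+1}" "\<eta> \<in> {a..b}" "b < s" for s \<eta> i j
  proof -
    have "KI s \<eta> i j = 0
      + (LBINT \<theta>=a..\<eta>. g \<theta> * ent (T (Suc 0) 4 * Z2 d n \<theta> \<eta>) i j)
          + (LBINT \<theta>=\<eta>..b. g \<theta> * ent (T (Suc 0) 3 * Z2 d n \<theta> \<eta>) i j)"
      unfolding KI_def by (rule
          site_integral_split2[OF _ _ cc[OF c2b[OF kT(4)]] cc[OF c2b[OF kT(3)]]])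
          (use that in \<open>auto simp: Kz_def W3 W4 k2\<close>)
    then show ?thesis using kz[of s \<eta> i j] that
      by (simp add: tsel(2) Kz_def Mz_def W2 k1 ent_smult ent_add[where n=m and m=n]
          mult_carrier_mat[OF kT(2) k1]
          e1[OF mult_carrier_mat[OF kT(3) k2]] e1[OF mult_carrier_mat[OF kT(4) k2]])
  qed
  \<comment> \<open>The diagonal must be excluded: there \<open>Kz\<close> uses the fourth group on
    both sides, which gives the blocks T_24 and T_42, while R1 pairs T_23 with T_42 and R2 pairs
    T_24 with T_32.\<close>
  have Kk: "kz s \<eta> i j = sK t s \<eta> i j" if s: "s \<in> {a..b+1}" and \<eta>: "\<eta> \<in> {a..b+1}" and ne: "\<eta> \<noteq> s"
      for s \<eta> i j
  proof -
    consider (pp) "b < s" "b < \<eta>" | (pi) "b < s" "\<eta> \<le> b" | (ip) "s \<le> b" "b < \<eta>" | (lt) "s \<le> b"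
        "\<eta> < s" | (gt) "\<eta> \<le> b" "s < \<eta>"
      using ne by fastforce
    then show ?thesis
    proof cases
      case pp
      have "KI s \<eta> i j = 0 + (LBINT \<theta>=a..b. g \<theta> * ent (T (Suc 0) (Suc 0)) i j)"
        unfolding KI_def by (rule site_integral_split1)
            (use pp in \<open>auto simp: Kz_def W1 intro!: continuous_intros cg\<close>)
      then show ?thesis using kz[OF s \<eta>, of i j] pp by (simp add: sK_def tsel(1) ent_smult)
    next
      case pi
      then show ?thesis using kQ[OF s, of \<eta> i j] \<eta> by (simp add: sK_def)
    next
      case ip
      then show ?thesis using kQ[OF \<eta>, of s j i] kz_sym[OF s \<eta>, of i j] s
          by (simp add: sK_def tsel(3) ent_transpose)
    next
      case lt
      have "KI s \<eta> i j = 0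
        + (LBINT \<theta>=a..\<eta>. g \<theta> * ent ((Z2 d n \<theta> s)\<^sup>T * T 4 4 * Z2 d n \<theta> \<eta>) i j)
            + (LBINT \<theta>=\<eta>..s. g \<theta> * ent ((Z2 d n \<theta> s)\<^sup>T * T 4 3 * Z2 d n \<theta> \<eta>) i j)
        + (LBINT \<theta>=s..b. g \<theta> * ent ((Z2 d n \<theta> s)\<^sup>T * T 3 3 * Z2 d n \<theta> \<eta>) i j)"
        unfolding KI_def by (rule
            site_integral_split3[OF _ _ _ cc[OF c2t[OF kT(13)]] cc[OF c2t[OF kT(12)]]
            cc[OF c2t[OF kT(10)]]])
          (use lt s \<eta> in \<open>auto simp: Kz_def W5 k2\<close>)
      then show ?thesis using kz[OF s \<eta>, of i j] lt
        by (simp add: sK_def tsel(5) Kz_def Mz_def W5 k1 k2 ent_smult ent_add[where n=n and m=n]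
          tri[OF k1 kT(6) k2] tri[OF k2 kT(9) k1] e1[OF tri[OF k2 kT(10) k2]]
              e1[OF tri[OF k2 kT(12) k2]] e1[OF tri[OF k2 kT(13) k2]])
    next
      case gt
      have "KI s \<eta> i j = 0
        + (LBINT \<theta>=a..s. g \<theta> * ent ((Z2 d n \<theta> s)\<^sup>T * T 4 4 * Z2 d n \<theta> \<eta>) i j)
            + (LBINT \<theta>=s..\<eta>. g \<theta> * ent ((Z2 d n \<theta> s)\<^sup>T * T 3 4 * Z2 d n \<theta> \<eta>) i j)
        + (LBINT \<theta>=\<eta>..b. g \<theta> * ent ((Z2 d n \<theta> s)\<^sup>T * T 3 3 * Z2 d n \<theta> \<eta>) i j)"
        unfolding KI_def by (rule
            site_integral_split3[OF _ _ _ cc[OF c2t[OF kT(13)]] cc[OF c2t[OF kT(11)]]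
            cc[OF c2t[OF kT(10)]]])
          (use gt s \<eta> in \<open>auto simp: Kz_def W5 k2\<close>)
      then show ?thesis using kz[OF s \<eta>, of i j] gt
        by (simp add: sK_def tsel(6) Kz_def Mz_def W5 k1 k2 ent_smult ent_add[where n=n and m=n]
          tri[OF k1 kT(7) k2] tri[OF k2 kT(8) k1] e1[OF tri[OF k2 kT(10) k2]]
              e1[OF tri[OF k2 kT(11) k2]] e1[OF tri[OF k2 kT(13) k2]])
    qed
  qed
  \<comment> \<open>The kernel of the tuple equals a symmetric kernel off the diagonal, and the
    multiplier is a symmetric matrix.\<close>
  show "ip Y (app (adm a b m n d g TT) X) = ip (app (adm a b m n d g TT) Y) X" if Y: "L2 Y"
  proof -
    have "ip Y (app t X) = ip (op (\<lambda>s i j. sM t s j i) (\<lambda>s \<theta> i j. sK t \<theta> s j i) Y) X"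
      unfolding app_def by (rule op_adjoint[OF bmul_sM[OF wt] bker_sK[OF wt] Y X])
    also have "\<dots> = ip (app t Y) X"
    proof (rule ip_cong)
      fix s i assume s: "s \<in> space mu"
      show "op (\<lambda>s i j. sM t s j i) (\<lambda>s \<theta> i j. sK t \<theta> s j i) Y s i = app t Y s i"
        unfolding app_def
      proof (rule op_cong[OF _ bker_sK[OF wt] Y s])
        show "bker (\<lambda>s \<theta> i j. sK t \<theta> s j i)"
          using bmeas2_swap[OF bkerD[OF bker_sK[OF wt]]] by (simp add: bker_def)
        have "sM t s i j = (if s \<le> b then g s * W (pad m (Z1 d n s)) (pad m (Z1 d n s)) i j else 0)"
            for i j
          by (simp add: sM_def tsel ent_smult W5 k1)
        then show "sM t s j i = sM t s i j" for j
            using W_sym[of "pad m (Z1 d n s)" "pad m (Z1 d n s)" i j] by simp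
        show "sK t \<theta> s j i = sK t s \<theta> i j" if "\<theta> \<in> space mu" "\<theta> \<noteq> s" for \<theta> j
          using Kk[of \<theta> s j i] Kk[of s \<theta> i j] kz_sym[of s \<theta> i j] s that by simp
      qed
    qed simp
    finally show ?thesis by (simp add: t_def)
  qed
  let ?Y = "op Mz Kz X"
  have Y: "L2 ?Y" by (rule L2_op[OF bMz bKz X])
  have GY: "L2 (op GM Z ?Y)" by (rule L2_op[OF bGM bZ Y])
  have "0 \<le> ip ?Y (op GM Z ?Y)"
    unfolding GM_def Z_def by (rule ip_psd_multiplier[OF TT L g cg Y])
  also have "\<dots> = ip X (op Mt Kt (op GM Z ?Y))"
    using op_adjoint[OF bMt bKt X GY] by (simp add: Mt_def Kt_def)
  also have "\<dots> = ip X (app t X)"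
  proof (rule ip_cong)
    fix s i assume s: "s \<in> space mu"
    have "op Mt Kt (op GM Z ?Y) s i = op Mt Kt (op ?M2 ?K2 X) s i"
      by (rule op_cong_vec[OF _ s]) (rule op_comp[OF bGM bZ bMz bKz X])
    also have "\<dots> = op (mcomp Mt ?M2) kz X s i"
      unfolding kz_def by (rule op_comp[OF bMt bKt bM2 bK2 X s])
    also have "\<dots> = app t X s i"
      unfolding app_def
      by (rule op_cong[OF _ bker_sK[OF wt] X s])
          (use Mm Kk s bker_kcomp[OF bMt bKt bM2 bK2] in \<open>auto simp: kz_def\<close>)
    finally show "op Mt Kt (op GM Z ?Y) s i = app t X s i" .
  qed simp
  finally show "0 \<le> ip X (app (adm a b m n d g TT) X)" by (simp add: t_def)
qed

text \<open>Both weights, 1 and (s - a)(b - s), are nonnegative on [a,b]. On that interval the tuple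
  agrees with the sum of two continuous extensions, each of them positive semidefinite and
  symmetric.\<close>

theorem Phi_psd:
  assumes t: "t \<in> Phi a b m n d"
      and N: "m + (d + 1) * n + length (exps2 d) * n + length (exps2 d) * n \<le> N" and X: "L2 X"
  shows "0 \<le> ip X (app t X)" "L2 Y \<Longrightarrow> ip Y (app t X) = ip (app t Y) X"
proof -
  let ?g = "\<lambda>s. (s - a) * (b - s)"
  obtain u v where tuv: "t = u \<oplus>\<^sub>p v" and u: "admissible a b m n d (\<lambda>s. 1) u"
      and v: "admissible a b m n d ?g v"
    using t by (auto simp: Phi_def)
  obtain U where U: "psd_mat (m + (d + 1) * n + length (exps2 d) * n + length (exps2 d) * n) U"
      "agree a b u (adm a b m n d (\<lambda>s. 1) U)"
    using admissible_adm[OF u] .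
  obtain V where V: "psd_mat (m + (d + 1) * n + length (exps2 d) * n + length (exps2 d) * n) V"
      "agree a b v (adm a b m n d ?g V)"
    using admissible_adm[OF v] .
  let ?u = "adm a b m n d (\<lambda>s. 1) U" and ?v = "adm a b m n d ?g V"
  note u' = adm_psd[OF U(1) N _ _ X, of "\<lambda>s. 1", simplified]
  have g: "\<And>s. s \<in> {a..b} \<Longrightarrow> 0 \<le> ?g s" "continuous_on UNIV ?g" by (auto intro!: continuous_intros)
  note v' = adm_psd[OF V(1) N g X]
  have split: "app t X s i = app ?u X s i + app ?v X s i" if "s \<in> space mu" "L2 X" for X s i
    using app_agree[OF agree_add[OF U(2) V(2)], of s X i] app_add[OF u'(1) v'(1) that(2), of s i]
        that by (simp add: tuv)
  have ip: "ip Y (app t X) = ip Y (app ?u X) + ip Y (app ?v X)" if "L2 X" "L2 Y" for X Y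
  proof -
    have "ip Y (app t X) = ip Y (\<lambda>s i. app ?u X s i + app ?v X s i)"
        by (rule ip_cong) (simp_all add: split that)
    then show ?thesis using ip_add_right[OF that(2) L2_app[OF u'(1) that(1)]
        L2_app[OF v'(1) that(1)]] by simp
  qed
  show "0 \<le> ip X (app t X)" using ip[OF X X] u'(2) v'(2) by simp
  show "ip Y (app t X) = ip (app t Y) X" if "L2 Y"
    using ip[OF X that] ip[OF that X] u'(3)[OF that] v'(3)[OF _ that] ip_commute[of X "app ?u Y"]
        ip_commute[of X "app ?v Y"]
      ip_commute[of X "app t Y"] by simp
qed

end

section \<open>Permanence properties of absolute continuity\<close>

lemma abs_cont_on_sum_le:
  assumes f: "abs_cont_on d l r f" and g: "abs_cont_on d' l r g"
    and le: "\<And>u v. l \<le> u \<Longrightarrow> u \<le> v \<Longrightarrow> v \<le> r \<Longrightarrow> d'' (h u) (h v) \<le> d (f u) (f v) + d' (g u) (g v)"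
  shows "abs_cont_on d'' l r h"
  unfolding abs_cont_on_iff
proof (intro allI impI)
  fix e :: real assume "e > 0"
  then have e2: "e / 2 > 0" by simp
  obtain \<delta> where \<delta>: "\<delta> > 0" "\<And>I. short_family l r \<delta> I \<Longrightarrow> (\<Sum>(u, v) \<in> I. d (f u) (f v)) < e / 2"
    using abs_cont_onE[OF f e2] by blast
  obtain \<delta>' where \<delta>': "\<delta>' > 0" "\<And>I. short_family l r \<delta>' I \<Longrightarrow> (\<Sum>(u, v) \<in> I. d' (g u) (g v)) < e / 2"
    using abs_cont_onE[OF g e2] by blast
  have "(\<Sum>(u, v) \<in> I. d'' (h u) (h v)) < e" if I: "short_family l r (min \<delta> \<delta>') I" for I
  proof -
    have "(\<Sum>(u, v) \<in> I. d'' (h u) (h v)) \<le> (\<Sum>(u, v) \<in> I. d (f u) (f v) + d' (g u) (g v))"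
      using I le by (intro sum_mono) (auto simp: short_family_def)
    also have "\<dots> = (\<Sum>(u, v) \<in> I. d (f u) (f v)) + (\<Sum>(u, v) \<in> I. d' (g u) (g v))"
      by (simp add: case_prod_unfold sum.distrib)
    also have "\<dots> < e / 2 + e / 2"
      using I by (intro add_strict_mono \<delta>(2) \<delta>'(2)) (auto simp: short_family_def)
    finally show ?thesis by simp
  qed
  then show "\<exists>\<delta>>0. \<forall>I. short_family l r \<delta> I \<longrightarrow> (\<Sum>(u, v) \<in> I. d'' (h u) (h v)) < e"
    using \<delta>(1) \<delta>'(1) by (intro exI[of _ "min \<delta> \<delta>'"]) simp
qed

lemma abs_cont_on_le:
  assumes f: "abs_cont_on d l r f" and C: "C \<ge> 0"
    and le: "\<And>u v. l \<le> u \<Longrightarrow> u \<le> v \<Longrightarrow> v \<le> r \<Longrightarrow> d' (g u) (g v) \<le> C * d (f u) (f v)"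
  shows "abs_cont_on d' l r g"
  unfolding abs_cont_on_iff
proof (intro allI impI)
  fix e :: real assume e: "e > 0"
  \<comment> \<open>The denominator is C + 1 because C may be 0.\<close>
  then have "e / (C + 1) > 0" using C by simp
  then obtain \<delta> where \<delta>: "\<delta> > 0" "\<And>I. short_family l r \<delta> I \<Longrightarrow> (\<Sum>(u, v) \<in> I. d (f u) (f v)) < e / (C + 1)"
    using abs_cont_onE[OF f] by blast
  have "(\<Sum>(u, v) \<in> I. d' (g u) (g v)) < e" if I: "short_family l r \<delta> I" for I
  proof -
    have "(\<Sum>(u, v) \<in> I. d' (g u) (g v)) \<le> (\<Sum>(u, v) \<in> I. C * d (f u) (f v))"
      using I le by (intro sum_mono) (auto simp: short_family_def)
    also have "\<dots> = C * (\<Sum>(u, v) \<in> I. d (f u) (f v))" by (simp add: sum_distrib_left case_prod_unfold)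
    also have "\<dots> \<le> C * (e / (C + 1))" using \<delta>(2)[OF I] C by (intro mult_left_mono) auto
    also have "\<dots> < e" using C e by (simp add: field_simps)
    finally show ?thesis .
  qed
  then show "\<exists>\<delta>>0. \<forall>I. short_family l r \<delta> I \<longrightarrow> (\<Sum>(u, v) \<in> I. d' (g u) (g v)) < e"
    using \<delta>(1) by blast
qed

lemma abs_cont_on_subinterval:
  assumes "abs_cont_on d l r f" "l \<le> l'" "r' \<le> r"
  shows "abs_cont_on d l' r' f"
proof -
  have "short_family l' r' \<delta> I \<Longrightarrow> short_family l r \<delta> I" for \<delta> I
    using assms(2,3) by (fastforce simp: short_family_def)
  then show ?thesis using assms(1) unfolding abs_cont_on_iff by meson
qed

lemma abs_cont_on_continuous:
  fixes f :: "real \<Rightarrow> real"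
  assumes "abs_cont_on dist l r f" shows "continuous_on {l..r} f"
  unfolding continuous_on_iff
proof (intro ballI allI impI)
  fix x e :: real assume x: "x \<in> {l..r}" and e: "e > 0"
  obtain \<delta> where \<delta>: "\<delta> > 0" "\<And>I. short_family l r \<delta> I \<Longrightarrow> (\<Sum>(u, v) \<in> I. dist (f u) (f v)) < e"
    using abs_cont_onE[OF assms e] by blast
  have "dist (f y) (f x) < e" if "y \<in> {l..r}" "dist y x < \<delta>" for y
    \<comment> \<open>A family that consists of a single interval turns absolute continuity into
      continuity.\<close>
    using \<delta>(2)[of "{(min x y, max x y)}"] x that
    by (auto simp: short_family_def pairwise_def dist_real_def min_def max_def abs_if split: if_splits)
  then show "\<exists>d>0. \<forall>x'\<in>{l..r}. dist x' x < d \<longrightarrow> dist (f x') (f x) < e" using \<delta>(1) by blast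
qed

text \<open>On a compact interval both factors are bounded, and the increment of the product is at
  most the sum of the two increments scaled by these bounds. The scaled distances are the reason why
  the comparison lemma allows a different distance for each function.\<close>

lemma abs_cont_on_mult:
  fixes f g :: "real \<Rightarrow> real"
  assumes f: "abs_cont_on dist l r f" and g: "abs_cont_on dist l r g"
  shows "abs_cont_on dist l r (\<lambda>s. f s * g s)"
proof -
  have "\<exists>M\<ge>0. \<forall>s\<in>{l..r}. \<bar>h s\<bar> \<le> M" if "abs_cont_on dist l r h" for h :: "real \<Rightarrow> real"
    using compact_continuous_image[OF abs_cont_on_continuous[OF that] compact_Icc]
    by (auto dest!: compact_imp_bounded simp: bounded_iff) (metis abs_ge_self abs_ge_zero order_trans)
  then obtain F G where F: "F \<ge> 0" "\<And>s. s \<in> {l..r} \<Longrightarrow> \<bar>f s\<bar> \<le> F"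
      and G: "G \<ge> 0" "\<And>s. s \<in> {l..r} \<Longrightarrow> \<bar>g s\<bar> \<le> G"
    using f g by meson
  have f': "abs_cont_on (\<lambda>x y. G * dist x y) l r f" by (rule abs_cont_on_le[OF f G(1)]) simp
  have g': "abs_cont_on (\<lambda>x y. F * dist x y) l r g" by (rule abs_cont_on_le[OF g F(1)]) simp
  show ?thesis
  proof (rule abs_cont_on_sum_le[OF f' g'])
    fix u v assume uv: "l \<le> u" "u \<le> v" "v \<le> r"
    have "\<bar>f u * g u - f v * g v\<bar> = \<bar>(f u - f v) * g u + f v * (g u - g v)\<bar>"
        by (simp add: algebra_simps)
    also have "\<dots> \<le> \<bar>f u - f v\<bar> * \<bar>g u\<bar> + \<bar>f v\<bar> * \<bar>g u - g v\<bar>"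
      using abs_triangle_ineq by (simp add: abs_mult[symmetric])
    also have "\<dots> \<le> \<bar>f u - f v\<bar> * G + F * \<bar>g u - g v\<bar>"
      using F(2)[of v] G(2)[of u] uv by (intro add_mono mult_left_mono mult_right_mono) auto
    finally show "dist (f u * g u) (f v * g v) \<le> G * dist (f u) (f v) + F * dist (g u) (g v)"
      by (simp add: dist_real_def mult.commute)
  qed
qed

lemma abs_cont_on_add:
  fixes f g :: "real \<Rightarrow> real"
  assumes f: "abs_cont_on dist l r f" and g: "abs_cont_on dist l r g"
  shows "abs_cont_on dist l r (\<lambda>s. f s + g s)"
  by (rule abs_cont_on_sum_le[OF f g]) (simp add: dist_triangle_add)

text \<open>The sum of the increments is the total length itself, so \<delta> = \<epsilon> works.
  The function is the polynomial factor in the Taylor remainder.\<close>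

lemma abs_cont_on_affine: "abs_cont_on dist l r (\<lambda>s. c - s :: real)"
proof -
  have "(\<Sum>(u, v)\<in>I. dist (c - u) (c - v)) = (\<Sum>(u, v)\<in>I. v - u)" if "short_family l r e I" for e I
    using that by (intro sum.cong) (auto simp: short_family_def dist_real_def)
  then show ?thesis unfolding abs_cont_on_iff by (metis short_family_def)
qed

lemma L2_vec_nth:
  assumes "f \<in> L2_vec {a..b} n" "a \<le> l" "r \<le> b"
  shows "integrable (lebesgue_on {l..r}) (\<lambda>s. vnt (f s) i)"
proof -
  have "finite_measure (lebesgue_on {a..b})" by (rule finite_measure_lebesgue_on) simp
  then have "integrable (lebesgue_on {a..b}) (\<lambda>s. vnt (f s) i)"
    by (rule finite_measure.square_integrable_imp_integrable)
        (use assms(1) in \<open>simp_all add: L2_vec_iff\<close>)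
  then show ?thesis
    unfolding integrable_lebesgue_on_iff_absolutely
    by (rule set_integrable_subset) (use assms in auto)
qed

section \<open>Elimination of the boundary values\<close>

lemma sob_deriv_increment:
  assumes f: "sob_deriv a b n f g" and s: "s \<in> {a..b}"
  shows "vnt (f s) i = vnt (f a) i + (LINT \<theta>|lebesgue_on {a..s}. vnt (g \<theta>) i)"
proof -
  have fL: "f \<in> L2_vec {a..b} n" and gL: "g \<in> L2_vec {a..b} n" using f by (auto simp: sob_deriv_def)
  have fc: "f s \<in> carrier_vec n" "g s \<in> carrier_vec n" if "s \<in> {a..b}" for s using fL gL that
      by (auto simp: L2_vec_def)
  show ?thesis
  proof (cases "i < n")
    case True
    have "abs_cont_on dist a b (\<lambda>s. f s $ i)" using f True by (auto simp: sob_deriv_def)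
    then have ac: "abs_cont_on dist a s (\<lambda>s. f s $ i)" by (rule abs_cont_on_subinterval) (use s in auto)
    have "AE s in lebesgue_on {a..b}. ((\<lambda>r. f r $ i) has_real_derivative g s $ i) (at s)"
        using f True by (auto simp: sob_deriv_def)
    then have "AE \<theta> in lebesgue_on {a..s}. ((\<lambda>r. f r $ i) has_real_derivative vnt (g \<theta>) i) (at \<theta>)"
      using s True carrier_vecD[OF fc(2)]
          by (auto simp: AE_restrict_space_iff vnt_def elim!: eventually_mono)
    from abs_cont_increment_eq_integral[OF _ ac this L2_vec_nth[OF gL]] s
    show ?thesis using fc(1)[of s] fc(1)[of a] True by (auto simp: vnt_def)
  next
    case False
    have "(LINT \<theta>|lebesgue_on {a..s}. vnt (g \<theta>) i) = (LINT \<theta>|lebesgue_on {a..s}. 0)"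
      using carrier_vecD[OF fc(2)] s False
          by (intro Bochner_Integration.integral_cong) (auto simp: vnt_def)
    then show ?thesis using fc(1)[of s] fc(1)[of a] s False by (auto simp: vnt_def)
  qed
qed

text \<open>Taylor's formula with integral remainder, from the increment of \<open>(s - \<theta>) g(\<theta>) + f(\<theta>)\<close>.\<close>

lemma sob_deriv2_increment:
  assumes f: "sob_deriv a b n f g" and g: "sob_deriv a b n g h" and s: "s \<in> {a..b}"
  shows "vnt (f s) i = vnt (f a) i + (s - a) * vnt (g a) i
      + (LINT \<theta>|lebesgue_on {a..s}. (s - \<theta>) * vnt (h \<theta>) i)"
proof -
  have fL: "f \<in> L2_vec {a..b} n" and gL: "g \<in> L2_vec {a..b} n" and hL: "h \<in> L2_vec {a..b} n"
      using f g by (auto simp: sob_deriv_def)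
  have fc: "f s \<in> carrier_vec n" "g s \<in> carrier_vec n" "h s \<in> carrier_vec n" if "s \<in> {a..b}" for s
    using fL gL hL that by (auto simp: L2_vec_def)
  show ?thesis
  proof (cases "i < n")
    case True
    have "abs_cont_on dist a s (\<lambda>s. f s $ i)" "abs_cont_on dist a s (\<lambda>s. g s $ i)"
      using f g True s by (auto simp: sob_deriv_def intro: abs_cont_on_subinterval[where r=b and l=a])
    then have ac: "abs_cont_on dist a s (\<lambda>\<theta>. (s - \<theta>) * g \<theta> $ i + f \<theta> $ i)"
      by (intro abs_cont_on_add abs_cont_on_mult abs_cont_on_affine)
    have "AE s in lebesgue_on {a..b}. ((\<lambda>r. f r $ i) has_real_derivative g s $ i) (at s)"
      "AE s in lebesgue_on {a..b}. ((\<lambda>r. g r $ i) has_real_derivative h s $ i) (at s)"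
          using f g True by (auto simp: sob_deriv_def)
    then have "AE \<theta> in lebesgue_on {a..b}.
        ((\<lambda>\<theta>. (s - \<theta>) * g \<theta> $ i + f \<theta> $ i) has_real_derivative (s - \<theta>) * vnt (h \<theta>) i) (at \<theta>)"
      using AE_space
    proof eventually_elim
      case (elim \<theta>)
      have "((\<lambda>\<theta>. (s - \<theta>) * g \<theta> $ i + f \<theta> $ i) has_real_derivative
          ((0 - 1) * g \<theta> $ i + (h \<theta> $ i) * (s - \<theta>)) + g \<theta> $ i) (at \<theta>)"
        by (intro DERIV_add DERIV_mult DERIV_diff DERIV_const DERIV_ident elim(1,2))
      moreover have "vnt (h \<theta>) i = h \<theta> $ i" using fc(3)[of \<theta>] elim(3) True by (auto simp: vnt_def)
      ultimately show ?case by (simp add: mult.commute)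
    qed
    then have der: "AE \<theta> in lebesgue_on {a..s}.
        ((\<lambda>\<theta>. (s - \<theta>) * g \<theta> $ i + f \<theta> $ i) has_real_derivative (s - \<theta>) * vnt (h \<theta>) i) (at \<theta>)"
      using s by (auto simp: AE_restrict_space_iff elim!: eventually_mono)
    have int: "integrable (lebesgue_on {a..s}) (\<lambda>\<theta>. (s - \<theta>) * vnt (h \<theta>) i)"
    proof (rule Bochner_Integration.integrable_bound)
      show "integrable (lebesgue_on {a..s}) (\<lambda>\<theta>. (s - a) * vnt (h \<theta>) i)"
        using L2_vec_nth[OF hL, of a s i] s by simp
      show "(\<lambda>\<theta>. (s - \<theta>) * vnt (h \<theta>) i) \<in> borel_measurable (lebesgue_on {a..s})"
        using borel_measurable_integrable[OF L2_vec_nth[OF hL, of a s i]] s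
        by (intro borel_measurable_times continuous_borel_measurable_lebesgue_on[of "\<lambda>\<theta>. s - \<theta>"]
            continuous_intros) auto
      show "AE \<theta> in lebesgue_on {a..s}. norm ((s - \<theta>) * vnt (h \<theta>) i) \<le> norm ((s - a) * vnt (h \<theta>) i)"
        by (rule AE_I2) (auto simp: abs_mult intro!: mult_right_mono)
    qed
    from abs_cont_increment_eq_integral[OF _ ac der int] s
    show ?thesis using fc[of s] fc[of a] True by (auto simp: vnt_def algebra_simps)
  next
    case False
    have "(LINT \<theta>|lebesgue_on {a..s}. (s - \<theta>) * vnt (h \<theta>) i) = (LINT \<theta>|lebesgue_on {a..s}. 0)"
      using carrier_vecD[OF fc(3)] s False
          by (intro Bochner_Integration.integral_cong) (auto simp: vnt_def)
    then show ?thesis using fc[of s] fc[of a] s False by (auto simp: vnt_def)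
  qed
qed

section \<open>Block matrices acting on stacked vectors\<close>

lemma dim_append_cols [simp]: "dim_row (A @\<^sub>c B) = dim_row A"
    "dim_col (A @\<^sub>c B) = dim_col A + dim_col B"
  by (auto simp: append_cols_def)

lemma dim_append_rows [simp]: "dim_row (A @\<^sub>r B) = dim_row A + dim_row B"
    "dim_col (A @\<^sub>r B) = dim_col A"
  by (auto simp: append_rows_def)

text \<open>Dimensions enter as equations between \<open>dim_row\<close>, \<open>dim_col\<close> and
  \<open>dim_vec\<close>, so that rewriting discharges them while it multiplies out nested
  blocks.\<close>

lemma append_cols_mult_vec:
  assumes "dim_row A = dim_row B" "dim_col A = dim_vec v" "dim_col B = dim_vec w"
  shows "(A @\<^sub>c B) *\<^sub>v (v @\<^sub>v w) = A *\<^sub>v v + B *\<^sub>v (w :: 'a :: comm_ring_1 vec)"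
proof -
  have "(A @\<^sub>c B) *\<^sub>v (v @\<^sub>v w)
      = (A *\<^sub>v v + B *\<^sub>v w) @\<^sub>v (0\<^sub>m 0 (dim_col A) *\<^sub>v v + 0\<^sub>m 0 (dim_col B) *\<^sub>v w)"
    unfolding append_cols_def using assms
    by (intro four_block_mat_mult_vec[where ?nr1.0="dim_row A" and ?nc1.0="dim_col A"
        and ?nc2.0="dim_col B" and ?nr2.0=0]) (auto intro!: carrier_matI carrier_vecI)
  then show ?thesis by (auto intro!: eq_vecI)
qed

lemma append_rows_mult_vec:
  assumes "dim_col A = dim_col B" "dim_col A = dim_vec v"
  shows "(A @\<^sub>r B) *\<^sub>v v = (A *\<^sub>v v) @\<^sub>v (B *\<^sub>v (v :: 'a :: comm_ring_1 vec))"
  using assms by (intro mat_mult_append[where ?nr1.0="dim_row A" and ?nr2.0="dim_row B"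
      and nc="dim_col A"]) (auto intro!: carrier_matI carrier_vecI)

lemma zero_mat_mult_vec: "dim_vec v = m \<Longrightarrow> 0\<^sub>m n m *\<^sub>v v = (0\<^sub>v n :: 'a :: comm_ring_1 vec)"
  by (auto intro!: eq_vecI)

lemma one_mat_mult_vec: "dim_vec v = n \<Longrightarrow> 1\<^sub>m n *\<^sub>v v = (v :: 'a :: comm_ring_1 vec)"
  by (auto intro!: one_mult_mat_vec carrier_vecI)

lemma smult_mat_mult_vec:
    "dim_vec v = dim_col A \<Longrightarrow> (c \<cdot>\<^sub>m A) *\<^sub>v v = c \<cdot>\<^sub>v (A *\<^sub>v (v :: 'a :: comm_ring_1 vec))"
  by (auto intro!: eq_vecI)

lemma zero_vec_add: "dim_vec v = n \<Longrightarrow> 0\<^sub>v n + v = (v :: 'a :: comm_ring_1 vec)"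
    "dim_vec v = n \<Longrightarrow> v + 0\<^sub>v n = (v :: 'a :: comm_ring_1 vec)"
  by (auto intro!: eq_vecI)

lemmas block_simps = append_cols_mult_vec append_rows_mult_vec zero_mat_mult_vec one_mat_mult_vec
    smult_mat_mult_vec zero_vec_add

lemma vnt_append: "vnt (v @\<^sub>v w) i = (if i < dim_vec v then vnt v i else vnt w (i - dim_vec v))"
  by (auto simp: vnt_def)

lemma vnt_zero [simp]: "vnt (0\<^sub>v n) i = 0"
  by (auto simp: vnt_def)

lemma vnt_dim_zero: "dim_vec v = 0 \<Longrightarrow> vnt v i = 0"
  by (auto simp: vnt_def)

lemma vnt_beyond: "dim_vec v \<le> i \<Longrightarrow> vnt v i = 0"
  by (auto simp: vnt_def)

lemma vnt_vint: "vnt (vint a b F) i = (LINT s|lebesgue_on {a..b}. vnt (F s) i)"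
  if "a \<le> b" "\<And>s. s \<in> {a..b} \<Longrightarrow> F s \<in> carrier_vec n"
proof -
  have d: "dim_vec (F s) = n" if "s \<in> {a..b}" for s
      using \<open>\<And>s. s \<in> {a..b} \<Longrightarrow> F s \<in> carrier_vec n\<close> that by auto
  show ?thesis
  proof (cases "i < n")
    case True
    then have "(LINT s|lebesgue_on {a..b}. F s $ i) = (LINT s|lebesgue_on {a..b}. vnt (F s) i)"
      by (intro Bochner_Integration.integral_cong) (auto simp: vnt_def d)
    then show ?thesis using True d[of a] \<open>a \<le> b\<close> unfolding vnt_def[of "vint a b F"]
        by (simp add: vint_def)
  next
    case False
    then have "(LINT s|lebesgue_on {a..b}. 0) = (LINT s|lebesgue_on {a..b}. vnt (F s) i)"
      by (intro Bochner_Integration.integral_cong) (auto simp: vnt_def d)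
    then show ?thesis using False d[of a] \<open>a \<le> b\<close> unfolding vnt_def[of "vint a b F"]
        by (simp add: vint_def)
  qed
qed

lemma ent_append_cols: "dim_row A = dim_row B \<Longrightarrow> ent (A @\<^sub>c B) i j
    = (if j < dim_col A then ent A i j else ent B i (j - dim_col A))"
  by (auto simp: ent_def append_cols_def)

lemma ent_append_rows: "dim_col A = dim_col B \<Longrightarrow> ent (A @\<^sub>r B) i j
    = (if i < dim_row A then ent A i j else ent B (i - dim_row A) j)"
  by (auto simp: ent_def append_rows_def)

lemma contm_append_cols:
  assumes F: "contm n m F" and G: "contm n k G" and l: "l = m + k" shows "contm n l (\<lambda>p. F p @\<^sub>c G p)"
proof -
  have d: "dim_row (F p) = n" "dim_row (G p) = n" "dim_col (F p) = m" "dim_col (G p) = k" for p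
    using contmD(1)[OF F, of p] contmD(1)[OF G, of p] by auto
  then have "ent (F p @\<^sub>c G p) i j = (if j < m then ent (F p) i j else ent (G p) i (j - m))" for p i j
    by (simp add: ent_append_cols)
  then have "continuous_on UNIV (\<lambda>p. ent (F p @\<^sub>c G p) i j)" for i j
    using contmD(2)[OF F] contmD(2)[OF G] by (cases "j < m") simp_all
  then show ?thesis using d l by (auto simp: contm_def intro!: carrier_matI)
qed

lemma contm_append_rows:
  assumes F: "contm n m F" and G: "contm k m G" and l: "l = n + k" shows "contm l m (\<lambda>p. F p @\<^sub>r G p)"
proof -
  have d: "dim_row (F p) = n" "dim_row (G p) = k" "dim_col (F p) = m" "dim_col (G p) = m" for p
    using contmD(1)[OF F, of p] contmD(1)[OF G, of p] by auto
  then have "ent (F p @\<^sub>r G p) i j = (if i < n then ent (F p) i j else ent (G p) (i - n) j)" for p i j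
    by (simp add: ent_append_rows)
  then have "continuous_on UNIV (\<lambda>p. ent (F p @\<^sub>r G p) i j)" for i j
    using contmD(2)[OF F] contmD(2)[OF G] by (cases "i < n") simp_all
  then show ?thesis using d l by (auto simp: contm_def intro!: carrier_matI)
qed

lemma L2_vec_append:
  assumes "f \<in> L2_vec A n" "g \<in> L2_vec A m" shows "(\<lambda>s. f s @\<^sub>v g s) \<in> L2_vec A (n + m)"
proof -
  define h where "h = (\<lambda>i s. if i < n then vnt (f s) i else vnt (g s) (i - n))"
  have e: "vnt (f s @\<^sub>v g s) i = h i s" if "s \<in> space (lebesgue_on A)" for s i
    using assms(1) that by (auto simp: L2_vec_def vnt_append h_def)
  have "h i \<in> borel_measurable (lebesgue_on A)" "integrable (lebesgue_on A) (\<lambda>s. (h i s)\<^sup>2)" for i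
    using assms by (cases "i < n"; simp add: L2_vec_iff h_def)+
  moreover have "(\<lambda>s. vnt (f s @\<^sub>v g s) i) \<in> borel_measurable (lebesgue_on A) \<longleftrightarrow> h i
      \<in> borel_measurable (lebesgue_on A)" for i
    by (rule measurable_cong) (rule e)
  moreover have "integrable (lebesgue_on A) (\<lambda>s. (vnt (f s @\<^sub>v g s) i)\<^sup>2) \<longleftrightarrow> integrable
      (lebesgue_on A) (\<lambda>s. (h i s)\<^sup>2)" for i
    by (rule Bochner_Integration.integrable_cong) (simp_all only: e)
  moreover have "f s @\<^sub>v g s \<in> carrier_vec (n + m)" if "s \<in> A" for s
    using assms that by (auto simp: L2_vec_def)
  ultimately show ?thesis unfolding L2_vec_iff[of "\<lambda>s. f s @\<^sub>v g s"] by blast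
qed

lemma integrable_contm_mult_vec:
  assumes F: "contm n q F" and z: "z \<in> L2_vec {a..b} q" and lr: "a \<le> l" "r \<le> b"
  shows "integrable (lebesgue_on {l..r}) (\<lambda>\<theta>. vnt (F \<theta> *\<^sub>v z \<theta>) i)"
proof -
  have e: "vnt (F \<theta> *\<^sub>v z \<theta>) i = (\<Sum>j<q. ent (F \<theta>) i j * vnt (z \<theta>) j)"
      if "\<theta> \<in> space (lebesgue_on {l..r})" for \<theta>
    using that z lr by (intro vnt_mult[OF contmD(1)[OF F]]) (auto simp: L2_vec_def)
  have "integrable (lebesgue_on {l..r}) (\<lambda>\<theta>. ent (F \<theta>) i j * vnt (z \<theta>) j)" for j
  proof -
    have "compact ((\<lambda>\<theta>. ent (F \<theta>) i j) ` {l..r})"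
      by (intro compact_continuous_image continuous_on_subset[OF contmD(2)[OF F]]) auto
    then obtain C where C: "\<forall>\<theta>\<in>{l..r}. \<bar>ent (F \<theta>) i j\<bar> \<le> C"
        by (auto dest!: compact_imp_bounded simp: bounded_iff)
    note zi = L2_vec_nth[OF z lr, of j]
    show ?thesis
    proof (rule Bochner_Integration.integrable_bound)
      show "integrable (lebesgue_on {l..r}) (\<lambda>\<theta>. C * vnt (z \<theta>) j)" using zi by simp
      show "(\<lambda>\<theta>. ent (F \<theta>) i j * vnt (z \<theta>) j) \<in> borel_measurable (lebesgue_on {l..r})"
        by (intro borel_measurable_times borel_measurable_integrable[OF zi]
            continuous_borel_measurable_lebesgue_on contmD(2)[OF F])
      show "AE \<theta> in lebesgue_on {l..r}. norm (ent (F \<theta>) i j * vnt (z \<theta>) j) \<le> norm (C * vnt (z \<theta>) j)"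
      proof (rule AE_I2)
        fix \<theta> assume "\<theta> \<in> space (lebesgue_on {l..r})"
        then have "\<bar>ent (F \<theta>) i j\<bar> \<le> \<bar>C\<bar>" using C by (auto intro: order_trans[OF _ abs_ge_self])
        then show "norm (ent (F \<theta>) i j * vnt (z \<theta>) j) \<le> norm (C * vnt (z \<theta>) j)"
          unfolding real_norm_def abs_mult by (rule mult_right_mono) simp
      qed
    qed
  qed
  then have "integrable (lebesgue_on {l..r}) (\<lambda>\<theta>. \<Sum>j<q. ent (F \<theta>) i j * vnt (z \<theta>) j)" by simp
  then show ?thesis by (rule Bochner_Integration.integrable_cong[THEN iffD2, OF refl, rotated]) (rule e)
qed

text \<open>A constant matrix leaves the integral. The boundary elimination produces a matrix
  applied to an integrated vector, whereas the tuples contain the product inside the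
  integral.\<close>

lemma integral_mult_contm_vec:
  assumes M: "M \<in> carrier_mat n p" and F: "contm p q F" and z: "z \<in> L2_vec {a..b} q"
  shows "(LINT \<theta>|lebesgue_on {a..b}. vnt ((M * F \<theta>) *\<^sub>v z \<theta>) i)
      = vnt (M *\<^sub>v vec p (\<lambda>l. LINT \<theta>|lebesgue_on {a..b}. vnt (F \<theta> *\<^sub>v z \<theta>) l)) i"
proof -
  have "(LINT \<theta>|lebesgue_on {a..b}. vnt ((M * F \<theta>) *\<^sub>v z \<theta>) i)
      = (LINT \<theta>|lebesgue_on {a..b}. (\<Sum>l<p. ent M i l * vnt (F \<theta> *\<^sub>v z \<theta>) l))"
  proof (intro Bochner_Integration.integral_cong refl)
    fix \<theta> assume "\<theta> \<in> space (lebesgue_on {a..b})"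
    then have z': "z \<theta> \<in> carrier_vec q" using z by (auto simp: L2_vec_def)
    have "(M * F \<theta>) *\<^sub>v z \<theta> = M *\<^sub>v (F \<theta> *\<^sub>v z \<theta>)" by (rule assoc_mult_mat_vec[OF M contmD(1)[OF F] z'])
    then show "vnt ((M * F \<theta>) *\<^sub>v z \<theta>) i = (\<Sum>l<p. ent M i l * vnt (F \<theta> *\<^sub>v z \<theta>) l)"
      using vnt_mult[OF M mult_mat_vec_carrier[OF contmD(1)[OF F] z'] order.refl] by simp
  qed
  also have "\<dots> = (\<Sum>l<p. ent M i l * (LINT \<theta>|lebesgue_on {a..b}. vnt (F \<theta> *\<^sub>v z \<theta>) l))"
    using integrable_contm_mult_vec[OF F z] by simp
  also have "\<dots> = vnt (M *\<^sub>v vec p (\<lambda>l. LINT \<theta>|lebesgue_on {a..b}. vnt (F \<theta> *\<^sub>v z \<theta>) l)) i"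
    by (subst vnt_mult[OF M _ order.refl]) (auto simp: vnt_def intro!: sum.cong)
  finally show ?thesis .
qed

context interval_sites begin

lemma site_tail:
  fixes f :: "real \<Rightarrow> real"
  assumes "integrable (lebesgue_on {a..b}) f"
  shows "integrable mu (\<lambda>s. if s \<le> b then f s else c)"
      "(LINT s|mu. (if s \<le> b then f s else c)) = (LINT s|lebesgue_on {a..b}. f s) + c"
proof -
  have i: "integrable (lebesgue_on {a..b}) (\<lambda>s. if s \<le> b then f s else c)"
    "(LINT s|lebesgue_on {a..b}. (if s \<le> b then f s else c)) = (LINT s|lebesgue_on {a..b}. f s)"
    using integral_lebesgue_on_interior_cong[OF assms, of "\<lambda>s. if s \<le> b then f s else c"] by auto
  show "integrable mu (\<lambda>s. if s \<le> b then f s else c)"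
      "(LINT s|mu. (if s \<le> b then f s else c)) = (LINT s|lebesgue_on {a..b}. f s) + c"
    using integral_lebesgue_on_tail[OF _ i(1), of c] i(2) ab by auto
qed

lemma L2_emb:
  assumes "z \<in> L2_vec {a..b} n" shows "L2 (emb x z)"
  unfolding L2_def L2f_def
proof (intro allI conjI)
  fix i
  show "(\<lambda>s. emb x z s i) \<in> borel_measurable mu"
    using site_tail(1)[OF L2_vec_nth[OF assms order.refl order.refl, of i], of "vnt x i"]
        by (simp add: emb_def)
  have "(\<lambda>s. (emb x z s i)\<^sup>2) = (\<lambda>s. if s \<le> b then (vnt (z s) i)\<^sup>2 else (vnt x i)\<^sup>2)"
      by (auto simp: emb_def)
  then show "integrable mu (\<lambda>s. (emb x z s i)\<^sup>2)" using site_tail(1)[of "\<lambda>s. (vnt (z s) i)\<^sup>2"] assms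
      by (simp add: L2_vec_iff)
qed

text \<open>The tail has length one and contributes exactly the scalar product of the vectors, so
  the encoding is isometric.\<close>

lemma ip_emb:
  assumes z: "z \<in> L2_vec {a..b} n" and z': "z' \<in> L2_vec {a..b} n"
      and x: "x \<in> carrier_vec m" "x' \<in> carrier_vec m" and N: "n \<le> N" "m \<le> N"
  shows "ip (emb x z) (emb x' z') = x \<bullet> x' + (LINT s|lebesgue_on {a..b}. z s \<bullet> z' s)"
proof -
  have i: "integrable (lebesgue_on {a..b}) (\<lambda>s. vnt (z s) i * vnt (z' s) i)" for i
    using z z' by (intro integrable_mult_squares) (simp_all add: L2_vec_iff)
  have "(\<lambda>s. emb x z s i * emb x' z' s i)
      = (\<lambda>s. if s \<le> b then vnt (z s) i * vnt (z' s) i else vnt x i * vnt x' i)" for i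
    by (auto simp: emb_def)
  then have "ip (emb x z) (emb x' z')
      = (\<Sum>i<N. (LINT s|lebesgue_on {a..b}. vnt (z s) i * vnt (z' s) i) + vnt x i * vnt x' i)"
    unfolding ip_def using site_tail(2)[OF i] by simp
  also have "\<dots> = (LINT s|lebesgue_on {a..b}. (\<Sum>i<N. vnt (z s) i * vnt (z' s) i))
      + (\<Sum>i<N. vnt x i * vnt x' i)"
    using i by (simp add: sum.distrib)
  also have "(LINT s|lebesgue_on {a..b}. (\<Sum>i<N. vnt (z s) i * vnt (z' s) i))
      = (LINT s|lebesgue_on {a..b}. z s \<bullet> z' s)"
    using z z' N by (intro Bochner_Integration.integral_cong refl)
        (auto simp: L2_vec_def intro!: scalar_prod_vnt[symmetric])
  also have "(\<Sum>i<N. vnt x i * vnt x' i) = x \<bullet> x'" by (rule scalar_prod_vnt[OF x N(2), symmetric])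
  finally show ?thesis by simp
qed

text \<open>Together with the next lemma, the justification of the encoding: on encoded pairs
  \<open>app\<close> is the operator that the tuple represents. Here the function component is
  evaluated, there the finite-dimensional one.\<close>

lemma app_emb_int:
  assumes t: "wft n m r q t" and x: "x \<in> carrier_vec m" and z: "z \<in> L2_vec {a..b} q"
      and N: "m \<le> N" "q \<le> N" and s: "s \<in> {a..b}"
  shows "app t (emb x z) s i = vnt (tQ2 t s *\<^sub>v x) i + vnt (tS t s *\<^sub>v z s) i
    + (LINT \<theta>|lebesgue_on {a..s}. vnt (tR1 t s \<theta> *\<^sub>v z \<theta>) i)
        + (LINT \<theta>|lebesgue_on {s..b}. vnt (tR2 t s \<theta> *\<^sub>v z \<theta>) i)"
proof -
  have z': "z \<theta> \<in> carrier_vec q" if "\<theta> \<in> {a..b}" for \<theta> using z that by (auto simp: L2_vec_def)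
  have int: "integrable mu (\<lambda>\<theta>. sK t s \<theta> i j * emb x z \<theta> j)" for j
    by (rule integrable_kernel_section[OF bker_sK[OF t] L2_emb[OF z]]) (use s in auto)
  define f where "f = (\<lambda>\<theta>. \<Sum>j<N. sK t s \<theta> i j * emb x z \<theta> j)"
  have f1: "f \<theta> = vnt (tR1 t s \<theta> *\<^sub>v z \<theta>) i" if "a < \<theta>" "\<theta> < s" for \<theta>
    using that s z'[of \<theta>] vnt_mult[OF wftD(14)[OF t] z'[of \<theta>] N(2), of s \<theta> i]
        by (simp add: f_def sK_def emb_def)
  have f2: "f \<theta> = vnt (tR2 t s \<theta> *\<^sub>v z \<theta>) i" if "s < \<theta>" "\<theta> < b" for \<theta>
    using that s z'[of \<theta>] vnt_mult[OF wftD(15)[OF t] z'[of \<theta>] N(2), of s \<theta> i]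
        by (simp add: f_def sK_def emb_def)
  have f3: "f \<theta> = vnt (tQ2 t s *\<^sub>v x) i" if "b < \<theta>" for \<theta>
    using that s vnt_mult[OF wftD(12)[OF t] x N(1), of s i] by (simp add: f_def sK_def emb_def)
  have sl: "a \<le> s" "s \<le> b" using s by auto
  note i1 = integral_lebesgue_on_interior_cong[OF
      integrable_contm_mult_vec[OF wftD(7)[OF t] z order.refl sl(2)] f1]
  note i2 = integral_lebesgue_on_interior_cong[OF
      integrable_contm_mult_vec[OF wftD(8)[OF t] z sl(1) order.refl] f2]
  note i12 = integral_lebesgue_on_combine[OF sl i1(1) i2(1)]
  have "app t (emb x z) s i = vnt (tS t s *\<^sub>v z s) i + (LINT \<theta>|mu. f \<theta>)"
    using int s vnt_mult[OF wftD(13)[OF t] z'[OF s] N(2), of s i]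
        by (simp add: app_def op_def sum.distrib sM_def emb_def f_def)
  also have "(LINT \<theta>|mu. f \<theta>) = (LINT \<theta>|lebesgue_on {a..b}. f \<theta>) + vnt (tQ2 t s *\<^sub>v x) i"
    by (rule integral_lebesgue_on_tail(2)[OF _ i12(1)]) (use f3 ab in auto)
  finally show ?thesis using i12(2) i1(2) i2(2) by simp
qed

lemma app_emb_pt:
  assumes t: "wft n m r q t" and x: "x \<in> carrier_vec m" and z: "z \<in> L2_vec {a..b} q"
      and N: "m \<le> N" "q \<le> N" and s: "b < s" "s \<le> b + 1"
  shows "app t (emb x z) s i = vnt (tP t *\<^sub>v x) i
      + (LINT \<theta>|lebesgue_on {a..b}. vnt (tQ1 t \<theta> *\<^sub>v z \<theta>) i)"
proof -
  have z': "z \<theta> \<in> carrier_vec q" if "\<theta> \<in> {a..b}" for \<theta> using z that by (auto simp: L2_vec_def)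
  have int: "integrable mu (\<lambda>\<theta>. sK t s \<theta> i j * emb x z \<theta> j)" for j
    by (rule integrable_kernel_section[OF bker_sK[OF t] L2_emb[OF z]]) (use s ab in auto)
  define f where "f = (\<lambda>\<theta>. \<Sum>j<N. sK t s \<theta> i j * emb x z \<theta> j)"
  have f1: "f \<theta> = vnt (tQ1 t \<theta> *\<^sub>v z \<theta>) i" if "a < \<theta>" "\<theta> < b" for \<theta>
    using that s vnt_mult[OF wftD(11)[OF t] z'[of \<theta>] N(2), of \<theta> i] by (simp add: f_def sK_def emb_def)
  have f3: "f \<theta> = vnt (tP t *\<^sub>v x) i" if "b < \<theta>" for \<theta>
    using that s vnt_mult[OF wftD(1)[OF t] x N(1), of i] by (simp add: f_def sK_def emb_def)
  note i1 = integral_lebesgue_on_interior_cong[OF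
      integrable_contm_mult_vec[OF wftD(2)[OF t] z order.refl order.refl] f1]
  have "app t (emb x z) s i = (LINT \<theta>|mu. f \<theta>)"
    using int s by (simp add: app_def op_def sum.distrib sM_def f_def)
  also have "\<dots> = (LINT \<theta>|lebesgue_on {a..b}. f \<theta>) + vnt (tP t *\<^sub>v x) i"
    by (rule integral_lebesgue_on_tail(2)[OF _ i1(1)]) (use f3 ab in auto)
  finally show ?thesis using i1(2) by simp
qed

end

lemma vnt_uminus_mult:
  assumes "A \<in> carrier_mat n m" "v \<in> carrier_vec m" shows "vnt ((- A) *\<^sub>v v) i = - vnt (A *\<^sub>v v) i"
  unfolding vnt_mult[OF assms order.refl]
      vnt_mult[OF uminus_carrier_mat[OF assms(1)] assms(2) order.refl]
  by (simp add: ent_uminus sum_negf)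

lemma vnt_add_mult:
  assumes "A \<in> carrier_mat n m" "B \<in> carrier_mat n m" "v \<in> carrier_vec m"
  shows "vnt ((A + B) *\<^sub>v v) i = vnt (A *\<^sub>v v) i + vnt (B *\<^sub>v v) i"
  unfolding vnt_mult[OF assms(1,3) order.refl] vnt_mult[OF assms(2,3) order.refl]
    vnt_mult[OF add_carrier_mat[OF assms(2)] assms(3) order.refl]
  by (simp add: ent_add[OF assms(1,2)] distrib_right sum.distrib)

section \<open>The system data and their block matrices\<close>

locale coupled_system =
  fixes D :: ode_pde and N :: nat
  assumes wf: "wf_ode_pde D" and N: "nx D + nw D + ny D + nz D + nbv D \<le> N"
begin

sublocale interval_sites "lo D" "hi D" N
  using wf by unfold_locales (simp add: wf_ode_pde_def)

lemma Ns: "nx D \<le> N" "nw D + nx D \<le> N" "nz D \<le> N" "ny D \<le> N" "n2 D + n3 D \<le> N" "nbv D \<le> N"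
    "nbc D \<le> N" "nw D \<le> N"
  using N by auto

lemma carriers:
  "cA D \<in> carrier_mat (nx D) (nx D)" "cBwo D \<in> carrier_mat (nx D) (nw D)"
  "cC D \<in> carrier_mat (ny D) (nx D)" "cDw D \<in> carrier_mat (ny D) (nw D)"
  "cC1 D \<in> carrier_mat (ny D) (nbv D)" "cE1 D \<in> carrier_mat (nx D) (nbv D)"
  "cB D \<in> carrier_mat (nbc D) (nbv D)"
  "cB1 D \<in> carrier_mat (nbc D) (nx D)" "cB2 D \<in> carrier_mat (nbc D) (nw D)"
  using wf by (auto simp: wf_ode_pde_def)

lemma contm_data:
  "contm (nz D) (nz D) (pA0 D)" "contm (nz D) (n2 D + n3 D) (pA1 D)"
  "contm (nz D) (n3 D) (pA2 D)" "contm (nz D) (nx D) (pE D)" "contm (nz D) (nw D) (pBwp D)"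
  "contm (ny D) (nz D) (pCa D)" "contm (ny D) (n2 D + n3 D) (pCb D)"
  "contm (nx D) (nz D) (pEa D)" "contm (nx D) (n2 D + n3 D) (pEb D)"
  using wf by (auto simp: wf_ode_pde_def intro!: contm_poly_mat1)

lemma Tmat_carrier: "Tmat D \<in> carrier_mat (nbv D) (nbc D)"
  by (rule carrier_matI) (simp_all add: Tmat_def Let_def)

lemma Vmat_carrier: "Vmat D \<in> carrier_mat (n2 D + n3 D) (nbc D)"
  by (rule carrier_matI) (simp_all add: Vmat_def Let_def)

lemma contm_Kmat: "contm (nz D) (nbc D) (Kmat D)"
  unfolding Kmat_def[abs_def] Let_def
  by (rule contm_append_rows contm_append_cols contm_smult contm_const[OF zero_carrier_mat]
      contm_const[OF one_carrier_mat]
      | intro continuous_intros | simp)+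

lemma contm_Nmat: "contm (nbv D) (nz D) (Nmat D)"
  unfolding Nmat_def[abs_def] Let_def
  by (rule contm_append_rows contm_append_cols contm_smult contm_const[OF zero_carrier_mat]
      contm_const[OF one_carrier_mat]
      | intro continuous_intros | simp)+

lemma contm_G0: "contm (nz D) (nz D) (G0 D)"
  unfolding G0_def[abs_def] Let_def
  by (rule contm_append_rows contm_append_cols contm_const[OF zero_carrier_mat]
      contm_const[OF one_carrier_mat] | simp)+

lemma contm_G3: "contm (n2 D + n3 D) (nz D) (G3 D)"
  unfolding G3_def[abs_def] Let_def
  by (rule contm_append_rows contm_append_cols contm_const[OF zero_carrier_mat]
      contm_const[OF one_carrier_mat] | simp)+

text \<open>\<open>mat_inverse\<close> fails only on nonunits of the matrix ring, so invertibility
  of BT is first translated into membership in the units of that ring.\<close>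

lemma BTi: "BTi D \<in> carrier_mat (nbc D) (nbc D)" "BTi D * (cB D * Tmat D) = 1\<^sub>m (nbc D)"
proof -
  have BT: "cB D * Tmat D \<in> carrier_mat (nbc D) (nbc D)" using carriers(7) Tmat_carrier by simp
  have "invertible_mat (cB D * Tmat D)" using wf by (simp add: wf_ode_pde_def)
  then obtain C where C: "inverts_mat (cB D * Tmat D) C" "inverts_mat C (cB D * Tmat D)"
      by (auto simp: invertible_mat_def)
  have Cc: "C \<in> carrier_mat (nbc D) (nbc D)"
    using C BT unfolding inverts_mat_def
    by (metis carrier_matD carrier_matI index_mult_mat(2,3) index_one_mat(2,3))
  then have "cB D * Tmat D \<in> Units (ring_mat TYPE(real) (nbc D) ())"
    using C BT carrier_matD(1)[OF carriers(7)] by (auto simp: Units_def ring_mat_def inverts_mat_def)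
  then obtain C' where "mat_inverse (cB D * Tmat D) = Some C'"
    using mat_inverse(1)[OF BT, of "()"] by (cases "mat_inverse (cB D * Tmat D)") auto
  then show "BTi D \<in> carrier_mat (nbc D) (nbc D)" "BTi D * (cB D * Tmat D) = 1\<^sub>m (nbc D)"
    using mat_inverse(2)[OF BT] by (auto simp: BTi_def mat_inv_def)
qed

lemma B21_carrier: "B21 D \<in> carrier_mat (nbc D) (nw D + nx D)"
  using carriers(8,9) by (intro carrier_matI) (auto simp: B21_def)

lemma contm_H0: "contm (nz D) (nw D + nx D) (H0 D)"
  unfolding H0_def[abs_def]
  by (intro contm_mult[OF contm_mult[OF contm_Kmat contm_const[OF BTi(1)]] contm_const[OF B21_carrier]])

lemma contm_H1: "contm (n2 D + n3 D) (nw D + nx D) (H1 D)"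
  unfolding H1_def[abs_def]
  by (intro contm_mult[OF contm_mult[OF contm_const[OF Vmat_carrier] contm_const[OF BTi(1)]]
      contm_const[OF B21_carrier]])

lemma contm_G2: "contm (nz D) (nz D) (\<lambda>p. G2 D (fst p) (snd p))"
  unfolding G2_def
  by (intro contm_uminus contm_mult[OF
      contm_mult[OF contm_mult[OF contm_comp[OF contm_Kmat] contm_const[OF BTi(1)]]
      contm_const[OF carriers(7)]] contm_comp[OF contm_Nmat]]
     continuous_intros)

lemma contm_G5: "contm (n2 D + n3 D) (nz D) (\<lambda>p. G5 D (fst p) (snd p))"
  unfolding G5_def
  by (intro contm_uminus contm_mult[OF
      contm_mult[OF contm_mult[OF contm_const[OF Vmat_carrier] contm_const[OF BTi(1)]]
      contm_const[OF carriers(7)]] contm_comp[OF contm_Nmat]]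
     continuous_intros)

text \<open>The Volterra kernel that rebuilds z_2 and z_3 from their highest derivatives once the
  left boundary values are known. \<open>G2\<close> carries the correction for expressing those
  values through the boundary conditions.\<close>

definition L1 :: "real \<Rightarrow> real \<Rightarrow> real mat" where
  "L1 s \<theta> = (let j = n1 D; k = n2 D; l = n3 D in
      0\<^sub>m j j @\<^sub>c 0\<^sub>m j k @\<^sub>c 0\<^sub>m j l
    @\<^sub>r 0\<^sub>m k j @\<^sub>c 1\<^sub>m k   @\<^sub>c 0\<^sub>m k l
    @\<^sub>r 0\<^sub>m l j @\<^sub>c 0\<^sub>m l k @\<^sub>c (s - \<theta>) \<cdot>\<^sub>m 1\<^sub>m l)"

text \<open>The same for the stacked first derivatives: only the derivative of z_3 has to be
  integrated up, with constant kernel.\<close>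

definition L4 :: "real \<Rightarrow> real \<Rightarrow> real mat" where
  "L4 s \<theta> = (let j = n1 D; k = n2 D; l = n3 D in
      0\<^sub>m k j @\<^sub>c 0\<^sub>m k k @\<^sub>c 0\<^sub>m k l
    @\<^sub>r 0\<^sub>m l j @\<^sub>c 0\<^sub>m l k @\<^sub>c 1\<^sub>m l)"

lemma G1_eq: "G1 D s \<theta> = L1 s \<theta> + G2 D s \<theta>" and G4_eq: "G4 D s \<theta> = L4 s \<theta> + G5 D s \<theta>"
  by (simp_all add: G1_def G4_def L1_def L4_def Let_def)

lemma contm_L1: "contm (nz D) (nz D) (\<lambda>p. L1 (fst p) (snd p))"
  unfolding L1_def Let_def
  by (rule contm_append_rows contm_append_cols contm_smult contm_const[OF zero_carrier_mat]
      contm_const[OF one_carrier_mat]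
      | intro continuous_intros | simp)+

lemma contm_L4: "contm (n2 D + n3 D) (nz D) (\<lambda>p. L4 (fst p) (snd p))"
  unfolding L4_def Let_def
  by (rule contm_append_rows contm_append_cols contm_const[OF zero_carrier_mat]
      contm_const[OF one_carrier_mat] | simp)+

lemma contm_G1: "contm (nz D) (nz D) (\<lambda>p. G1 D (fst p) (snd p))"
  unfolding G1_eq by (intro contm_add contm_L1 contm_G2)

lemma contm_G4: "contm (n2 D + n3 D) (nz D) (\<lambda>p. G4 D (fst p) (snd p))"
  unfolding G4_eq by (intro contm_add contm_L4 contm_G5)

lemma T1_carrier: "T1 D \<in> carrier_mat (nbv D) (nw D + nx D)"
  unfolding T1_def by (intro mult_carrier_mat[OF mult_carrier_mat[OF Tmat_carrier BTi(1)] B21_carrier])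

lemma contm_T2: "contm (nbv D) (nz D) (T2 D)"
  unfolding T2_def[abs_def]
  by (intro contm_add contm_uminus
      contm_mult[OF contm_const[OF
      mult_carrier_mat[OF mult_carrier_mat[OF Tmat_carrier BTi(1)] carriers(7)]] contm_Nmat] contm_Nmat)

end

text \<open>The situation at one instant: functions of space subject to the boundary conditions,
  with no reference to the dynamics. It is interpreted at almost every time.\<close>

locale boundary_value = coupled_system +
  fixes w x :: "real vec" and z1 z2 z3 z2s z3s z3ss :: "real \<Rightarrow> real vec"
  assumes w: "w \<in> carrier_vec (nw D)" and x: "x \<in> carrier_vec (nx D)"
    and z1: "z1 \<in> L2_vec {lo D..hi D} (n1 D)"
    and z2: "sob_deriv (lo D) (hi D) (n2 D) z2 z2s"
    and z3: "sob_deriv (lo D) (hi D) (n3 D) z3 z3s"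
    and z3s: "sob_deriv (lo D) (hi D) (n3 D) z3s z3ss"
    and bc: "cB D *\<^sub>v (z2 (lo D) @\<^sub>v z2 (hi D) @\<^sub>v z3 (lo D) @\<^sub>v z3 (hi D) @\<^sub>v z3s (lo D) @\<^sub>v z3s
        (hi D))
       = cB1 D *\<^sub>v x + cB2 D *\<^sub>v w"
begin

abbreviation "a \<equiv> lo D"
abbreviation "b \<equiv> hi D"
definition "u = w @\<^sub>v x"
text \<open>The free coordinates: everything differentiated as often as its space permits. No
  boundary condition restricts them.\<close>

definition "zf = (\<lambda>s. z1 s @\<^sub>v z2s s @\<^sub>v z3ss s)"
definition "zp = (\<lambda>s. z1 s @\<^sub>v z2 s @\<^sub>v z3 s)"
definition "zs = (\<lambda>s. z2s s @\<^sub>v z3s s)"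
definition "zb = z2 a @\<^sub>v z2 b @\<^sub>v z3 a @\<^sub>v z3 b @\<^sub>v z3s a @\<^sub>v z3s b"
text \<open>The constants of integration. There are n_2 + 2 n_3 of them, as many as boundary
  conditions, and so BT is square.\<close>

definition "c = z2 a @\<^sub>v z3 a @\<^sub>v z3s a"
text \<open>What the integral remainders contribute to the values at the right end point.\<close>

definition "vI = Matrix.vec (nbv D) (\<lambda>l. LINT \<theta>|lebesgue_on {a..b}. vnt (Nmat D \<theta> *\<^sub>v zf \<theta>) l)"

lemma L2s: "z2 \<in> L2_vec {a..b} (n2 D)" "z2s \<in> L2_vec {a..b} (n2 D)" "z3 \<in> L2_vec {a..b} (n3 D)"
    "z3s \<in> L2_vec {a..b} (n3 D)" "z3ss \<in> L2_vec {a..b} (n3 D)"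
  using z2 z3 z3s by (auto simp: sob_deriv_def)

lemma dims: assumes "s \<in> {a..b}"
  shows "dim_vec (z1 s) = n1 D" "dim_vec (z2 s) = n2 D" "dim_vec (z2s s) = n2 D" "dim_vec (z3 s) = n3 D"
    "dim_vec (z3s s) = n3 D" "dim_vec (z3ss s) = n3 D"
  using z1 L2s assms by (auto simp: L2_vec_def)

lemma ends: "a \<in> {a..b}" "b \<in> {a..b}" using ab by auto

lemma zf: "zf \<in> L2_vec {a..b} (nz D)" and zp: "zp \<in> L2_vec {a..b} (nz D)"
    and zs: "zs \<in> L2_vec {a..b} (n2 D + n3 D)"
  unfolding zf_def zp_def zs_def add.assoc by (intro L2_vec_append z1 L2s)+

lemma zfc: "s \<in> {a..b} \<Longrightarrow> zf s \<in> carrier_vec (nz D)"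
  using zf by (auto simp: L2_vec_def)

lemma uc: "u \<in> carrier_vec (nw D + nx D)" and zbc: "zb \<in> carrier_vec (nbv D)"
    and cc: "c \<in> carrier_vec (nbc D)"
  and vIc: "vI \<in> carrier_vec (nbv D)"
  using w x dims[OF ends(1)] dims[OF ends(2)]
      by (auto simp: u_def zb_def c_def vI_def intro!: carrier_vecI)

lemma N_zf: "\<theta> \<in> {a..b} \<Longrightarrow> Nmat D \<theta> *\<^sub>v zf \<theta>
    = 0\<^sub>v (n2 D) @\<^sub>v z2s \<theta> @\<^sub>v 0\<^sub>v (n3 D) @\<^sub>v ((b - \<theta>) \<cdot>\<^sub>v z3ss \<theta>) @\<^sub>v 0\<^sub>v (n3 D) @\<^sub>v z3ss \<theta>"
  using dims[of \<theta>] by (simp add: Nmat_def Let_def zf_def block_simps)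

lemma T_c: "Tmat D *\<^sub>v c = z2 a @\<^sub>v z2 a @\<^sub>v z3 a @\<^sub>v (z3 a + (b - a) \<cdot>\<^sub>v z3s a) @\<^sub>v z3s a @\<^sub>v z3s a"
  using dims[OF ends(1)] by (simp add: Tmat_def Let_def c_def block_simps)

lemma K_c: "Kmat D s *\<^sub>v c = 0\<^sub>v (n1 D) @\<^sub>v z2 a @\<^sub>v (z3 a + (s - a) \<cdot>\<^sub>v z3s a)"
  using dims[OF ends(1)] by (simp add: Kmat_def Let_def c_def block_simps)

lemma V_c: "Vmat D *\<^sub>v c = 0\<^sub>v (n2 D) @\<^sub>v z3s a"
  using dims[OF ends(1)] by (simp add: Vmat_def Let_def c_def block_simps)

lemma G0_zf: "s \<in> {a..b} \<Longrightarrow> G0 D s *\<^sub>v zf s = z1 s @\<^sub>v 0\<^sub>v (n2 D) @\<^sub>v 0\<^sub>v (n3 D)"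
  using dims[of s] by (simp add: G0_def Let_def zf_def block_simps)

lemma G3_zf: "s \<in> {a..b} \<Longrightarrow> G3 D s *\<^sub>v zf s = z2s s @\<^sub>v 0\<^sub>v (n3 D)"
  using dims[of s] by (simp add: G3_def Let_def zf_def block_simps)

lemma L1_zf: "\<theta> \<in> {a..b} \<Longrightarrow> L1 s \<theta> *\<^sub>v zf \<theta> = 0\<^sub>v (n1 D) @\<^sub>v z2s \<theta> @\<^sub>v ((s - \<theta>) \<cdot>\<^sub>v z3ss \<theta>)"
  using dims[of \<theta>] by (simp add: L1_def Let_def zf_def block_simps)

lemma L4_zf: "\<theta> \<in> {a..b} \<Longrightarrow> L4 s \<theta> *\<^sub>v zf \<theta> = 0\<^sub>v (n2 D) @\<^sub>v z3ss \<theta>"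
  using dims[of \<theta>] by (simp add: L4_def Let_def zf_def block_simps)

lemma vnt_add': "dim_vec v = dim_vec v' \<Longrightarrow> vnt (v + v') i = vnt v i + vnt v' i"
  by (rule vnt_add[where n="dim_vec v"]) (auto intro!: carrier_vecI)

text \<open>Taylor expansion of the right boundary values about the left end point: T carries the
  polynomial part and N the remainders. The rows of N that belong to the left end point are
  0.\<close>

lemma zb_eq: "zb = Tmat D *\<^sub>v c + vI"
proof (rule vnt_eqI[of _ "nbv D"])
  fix i
  have "vnt vI i = (LINT \<theta>|lebesgue_on {a..b}. vnt (Nmat D \<theta> *\<^sub>v zf \<theta>) i)"
  proof (cases "i < nbv D")
    case False
    have "(LINT \<theta>|lebesgue_on {a..b}. vnt (Nmat D \<theta> *\<^sub>v zf \<theta>) i) = (LINT \<theta>|lebesgue_on {a..b}. 0)"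
      using False carrier_matD(1)[OF contmD(1)[OF contm_Nmat]]
          by (intro Bochner_Integration.integral_cong) (auto intro!: vnt_beyond)
    then show ?thesis using False by (simp add: vI_def vnt_beyond)
  qed (simp add: vI_def vnt_def[of "Matrix.vec n f" for n f])
  also have "\<dots> = (LINT \<theta>|lebesgue_on {a..b}. vnt
      (0\<^sub>v (n2 D) @\<^sub>v z2s \<theta> @\<^sub>v 0\<^sub>v (n3 D) @\<^sub>v ((b - \<theta>) \<cdot>\<^sub>v z3ss \<theta>) @\<^sub>v 0\<^sub>v (n3 D) @\<^sub>v z3ss \<theta>) i)"
    using N_zf by (intro Bochner_Integration.integral_cong) auto
  also have "\<dots> = (LINT \<theta>|lebesgue_on {a..b}.
      (if i < n2 D then 0 else if i - n2 D < n2 D then vnt (z2s \<theta>) (i - n2 D)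
     else if i - n2 D - n2 D < n3 D then 0 else if i - n2 D - n2 D - n3 D < n3 D then (b - \<theta>)
         * vnt (z3ss \<theta>) (i - n2 D - n2 D - n3 D)
     else if i - n2 D - n2 D - n3 D
         - n3 D < n3 D then 0 else vnt (z3ss \<theta>) (i - n2 D - n2 D - n3 D - n3 D - n3 D)))"
    using dims by (intro Bochner_Integration.integral_cong) (auto simp: vnt_append vnt_smult)
  finally have vI': "vnt vI i = \<dots>" .
  have "vnt (Tmat D *\<^sub>v c + vI) i = vnt (Tmat D *\<^sub>v c) i + vnt vI i"
    by (rule vnt_add[OF mult_mat_vec_carrier[OF Tmat_carrier cc] vIc])
  then show "vnt zb i = vnt (Tmat D *\<^sub>v c + vI) i"
    using dims[OF ends(1)] dims[OF ends(2)] sob_deriv_increment[OF z2 ends(2)]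
        sob_deriv2_increment[OF z3 z3s ends(2)] sob_deriv_increment[OF z3s ends(2)]
    unfolding T_c vI' zb_def by (simp add: vnt_append vnt_add' vnt_smult)
qed (intro zbc add_carrier_vec mult_mat_vec_carrier[OF Tmat_carrier cc] vIc)+

text \<open>The left boundary values \<open>c\<close> determine \<open>z\<^sub>b\<close> up to integrals of \<open>z\<^sub>f\<close>, so the boundary condition
  is a linear system for \<open>c\<close> with matrix \<open>BT\<close>.\<close>

lemma c_eq: "c = BTi D *\<^sub>v (B21 D *\<^sub>v u - cB D *\<^sub>v vI)"
proof -
  have Tc: "Tmat D *\<^sub>v c \<in> carrier_vec (nbv D)" by (rule mult_mat_vec_carrier[OF Tmat_carrier cc])
  have "B21 D *\<^sub>v u = cB2 D *\<^sub>v w + cB1 D *\<^sub>v x"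
    unfolding B21_def u_def using carriers(8,9) w x by (intro append_cols_mult_vec) auto
  also have "\<dots> = cB1 D *\<^sub>v x + cB2 D *\<^sub>v w"
    by (rule comm_add_vec[of _ "nbc D"])
        (intro mult_mat_vec_carrier[OF carriers(9) w] mult_mat_vec_carrier[OF carriers(8) x])+
  also have "\<dots> = cB D *\<^sub>v (Tmat D *\<^sub>v c + vI)" using bc unfolding zb_eq[symmetric] by (simp add: zb_def)
  also have "\<dots> = cB D *\<^sub>v (Tmat D *\<^sub>v c) + cB D *\<^sub>v vI"
    by (rule mult_add_distrib_mat_vec[OF carriers(7) Tc vIc])
  finally have "B21 D *\<^sub>v u - cB D *\<^sub>v vI = cB D *\<^sub>v (Tmat D *\<^sub>v c)"
    using mult_mat_vec_carrier[OF carriers(7) Tc] mult_mat_vec_carrier[OF carriers(7) vIc]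
        by (auto intro!: eq_vecI)
  then have "BTi D *\<^sub>v (B21 D *\<^sub>v u - cB D *\<^sub>v vI) = BTi D *\<^sub>v ((cB D * Tmat D) *\<^sub>v c)"
    using assoc_mult_mat_vec[OF carriers(7) Tmat_carrier cc] by simp
  also have "\<dots> = (BTi D * (cB D * Tmat D)) *\<^sub>v c"
    by (rule assoc_mult_mat_vec[OF BTi(1) mult_carrier_mat[OF carriers(7) Tmat_carrier] cc, symmetric])
  also have "\<dots> = c" using BTi(2) cc by simp
  finally show ?thesis by simp
qed

text \<open>The constants of integration enter the state, its derivatives and the boundary values
  through M = K(s), V and T. Eliminating them once for a general M produces the pairs H_0 and G_2,
  H_1 and G_5, T_1 and the first summand of T_2.\<close>

lemma M_c:
  assumes M: "M \<in> carrier_mat p (nbc D)"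
  shows "vnt (M *\<^sub>v c) i = vnt ((M * BTi D * B21 D) *\<^sub>v u) i
      - (LINT \<theta>|lebesgue_on {a..b}. vnt ((M * BTi D * cB D * Nmat D \<theta>) *\<^sub>v zf \<theta>) i)"
proof -
  have Bu: "B21 D *\<^sub>v u \<in> carrier_vec (nbc D)" and BvI: "cB D *\<^sub>v vI \<in> carrier_vec (nbc D)"
    by (rule mult_mat_vec_carrier[OF B21_carrier uc] mult_mat_vec_carrier[OF carriers(7) vIc])+
  have MB: "M * BTi D \<in> carrier_mat p (nbc D)" using M BTi(1) by simp
  have "M *\<^sub>v c = M *\<^sub>v (BTi D *\<^sub>v (B21 D *\<^sub>v u - cB D *\<^sub>v vI))" using c_eq by simp
  also have "\<dots> = (M * BTi D) *\<^sub>v (B21 D *\<^sub>v u - cB D *\<^sub>v vI)"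
    by (rule assoc_mult_mat_vec[symmetric, OF M BTi(1)]) (use Bu BvI in auto)
  also have "\<dots> = (M * BTi D) *\<^sub>v (B21 D *\<^sub>v u) - (M * BTi D) *\<^sub>v (cB D *\<^sub>v vI)"
    by (rule mult_minus_distrib_mat_vec[OF MB Bu BvI])
  also have "(M * BTi D) *\<^sub>v (B21 D *\<^sub>v u) = (M * BTi D * B21 D) *\<^sub>v u"
    by (rule assoc_mult_mat_vec[symmetric, OF MB B21_carrier uc])
  also have "(M * BTi D) *\<^sub>v (cB D *\<^sub>v vI) = (M * BTi D * cB D) *\<^sub>v vI"
    by (rule assoc_mult_mat_vec[symmetric, OF MB carriers(7) vIc])
  finally have "vnt (M *\<^sub>v c) i = vnt ((M * BTi D * B21 D) *\<^sub>v u) i - vnt ((M * BTi D * cB D) *\<^sub>v vI) i"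
    using vnt_minus[OF mult_mat_vec_carrier[OF mult_carrier_mat[OF MB B21_carrier] uc]
        mult_mat_vec_carrier[OF mult_carrier_mat[OF MB carriers(7)] vIc]] by simp
  then show ?thesis
    unfolding integral_mult_contm_vec[OF mult_carrier_mat[OF MB carriers(7)] contm_Nmat zf] vI_def
        by simp
qed

text \<open>The second kernel is common to both triangles. Its integrals over [a,s] and [s,b]
  combine to one over [a,b], which together with the term in u is M c; the Volterra part L remains
  on the first triangle.\<close>

lemma app_transform:
  assumes t: "wft n (nw D + nx D) p (nz D) t" and s: "s \<in> {a..b}"
    and M: "M \<in> carrier_mat p (nbc D)" and Q2: "tQ2 t s = M * BTi D * B21 D"
    and L: "contm p (nz D) L" and R1: "\<And>\<theta>. tR1 t s \<theta> = L \<theta> + tR2 t s \<theta>"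
    and R2: "\<And>\<theta>. tR2 t s \<theta> = - (M * BTi D * cB D * Nmat D \<theta>)"
  shows "app t (emb u zf) s i = vnt (M *\<^sub>v c) i + vnt (tS t s *\<^sub>v zf s) i
      + (LINT \<theta>|lebesgue_on {a..s}. vnt (L \<theta> *\<^sub>v zf \<theta>) i)"
proof -
  have sl: "a \<le> s" "s \<le> b" using s by auto
  have MBc: "M * BTi D * cB D * Nmat D \<theta> \<in> carrier_mat p (nz D)" for \<theta>
    by (intro mult_carrier_mat[OF mult_carrier_mat[OF mult_carrier_mat[OF M BTi(1)] carriers(7)]
        contmD(1)[OF contm_Nmat]])
  have iL: "integrable (lebesgue_on {a..s}) (\<lambda>\<theta>. vnt (L \<theta> *\<^sub>v zf \<theta>) i)"
    by (rule integrable_contm_mult_vec[OF L zf order.refl sl(2)])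
  have iR: "integrable (lebesgue_on {a..s}) (\<lambda>\<theta>. vnt (tR2 t s \<theta> *\<^sub>v zf \<theta>) i)"
      "integrable (lebesgue_on {s..b}) (\<lambda>\<theta>. vnt (tR2 t s \<theta> *\<^sub>v zf \<theta>) i)"
    by (rule integrable_contm_mult_vec[OF wftD(8)[OF t] zf]; use sl in simp)+
  have "(LINT \<theta>|lebesgue_on {a..s}. vnt (tR1 t s \<theta> *\<^sub>v zf \<theta>) i)
      = (LINT \<theta>|lebesgue_on {a..s}. vnt (L \<theta> *\<^sub>v zf \<theta>) i + vnt (tR2 t s \<theta> *\<^sub>v zf \<theta>) i)"
    unfolding R1 using s zfc by
        (intro Bochner_Integration.integral_cong refl
        vnt_add_mult[OF contmD(1)[OF L] wftD(15)[OF t]]) auto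
  also have "\<dots> = (LINT \<theta>|lebesgue_on {a..s}. vnt (L \<theta> *\<^sub>v zf \<theta>) i)
      + (LINT \<theta>|lebesgue_on {a..s}. vnt (tR2 t s \<theta> *\<^sub>v zf \<theta>) i)"
    using iL iR by simp
  finally have e1: "(LINT \<theta>|lebesgue_on {a..s}. vnt (tR1 t s \<theta> *\<^sub>v zf \<theta>) i) = \<dots>" .
  have e2: "(LINT \<theta>|lebesgue_on {a..s}. vnt (tR2 t s \<theta> *\<^sub>v zf \<theta>) i)
      + (LINT \<theta>|lebesgue_on {s..b}. vnt (tR2 t s \<theta> *\<^sub>v zf \<theta>) i)
    = (LINT \<theta>|lebesgue_on {a..b}. vnt (tR2 t s \<theta> *\<^sub>v zf \<theta>) i)"
    using integral_lebesgue_on_combine(2)[OF sl iR] by simp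
  have "(LINT \<theta>|lebesgue_on {a..b}. vnt (tR2 t s \<theta> *\<^sub>v zf \<theta>) i)
      = (LINT \<theta>|lebesgue_on {a..b}. - vnt ((M * BTi D * cB D * Nmat D \<theta>) *\<^sub>v zf \<theta>) i)"
    unfolding R2 using zfc by (intro Bochner_Integration.integral_cong refl vnt_uminus_mult[OF MBc])
        auto
  then have e3: "(LINT \<theta>|lebesgue_on {a..b}. vnt (tR2 t s \<theta> *\<^sub>v zf \<theta>) i) =
      - (LINT \<theta>|lebesgue_on {a..b}. vnt ((M * BTi D * cB D * Nmat D \<theta>) *\<^sub>v zf \<theta>) i)"
    by simp
  show ?thesis
    using app_emb_int[OF t uc zf Ns(2,3) s, of i] e1 e2 e3 M_c[OF M, of i] unfolding Q2 by simp
qed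

end

lemma integral_zero_mat_mult:
  assumes "z \<in> L2_vec {a..b} q" "a \<le> l" "r \<le> b"
  shows "(LINT \<theta>|lebesgue_on {l..r}. vnt (0\<^sub>m n q *\<^sub>v z \<theta>) i) = 0"
proof -
  have d: "dim_vec (z \<theta>) = q" if "\<theta> \<in> {l..r}" for \<theta> using assms that by (auto simp: L2_vec_def)
  have "(LINT \<theta>|lebesgue_on {l..r}. vnt (0\<^sub>m n q *\<^sub>v z \<theta>) i) = (LINT \<theta>|lebesgue_on {l..r}. 0)"
    by (intro Bochner_Integration.integral_cong) (auto simp: zero_mat_mult_vec d)
  then show ?thesis by simp
qed

lemma L2_vec_zero: "(\<lambda>_. 0\<^sub>v n) \<in> L2_vec A n"
  by (auto simp: L2_vec_def)

lemma vnt_zero_mat_mult: "dim_vec v = m \<Longrightarrow> vnt (0\<^sub>m n m *\<^sub>v v) i = 0"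
  by (simp add: zero_mat_mult_vec)

section \<open>Dimensions of the tuples built from the system data\<close>

context coupled_system begin

text \<open>\<open>tX\<close> is the operator \<T> that reconstructs (x, z_p) from U.
  \<open>tH0\<close> keeps only z_p, \<open>tH1\<close> gives the stacked first derivatives and
  \<open>tT\<close> the boundary values.\<close>

definition "tX = PQRS (I1 D) (zmat1 (nx D) (nz D)) (H0 D) (G0 D) (G1 D) (G2 D)"
definition "tH0 = PQRS (0\<^sub>m 0 (nw D + nx D)) (zmat1 0 (nz D)) (H0 D) (G0 D) (G1 D) (G2 D)"
definition "tH1 = PQRS (0\<^sub>m 0 (nw D + nx D)) (zmat1 0 (nz D)) (H1 D) (G3 D) (G4 D) (G5 D)"
definition "tT = PQRS (T1 D) (T2 D) (zmat1 0 (nw D + nx D)) (zmat1 0 (nz D)) (zmat2 0 (nz D))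
    (zmat2 0 (nz D))"

lemma I1_carrier: "I1 D \<in> carrier_mat (nx D) (nw D + nx D)"
    and I0_carrier: "I0 D \<in> carrier_mat (nw D) (nw D + nx D)"
  by (auto simp: I1_def I0_def intro!: carrier_matI)

lemma hatB0_carrier: "hatB0 D \<in> carrier_mat (nx D) (nw D + nx D)"
    and hatD0_carrier: "hatD0 D \<in> carrier_mat (ny D) (nw D + nx D)"
  using carriers(2,4) by (auto simp: hatB0_def hatD0_def intro!: carrier_matI)

lemma contm_hatB2: "contm (nz D) (nw D + nx D) (hatB2 D)"
  unfolding hatB2_def[abs_def]
      by (rule contm_append_cols[OF contm_data(5) contm_const[OF zero_carrier_mat]]) simp

lemmas contm_zero = contm_const[OF zero_carrier_mat]

lemma wft_tX: "wft (nx D) (nw D + nx D) (nz D) (nz D) tX"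
  unfolding tX_def by (intro wft_pqrsI I1_carrier contm_zero contm_H0 contm_G0 contm_G1 contm_G2)

lemma wft_tH0: "wft 0 (nw D + nx D) (nz D) (nz D) tH0"
  unfolding tH0_def by (intro wft_pqrsI zero_carrier_mat contm_zero contm_H0 contm_G0 contm_G1 contm_G2)

lemma wft_tH1: "wft 0 (nw D + nx D) (n2 D + n3 D) (nz D) tH1"
  unfolding tH1_def by (intro wft_pqrsI zero_carrier_mat contm_zero contm_H1 contm_G3 contm_G4 contm_G5)

lemma wft_tT: "wft (nbv D) (nw D + nx D) 0 (nz D) tT"
  unfolding tT_def by (intro wft_pqrsI T1_carrier contm_T2 contm_zero)

definition "A_z = PQRS (0\<^sub>m (nx D) 0) (pEa D) (zmat1 (nz D) 0) (pA0 D) (zmat2 (nz D) (nz D))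
    (zmat2 (nz D) (nz D))"
definition "A_zs = PQRS (0\<^sub>m (nx D) 0) (pEb D) (zmat1 (nz D) 0) (pA1 D) (zmat2 (nz D) (n2 D + n3 D))
    (zmat2 (nz D) (n2 D + n3 D))"
definition "A_zb = PQRS (cE1 D) (zmat1 (nx D) 0) (zmat1 (nz D) (nbv D)) (zmat1 (nz D) 0)
    (zmat2 (nz D) 0) (zmat2 (nz D) 0)"
definition "A_u = PQRS (0\<^sub>m (nx D) (nw D) @\<^sub>c cA D) (zmat1 (nx D) (nz D))
    (\<lambda>s. 0\<^sub>m (nz D) (nw D) @\<^sub>c pE D s)
       (\<lambda>s. 0\<^sub>m (nz D) (n1 D) @\<^sub>c 0\<^sub>m (nz D) (n2 D) @\<^sub>c pA2 D s) (zmat2 (nz D) (nz D))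
           (zmat2 (nz D) (nz D))"
definition "C_z = PQRS (0\<^sub>m (ny D) 0) (pCa D) (zmat1 0 0) (zmat1 0 (nz D)) (zmat2 0 (nz D))
    (zmat2 0 (nz D))"
definition "C_zs = PQRS (0\<^sub>m (ny D) 0) (pCb D) (zmat1 0 0) (zmat1 0 (n2 D + n3 D))
    (zmat2 0 (n2 D + n3 D)) (zmat2 0 (n2 D + n3 D))"
definition "C_zb = PQRS (cC1 D) (zmat1 (ny D) 0) (zmat1 0 (nbv D)) (zmat1 0 0) (zmat2 0 0) (zmat2 0 0)"
definition "C_u = PQRS (0\<^sub>m (ny D) (nw D) @\<^sub>c cC D) (zmat1 (ny D) (nz D)) (zmat1 0 (nw D + nx D))
    (zmat1 0 (nz D)) (zmat2 0 (nz D)) (zmat2 0 (nz D))"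

lemma hatA_eq: "hatA D = pqrs_comp (lo D) (hi D) A_z tH0 \<oplus>\<^sub>p pqrs_comp (lo D) (hi D) A_zs tH1 \<oplus>\<^sub>p
    pqrs_comp (lo D) (hi D) A_zb tT \<oplus>\<^sub>p A_u"
  by (simp only: hatA_def Let_def A_z_def A_zs_def A_zb_def A_u_def tH0_def tH1_def tT_def)

lemma hatC_eq: "hatC D = pqrs_comp (lo D) (hi D) C_z tH0 \<oplus>\<^sub>p pqrs_comp (lo D) (hi D) C_zs tH1 \<oplus>\<^sub>p
    pqrs_comp (lo D) (hi D) C_zb tT \<oplus>\<^sub>p C_u"
  by (simp only: hatC_def Let_def C_z_def C_zs_def C_zb_def C_u_def tH0_def tH1_def tT_def)

lemma wft_A: "wft (nx D) 0 (nz D) (nz D) A_z" "wft (nx D) 0 (nz D) (n2 D + n3 D) A_zs"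
    "wft (nx D) (nbv D) (nz D) 0 A_zb"
  "wft (nx D) (nw D + nx D) (nz D) (nz D) A_u"
proof -
  show "wft (nx D) 0 (nz D) (nz D) A_z" "wft (nx D) 0 (nz D) (n2 D + n3 D) A_zs"
      "wft (nx D) (nbv D) (nz D) 0 A_zb"
    unfolding A_z_def A_zs_def A_zb_def
        by (intro wft_pqrsI zero_carrier_mat carriers contm_data contm_zero)+
  show "wft (nx D) (nw D + nx D) (nz D) (nz D) A_u"
    unfolding A_u_def
  proof (intro wft_pqrsI contm_zero)
    show "0\<^sub>m (nx D) (nw D) @\<^sub>c cA D \<in> carrier_mat (nx D) (nw D + nx D)" using carriers(1)
        by (intro carrier_matI) auto
    show "contm (nz D) (nw D + nx D) (\<lambda>s. 0\<^sub>m (nz D) (nw D) @\<^sub>c pE D s)"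
      by (rule contm_append_cols[OF contm_zero contm_data(4) refl])
    show "contm (nz D) (nz D) (\<lambda>s. 0\<^sub>m (nz D) (n1 D) @\<^sub>c 0\<^sub>m (nz D) (n2 D) @\<^sub>c pA2 D s)"
      by (rule contm_append_cols[OF contm_zero contm_append_cols[OF contm_zero contm_data(3) refl]])
          simp
  qed
qed

lemma wft_C: "wft (ny D) 0 0 (nz D) C_z" "wft (ny D) 0 0 (n2 D + n3 D) C_zs"
    "wft (ny D) (nbv D) 0 0 C_zb"
  "wft (ny D) (nw D + nx D) 0 (nz D) C_u"
proof -
  show "wft (ny D) 0 0 (nz D) C_z" "wft (ny D) 0 0 (n2 D + n3 D) C_zs" "wft (ny D) (nbv D) 0 0 C_zb"
    unfolding C_z_def C_zs_def C_zb_def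
        by (intro wft_pqrsI zero_carrier_mat carriers contm_data contm_zero)+
  show "wft (ny D) (nw D + nx D) 0 (nz D) C_u"
    unfolding C_u_def
  proof (intro wft_pqrsI contm_zero)
    show "0\<^sub>m (ny D) (nw D) @\<^sub>c cC D \<in> carrier_mat (ny D) (nw D + nx D)" using carriers(3)
        by (intro carrier_matI) auto
  qed
qed

lemma wft_hatA: "wft (nx D) (nw D + nx D) (nz D) (nz D) (hatA D)"
  unfolding hatA_eq by (intro wft_add wft_comp[OF wft_A(1) wft_tH0] wft_comp[OF wft_A(2) wft_tH1]
      wft_comp[OF wft_A(3) wft_tT] wft_A(4))

lemma wft_hatC: "wft (ny D) (nw D + nx D) 0 (nz D) (hatC D)"
  unfolding hatC_eq by (intro wft_add wft_comp[OF wft_C(1) wft_tH0] wft_comp[OF wft_C(2) wft_tH1]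
      wft_comp[OF wft_C(3) wft_tT] wft_C(4))

definition "tA = PQRS (hatA0 D + hatB0 D) (hatA1 D) (\<lambda>s. hatA2 D s + hatB2 D s) (hatA3 D) (hatA4 D)
    (hatA5 D)"
text \<open>The output is a vector, so the function component of the range has dimension 0.\<close>

definition "tC = PQRS (hatC0 D + hatD0 D) (hatC1 D) (zmat1 0 (nw D + nx D)) (zmat1 0 (nz D))
    (zmat2 0 (nz D)) (zmat2 0 (nz D))"

lemma wft_tA: "wft (nx D) (nw D + nx D) (nz D) (nz D) tA"
  unfolding tA_def
  by (intro wft_pqrsI add_carrier_mat hatB0_carrier wftD(2-6)[OF wft_hatA]
      contm_add[OF wftD(3)[OF wft_hatA] contm_hatB2])

lemma wft_tC: "wft (ny D) (nw D + nx D) 0 (nz D) tC"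
  unfolding tC_def by (intro wft_pqrsI add_carrier_mat hatD0_carrier wftD(2)[OF wft_hatC] contm_zero)

end

section \<open>Values of the tuples at the coordinates U of a fixed time\<close>

context boundary_value begin

text \<open>Taylor's formula in block form: constants of integration, the component z_1 that is not
  differentiated, and the integral remainders.\<close>

lemma zp_eq:
  assumes s: "s \<in> {a..b}"
  shows "vnt (Kmat D s *\<^sub>v c) i + vnt (G0 D s *\<^sub>v zf s) i
      + (LINT \<theta>|lebesgue_on {a..s}. vnt (L1 s \<theta> *\<^sub>v zf \<theta>) i) = vnt (zp s) i"
proof -
  have "(LINT \<theta>|lebesgue_on {a..s}. vnt (L1 s \<theta> *\<^sub>v zf \<theta>) i)
      = (LINT \<theta>|lebesgue_on {a..s}.
      (if i < n1 D then 0 else if i - n1 D < n2 D then vnt (z2s \<theta>) (i - n1 D)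
     else (s - \<theta>) * vnt (z3ss \<theta>) (i - n1 D - n2 D)))"
    using L1_zf dims s by (intro Bochner_Integration.integral_cong) (auto simp: vnt_append vnt_smult)
  then show ?thesis
    using dims[OF ends(1)] dims[OF s] sob_deriv_increment[OF z2 s] sob_deriv2_increment[OF z3 z3s s]
    unfolding K_c G0_zf[OF s] zp_def by (simp add: vnt_append vnt_add' vnt_smult)
qed

lemma zs_eq:
  assumes s: "s \<in> {a..b}"
  shows "vnt (Vmat D *\<^sub>v c) i + vnt (G3 D s *\<^sub>v zf s) i
      + (LINT \<theta>|lebesgue_on {a..s}. vnt (L4 s \<theta> *\<^sub>v zf \<theta>) i) = vnt (zs s) i"
proof -
  have "(LINT \<theta>|lebesgue_on {a..s}. vnt (L4 s \<theta> *\<^sub>v zf \<theta>) i)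
      = (LINT \<theta>|lebesgue_on {a..s}. (if i < n2 D then 0 else vnt (z3ss \<theta>) (i - n2 D)))"
    using L4_zf dims s by (intro Bochner_Integration.integral_cong) (auto simp: vnt_append vnt_smult)
  then show ?thesis
    using dims[OF ends(1)] dims[OF s] sob_deriv_increment[OF z3s s]
    unfolding V_c G3_zf[OF s] zs_def by (simp add: vnt_append vnt_add' vnt_smult)
qed

lemma I1_u: "I1 D *\<^sub>v u = x" and I0_u: "I0 D *\<^sub>v u = w"
  using w x by (auto simp: I1_def I0_def u_def block_simps)

text \<open>Stated for every tuple with these function entries, because \<open>tX\<close> and
  \<open>tH0\<close> differ only in their finite-dimensional row.\<close>

lemma app_tX_int:
  assumes "wft n (nw D + nx D) (nz D) (nz D) t" "tQ2 t = H0 D" "tS t = G0 D" "tR1 t = G1 D"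
      "tR2 t = G2 D" and s: "s \<in> {a..b}"
  shows "app t (emb u zf) s i = vnt (zp s) i"
proof -
  have "app t (emb u zf) s i = vnt (Kmat D s *\<^sub>v c) i + vnt (tS t s *\<^sub>v zf s) i
      + (LINT \<theta>|lebesgue_on {a..s}. vnt (L1 s \<theta> *\<^sub>v zf \<theta>) i)"
  proof (rule app_transform[OF assms(1) s contmD(1)[OF contm_Kmat]])
    show "contm (nz D) (nz D) (L1 s)" by (rule contm_comp2[OF contm_L1]) (intro continuous_intros)+
  qed (simp_all add: assms H0_def G1_eq G2_def)
  then show ?thesis using zp_eq[OF s, of i] by (simp add: assms)
qed

lemma app_tX:
  assumes s: "s \<in> {a..b+1}" shows "app tX (emb u zf) s i = emb x zp s i"
proof (cases "s \<le> b")
  case True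
  then show ?thesis using app_tX_int[OF wft_tX, of s i] s by (simp add: tX_def emb_def)
next
  case False
  then show ?thesis
    using app_emb_pt[OF wft_tX uc zf Ns(2,3), of s i] s
        integral_zero_mat_mult[OF zf order.refl order.refl, of "nx D" i]
    by (simp add: emb_def tX_def I1_u)
qed

lemma app_tH0:
  assumes s: "s \<in> {a..b+1}" shows "app tH0 (emb u zf) s i = emb (0\<^sub>v 0) zp s i"
proof (cases "s \<le> b")
  case True
  then show ?thesis using app_tX_int[OF wft_tH0, of s i] s by (simp add: tH0_def emb_def)
next
  case False
  then show ?thesis
    using app_emb_pt[OF wft_tH0 uc zf Ns(2,3), of s i] s
        integral_zero_mat_mult[OF zf order.refl order.refl, of 0 i]
    by (simp add: emb_def tH0_def vnt_dim_zero)
qed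

lemma app_tH1:
  assumes s: "s \<in> {a..b+1}" shows "app tH1 (emb u zf) s i = emb (0\<^sub>v 0) zs s i"
proof (cases "s \<le> b")
  case True
  then have s': "s \<in> {a..b}" using s by simp
  have "app tH1 (emb u zf) s i = vnt (Vmat D *\<^sub>v c) i + vnt (tS tH1 s *\<^sub>v zf s) i
      + (LINT \<theta>|lebesgue_on {a..s}. vnt (L4 s \<theta> *\<^sub>v zf \<theta>) i)"
  proof (rule app_transform[OF wft_tH1 s' Vmat_carrier])
    show "contm (n2 D + n3 D) (nz D) (L4 s)"
        by (rule contm_comp2[OF contm_L4]) (intro continuous_intros)+
  qed (simp_all add: tH1_def H1_def G4_eq G5_def)
  then show ?thesis using zs_eq[OF s', of i] True by (simp add: tH1_def emb_def)
next
  case False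
  then show ?thesis
    using app_emb_pt[OF wft_tH1 uc zf Ns(2,3), of s i] s
        integral_zero_mat_mult[OF zf order.refl order.refl, of 0 i]
    by (simp add: emb_def tH1_def vnt_dim_zero)
qed

lemma app_no_int:
  assumes t: "wft n m 0 q t" and y: "y \<in> carrier_vec m" and z: "z \<in> L2_vec {a..b} q"
      and N: "m \<le> N" "q \<le> N" and s: "s \<in> {a..b}"
  shows "app t (emb y z) s i = 0"
  using app_emb_int[OF t y z N s, of i] carrier_matD(1)[OF wftD(12)[OF t]]
      carrier_matD(1)[OF wftD(13)[OF t]]
    carrier_matD(1)[OF wftD(14)[OF t]] carrier_matD(1)[OF wftD(15)[OF t]] by (simp add: vnt_dim_zero)

text \<open>The first summand of T_2 comes from the elimination of c and the second restores the
  remainders \<open>vI\<close>, which gives z_b = T c + vI.\<close>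

lemma app_tT:
  assumes s: "s \<in> {a..b+1}" shows "app tT (emb u zf) s i = emb zb (\<lambda>_. 0\<^sub>v 0) s i"
proof (cases "s \<le> b")
  case True
  then show ?thesis using app_no_int[OF wft_tT uc zf Ns(2,3), of s i] s
      by (simp add: emb_def vnt_dim_zero)
next
  case False
  have MB: "Tmat D * BTi D * cB D \<in> carrier_mat (nbv D) (nbv D)"
      by (intro mult_carrier_mat[OF mult_carrier_mat[OF Tmat_carrier BTi(1)] carriers(7)])
  have MBN: "contm (nbv D) (nz D) (\<lambda>\<theta>. Tmat D * BTi D * cB D * Nmat D \<theta>)"
      by (rule contm_mult[OF contm_const[OF MB] contm_Nmat])
  have i1: "integrable (lebesgue_on {a..b}) (\<lambda>\<theta>. vnt ((Tmat D * BTi D * cB D * Nmat D \<theta>) *\<^sub>v zf \<theta>) i)"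
    "integrable (lebesgue_on {a..b}) (\<lambda>\<theta>. vnt (Nmat D \<theta> *\<^sub>v zf \<theta>) i)"
    by (rule integrable_contm_mult_vec[OF MBN zf order.refl order.refl]
        integrable_contm_mult_vec[OF contm_Nmat zf order.refl order.refl])+
  have "(LINT \<theta>|lebesgue_on {a..b}. vnt (T2 D \<theta> *\<^sub>v zf \<theta>) i)
     = (LINT \<theta>|lebesgue_on {a..b}. - vnt ((Tmat D * BTi D * cB D * Nmat D \<theta>) *\<^sub>v zf \<theta>) i
         + vnt (Nmat D \<theta> *\<^sub>v zf \<theta>) i)"
  proof (intro Bochner_Integration.integral_cong refl)
    fix \<theta> assume "\<theta> \<in> space (lebesgue_on {a..b})"
    then have z: "zf \<theta> \<in> carrier_vec (nz D)" using zfc by simp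
    show "vnt (T2 D \<theta> *\<^sub>v zf \<theta>) i = - vnt ((Tmat D * BTi D * cB D * Nmat D \<theta>) *\<^sub>v zf \<theta>) i
        + vnt (Nmat D \<theta> *\<^sub>v zf \<theta>) i"
      unfolding T2_def vnt_add_mult[OF uminus_carrier_mat[OF contmD(1)[OF MBN]]
          contmD(1)[OF contm_Nmat] z]
        vnt_uminus_mult[OF contmD(1)[OF MBN] z] by simp
  qed
  also have "\<dots> = - (LINT \<theta>|lebesgue_on {a..b}. vnt ((Tmat D * BTi D * cB D * Nmat D \<theta>) *\<^sub>v zf \<theta>) i)
      + (LINT \<theta>|lebesgue_on {a..b}. vnt (Nmat D \<theta> *\<^sub>v zf \<theta>) i)"
    using i1 by simp
  finally have e: "(LINT \<theta>|lebesgue_on {a..b}. vnt (T2 D \<theta> *\<^sub>v zf \<theta>) i) = \<dots>" .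
  have "vnt zb i = vnt (Tmat D *\<^sub>v c) i + vnt vI i"
    unfolding zb_eq by (rule vnt_add[OF mult_mat_vec_carrier[OF Tmat_carrier cc] vIc])
  also have "vnt vI i = (LINT \<theta>|lebesgue_on {a..b}. vnt (Nmat D \<theta> *\<^sub>v zf \<theta>) i)"
    using integral_mult_contm_vec[OF one_carrier_mat contm_Nmat zf, of i]
        left_mult_one_mat[OF contmD(1)[OF contm_Nmat]] vIc
    unfolding vI_def[symmetric] by (simp add: one_mult_mat_vec[OF vIc])
  finally show ?thesis
    using app_emb_pt[OF wft_tT uc zf Ns(2,3), of s i] s False M_c[OF Tmat_carrier, of i] e
        by (simp add: tT_def emb_def T1_def)
qed

text \<open>The right-hand sides of the equations as explicit representatives. For a solution the
  derivative of z_p equals \<open>zd\<close> almost everywhere in s only.\<close>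

definition "xd = cA D *\<^sub>v x + pde_output a b (cE1 D) (pEa D) (pEb D) zb zp zs + cBwo D *\<^sub>v w"
definition "zd = (\<lambda>s. pA0 D s *\<^sub>v zp s + pA1 D s *\<^sub>v zs s + pA2 D s *\<^sub>v z3ss s + pE D s *\<^sub>v x
    + pBwp D s *\<^sub>v w)"
definition "y = cC D *\<^sub>v x + pde_output a b (cC1 D) (pCa D) (pCb D) zb zp zs + cDw D *\<^sub>v w"

lemma vnt_pde_output:
  assumes F: "F1 \<in> carrier_mat p (nbv D)" "contm p (nz D) Fa" "contm p (n2 D + n3 D) Fb"
  shows "pde_output a b F1 Fa Fb zb zp zs \<in> carrier_vec p"
    "vnt (pde_output a b F1 Fa Fb zb zp zs) i = vnt (F1 *\<^sub>v zb) i
        + (LINT s|lebesgue_on {a..b}. vnt (Fa s *\<^sub>v zp s) i)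
      + (LINT s|lebesgue_on {a..b}. vnt (Fb s *\<^sub>v zs s) i)"
proof -
  have c: "Fa s *\<^sub>v zp s \<in> carrier_vec p" "Fb s *\<^sub>v zs s \<in> carrier_vec p" if "s \<in> {a..b}" for s
    using zp zs that by (auto simp: L2_vec_def intro!: mult_mat_vec_carrier[OF contmD(1)[OF F(2)]]
        mult_mat_vec_carrier[OF contmD(1)[OF F(3)]])
  have cv: "vint a b (\<lambda>s. Fa s *\<^sub>v zp s + Fb s *\<^sub>v zs s) \<in> carrier_vec p"
    using c[OF ends(1)] contmD(1)[OF F(3), of a] by (auto simp: vint_def intro!: carrier_vecI)
  show "pde_output a b F1 Fa Fb zb zp zs \<in> carrier_vec p"
    unfolding pde_output_def by (intro add_carrier_vec mult_mat_vec_carrier[OF F(1) zbc] cv)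
  have "vnt (vint a b (\<lambda>s. Fa s *\<^sub>v zp s + Fb s *\<^sub>v zs s)) i
      = (LINT s|lebesgue_on {a..b}. vnt (Fa s *\<^sub>v zp s + Fb s *\<^sub>v zs s) i)"
    by (rule vnt_vint[where n=p]) (use ab c in \<open>auto intro!: add_carrier_vec\<close>)
  also have "\<dots> = (LINT s|lebesgue_on {a..b}. vnt (Fa s *\<^sub>v zp s) i + vnt (Fb s *\<^sub>v zs s) i)"
    by (intro Bochner_Integration.integral_cong refl vnt_add[where n=p]) (use c in auto)
  also have "\<dots> = (LINT s|lebesgue_on {a..b}. vnt (Fa s *\<^sub>v zp s) i)
      + (LINT s|lebesgue_on {a..b}. vnt (Fb s *\<^sub>v zs s) i)"
    using integrable_contm_mult_vec[OF F(2) zp order.refl order.refl]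
        integrable_contm_mult_vec[OF F(3) zs order.refl order.refl] by simp
  finally show "vnt (pde_output a b F1 Fa Fb zb zp zs) i = vnt (F1 *\<^sub>v zb) i
      + (LINT s|lebesgue_on {a..b}. vnt (Fa s *\<^sub>v zp s) i)
      + (LINT s|lebesgue_on {a..b}. vnt (Fb s *\<^sub>v zs s) i)"
    unfolding pde_output_def vnt_add[OF mult_mat_vec_carrier[OF F(1) zbc] cv] by simp
qed

lemma L2_U: "L2 (emb u zf)"
  by (rule L2_emb[OF zf])

lemma app_comp_tH0:
  assumes "wft n 0 r (nz D) t" "s \<in> {a..b+1}"
  shows "app (pqrs_comp a b t tH0) (emb u zf) s i = app t (emb (0\<^sub>v 0) zp) s i"
  using app_comp[OF assms(1) wft_tH0 _ Ns(3) L2_U assms(2), of i]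
      app_cong_vec[of "app tH0 (emb u zf)" "emb (0\<^sub>v 0) zp" s t i] app_tH0 assms(2) by simp

lemma app_comp_tH1:
  assumes "wft n 0 r (n2 D + n3 D) t" "s \<in> {a..b+1}"
  shows "app (pqrs_comp a b t tH1) (emb u zf) s i = app t (emb (0\<^sub>v 0) zs) s i"
  using app_comp[OF assms(1) wft_tH1 _ Ns(5) L2_U assms(2), of i]
      app_cong_vec[of "app tH1 (emb u zf)" "emb (0\<^sub>v 0) zs" s t i] app_tH1 assms(2) by simp

lemma app_comp_tT:
  assumes "wft n (nbv D) r 0 t" "s \<in> {a..b+1}"
  shows "app (pqrs_comp a b t tT) (emb u zf) s i = app t (emb zb (\<lambda>_. 0\<^sub>v 0)) s i"
  using app_comp[OF assms(1) wft_tT Ns(6) _ L2_U assms(2), of i]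
      app_cong_vec[of "app tT (emb u zf)" "emb zb (\<lambda>_. 0\<^sub>v 0)" s t i] app_tT assms(2) by simp

lemma app_hatA:
  assumes "s \<in> {a..b+1}"
  shows "app (hatA D) (emb u zf) s i = app A_z (emb (0\<^sub>v 0) zp) s i + app A_zs (emb (0\<^sub>v 0) zs) s i
      + app A_zb (emb zb (\<lambda>_. 0\<^sub>v 0)) s i + app A_u (emb u zf) s i"
proof -
  note W = wft_comp[OF wft_A(1) wft_tH0, of a b] wft_comp[OF wft_A(2) wft_tH1, of a b]
      wft_comp[OF wft_A(3) wft_tT, of a b]
  show ?thesis
    unfolding hatA_eq app_add[OF wft_add[OF wft_add[OF W(1,2)] W(3)] wft_A(4) L2_U assms]
      app_add[OF wft_add[OF W(1,2)] W(3) L2_U assms] app_add[OF W(1,2) L2_U assms]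
      app_comp_tH0[OF wft_A(1) assms] app_comp_tH1[OF wft_A(2) assms] app_comp_tT[OF wft_A(3) assms]
          by simp
qed

lemma app_hatC:
  assumes "s \<in> {a..b+1}"
  shows "app (hatC D) (emb u zf) s i = app C_z (emb (0\<^sub>v 0) zp) s i + app C_zs (emb (0\<^sub>v 0) zs) s i
      + app C_zb (emb zb (\<lambda>_. 0\<^sub>v 0)) s i + app C_u (emb u zf) s i"
proof -
  note W = wft_comp[OF wft_C(1) wft_tH0, of a b] wft_comp[OF wft_C(2) wft_tH1, of a b]
      wft_comp[OF wft_C(3) wft_tT, of a b]
  show ?thesis
    unfolding hatC_eq app_add[OF wft_add[OF wft_add[OF W(1,2)] W(3)] wft_C(4) L2_U assms]
      app_add[OF wft_add[OF W(1,2)] W(3) L2_U assms] app_add[OF W(1,2) L2_U assms]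
      app_comp_tH0[OF wft_C(1) assms] app_comp_tH1[OF wft_C(2) assms] app_comp_tT[OF wft_C(3) assms]
          by simp
qed

lemma hat_u: "hatB0 D *\<^sub>v u = cBwo D *\<^sub>v w" "hatD0 D *\<^sub>v u = cDw D *\<^sub>v w"
    "hatB2 D s *\<^sub>v u = pBwp D s *\<^sub>v w"
  "(0\<^sub>m (nx D) (nw D) @\<^sub>c cA D) *\<^sub>v u = cA D *\<^sub>v x" "(0\<^sub>m (ny D) (nw D) @\<^sub>c cC D) *\<^sub>v u = cC D *\<^sub>v x"
  "(0\<^sub>m (nz D) (nw D) @\<^sub>c pE D s) *\<^sub>v u = pE D s *\<^sub>v x"
  using w x carriers contmD(1)[OF contm_data(5), of s] contmD(1)[OF contm_data(4), of s]
  by (auto simp: hatB0_def hatD0_def hatB2_def u_def block_simps)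

lemma A2_zf: "s \<in> {a..b} \<Longrightarrow> (0\<^sub>m (nz D) (n1 D) @\<^sub>c 0\<^sub>m (nz D) (n2 D) @\<^sub>c pA2 D s) *\<^sub>v zf s
    = pA2 D s *\<^sub>v z3ss s"
  using dims[of s] carrier_matD[OF contmD(1)[OF contm_data(3), of s]] by (simp add: zf_def block_simps)

end

context boundary_value begin

lemma zero_L2: "(\<lambda>_. 0\<^sub>v 0) \<in> L2_vec {a..b} 0"
  by (rule L2_vec_zero)

lemma yc: "y \<in> carrier_vec (ny D)"
  unfolding y_def
  by (intro add_carrier_vec mult_mat_vec_carrier[OF carriers(3) x]
      mult_mat_vec_carrier[OF carriers(4) w]
      vnt_pde_output(1)[OF carriers(5) contm_data(6,7)])

lemma vnt_xd: "vnt xd i = vnt (cA D *\<^sub>v x) i + vnt (cE1 D *\<^sub>v zb) i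
    + (LINT s|lebesgue_on {a..b}. vnt (pEa D s *\<^sub>v zp s) i)
      + (LINT s|lebesgue_on {a..b}. vnt (pEb D s *\<^sub>v zs s) i) + vnt (cBwo D *\<^sub>v w) i"
proof -
  note p = vnt_pde_output[OF carriers(6) contm_data(8,9)]
  note c = mult_mat_vec_carrier[OF carriers(1) x] mult_mat_vec_carrier[OF carriers(2) w]
  show ?thesis unfolding xd_def vnt_add[OF add_carrier_vec[OF c(1) p(1)] c(2)] vnt_add[OF c(1) p(1)]
      p(2) by simp
qed

lemma vnt_y: "vnt y i = vnt (cC D *\<^sub>v x) i + vnt (cC1 D *\<^sub>v zb) i
    + (LINT s|lebesgue_on {a..b}. vnt (pCa D s *\<^sub>v zp s) i)
      + (LINT s|lebesgue_on {a..b}. vnt (pCb D s *\<^sub>v zs s) i) + vnt (cDw D *\<^sub>v w) i"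
proof -
  note p = vnt_pde_output[OF carriers(5) contm_data(6,7)]
  note c = mult_mat_vec_carrier[OF carriers(3) x] mult_mat_vec_carrier[OF carriers(4) w]
  show ?thesis unfolding y_def vnt_add[OF add_carrier_vec[OF c(1) p(1)] c(2)] vnt_add[OF c(1) p(1)]
      p(2) by simp
qed

lemma vnt_zd: assumes s: "s \<in> {a..b}"
  shows "vnt (zd s) i = vnt (pA0 D s *\<^sub>v zp s) i + vnt (pA1 D s *\<^sub>v zs s) i
      + vnt (pA2 D s *\<^sub>v z3ss s) i + vnt (pE D s *\<^sub>v x) i + vnt (pBwp D s *\<^sub>v w) i"
proof -
  have d: "dim_row (pA1 D s) = nz D" "dim_row (pA2 D s) = nz D" "dim_row (pE D s) = nz D"
      "dim_row (pBwp D s) = nz D" "dim_row (pA0 D s) = nz D"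
    by (rule carrier_matD(1)[OF contmD(1)[OF contm_data(2)]]
        carrier_matD(1)[OF contmD(1)[OF contm_data(3)]] carrier_matD(1)[OF contmD(1)[OF contm_data(4)]]
      carrier_matD(1)[OF contmD(1)[OF contm_data(5)]] carrier_matD(1)[OF contmD(1)[OF contm_data(1)]])+
  show ?thesis unfolding zd_def by (simp add: vnt_add' d)
qed

text \<open>Each summand of \<open>hatA\<close> contributes the terms of the equations that belong
  to its source. The boundary values act on the ordinary differential equation only, so
  \<open>A_zb\<close> vanishes on [a,b].\<close>

lemma app_tA:
  assumes s: "s \<in> {a..b+1}" shows "app tA (emb u zf) s i = emb xd zd s i"
proof (cases "s \<le> b")
  case True
  then have s': "s \<in> {a..b}" using s by simp
  note i0 = integral_zero_mat_mult[where n="nz D" and i=i]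
  have sl: "a \<le> s" "s \<le> b" using s' by auto
  have "app tA (emb u zf) s i = app (hatA D) (emb u zf) s i + vnt (hatB2 D s *\<^sub>v u) i"
    using app_emb_int[OF wft_tA uc zf Ns(2,3) s', of i] app_emb_int[OF wft_hatA uc zf Ns(2,3) s', of i]
      vnt_add_mult[OF wftD(12)[OF wft_hatA] contmD(1)[OF contm_hatB2] uc, of s s i]
          by (simp add: tA_def)
  moreover have "app A_z (emb (0\<^sub>v 0) zp) s i = vnt (pA0 D s *\<^sub>v zp s) i"
    using app_emb_int[OF wft_A(1) zero_carrier_vec zp _ Ns(3) s', of i] i0[OF zp order.refl sl(2)]
        i0[OF zp sl(1) order.refl]
    by (simp add: A_z_def vnt_zero_mat_mult)
  moreover have "app A_zs (emb (0\<^sub>v 0) zs) s i = vnt (pA1 D s *\<^sub>v zs s) i"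
    using app_emb_int[OF wft_A(2) zero_carrier_vec zs _ Ns(5) s', of i] i0[OF zs order.refl sl(2)]
        i0[OF zs sl(1) order.refl]
    by (simp add: A_zs_def vnt_zero_mat_mult)
  moreover have "app A_zb (emb zb (\<lambda>_. 0\<^sub>v 0)) s i = 0"
    using app_emb_int[OF wft_A(3) zbc zero_L2 Ns(6) _ s', of i] i0[OF zero_L2 order.refl sl(2)]
        i0[OF zero_L2 sl(1) order.refl] carrier_vecD[OF zbc]
    by (simp add: A_zb_def vnt_zero_mat_mult)
  moreover have "app A_u (emb u zf) s i = vnt (pE D s *\<^sub>v x) i + vnt (pA2 D s *\<^sub>v z3ss s) i"
    using app_emb_int[OF wft_A(4) uc zf Ns(2,3) s', of i] i0[OF zf order.refl sl(2)]
        i0[OF zf sl(1) order.refl]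
    by (simp add: A_u_def hat_u A2_zf[OF s'])
  ultimately show ?thesis using True app_hatA[OF s, of i] vnt_zd[OF s', of i]
      by (simp add: emb_def hat_u)
next
  case False
  then have s': "b < s" "s \<le> b + 1" using s by auto
  note i0 = integral_zero_mat_mult[where n="nx D" and i=i, OF _ order.refl order.refl]
  have "app tA (emb u zf) s i = app (hatA D) (emb u zf) s i + vnt (hatB0 D *\<^sub>v u) i"
    using app_emb_pt[OF wft_tA uc zf Ns(2,3) s', of i] app_emb_pt[OF wft_hatA uc zf Ns(2,3) s', of i]
      vnt_add_mult[OF wftD(1)[OF wft_hatA] hatB0_carrier uc, of i] by (simp add: tA_def)
  moreover have "app A_z (emb (0\<^sub>v 0) zp) s i = (LINT s|lebesgue_on {a..b}. vnt (pEa D s *\<^sub>v zp s) i)"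
    using app_emb_pt[OF wft_A(1) zero_carrier_vec zp _ Ns(3) s', of i]
        by (simp add: A_z_def vnt_zero_mat_mult)
  moreover have "app A_zs (emb (0\<^sub>v 0) zs) s i = (LINT s|lebesgue_on {a..b}. vnt (pEb D s *\<^sub>v zs s) i)"
    using app_emb_pt[OF wft_A(2) zero_carrier_vec zs _ Ns(5) s', of i]
        by (simp add: A_zs_def vnt_zero_mat_mult)
  moreover have "app A_zb (emb zb (\<lambda>_. 0\<^sub>v 0)) s i = vnt (cE1 D *\<^sub>v zb) i"
    using app_emb_pt[OF wft_A(3) zbc zero_L2 Ns(6) _ s', of i] i0[OF zero_L2] by (simp add: A_zb_def)
  moreover have "app A_u (emb u zf) s i = vnt (cA D *\<^sub>v x) i"
    using app_emb_pt[OF wft_A(4) uc zf Ns(2,3) s', of i] i0[OF zf] by (simp add: A_u_def hat_u)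
  ultimately show ?thesis using False app_hatA[OF s, of i] vnt_xd[of i] by (simp add: emb_def hat_u)
qed

lemma app_tC:
  assumes s: "s \<in> {a..b+1}" shows "app tC (emb u zf) s i = emb y (\<lambda>_. 0\<^sub>v 0) s i"
proof (cases "s \<le> b")
  case True
  then show ?thesis using app_no_int[OF wft_tC uc zf Ns(2,3), of s i] s
      by (simp add: emb_def vnt_dim_zero)
next
  case False
  then have s': "b < s" "s \<le> b + 1" using s by auto
  note i0 = integral_zero_mat_mult[where n="ny D" and i=i, OF _ order.refl order.refl]
  have "app tC (emb u zf) s i = app (hatC D) (emb u zf) s i + vnt (hatD0 D *\<^sub>v u) i"
    using app_emb_pt[OF wft_tC uc zf Ns(2,3) s', of i] app_emb_pt[OF wft_hatC uc zf Ns(2,3) s', of i]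
      vnt_add_mult[OF wftD(1)[OF wft_hatC] hatD0_carrier uc, of i] by (simp add: tC_def)
  moreover have "app C_z (emb (0\<^sub>v 0) zp) s i = (LINT s|lebesgue_on {a..b}. vnt (pCa D s *\<^sub>v zp s) i)"
    using app_emb_pt[OF wft_C(1) zero_carrier_vec zp _ Ns(3) s', of i]
        by (simp add: C_z_def vnt_zero_mat_mult)
  moreover have "app C_zs (emb (0\<^sub>v 0) zs) s i = (LINT s|lebesgue_on {a..b}. vnt (pCb D s *\<^sub>v zs s) i)"
    using app_emb_pt[OF wft_C(2) zero_carrier_vec zs _ Ns(5) s', of i]
        by (simp add: C_zs_def vnt_zero_mat_mult)
  moreover have "app C_zb (emb zb (\<lambda>_. 0\<^sub>v 0)) s i = vnt (cC1 D *\<^sub>v zb) i"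
    using app_emb_pt[OF wft_C(3) zbc zero_L2 Ns(6) _ s', of i] i0[OF zero_L2] by (simp add: C_zb_def)
  moreover have "app C_u (emb u zf) s i = vnt (cC D *\<^sub>v x) i"
    using app_emb_pt[OF wft_C(4) uc zf Ns(2,3) s', of i] i0[OF zf] by (simp add: C_u_def hat_u)
  ultimately show ?thesis using False app_hatC[OF s, of i] vnt_y[of i] by (simp add: emb_def hat_u)
qed

end

section \<open>The supply rate and the dissipation inequality\<close>

context coupled_system begin

definition "supply = PQRS ((hatC0 D + hatD0 D)\<^sup>T * I0 D) (zmat1 (nw D + nx D) (nz D))
    (\<lambda>s. (hatC1 D s)\<^sup>T * I0 D)
              (zmat1 (nz D) (nz D)) (zmat2 (nz D) (nz D)) (zmat2 (nz D) (nz D))"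

lemma wft_supply:
  assumes "nw D = ny D" shows "wft (nw D + nx D) (nw D + nx D) (nz D) (nz D) supply"
  unfolding supply_def
proof (intro wft_pqrsI contm_zero)
  show "(hatC0 D + hatD0 D)\<^sup>T * I0 D \<in> carrier_mat (nw D + nx D) (nw D + nx D)"
    using mult_carrier_mat[OF
        transpose_carrier_mat[THEN iffD2, OF add_carrier_mat[OF hatD0_carrier]]
        I0_carrier[unfolded assms]] unfolding assms .
  show "contm (nz D) (nw D + nx D) (\<lambda>s. (hatC1 D s)\<^sup>T * I0 D)"
    using contm_mult[OF contm_transpose[OF wftD(2)[OF wft_hatC]]
        contm_const[OF I0_carrier[unfolded assms]]] unfolding assms .
qed

end

context boundary_value begin

text \<open>I_0 extracts w from U, so the supply operator applied to U is the adjoint of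
  \<open>tC\<close> applied to w. Moving the adjoint to the other side leaves the scalar product of
  y and w.\<close>

lemma ip_supply:
  assumes wy: "nw D = ny D" shows "ip (emb u zf) (app supply (emb u zf)) = w \<bullet> y"
proof -
  have w': "w \<in> carrier_vec (ny D)" using w wy by simp
  have CD: "hatC0 D + hatD0 D \<in> carrier_mat (ny D) (nw D + nx D)" using hatD0_carrier by simp
  have C1: "hatC1 D s \<in> carrier_mat (ny D) (nz D)" for s by (rule wftD(11)[OF wft_hatC])
  have I0: "I0 D \<in> carrier_mat (ny D) (nw D + nx D)" using I0_carrier wy by simp
  have "ip (emb u zf) (app supply (emb u zf)) = ip (emb u zf) (app (pqrs_adj tC) (emb w (\<lambda>_. 0\<^sub>v 0)))"
  proof (rule ip_cong)
    fix s i assume s: "s \<in> space mu"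
    show "app supply (emb u zf) s i = app (pqrs_adj tC) (emb w (\<lambda>_. 0\<^sub>v 0)) s i"
    proof (cases "s \<le> b")
      case True
      then have s': "s \<in> {a..b}" "a \<le> s" "s \<le> b" using s by auto
      have "(hatC1 D s)\<^sup>T * I0 D *\<^sub>v u = (hatC1 D s)\<^sup>T *\<^sub>v w"
        using assoc_mult_mat_vec[OF transpose_carrier_mat[THEN iffD2, OF C1] I0 uc] by (simp add: I0_u)
      then show ?thesis
        using app_emb_int[OF wft_supply[OF wy] uc zf Ns(2,3) s'(1), of i]
            app_emb_int[OF wft_adj[OF wft_tC] w' zero_L2 Ns(4) _ s'(1), of i]
          integral_zero_mat_mult[OF zf order.refl s'(3), of "nz D" i]
              integral_zero_mat_mult[OF zf s'(2) order.refl, of "nz D" i]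
          integral_zero_mat_mult[OF zero_L2 order.refl s'(3), of "nz D" i]
              integral_zero_mat_mult[OF zero_L2 s'(2) order.refl, of "nz D" i]
        by (simp add: supply_def tC_def pqrs_adj_def vnt_zero_mat_mult carrier_vecD[OF zfc[OF s'(1)]])
    next
      case False
      then have s': "b < s" "s \<le> b + 1" using s by auto
      have "(hatC0 D + hatD0 D)\<^sup>T * I0 D *\<^sub>v u = (hatC0 D + hatD0 D)\<^sup>T *\<^sub>v w"
        using assoc_mult_mat_vec[OF transpose_carrier_mat[THEN iffD2, OF CD] I0 uc] by (simp add: I0_u)
      then show ?thesis
        using app_emb_pt[OF wft_supply[OF wy] uc zf Ns(2,3) s', of i]
            app_emb_pt[OF wft_adj[OF wft_tC] w' zero_L2 Ns(4) _ s', of i]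
          integral_zero_mat_mult[OF zf order.refl order.refl, of "nw D + nx D" i]
          integral_zero_mat_mult[OF zero_L2 order.refl order.refl, of "nw D + nx D" i]
        by (simp add: supply_def tC_def pqrs_adj_def)
    qed
  qed simp
  also have "\<dots> = ip (app tC (emb u zf)) (emb w (\<lambda>_. 0\<^sub>v 0))"
    by (rule app_adj[OF wft_tC L2_U L2_emb[OF zero_L2]])
  also have "\<dots> = ip (emb y (\<lambda>_. 0\<^sub>v 0)) (emb w (\<lambda>_. 0\<^sub>v 0))"
    using app_tC by (intro ip_cong) auto
  also have "\<dots> = y \<bullet> w"
    using ip_emb[OF zero_L2 zero_L2 yc w' _ Ns(4)] by (simp add: scalar_prod_def)
  also have "\<dots> = w \<bullet> y" by (rule comm_scalar_prod[OF yc w'])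
  finally show ?thesis .
qed

text \<open>Moving the adjoint of \<open>tX\<close> across the product turns the quadratic form of J
  at U into the energy rate minus the supply. The hypothesis on -J - J^* says that twice this form
  is at most 0.\<close>

lemma dissipation:
  assumes wy: "nw D = ny D" and p: "wft (nx D) (nx D) (nz D) (nz D) p"
    and J: "J = pqrs_comp a b (pqrs_comp a b (pqrs_adj tX) p) tA -\<^sub>p supply"
    and Phi: "\<ominus>\<^sub>p J -\<^sub>p pqrs_adj J \<in> Phi a b (nw D + nx D) (nz D) d"
    and Nd: "nw D + nx D + (d + 1) * nz D + length (exps2 d) * nz D + length (exps2 d) * nz D \<le> N"
  shows "ip (emb x zp) (app p (emb xd zd)) \<le> w \<bullet> y"
proof -
  let ?U = "emb u zf" and ?K = "pqrs_comp a b (pqrs_adj tX) p"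
  note wX = wft_adj[OF wft_tX]
  note wK = wft_comp[OF wX p, of a b]
  note wKA = wft_comp[OF wK wft_tA, of a b]
  have wJ: "wft (nw D + nx D) (nw D + nx D) (nz D) (nz D) J" unfolding J
      by (rule wft_minus[OF wKA wft_supply[OF wy]])
  have L2A: "L2 (app tA ?U)" by (rule L2_app[OF wft_tA L2_U])
  have L2pA: "L2 (app p (app tA ?U))" by (rule L2_app[OF p L2A])
  have "ip ?U (app J ?U) = ip ?U
      (\<lambda>s i. app (pqrs_adj tX) (app p (app tA ?U)) s i + (-1) * app supply ?U s i)"
  proof (rule ip_cong)
    fix s i assume "s \<in> space mu"
    then have s: "s \<in> {a..b+1}" by simp
    have "app J ?U s i = app (pqrs_comp a b ?K tA) ?U s i - app supply ?U s i"
      unfolding J by (rule app_minus[OF wKA wft_supply[OF wy] L2_U s])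
    also have "app (pqrs_comp a b ?K tA) ?U s i = app ?K (app tA ?U) s i"
      by (rule app_comp[OF wK wft_tA Ns(1,3) L2_U s])
    also have "\<dots> = app (pqrs_adj tX) (app p (app tA ?U)) s i"
      by (rule app_comp[OF wX p Ns(1,3) L2A s])
    finally show "app J ?U s i = app (pqrs_adj tX) (app p (app tA ?U)) s i + (-1)
        * app supply ?U s i" by simp
  qed simp
  also have "\<dots> = ip ?U (app (pqrs_adj tX) (app p (app tA ?U))) + ip ?U (\<lambda>s i. (-1) * app supply ?U s i)"
  proof (rule ip_add_right[OF L2_U L2_app[OF wX L2pA]])
    show "L2 (\<lambda>s i. (-1) * app supply ?U s i)"
      using L2_app[OF wft_supply[OF wy] L2_U] unfolding L2_def by (intro allI L2f_scale) simp
  qed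
  also have "ip ?U (\<lambda>s i. (-1) * app supply ?U s i) = - (w \<bullet> y)"
      unfolding ip_scale_right ip_supply[OF wy] by simp
  also have "ip ?U (app (pqrs_adj tX) (app p (app tA ?U))) = ip (app tX ?U) (app p (app tA ?U))"
    by (rule app_adj[OF wft_tX L2_U L2pA])
  also have "\<dots> = ip (emb x zp) (app p (emb xd zd))"
  proof (rule ip_cong)
    fix s i assume s: "s \<in> space mu"
    then show "app tX ?U s i = emb x zp s i" using app_tX by simp
    show "app p (app tA ?U) s i = app p (emb xd zd) s i" using s by (intro app_cong_vec app_tA) auto
  qed
  finally have J1: "ip ?U (app J ?U) = ip (emb x zp) (app p (emb xd zd)) + - (w \<bullet> y)" .
  have L2J: "L2 (app J ?U)" by (rule L2_app[OF wJ L2_U])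
  have L2J': "L2 (app (pqrs_adj J) ?U)" by (rule L2_app[OF wft_adj[OF wJ] L2_U])
  have "0 \<le> ip ?U (app (\<ominus>\<^sub>p J -\<^sub>p pqrs_adj J) ?U)" by (rule Phi_psd(1)[OF Phi Nd L2_U])
  also have "\<dots> = ip ?U (\<lambda>s i. (-1) * (app J ?U s i + app (pqrs_adj J) ?U s i))"
  proof (rule ip_cong)
    fix s i assume "s \<in> space mu"
    then show "app (\<ominus>\<^sub>p J -\<^sub>p pqrs_adj J) ?U s i = (-1) * (app J ?U s i + app (pqrs_adj J) ?U s i)"
      using app_minus[OF wft_uminus[OF wJ] wft_adj[OF wJ] L2_U, of s i] by (simp add: app_uminus)
  qed simp
  also have "\<dots> = - (ip ?U (app J ?U) + ip ?U (app (pqrs_adj J) ?U))"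
    unfolding ip_scale_right ip_add_right[OF L2_U L2J L2J'] by simp
  \<comment> \<open>Over the reals an operator and its adjoint have the same quadratic form; this is
    the factor 2.\<close>
  also have "ip ?U (app (pqrs_adj J) ?U) = ip ?U (app J ?U)"
    using app_adj[OF wJ L2_U L2_U] ip_commute by simp
  finally show ?thesis using J1 by simp
qed

end

section \<open>The storage function\<close>

text \<open>The form may be degenerate, since equality of padded functions is never imposed;
  \<open>\<nu>\<close> is a seminorm, and the arguments below use positivity without
  definiteness.\<close>

locale psd_form = diffuse_finite_measure +
  fixes Op :: "('a \<Rightarrow> nat \<Rightarrow> real) \<Rightarrow> 'a \<Rightarrow> nat \<Rightarrow> real"
  assumes L2_Op: "L2 X \<Longrightarrow> L2 (Op X)"
    and sym: "L2 X \<Longrightarrow> L2 Y \<Longrightarrow> ip X (Op Y) = ip (Op X) Y"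
    and psd: "L2 X \<Longrightarrow> 0 \<le> ip X (Op X)"
begin

definition B :: "('a \<Rightarrow> nat \<Rightarrow> real) \<Rightarrow> ('a \<Rightarrow> nat \<Rightarrow> real) \<Rightarrow> real" where
  "B X Y = ip X (Op Y)"

definition \<nu> :: "('a \<Rightarrow> nat \<Rightarrow> real) \<Rightarrow> real" where
  "\<nu> X = sqrt (B X X)"

lemma L2_lincomb: "L2 X \<Longrightarrow> L2 Y \<Longrightarrow> L2 (\<lambda>s i. c * X s i + d * Y s i)"
  unfolding L2_def by (intro allI L2f_add L2f_scale) auto

lemma B_commute: "L2 X \<Longrightarrow> L2 Y \<Longrightarrow> B X Y = B Y X"
  unfolding B_def using sym[of X Y] ip_commute by simp

lemma B_lincomb_right:
  assumes "L2 Z" "L2 X" "L2 Y" shows "B Z (\<lambda>s i. c * X s i + d * Y s i) = c * B Z X + d * B Z Y"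
proof -
  have "B Z (\<lambda>s i. c * X s i + d * Y s i) = ip (Op Z) (\<lambda>s i. c * X s i + d * Y s i)"
    unfolding B_def by (rule sym[OF assms(1) L2_lincomb[OF assms(2,3)]])
  also have "\<dots> = ip (Op Z) (\<lambda>s i. c * X s i) + ip (Op Z) (\<lambda>s i. d * Y s i)"
    using L2_lincomb[OF assms(2,2), of c 0] L2_lincomb[OF assms(3,3), of d 0]
        by (intro ip_add_right[OF L2_Op[OF assms(1)]]) simp_all
  finally show ?thesis unfolding ip_scale_right B_def using sym assms by simp
qed

lemma B_lincomb:
  assumes X: "L2 X" and Y: "L2 Y"
  shows "B (\<lambda>s i. c * X s i + d * Y s i) (\<lambda>s i. c * X s i + d * Y s i) = c\<^sup>2 * B X X + 2 * c * d
      * B X Y + d\<^sup>2 * B Y Y"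
proof -
  note Z = L2_lincomb[OF X Y, of c d]
  have "B (\<lambda>s i. c * X s i + d * Y s i) (\<lambda>s i. c * X s i + d * Y s i) = c
      * B X (\<lambda>s i. c * X s i + d * Y s i) + d * B Y (\<lambda>s i. c * X s i + d * Y s i)"
    using B_lincomb_right[OF Z X Y] B_commute[OF Z X] B_commute[OF Z Y] by simp
  then show ?thesis unfolding B_lincomb_right[OF X X Y] B_lincomb_right[OF Y X Y] B_commute[OF Y X]
    by (simp add: power2_eq_square algebra_simps)
qed

lemma Cauchy_Schwarz:
  assumes X: "L2 X" and Y: "L2 Y" shows "\<bar>B X Y\<bar> \<le> \<nu> X * \<nu> Y"
proof -
  have nn: "0 \<le> c\<^sup>2 * B X X + 2 * c * d * B X Y + d\<^sup>2 * B Y Y" for c d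
    using psd[OF L2_lincomb[OF X Y, of c d]] unfolding B_def[symmetric] B_lincomb[OF X Y] .
  have X0: "0 \<le> B X X" and Y0: "0 \<le> B Y Y" using psd X Y by (auto simp: B_def)
  have "(B X Y)\<^sup>2 \<le> B X X * B Y Y"
  proof (cases "B Y Y = 0")
    case True
    have "B X Y = 0"
    proof (rule ccontr)
      assume "B X Y \<noteq> 0"
      \<comment> \<open>With this coefficient the quadratic form equals B(X,X) - (B(X,X) + 1) = -1,
        a contradiction. It is the degenerate case of the discriminant argument.\<close>
      then show False using nn[of 1 "- (B X X + 1) / (2 * B X Y)"] True by (simp add: field_simps)
    qed
    then show ?thesis using X0 Y0 by simp
  next
    case False
    then have pos: "B Y Y > 0" using Y0 by simp
    have "0 \<le> B Y Y * (B X X * B Y Y - (B X Y)\<^sup>2)"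
      \<comment> \<open>The unnormalised minimiser of the quadratic form, which avoids division by
        B(Y,Y).\<close>
      using nn[of "B Y Y" "- B X Y"] by (simp add: power2_eq_square algebra_simps)
    then show ?thesis using pos by (simp add: zero_le_mult_iff)
  qed
  then have "sqrt ((B X Y)\<^sup>2) \<le> sqrt (B X X * B Y Y)" by (rule real_sqrt_le_mono)
  then show ?thesis by (simp add: \<nu>_def real_sqrt_mult)
qed

lemma \<nu>_diff:
  assumes X: "L2 X" and Y: "L2 Y" shows "\<bar>\<nu> X - \<nu> Y\<bar> \<le> \<nu> (\<lambda>s i. X s i - Y s i)"
proof -
  have X0: "0 \<le> B X X" and Y0: "0 \<le> B Y Y" using psd X Y by (auto simp: B_def)
  have "(\<nu> X - \<nu> Y)\<^sup>2 = B X X - 2 * (\<nu> X * \<nu> Y) + B Y Y"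
    using X0 Y0 by (simp add: power2_diff \<nu>_def)
  also have "\<dots> \<le> B X X - 2 * B X Y + B Y Y"
    using Cauchy_Schwarz[OF X Y] by linarith
  also have "\<dots> = B (\<lambda>s i. X s i - Y s i) (\<lambda>s i. X s i - Y s i)"
    using B_lincomb[OF X Y, of 1 "-1"] by simp
  finally show ?thesis unfolding \<nu>_def[of "\<lambda>s i. X s i - Y s i"] by (simp add: real_le_rsqrt)
qed

text \<open>Write F(t+h) = F(t) + h (G + R) with R tending to 0 in norm. The difference quotient of
  the energy then differs from 2 B(F(t), G) by 2 B(F(t), R) + h B(G + R, G + R), and the bound by C
  makes both terms tend to 0.\<close>

lemma energy_derivative:
  assumes F: "\<And>r. 0 \<le> r \<Longrightarrow> L2 (F r)" and G: "L2 G" and t: "0 < t"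
      and C: "0 \<le> C" "\<And>Z. L2 Z \<Longrightarrow> B Z Z \<le> C * ip Z Z"
    and lim: "((\<lambda>h. ip (\<lambda>s i. 1 / h * (F (t + h) s i - F t s i) - G s i)
        (\<lambda>s i. 1 / h * (F (t + h) s i - F t s i) - G s i)) \<longlongrightarrow> 0) (at 0)"
  shows "((\<lambda>t. B (F t) (F t)) has_real_derivative 2 * B (F t) G) (at t)"
proof -
  let ?R = "\<lambda>h s i. 1 / h * (F (t + h) s i - F t s i) - G s i"
  have Ft: "L2 (F t)" using F t by simp
  have L2R: "L2 (?R h)" if "0 \<le> t + h" for h
    using L2_lincomb[OF L2_lincomb[OF F[OF that] Ft, of "1 / h" "- (1 / h)"] G, of 1 "-1"]
        by (simp add: algebra_simps)
  have key: "norm ((B (F (t + h)) (F (t + h)) - B (F t) (F t)) / h - 2 * B (F t) G)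
      \<le> 2 * \<nu> (F t) * sqrt (C * ip (?R h) (?R h)) + \<bar>h\<bar>
          * (\<nu> G + sqrt (C * ip (?R h) (?R h)))\<^sup>2" if h: "h \<noteq> 0" "0 \<le> t + h" for h
  proof -
    define R where "R = ?R h"
    have R: "L2 R" unfolding R_def by (rule L2R[OF h(2)])
    have G1: "L2 (\<lambda>s i. 1 * G s i + 1 * R s i)" by (rule L2_lincomb[OF G R])
    have Feq: "F (t + h) = (\<lambda>s i. 1 * F t s i + h * (1 * G s i + 1 * R s i))" using h
        by (auto simp: R_def fun_eq_iff field_simps)
    have "B (F (t + h)) (F (t + h)) = B (F t) (F t) + 2 * h * B (F t) (\<lambda>s i. 1 * G s i + 1 * R s i)
       + h\<^sup>2 * B (\<lambda>s i. 1 * G s i + 1 * R s i) (\<lambda>s i. 1 * G s i + 1 * R s i)"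
      unfolding Feq B_lincomb[OF Ft G1] by simp
    also have "B (F t) (\<lambda>s i. 1 * G s i + 1 * R s i) = B (F t) G + B (F t) R"
      unfolding B_lincomb_right[OF Ft G R] by simp
    also have "B (\<lambda>s i. 1 * G s i + 1 * R s i) (\<lambda>s i. 1 * G s i + 1 * R s i) = B G G + 2 * B G R
        + B R R"
      unfolding B_lincomb[OF G R] by simp
    finally have e: "(B (F (t + h)) (F (t + h)) - B (F t) (F t)) / h - 2 * B (F t) G
       = 2 * B (F t) R + h * (B G G + 2 * B G R + B R R)"
      using h by (simp add: field_simps power2_eq_square)
    have nuR: "\<nu> R \<le> sqrt (C * ip R R)" unfolding \<nu>_def by (rule real_sqrt_le_mono) (rule C(2)[OF R])
    have nu0: "0 \<le> \<nu> Z" if "L2 Z" for Z using psd[OF that] by (simp add: \<nu>_def B_def)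
    have nusq: "B Z Z = (\<nu> Z)\<^sup>2" if "L2 Z" for Z using psd[OF that] by (simp add: \<nu>_def B_def)
    have b1: "\<bar>B (F t) R\<bar> \<le> \<nu> (F t) * sqrt (C * ip R R)"
      using Cauchy_Schwarz[OF Ft R] mult_left_mono[OF nuR nu0[OF Ft]] by linarith
    have b2: "\<bar>B G G + 2 * B G R + B R R\<bar> \<le> (\<nu> G + \<nu> R)\<^sup>2"
    proof -
      have "0 \<le> B G G" "0 \<le> B R R" using psd[OF G] psd[OF R] by (simp_all add: B_def)
      then have "\<bar>B G G + 2 * B G R + B R R\<bar> \<le> B G G + 2 * (\<nu> G * \<nu> R) + B R R"
        using Cauchy_Schwarz[OF G R] by linarith
      then show ?thesis unfolding nusq[OF G] nusq[OF R] by (simp add: power2_sum)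
    qed
    have b3: "(\<nu> G + \<nu> R)\<^sup>2 \<le> (\<nu> G + sqrt (C * ip R R))\<^sup>2"
      using nuR nu0[OF G] nu0[OF R] by (intro power_mono) auto
    have "\<bar>h * (B G G + 2 * B G R + B R R)\<bar> \<le> \<bar>h\<bar> * (\<nu> G + sqrt (C * ip R R))\<^sup>2"
      unfolding abs_mult by (rule mult_left_mono) (use b2 b3 in auto)
    then show ?thesis unfolding R_def[symmetric] e real_norm_def using b1
        abs_triangle_ineq[of "2 * B (F t) R" "h * (B G G + 2 * B G R + B R R)"] by (simp add: abs_mult)
  qed
  have "((\<lambda>h. 2 * \<nu> (F t) * sqrt (C * ip (?R h) (?R h)) + \<bar>h\<bar> * (\<nu> G + sqrt (C * ip (?R h) (?R h)))\<^sup>2) \<longlongrightarrow>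
      2 * \<nu> (F t) * sqrt (C * 0) + \<bar>0\<bar> * (\<nu> G + sqrt (C * 0))\<^sup>2) (at 0)"
    by (intro tendsto_intros lim)
  then have lim0: "((\<lambda>h. 2 * \<nu> (F t) * sqrt (C * ip (?R h) (?R h)) + \<bar>h\<bar>
      * (\<nu> G + sqrt (C * ip (?R h) (?R h)))\<^sup>2) \<longlongrightarrow> 0) (at 0)"
    by simp
  \<comment> \<open>For |h| < t the time t + h stays nonnegative, where the state is known to be
    square integrable.\<close>
  have "\<forall>\<^sub>F h in at 0. norm ((B (F (t + h)) (F (t + h)) - B (F t) (F t)) / h - 2 * B (F t) G)
      \<le> 2 * \<nu> (F t) * sqrt (C * ip (?R h) (?R h)) + \<bar>h\<bar> * (\<nu> G + sqrt (C * ip (?R h) (?R h)))\<^sup>2"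
    unfolding eventually_at using t key by (intro exI[of _ t]) (auto simp: dist_real_def abs_less_iff)
  then have "((\<lambda>h. (B (F (t + h)) (F (t + h)) - B (F t) (F t)) / h - 2 * B (F t) G) \<longlongrightarrow> 0) (at 0)"
    by (rule Lim_null_comparison[OF _ lim0])
  then show ?thesis unfolding DERIV_def by (subst LIM_zero_iff[symmetric])
qed

end

section \<open>Distances between states and the shift by \<open>\<epsilon>\<close>\<close>

lemma L2_vec_minus:
  assumes f: "f \<in> L2_vec A n" and g: "g \<in> L2_vec A n" shows "(\<lambda>s. f s - g s) \<in> L2_vec A n"
proof -
  have e: "vnt (f s - g s) i = vnt (f s) i - vnt (g s) i" if "s \<in> space (lebesgue_on A)" for s i
    using f g that by (intro vnt_minus) (auto simp: L2_vec_def)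
  have fg: "(\<lambda>s. vnt (f s) i) \<in> borel_measurable (lebesgue_on A)"
      "integrable (lebesgue_on A) (\<lambda>s. (vnt (f s) i)\<^sup>2)"
    "(\<lambda>s. vnt (g s) i) \<in> borel_measurable (lebesgue_on A)"
        "integrable (lebesgue_on A) (\<lambda>s. (vnt (g s) i)\<^sup>2)" for i
    using f g by (simp_all add: L2_vec_iff)
  have "integrable (lebesgue_on A) (\<lambda>s. (vnt (f s) i - vnt (g s) i)\<^sup>2)" for i
    unfolding power2_diff using fg integrable_mult_squares[OF fg(1,3,2,4)] by (simp add: mult.assoc)
  moreover have "(\<lambda>s. vnt (f s) i - vnt (g s) i) \<in> borel_measurable (lebesgue_on A)" for i using fg
      by simp
  moreover have "(\<lambda>s. vnt (f s - g s) i)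
      \<in> borel_measurable (lebesgue_on A) \<longleftrightarrow> (\<lambda>s. vnt (f s) i - vnt (g s) i)
      \<in> borel_measurable (lebesgue_on A)" for i
    by (rule measurable_cong) (rule e)
  moreover have "integrable (lebesgue_on A) (\<lambda>s. (vnt (f s - g s) i)\<^sup>2) \<longleftrightarrow> integrable (lebesgue_on A)
      (\<lambda>s. (vnt (f s) i - vnt (g s) i)\<^sup>2)" for i
    by (rule Bochner_Integration.integrable_cong) (simp_all only: e)
  moreover have "f s - g s \<in> carrier_vec n" if "s \<in> A" for s using f g that by (auto simp: L2_vec_def)
  ultimately show ?thesis unfolding L2_vec_iff[of "\<lambda>s. f s - g s"] by blast
qed

lemma L2_vec_smult: "f \<in> L2_vec A n \<Longrightarrow> (\<lambda>s. c \<cdot>\<^sub>v f s) \<in> L2_vec A n"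
  by (auto simp: L2_vec_iff vnt_smult power_mult_distrib intro: borel_measurable_times)

lemma L2_vec_scalar_prod:
  assumes "f \<in> L2_vec A n" "g \<in> L2_vec A n" shows "integrable (lebesgue_on A) (\<lambda>s. f s \<bullet> g s)"
proof -
  have "integrable (lebesgue_on A) (\<lambda>s. \<Sum>i<n. vnt (f s) i * vnt (g s) i)"
    using assms by (intro Bochner_Integration.integrable_sum integrable_mult_squares)
        (simp_all add: L2_vec_iff)
  then show ?thesis
    by (rule Bochner_Integration.integrable_cong[THEN iffD2, OF refl, rotated])
      (rule scalar_prod_vnt, use assms in \<open>auto simp: L2_vec_def\<close>)
qed

context interval_sites begin

lemma L2_cong: "(\<And>s i. s \<in> space mu \<Longrightarrow> X s i = Y s i) \<Longrightarrow> L2 X \<Longrightarrow> L2 Y"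
  unfolding L2_def L2f_def
  using measurable_cong[of mu "\<lambda>s. X s i" "\<lambda>s. Y s i" borel for i]
      Bochner_Integration.integrable_cong[OF refl, of mu "\<lambda>s. (X s i)\<^sup>2" "\<lambda>s. (Y s i)\<^sup>2" for i]
  by metis

lemma state_norm_emb:
  assumes "z \<in> L2_vec {a..b} n" "x \<in> carrier_vec m" "n \<le> N" "m \<le> N"
  shows "state_norm a b (x, z) = sqrt (ip (emb x z) (emb x z))"
  using ip_emb[OF assms(1,1,2,2,3,4)] by simp

lemma emb_minus:
  assumes "z \<in> L2_vec {a..b} n" "z' \<in> L2_vec {a..b} n" "x \<in> carrier_vec m" "x' \<in> carrier_vec m"
      "s \<in> {a..b+1}"
  shows "emb (x - x') (\<lambda>s. z s - z' s) s i = emb x z s i - emb x' z' s i"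
  using assms by (auto simp: emb_def L2_vec_def vnt_minus[where n=n] vnt_minus[where n=m])

lemma emb_smult: "emb (c \<cdot>\<^sub>v x) (\<lambda>s. c \<cdot>\<^sub>v z s) s i = c * emb x z s i"
  by (simp add: emb_def vnt_smult)

lemma state_dist_emb:
  assumes z: "z \<in> L2_vec {a..b} n" "z' \<in> L2_vec {a..b} n"
      and x: "x \<in> carrier_vec m" "x' \<in> carrier_vec m" and N: "n \<le> N" "m \<le> N"
  shows "state_dist a b (x, z) (x', z')
      = sqrt (ip (\<lambda>s i. emb x z s i - emb x' z' s i) (\<lambda>s i. emb x z s i - emb x' z' s i))"
proof -
  have "ip (emb (x - x') (\<lambda>s. z s - z' s)) (emb (x - x') (\<lambda>s. z s - z' s))
      = ip (\<lambda>s i. emb x z s i - emb x' z' s i) (\<lambda>s i. emb x z s i - emb x' z' s i)"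
    by (rule ip_cong) (simp_all add: emb_minus[OF z x])
  then show ?thesis
    using state_norm_emb[OF L2_vec_minus[OF z] minus_carrier_vec[OF x] N]
        by (simp add: state_dist_def state_diff_def)
qed

text \<open>The partial differential equation holds for almost every s; pairing with a fixed
  function does not see the difference.\<close>

lemma ip_emb_AE_cong:
  assumes G: "L2 G" and Z: "L2 (emb x z)" "L2 (emb x z')"
      and eq: "AE s in lebesgue_on {a..b}. z s = z' s"
  shows "ip G (emb x z) = ip G (emb x z')"
proof -
  have ae: "AE s in mu. emb x z s i = emb x z' s i" for i
    using eq by (auto simp: AE_restrict_space_iff emb_def elim!: eventually_mono)
  have "AE s in mu. G s i * emb x z s i = G s i * emb x z' s i" for i
    using ae[of i] by (rule eventually_mono) simp
  then have "(LINT s|mu. G s i * emb x z s i) = (LINT s|mu. G s i * emb x z' s i)" for i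
    by (rule integral_cong_AE[OF borel_measurable_integrable[OF L2f_mult[OF L2D[OF G] L2D[OF Z(1)]]]
        borel_measurable_integrable[OF L2f_mult[OF L2D[OF G] L2D[OF Z(2)]]]])
  then show ?thesis by (simp add: ip_def)
qed

text \<open>\<epsilon> times the identity as a tuple. A general X need not be constant on (b, b+1],
  where the tuple replaces it by \<epsilon> times its mean. The form is then \<epsilon> times
  squared means there and \<epsilon> times integrals of squares on [a,b].\<close>

lemma diagonal_psd:
  fixes n m :: nat and \<epsilon> :: real
  defines "t \<equiv> PQRS (\<epsilon> \<cdot>\<^sub>m 1\<^sub>m m) (zmat1 m n) (zmat1 n m) (\<lambda>_. \<epsilon> \<cdot>\<^sub>m 1\<^sub>m n) (zmat2 n n) (zmat2 n n)"
  assumes N: "m \<le> N" "n \<le> N" and X: "L2 X" and e: "0 \<le> \<epsilon>"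
  shows "wft m m n n t" "0 \<le> ip X (app t X)" "L2 Y \<Longrightarrow> ip Y (app t X) = ip (app t Y) X"
proof -
  show wt: "wft m m n n t" unfolding t_def
      by (intro wft_pqrsI contm_const smult_carrier_mat one_carrier_mat zero_carrier_mat)
  have sel: "tP t = \<epsilon> \<cdot>\<^sub>m 1\<^sub>m m" "tQ1 t s = 0\<^sub>m m n" "tQ2 t s = 0\<^sub>m n m" "tS t s = \<epsilon> \<cdot>\<^sub>m 1\<^sub>m n"
      "tR1 t s \<theta> = 0\<^sub>m n n" "tR2 t s \<theta> = 0\<^sub>m n n" for s \<theta>
    by (simp_all add: t_def)
  have sM: "sM t s i j = (if s \<le> b then (if i = j \<and> i < n then \<epsilon> else 0) else 0)"
    and sK: "sK t s \<theta> i j = (if s \<le> b \<or> \<theta> \<le> b then 0 else if i = j \<and> i < m then \<epsilon> else 0)" for s \<theta> i j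
    by (auto simp: sM_def sK_def sel ent_zero ent_smult ent_one)
  define I where "I = (\<lambda>Y i. LINT \<theta>|mu. (if \<theta> \<le> b then 0 else \<epsilon>) * Y \<theta> (i::nat))"
  have app: "app t Y s i = (if s
      \<le> b then (if i < n then \<epsilon> * Y s i else 0) else (if i < m then I Y i else 0))" if s: "s
      \<in> space mu" for Y s i
  proof (cases "s \<le> b")
    case True
    then have "app t Y s i = (\<Sum>j<N. (if i = j then (if i < n then \<epsilon> * Y s i else 0) else 0))"
      unfolding app_def op_def by (intro sum.cong) (auto simp: sM sK)
    then show ?thesis using True N by auto
  next
    case False
    have "(LINT \<theta>|mu. sK t s \<theta> i j * Y \<theta> j) = (if i = j then (if i < m then I Y i else 0) else 0)" for j
    proof (cases "i = j \<and> i < m")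
      case True
      then show ?thesis unfolding I_def using False
          by (auto simp: sK intro!: Bochner_Integration.integral_cong)
    next
      case nij: False
      have "(LINT \<theta>|mu. sK t s \<theta> i j * Y \<theta> j) = (LINT \<theta>|mu. 0)"
        using nij False by (intro Bochner_Integration.integral_cong) (auto simp: sK)
      then show ?thesis using nij by auto
    qed
    then have "app t Y s i = (\<Sum>j<N. (if i = j then (if i < m then I Y i else 0) else 0))"
      using False unfolding app_def op_def by (intro sum.cong) (auto simp: sM)
    then show ?thesis using False N by auto
  qed
  have bI: "bmeas (\<lambda>s. if s \<le> b then 1 else 0)" by (rule bmeas_le)
  have b0: "bmeas (\<lambda>s. if s \<le> b then \<epsilon> else 0)" "bmeas (\<lambda>s. if s \<le> b then 0 else \<epsilon>)"
      "bmeas (\<lambda>s. if s \<le> b then 0 else 1)"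
    using bmeas_If[OF bI bmeas_const bmeas_const] by auto
  have ip: "ip Y (app t X) =
      (\<Sum>i<N. (if i < n then LINT s|mu. (if s \<le> b then \<epsilon> else 0) * (Y s i * X s i) else 0)
      + (if i < m then (LINT s|mu. (if s \<le> b then 0 else 1) * Y s i) * I X i else 0))" if X: "L2
          X" and Y: "L2 Y" for X Y
    unfolding ip_def
  proof (intro sum.cong refl)
    fix i
    have i1: "integrable mu (\<lambda>s. (if s \<le> b then \<epsilon> else 0) * (Y s i * X s i))"
      by (intro integrable_bmeas_mult b0 L2f_mult L2D X Y)
    have i2: "integrable mu (\<lambda>s. (if s \<le> b then 0 else 1) * Y s i)"
      by (intro integrable_bmeas_mult b0 L2_integrable Y)
    have "(LINT s|mu. Y s i * app t X s i)
        = (LINT s|mu. (if i < n then (if s \<le> b then \<epsilon> else 0) * (Y s i * X s i) else 0)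
        + (if i < m then (if s \<le> b then 0 else 1) * Y s i * I X i else 0))"
      by (intro Bochner_Integration.integral_cong) (auto simp: app)
    also have "\<dots> = (if i < n then LINT s|mu. (if s \<le> b then \<epsilon> else 0) * (Y s i * X s i) else 0)
        + (if i < m then (LINT s|mu. (if s \<le> b then 0 else 1) * Y s i) * I X i else 0)"
      using i1 i2 by auto
    finally show "(LINT s|mu. Y s i * app t X s i) = \<dots>" .
  qed
  have I1: "I Y i = \<epsilon> * (LINT s|mu. (if s \<le> b then 0 else 1) * Y s i)" for Y i
  proof -
    have "I Y i = (LINT s|mu. \<epsilon> * ((if s \<le> b then 0 else 1) * Y s i))" unfolding I_def
        by (intro Bochner_Integration.integral_cong) auto
    then show ?thesis by simp
  qed
  show "0 \<le> ip X (app t X)"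
    unfolding ip[OF X X] I1 using e
        by (intro sum_nonneg add_nonneg_nonneg)
        (auto intro!: Bochner_Integration.integral_nonneg mult_nonneg_nonneg simp:
        mult.left_commute[of _ \<epsilon>])
  show "ip Y (app t X) = ip (app t Y) X" if Y: "L2 Y"
    unfolding ip_commute[of "app t Y" X] ip[OF X Y] ip[OF Y X] I1
    by (intro sum.cong refl arg_cong2[of _ _ _ _ "(+)"] if_cong) (simp_all add: mult_ac)
qed

end

text \<open>The hypothesis concerns the tuple with \<epsilon> subtracted from P and S. Adding back
  \<epsilon> times the identity preserves positivity and symmetry.\<close>

lemma (in interval_sites) shifted_psd:
  assumes P: "P \<in> carrier_mat m m" and Q: "contm m n Q" and S: "contm n n S"
    and R: "contm n n (\<lambda>q. R1 (fst q) (snd q))" "contm n n (\<lambda>q. R2 (fst q) (snd q))"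
    and Phi: "PQRS (P - \<epsilon> \<cdot>\<^sub>m 1\<^sub>m m) Q (\<lambda>s. (Q s)\<^sup>T) (\<lambda>s. S s - \<epsilon> \<cdot>\<^sub>m 1\<^sub>m n) R1 R2 \<in> Phi a b m n d"
    and N: "m + (d + 1) * n + length (exps2 d) * n + length (exps2 d) * n \<le> N" and e: "0 \<le> \<epsilon>"
        and X: "L2 X"
  shows "wft m m n n (PQRS P Q (\<lambda>s. (Q s)\<^sup>T) S R1 R2)"
    "0 \<le> ip X (app (PQRS P Q (\<lambda>s. (Q s)\<^sup>T) S R1 R2) X)"
    "L2 Y \<Longrightarrow> ip Y (app (PQRS P Q (\<lambda>s. (Q s)\<^sup>T) S R1 R2) X)
        = ip (app (PQRS P Q (\<lambda>s. (Q s)\<^sup>T) S R1 R2) Y) X"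
proof -
  let ?p = "PQRS P Q (\<lambda>s. (Q s)\<^sup>T) S R1 R2"
  let ?q = "PQRS (P - \<epsilon> \<cdot>\<^sub>m 1\<^sub>m m) Q (\<lambda>s. (Q s)\<^sup>T) (\<lambda>s. S s - \<epsilon> \<cdot>\<^sub>m 1\<^sub>m n) R1 R2"
  let ?e = "PQRS (\<epsilon> \<cdot>\<^sub>m 1\<^sub>m m) (zmat1 m n) (zmat1 n m) (\<lambda>_. \<epsilon> \<cdot>\<^sub>m 1\<^sub>m n) (zmat2 n n) (zmat2 n n)"
  have one: "\<epsilon> \<cdot>\<^sub>m 1\<^sub>m k \<in> carrier_mat k k" for k :: nat by simp
  show wp: "wft m m n n ?p" by (intro wft_pqrsI P Q contm_transpose S R)
  have wq: "wft m m n n ?q"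
      by (intro wft_pqrsI minus_carrier_mat one Q contm_transpose contm_minus S contm_const R)
  have mn: "m \<le> N" "n \<le> N" using N by auto
  note de = diagonal_psd[OF mn _ e]
  note we = de(1)[OF X]
  have app: "app ?p X s i = app ?q X s i + app ?e X s i" if "s \<in> space mu" "L2 X" for X s i
  proof -
    note c = P contmD(1)[OF Q] transpose_carrier_mat[THEN iffD2, OF contmD(1)[OF Q]] contmD(1)[OF S]
      contmD(1)[OF contm_comp2[OF R(1) continuous_on_const continuous_on_const]]
          contmD(1)[OF contm_comp2[OF R(2) continuous_on_const continuous_on_const]]
    have "app ?p X s i = app (?q \<oplus>\<^sub>p ?e) X s i"
      unfolding app_def
      by (rule op_cong_pointwise)
        (simp_all add: sM_def sK_def pqrs_sel ent_zero ent_add[OF minus_carrier_mat[OF one] one]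
            ent_minus[OF c(1) one] ent_minus[OF c(4) one]
          ent_add[OF c(2) zero_carrier_mat] ent_add[OF c(3) zero_carrier_mat]
              ent_add[OF c(5) zero_carrier_mat] ent_add[OF c(6) zero_carrier_mat])
    then show ?thesis using app_add[OF wq we that(2), of s i] that(1) by simp
  qed
  have ip: "ip Y (app ?p X) = ip Y (app ?q X) + ip Y (app ?e X)" if "L2 X" "L2 Y" for X Y
  proof -
    have "ip Y (app ?p X) = ip Y (\<lambda>s i. app ?q X s i + app ?e X s i)"
        by (rule ip_cong) (simp_all add: app that)
    then show ?thesis using ip_add_right[OF that(2) L2_app[OF wq that(1)] L2_app[OF we that(1)]] by simp
  qed
  note ph = Phi_psd[OF Phi N]
  show "0 \<le> ip X (app ?p X)" using ip[OF X X] ph(1)[OF X] de(2)[OF X] by simp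
  show "ip Y (app ?p X) = ip (app ?p Y) X" if Y: "L2 Y"
    using ip[OF X Y] ip[OF Y X] ph(2)[OF X Y] de(3)[OF X Y] ip_commute[of X "app ?q Y"]
        ip_commute[of X "app ?e Y"]
      ip_commute[of X "app ?p Y"] by simp
qed

text \<open>The square root \<open>\<nu>\<close> of the storage function is Lipschitz with respect to the state distance,
  hence absolutely continuous along the solution; therefore so is its square.\<close>

lemma (in coupled_system) energy_balance:
  assumes wy: "nw D = ny D" and p: "wft (nx D) (nx D) (nz D) (nz D) p"
    and psd: "\<And>X. L2 X \<Longrightarrow> 0 \<le> ip X (app p X)"
    and sym: "\<And>X Y. L2 X \<Longrightarrow> L2 Y \<Longrightarrow> ip X (app p Y) = ip (app p X) Y"
    and J: "J = pqrs_comp (lo D) (hi D) (pqrs_comp (lo D) (hi D) (pqrs_adj tX) p) tA -\<^sub>p supply"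
    and Phi: "\<ominus>\<^sub>p J -\<^sub>p pqrs_adj J \<in> Phi (lo D) (hi D) (nw D + nx D) (nz D) d"
    and Nd: "nw D + nx D + (d + 1) * nz D + length (exps2 d) * nz D + length (exps2 d) * nz D \<le> N"
    and w: "w \<in> L2_vec {0..} (nw D)" and y: "y \<in> L2_vec {0..} (ny D)"
    and sol: "is_solution D w y x z1 z2 z3" and \<tau>: "0 \<le> \<tau>"
  shows "0 \<le> (LINT t|lebesgue_on {0..\<tau>}. w t \<bullet> y t)"
proof -
  interpret pf: psd_form mu N "app p"
    by unfold_locales (auto intro: L2_app[OF p] sym psd)
  define zp where "zp = (\<lambda>t s. z1 t s @\<^sub>v z2 t s @\<^sub>v z3 t s)"
  note sol' = sol[unfolded is_solution_def Let_def]
  have st: "x t \<in> carrier_vec (nx D)" "zp t \<in> L2_vec {lo D..hi D} (nz D)" if "0 \<le> t" for t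
  proof -
    have *: "x t \<in> carrier_vec (nx D) \<and> z1 t \<in> L2_vec {lo D..hi D} (n1 D) \<and> z2 t
        \<in> L2_vec {lo D..hi D} (n2 D) \<and> z3 t \<in> L2_vec {lo D..hi D} (n3 D)"
      using sol' that by blast
    then show "x t \<in> carrier_vec (nx D)" "zp t \<in> L2_vec {lo D..hi D} (nz D)"
      unfolding zp_def add.assoc by (auto intro!: L2_vec_append)
  qed
  have ac: "abs_cont_on (state_dist (lo D) (hi D)) 0 \<tau> (\<lambda>t. (x t, zp t))"
    using sol' \<tau> unfolding zp_def by blast
  have init: "x 0 = 0\<^sub>v (nx D)" "AE s in lebesgue_on {lo D..hi D}. zp 0 s = 0\<^sub>v (nz D)"
    using sol' unfolding zp_def by blast+
  define F where "F = (\<lambda>t. emb (x t) (zp t))"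
  have L2F: "L2 (F t)" if "0 \<le> t" for t unfolding F_def by (rule L2_emb[OF st(2)[OF that]])
  obtain C where C: "C \<ge> 0" "\<And>Z. L2 Z \<Longrightarrow> ip Z (app p Z) \<le> C * ip Z Z"
    unfolding app_def using ip_op_bounded[OF bmul_sM[OF p] bker_sK[OF p]] by blast
  have CB: "pf.B Z Z \<le> C * ip Z Z" if "L2 Z" for Z using C(2)[OF that] by (simp add: pf.B_def)
  define V where "V = (\<lambda>t. pf.B (F t) (F t))"
  have V0: "0 \<le> V t" if "0 \<le> t" for t using psd[OF L2F[OF that]] by (simp add: V_def pf.B_def)
  have "abs_cont_on dist 0 \<tau> (\<lambda>t. pf.\<nu> (F t))"
  proof (rule abs_cont_on_le[OF ac])
    show "0 \<le> sqrt C" using C by simp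
    fix r t assume rt: "0 \<le> r" "r \<le> t" "t \<le> \<tau>"
    then have t0: "0 \<le> t" by simp
    have L2d: "L2 (\<lambda>s i. F r s i - F t s i)"
        using pf.L2_lincomb[OF L2F[OF rt(1)] L2F[OF t0], of 1 "-1"] by simp
    have "\<bar>pf.\<nu> (F r) - pf.\<nu> (F t)\<bar> \<le> pf.\<nu> (\<lambda>s i. F r s i - F t s i)"
      by (rule pf.\<nu>_diff[OF L2F[OF rt(1)] L2F[OF t0]])
    also have "\<dots> \<le> sqrt (C * ip (\<lambda>s i. F r s i - F t s i) (\<lambda>s i. F r s i - F t s i))"
      unfolding pf.\<nu>_def by (rule real_sqrt_le_mono[OF CB[OF L2d]])
    also have "\<dots> = sqrt C * state_dist (lo D) (hi D) (x r, zp r) (x t, zp t)"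
      using state_dist_emb[OF st(2)[OF rt(1)] st(2)[OF t0] st(1)[OF rt(1)] st(1)[OF t0] Ns(3,1)]
          by (simp add: F_def real_sqrt_mult)
    finally show "dist (pf.\<nu> (F r)) (pf.\<nu> (F t)) \<le> sqrt C
        * state_dist (lo D) (hi D) (x r, zp r) (x t, zp t)"
      by (simp add: dist_real_def)
  qed
  \<comment> \<open>V is the square of \<open>\<nu>\<close> wherever V is nonnegative, which is
    known on [0, \<tau>].\<close>
  from abs_cont_on_mult[OF this this] have acV: "abs_cont_on dist 0 \<tau> V"
    by (rule abs_cont_on_le[where C=1]) (use V0 in \<open>auto simp: V_def pf.\<nu>_def\<close>)
  have "ip (F 0) (F 0) = x 0 \<bullet> x 0 + (LINT s|lebesgue_on {lo D..hi D}. zp 0 s \<bullet> zp 0 s)"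
    unfolding F_def by (rule ip_emb[OF st(2)[OF order.refl] st(2)[OF order.refl]
        st(1)[OF order.refl] st(1)[OF order.refl] Ns(3,1)])
  also have "(LINT s|lebesgue_on {lo D..hi D}. zp 0 s \<bullet> zp 0 s) = 0"
    by (rule integral_eq_zero_AE) (use init(2) in \<open>auto elim!: eventually_mono\<close>)
  finally have "ip (F 0) (F 0) = 0" using init(1) by simp
  \<comment> \<open>The initial state vanishes only almost everywhere, so V(0) is squeezed between 0
    and C times a squared norm that is 0.\<close>
  then have V00: "V 0 = 0" using CB[OF L2F[of 0]] V0[of 0] by (simp add: V_def)
  have supply_int: "integrable (lebesgue_on {0..\<tau>}) (\<lambda>t. w t \<bullet> y t)"
  proof -
    have "integrable (lebesgue_on {0..}) (\<lambda>t. w t \<bullet> y t)" using L2_vec_scalar_prod[OF w y[folded wy]] .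
    then have "set_integrable lebesgue {0..} (\<lambda>t. w t \<bullet> y t)"
        by (simp add: integrable_restrict_space set_integrable_def)
    then have "set_integrable lebesgue {0..\<tau>} (\<lambda>t. w t \<bullet> y t)" by (rule set_integrable_subset) auto
    then show ?thesis by (simp add: integrable_restrict_space set_integrable_def)
  qed
  note ae = sol'[THEN conjunct2, THEN conjunct2, THEN conjunct2, THEN conjunct2]
  \<comment> \<open>The null set {0} is discarded because derivatives are two-sided and the state is
    prescribed for nonnegative times only.\<close>
  have "AE t in lebesgue_on {0..}. \<exists>v. (V has_real_derivative v) (at t) \<and> v \<le> 2 * (w t \<bullet> y t)"
    using ae AE_space AE_lebesgue_on_neq[of "{0..}" 0, simplified]
  proof eventually_elim
    case (elim t)
    then have t: "0 < t" by auto
    then have t0: "0 \<le> t" by simp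
    from elim(1) have z1t: "z1 t \<in> L2_vec {lo D..hi D} (n1 D)" by (simp add: state_space_def)
    from elim(1) obtain xd zd z2s z3s z3ss where
      xd: "xd \<in> carrier_vec (nx D)" and zd: "zd \<in> L2_vec {lo D..hi D} (nz D)"
      and der: "has_state_deriv (lo D) (hi D) (\<lambda>t. (x t, \<lambda>s. z1 t s @\<^sub>v z2 t s @\<^sub>v z3 t s)) (xd, zd) t"
      and s2: "sob_deriv (lo D) (hi D) (n2 D) (z2 t) z2s"
          and s3: "sob_deriv (lo D) (hi D) (n3 D) (z3 t) z3s"
      and s3s: "sob_deriv (lo D) (hi D) (n3 D) z3s z3ss"
      and xde: "xd = cA D *\<^sub>v x t + pde_output (lo D) (hi D) (cE1 D) (pEa D) (pEb D)
            (z2 t (lo D) @\<^sub>v z2 t (hi D) @\<^sub>v z3 t (lo D) @\<^sub>v z3 t (hi D) @\<^sub>v z3s (lo D) @\<^sub>v z3s (hi D))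
            (\<lambda>s. z1 t s @\<^sub>v z2 t s @\<^sub>v z3 t s) (\<lambda>s. z2s s @\<^sub>v z3s s) + cBwo D *\<^sub>v w t"
      and zde: "AE s in lebesgue_on {lo D..hi D}. zd s = pA0 D s *\<^sub>v (z1 t s @\<^sub>v z2 t s @\<^sub>v z3 t s)
          + pA1 D s *\<^sub>v (z2s s @\<^sub>v z3s s)
            + pA2 D s *\<^sub>v z3ss s + pE D s *\<^sub>v x t + pBwp D s *\<^sub>v w t"
      and ye: "y t = cC D *\<^sub>v x t + pde_output (lo D) (hi D) (cC1 D) (pCa D) (pCb D)
            (z2 t (lo D) @\<^sub>v z2 t (hi D) @\<^sub>v z3 t (lo D) @\<^sub>v z3 t (hi D) @\<^sub>v z3s (lo D) @\<^sub>v z3s (hi D))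
            (\<lambda>s. z1 t s @\<^sub>v z2 t s @\<^sub>v z3 t s) (\<lambda>s. z2s s @\<^sub>v z3s s) + cDw D *\<^sub>v w t"
      and bc: "cB D *\<^sub>v (z2 t (lo D) @\<^sub>v z2 t (hi D) @\<^sub>v z3 t (lo D) @\<^sub>v z3 t (hi D) @\<^sub>v z3s (lo D)
          @\<^sub>v z3s (hi D)) = cB1 D *\<^sub>v x t + cB2 D *\<^sub>v w t"
      by (elim conjE exE) (rule that)
    have wt: "w t \<in> carrier_vec (nw D)" using w t0 by (auto simp: L2_vec_def)
    interpret bv: boundary_value D N "w t" "x t" "z1 t" "z2 t" "z3 t" z2s z3s z3ss
      by unfold_locales (rule wt st(1)[OF t0] z1t s2 s3 s3s bc)+
    have zpe: "bv.zp = zp t" by (simp add: bv.zp_def zp_def)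
    have xde': "xd = bv.xd" unfolding xde bv.xd_def bv.zb_def bv.zp_def bv.zs_def ..
    have ye': "y t = bv.y" unfolding ye bv.y_def bv.zb_def bv.zp_def bv.zs_def ..
    have zde': "AE s in lebesgue_on {lo D..hi D}. zd s = bv.zd s" using zde
        unfolding bv.zd_def bv.zp_def bv.zs_def .
    define G where "G = emb xd zd"
    have L2G: "L2 G" unfolding G_def by (rule L2_emb[OF zd])
    \<comment> \<open>Square integrability of the explicit right-hand side is inherited from the
      operator \<open>tA\<close>, whose value at U it is.\<close>
    have L2G': "L2 (emb xd bv.zd)"
      by (rule L2_cong[OF _ L2_app[OF wft_tA bv.L2_U]]) (simp add: bv.app_tA xde')
    \<comment> \<open>The operator is moved to the left factor first, so that the derivative appears
      bare and may be replaced by the almost everywhere equal right-hand side; then it is moved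
      back.\<close>
    have "pf.B (F t) G = ip (app p (F t)) (emb xd zd)" unfolding pf.B_def G_def[symmetric]
        by (rule sym[OF L2F[OF t0] L2G])
    also have "\<dots> = ip (app p (F t)) (emb xd bv.zd)"
      by (rule ip_emb_AE_cong[OF L2_app[OF p L2F[OF t0]] L2G[unfolded G_def] L2G' zde'])
    also have "\<dots> = ip (F t) (app p (emb xd bv.zd))" by (rule sym[OF L2F[OF t0] L2G', symmetric])
    also have "\<dots> \<le> w t \<bullet> y t"
      using bv.dissipation[OF wy p J Phi Nd] unfolding F_def zpe xde' ye' .
    finally have le: "pf.B (F t) G \<le> w t \<bullet> y t" .
    let ?R = "\<lambda>h s i. 1 / h * (F (t + h) s i - F t s i) - G s i"
    \<comment> \<open>In the encoding the difference quotient is taken pointwise, so the limit that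
      defines the derivative of the state becomes the limit required by
      \<open>energy_derivative\<close>.\<close>
    have dist: "state_dist (lo D) (hi D)
        (state_scale (1 / h) (state_diff (x (t + h), zp (t + h)) (x t, zp t))) (xd, zd)
        = sqrt (ip (?R h) (?R h))"
      if h: "0 \<le> t + h" for h
    proof -
      note zz = L2_vec_minus[OF st(2)[OF h] st(2)[OF t0]]
      have "state_dist (lo D) (hi D)
          (state_scale (1 / h) (state_diff (x (t + h), zp (t + h)) (x t, zp t))) (xd, zd)
        = sqrt (ip (\<lambda>s i. emb ((1 / h) \<cdot>\<^sub>v (x (t + h) - x t))
            (\<lambda>s. (1 / h) \<cdot>\<^sub>v (zp (t + h) s - zp t s)) s i - emb xd zd s i)
            (\<lambda>s i. emb ((1 / h) \<cdot>\<^sub>v (x (t + h) - x t)) (\<lambda>s. (1 / h) \<cdot>\<^sub>v (zp (t + h) s - zp t s)) s i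
                - emb xd zd s i))"
        unfolding state_scale_def state_diff_def fst_conv snd_conv
        by (rule state_dist_emb[OF L2_vec_smult[OF zz] zd _ xd Ns(3,1)])
            (use st(1)[OF h] st(1)[OF t0] in auto)
      also have "ip (\<lambda>s i. emb ((1 / h) \<cdot>\<^sub>v (x (t + h) - x t))
          (\<lambda>s. (1 / h) \<cdot>\<^sub>v (zp (t + h) s - zp t s)) s i - emb xd zd s i)
            (\<lambda>s i. emb ((1 / h) \<cdot>\<^sub>v (x (t + h) - x t)) (\<lambda>s. (1 / h) \<cdot>\<^sub>v (zp (t + h) s - zp t s)) s i
                - emb xd zd s i) = ip (?R h) (?R h)"
        by (rule ip_cong) (simp_all add: emb_smult
            emb_minus[OF st(2)[OF h] st(2)[OF t0] st(1)[OF h] st(1)[OF t0]] F_def G_def)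
      finally show ?thesis .
    qed
    have "((\<lambda>h. (state_dist (lo D) (hi D)
        (state_scale (1 / h) (state_diff (x (t + h), zp (t + h)) (x t, zp t))) (xd, zd))\<^sup>2) \<longlongrightarrow> 0\<^sup>2)
        (at 0)"
      using der unfolding has_state_deriv_def zp_def[symmetric]
          by (intro tendsto_power) (simp add: zp_def)
    moreover have "\<forall>\<^sub>F h in at 0.
        (state_dist (lo D) (hi D)
        (state_scale (1 / h) (state_diff (x (t + h), zp (t + h)) (x t, zp t))) (xd, zd))\<^sup>2
        = ip (?R h) (?R h)"
      unfolding eventually_at using t dist ip_nonneg
          by (intro exI[of _ t]) (auto simp: dist_real_def abs_less_iff)
    ultimately have lim: "((\<lambda>h. ip (?R h) (?R h)) \<longlongrightarrow> 0) (at 0)"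
      by (simp add: tendsto_cong)
    have "(V has_real_derivative 2 * pf.B (F t) G) (at t)"
      unfolding V_def by (rule pf.energy_derivative[OF L2F L2G t C(1) CB lim])
    then show ?case using le by auto
  qed
  then have "AE t in lebesgue_on {0..\<tau>}. \<exists>v. (V has_real_derivative v) (at t) \<and> v \<le> 2 * (w t \<bullet> y t)"
    by (auto simp: AE_restrict_space_iff elim!: eventually_mono)
  from abs_cont_increment_le_integral[OF \<tau> acV this] supply_int
  have "V \<tau> - V 0 \<le> 2 * (LINT t|lebesgue_on {0..\<tau>}. w t \<bullet> y t)" by simp
  then show ?thesis using V0[OF \<tau>] V00 by simp
qed

section \<open>Passage to the infinite horizon\<close>

theorem theorem5:
  fixes D :: ode_pde
    and \<epsilon> \<gamma> :: real and d1 d2 :: nat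
    and P :: "real mat" and Q S :: "real \<Rightarrow> real mat" and R1 R2 :: "real \<Rightarrow> real \<Rightarrow> real mat"
    and K J :: pqrs
    and w y x :: "real \<Rightarrow> real vec" and z1 z2 z3 :: "real \<Rightarrow> real \<Rightarrow> real vec"
  assumes "wf_ode_pde D" and "nw D = ny D"
    and "\<epsilon> > 0" and "\<gamma> > 0"
    and "P \<in> carrier_mat (nx D) (nx D)" and "P\<^sup>T = P"
    and "poly_mat1 (nx D) (nz D) Q"
    and "poly_mat1 (nz D) (nz D) S" and "\<And>s. (S s)\<^sup>T = S s"
    and "poly_mat2 (nz D) (nz D) R1" and "poly_mat2 (nz D) (nz D) R2"
    and "PQRS (P - \<epsilon> \<cdot>\<^sub>m 1\<^sub>m (nx D)) Q (\<lambda>s. (Q s)\<^sup>T) (\<lambda>s. S s - \<epsilon> \<cdot>\<^sub>m 1\<^sub>m (nz D)) R1 R2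
           \<in> Phi (lo D) (hi D) (nx D) (nz D) d1"
    and "K = pqrs_comp (lo D) (hi D)
           (pqrs_adj (PQRS (I1 D) (zmat1 (nx D) (nz D)) (H0 D) (G0 D) (G1 D) (G2 D)))
           (PQRS P Q (\<lambda>s. (Q s)\<^sup>T) S R1 R2)"
    and "J = pqrs_comp (lo D) (hi D) K
           (PQRS (hatA0 D + hatB0 D) (hatA1 D) (\<lambda>s. hatA2 D s + hatB2 D s)
              (hatA3 D) (hatA4 D) (hatA5 D))
         -\<^sub>p PQRS ((hatC0 D + hatD0 D)\<^sup>T * I0 D) (zmat1 (nw D + nx D) (nz D))
              (\<lambda>s. (hatC1 D s)\<^sup>T * I0 D)
              (zmat1 (nz D) (nz D)) (zmat2 (nz D) (nz D)) (zmat2 (nz D) (nz D))"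
    and "\<ominus>\<^sub>p J -\<^sub>p pqrs_adj J \<in> Phi (lo D) (hi D) (nw D + nx D) (nz D) d2"
    and "w \<in> L2_vec {0..} (nw D)" and "y \<in> L2_vec {0..} (ny D)"
    and "is_solution D w y x z1 z2 z3"
  shows "0 \<le> (LINT t|lebesgue_on {0..}. w t \<bullet> y t)"
proof -
  \<comment> \<open>The sizes of the matrices T in the two positivity conditions, without their
    finite-dimensional block. Adding them to the dimensions of the system gives an \<open>N\<close>
    that serves both conditions and all products at once.\<close>
  define l1 l2 where "l1 = (d1 + 1) * nz D + length (exps2 d1) * nz D + length (exps2 d1) * nz D"
    and "l2 = (d2 + 1) * nz D + length (exps2 d2) * nz D + length (exps2 d2) * nz D"
  define N where "N = nx D + nw D + ny D + nz D + nbv D + l1 + l2"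
  interpret coupled_system D N
    by unfold_locales (use assms(1) in \<open>simp_all add: N_def\<close>)
  have Nd: "nx D + (d1 + 1) * nz D + length (exps2 d1) * nz D + length (exps2 d1) * nz D \<le> N"
    "nw D + nx D + (d2 + 1) * nz D + length (exps2 d2) * nz D + length (exps2 d2) * nz D \<le> N"
    by (simp_all add: N_def l1_def l2_def)
  let ?p = "PQRS P Q (\<lambda>s. (Q s)\<^sup>T) S R1 R2"
  note p = shifted_psd[OF assms(5) contm_poly_mat1[OF assms(7)] contm_poly_mat1[OF assms(8)]
      contm_poly_mat2[OF assms(10)]
      contm_poly_mat2[OF assms(11)] assms(12) Nd(1) less_imp_le[OF assms(3)]]
  have J: "J = pqrs_comp (lo D) (hi D) (pqrs_comp (lo D) (hi D) (pqrs_adj tX) ?p) tA -\<^sub>p supply"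
    unfolding assms(13,14) tX_def tA_def supply_def ..
  have wp: "wft (nx D) (nx D) (nz D) (nz D) ?p"
    by (intro wft_pqrsI assms(5) contm_transpose contm_poly_mat1 contm_poly_mat2 assms(7,8,10,11))
  have nn: "0 \<le> (LINT t|lebesgue_on {0..\<tau>}. w t \<bullet> y t)" if "0 \<le> \<tau>" for \<tau>
    by (rule energy_balance[OF assms(2) wp p(2) p(3)[rotated] J assms(15) Nd(2) assms(16-18) that])
  let ?f = "\<lambda>t. w t \<bullet> y t"
  have "set_integrable lebesgue {0..} ?f"
    using L2_vec_scalar_prod[OF assms(16) assms(17)[folded assms(2)]]
        by (simp add: integrable_restrict_space set_integrable_def)
  \<comment> \<open>The supply rate is integrable on the half line, being a product of square
    integrable functions, so its integral is the limit of the nonnegative integrals over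
    [0, \<tau>].\<close>
  then have "((\<lambda>\<tau>. LINT t:{0..\<tau>}|lebesgue. ?f t) \<longlongrightarrow> (LINT t:{0..}|lebesgue. ?f t)) at_top"
    by (intro tendsto_set_lebesgue_integral_at_top) auto
  moreover have "(LINT t:{0..\<tau>}|lebesgue. ?f t) = (LINT t|lebesgue_on {0..\<tau>}. ?f t)"
      "(LINT t:{0..}|lebesgue. ?f t) = (LINT t|lebesgue_on {0..}. ?f t)" for \<tau>
    by (simp_all add: set_lebesgue_integral_def integral_restrict_space)
  ultimately have lim: "((\<lambda>\<tau>. LINT t|lebesgue_on {0..\<tau>}. ?f t) \<longlongrightarrow> (LINT t|lebesgue_on {0..}. ?f t))
      at_top" by simp
  show ?thesis
    by (rule tendsto_lowerbound[OF lim]) (use nn in \<open>auto intro: eventually_at_top_linorderI[of 0]\<close>)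
qed

end
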